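(* Let $F$ be an infinite field and $A$ a semiassociative $F$-algebra of degree $n$. Let $K\subseteq\mathfrak{N}(A)$ be an $n$-dimensional étale $F$-subalgebra and let $E/F$ be a field extension splitting $K$. Then $E$ splits $A$, i.e. $E\otimes_F A\cong M_n(E;c)$ for some reduced skew set $c$ over $E$. Furthermore, the isomorphism can be chosen so that $E\otimes_F K$ is mapped onto the diagonal subalgebra $Ee_{11}+\cdots+Ee_{nn}$ of $M_n(E;c)$.
   Context: Algebras are unital and not necessarily associative. The associator is $(x,y,z)=(xy)z-x(yz)$; the nucleus $\mathfrak{N}(A)$ is the set of $x\in A$ with $(x,A,A)=(A,x,A)=(A,A,x)=0$, an associative subalgebra; the center is $Z(A)=\{x\in\mathfrak{N}(A):xa=ax\text{ for all }a\in A\}$; $A$ is $F$-central if $Z(A)=F$. An étale $F$-algebra is a finite direct product of finite separable field extensions of $F$. A field extension $E/F$ splits an $n$-dimensional étale $F$-algebra $K$ if $E\otimes_F K\cong E^n$. A module over an associative ring is minimally faithful if it is faithful and has no faithful proper section (quotient of submodules). A finite dimensional $F$-central algebra $A$ is semiassociative if there is an étale $F$-subalgebra $K\subseteq\mathfrak{N}(A)$ (containing $1_A$) such that $A$ is minimally faithful (equivalently, faithful and cyclic) as a $K\otimes_F K$-module via $(k\otimes k')a=kak'$; the degree of $A$ is $\sqrt{\dim_F A}=\dim_F K$. A reduced skew set of degree $n$ over a field $E$ is a family $c=(c_{ijk})_{1\le i,j,k\le n}$ of elements of $E$ (zeros allowed) with $c_{iij}=c_{ijj}=1$ for all $i,j$.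 The skew matrix algebra $M_n(E;c)$ is the $E$-algebra with basis $\{e_{ij}\}_{1\le i,j\le n}$ and multiplication $e_{ij}e_{k\ell}=\delta_{jk}c_{ij\ell}e_{i\ell}$. A semiassociative algebra is split if it is isomorphic to a skew matrix algebra; $E/F$ splits $A$ if $E\otimes_F A$ is split (over $E$). *)

theory Defs
  imports
    "Jordan_Normal_Form.Missing_VectorSpace"
    "HOL-Algebra.Finite_Extensions"
    "HOL-Algebra.Free_Abelian_Groups"
    "HOL-Algebra.QuotRing"
begin

section \<open>Nonassociative algebras over a field\<close>

text \<open>Algebras over a field \<open>F\<close> are records of type \<open>('f, 'a) module\<close>: that record extends
  \<open>'a ring\<close>, so it carries addition, multiplication, unit and scalar action. A subset \<open>K\<close>
  is turned into an algebra by replacing the carrier, \<open>A\<lparr>carrier := K\<rparr>\<close>.\<close>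

locale unital_algebra = vectorspace F A for F :: "'f ring" and A :: "('f, 'a) module" +
  assumes mult_closed: "\<lbrakk>x \<in> carrier A; y \<in> carrier A\<rbrakk> \<Longrightarrow> x \<otimes>\<^bsub>A\<^esub> y \<in> carrier A"
    and one_closed: "\<one>\<^bsub>A\<^esub> \<in> carrier A"
    and l_one: "x \<in> carrier A \<Longrightarrow> \<one>\<^bsub>A\<^esub> \<otimes>\<^bsub>A\<^esub> x = x"
    and r_one: "x \<in> carrier A \<Longrightarrow> x \<otimes>\<^bsub>A\<^esub> \<one>\<^bsub>A\<^esub> = x"
    and l_distr: "\<lbrakk>x \<in> carrier A; y \<in> carrier A; z \<in> carrier A\<rbrakk> \<Longrightarrow>
      (x \<oplus>\<^bsub>A\<^esub> y) \<otimes>\<^bsub>A\<^esub> z = x \<otimes>\<^bsub>A\<^esub> z \<oplus>\<^bsub>A\<^esub> y \<otimes>\<^bsub>A\<^esub> z"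
    and r_distr: "\<lbrakk>x \<in> carrier A; y \<in> carrier A; z \<in> carrier A\<rbrakk> \<Longrightarrow>
      z \<otimes>\<^bsub>A\<^esub> (x \<oplus>\<^bsub>A\<^esub> y) = z \<otimes>\<^bsub>A\<^esub> x \<oplus>\<^bsub>A\<^esub> z \<otimes>\<^bsub>A\<^esub> y"
    and smult_mult_left: "\<lbrakk>r \<in> carrier F; x \<in> carrier A; y \<in> carrier A\<rbrakk> \<Longrightarrow>
      (r \<odot>\<^bsub>A\<^esub> x) \<otimes>\<^bsub>A\<^esub> y = r \<odot>\<^bsub>A\<^esub> (x \<otimes>\<^bsub>A\<^esub> y)"
    and smult_mult_right: "\<lbrakk>r \<in> carrier F; x \<in> carrier A; y \<in> carrier A\<rbrakk> \<Longrightarrow>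
      x \<otimes>\<^bsub>A\<^esub> (r \<odot>\<^bsub>A\<^esub> y) = r \<odot>\<^bsub>A\<^esub> (x \<otimes>\<^bsub>A\<^esub> y)"

definition associator :: "('f, 'a) module \<Rightarrow> 'a \<Rightarrow> 'a \<Rightarrow> 'a \<Rightarrow> 'a" where
  "associator A x y z = (x \<otimes>\<^bsub>A\<^esub> y) \<otimes>\<^bsub>A\<^esub> z \<ominus>\<^bsub>A\<^esub> x \<otimes>\<^bsub>A\<^esub> (y \<otimes>\<^bsub>A\<^esub> z)"

definition nucleus :: "('f, 'a) module \<Rightarrow> 'a set" where
  "nucleus A = {x \<in> carrier A. \<forall>a\<in>carrier A. \<forall>b\<in>carrier A.
     associator A x a b = \<zero>\<^bsub>A\<^esub> \<and> associator A a x b = \<zero>\<^bsub>A\<^esub> \<and> associator A a b x = \<zero>\<^bsub>A\<^esub>}"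

definition algebra_center :: "('f, 'a) module \<Rightarrow> 'a set" where
  "algebra_center A = {x \<in> nucleus A. \<forall>a\<in>carrier A. x \<otimes>\<^bsub>A\<^esub> a = a \<otimes>\<^bsub>A\<^esub> x}"

definition scalars :: "'f ring \<Rightarrow> ('f, 'a) module \<Rightarrow> 'a set" where
  "scalars F A = (\<lambda>r. r \<odot>\<^bsub>A\<^esub> \<one>\<^bsub>A\<^esub>) ` carrier F"

text \<open>The condition \<open>\<one> \<noteq> \<zero>\<close> says that \<open>F\<close> embeds into \<open>A\<close>, which is implicit
  in the identity \<open>Z(A) = F\<close>.\<close>

definition central_algebra :: "'f ring \<Rightarrow> ('f, 'a) module \<Rightarrow> bool" where
  "central_algebra F A \<longleftrightarrow>
     unital_algebra F A \<and> \<one>\<^bsub>A\<^esub> \<noteq> \<zero>\<^bsub>A\<^esub> \<and> algebra_center A = scalars F A"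

definition unital_subalgebra :: "'f ring \<Rightarrow> ('f, 'a) module \<Rightarrow> 'a set \<Rightarrow> bool" where
  "unital_subalgebra F A K \<longleftrightarrow> VectorSpace.subspace F K A \<and> \<one>\<^bsub>A\<^esub> \<in> K \<and> (\<forall>x\<in>K. \<forall>y\<in>K. x \<otimes>\<^bsub>A\<^esub> y \<in> K)"

definition algebra_iso ::
  "'f ring \<Rightarrow> ('f, 'a) module \<Rightarrow> ('f, 'b) module \<Rightarrow> ('a \<Rightarrow> 'b) set" where
  "algebra_iso F A B =
     {h \<in> ring_iso A B. \<forall>r\<in>carrier F. \<forall>x\<in>carrier A. h (r \<odot>\<^bsub>A\<^esub> x) = r \<odot>\<^bsub>B\<^esub> h x}"

definition product_algebra :: "'i set \<Rightarrow> ('i \<Rightarrow> ('f, 'a) module) \<Rightarrow> ('f, 'i \<Rightarrow> 'a) module" where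
  "product_algebra I L =
     \<lparr>carrier = (\<Pi>\<^sub>E i\<in>I. carrier (L i)),
      monoid.mult = (\<lambda>x y. \<lambda>i\<in>I. x i \<otimes>\<^bsub>L i\<^esub> y i),
      one = (\<lambda>i\<in>I. \<one>\<^bsub>L i\<^esub>),
      ring.zero = (\<lambda>i\<in>I. \<zero>\<^bsub>L i\<^esub>),
      add = (\<lambda>x y. \<lambda>i\<in>I. x i \<oplus>\<^bsub>L i\<^esub> y i),
      smult = (\<lambda>r x. \<lambda>i\<in>I. r \<odot>\<^bsub>L i\<^esub> x i)\<rparr>"

definition algebra_via :: "('f \<Rightarrow> 'e) \<Rightarrow> 'e ring \<Rightarrow> ('f, 'e) module" where
  "algebra_via \<phi> E =
     \<lparr>carrier = carrier E, monoid.mult = monoid.mult E, one = \<one>\<^bsub>E\<^esub>, ring.zero = \<zero>\<^bsub>E\<^esub>, add = add E,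
      smult = (\<lambda>r x. \<phi> r \<otimes>\<^bsub>E\<^esub> x)\<rparr>"


section \<open>Tensor products\<close>

text \<open>\<open>B \<otimes>\<^sub>F C\<close> is the free abelian group on \<open>B \<times> C\<close> modulo the subgroup generated by the
  relations of bilinearity. Its elements are cosets. Multiplication and scalar action are
  given on representatives and extended to cosets in the same way as \<^const>\<open>rcoset_mult\<close>.
  Scalars are taken from the left factor \<open>B\<close>, acting by \<open>b (b' \<otimes> c) = bb' \<otimes> c\<close>.\<close>

definition tensor_free ::
  "('f, 'b) module \<Rightarrow> ('f, 'c) module \<Rightarrow> ('b \<times> 'c \<Rightarrow>\<^sub>0 int) monoid" where
  "tensor_free B C = free_Abelian_group (carrier B \<times> carrier C)"

definition tensor_relations ::
  "'f ring \<Rightarrow> ('f, 'b) module \<Rightarrow> ('f, 'c) module \<Rightarrow> ('b \<times> 'c \<Rightarrow>\<^sub>0 int) set" where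
  "tensor_relations F B C =
     {frag_of (b \<oplus>\<^bsub>B\<^esub> b', c) - frag_of (b, c) - frag_of (b', c) | b b' c.
        b \<in> carrier B \<and> b' \<in> carrier B \<and> c \<in> carrier C} \<union>
     {frag_of (b, c \<oplus>\<^bsub>C\<^esub> c') - frag_of (b, c) - frag_of (b, c') | b c c'.
        b \<in> carrier B \<and> c \<in> carrier C \<and> c' \<in> carrier C} \<union>
     {frag_of (r \<odot>\<^bsub>B\<^esub> b, c) - frag_of (b, r \<odot>\<^bsub>C\<^esub> c) | r b c.
        r \<in> carrier F \<and> b \<in> carrier B \<and> c \<in> carrier C}"

definition tensor_kernel ::
  "'f ring \<Rightarrow> ('f, 'b) module \<Rightarrow> ('f, 'c) module \<Rightarrow> ('b \<times> 'c \<Rightarrow>\<^sub>0 int) set" where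
  "tensor_kernel F B C = generate (tensor_free B C) (tensor_relations F B C)"

definition tensor_class ::
  "'f ring \<Rightarrow> ('f, 'b) module \<Rightarrow> ('f, 'c) module \<Rightarrow>
   ('b \<times> 'c \<Rightarrow>\<^sub>0 int) \<Rightarrow> ('b \<times> 'c \<Rightarrow>\<^sub>0 int) set" where
  "tensor_class F B C x = tensor_kernel F B C #>\<^bsub>tensor_free B C\<^esub> x"

definition tensor_algebra ::
  "'f ring \<Rightarrow> ('f, 'b) module \<Rightarrow> ('f, 'c) module \<Rightarrow> ('b, ('b \<times> 'c \<Rightarrow>\<^sub>0 int) set) module" where
  "tensor_algebra F B C =
     \<lparr>carrier = carrier (tensor_free B C Mod tensor_kernel F B C),
      monoid.mult = (\<lambda>U V. \<Union>x\<in>U. \<Union>y\<in>V. tensor_class F B C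
        (frag_extend (\<lambda>(b, c). frag_extend (\<lambda>(b', c'). frag_of (b \<otimes>\<^bsub>B\<^esub> b', c \<otimes>\<^bsub>C\<^esub> c')) y) x)),
      one = tensor_class F B C (frag_of (\<one>\<^bsub>B\<^esub>, \<one>\<^bsub>C\<^esub>)),
      ring.zero = tensor_kernel F B C,
      add = monoid.mult (tensor_free B C Mod tensor_kernel F B C),
      smult = (\<lambda>b U. \<Union>x\<in>U. tensor_class F B C
        (frag_extend (\<lambda>(b', c). frag_of (b \<otimes>\<^bsub>B\<^esub> b', c)) x))\<rparr>"

text \<open>The natural map \<open>B \<otimes>\<^sub>F K \<rightarrow> B \<otimes>\<^sub>F C\<close> for a subspace \<open>K\<close> of \<open>C\<close>.\<close>

definition tensor_inclusion ::
  "'f ring \<Rightarrow> ('f, 'b) module \<Rightarrow> ('f, 'c) module \<Rightarrow>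
   ('b \<times> 'c \<Rightarrow>\<^sub>0 int) set \<Rightarrow> ('b \<times> 'c \<Rightarrow>\<^sub>0 int) set" where
  "tensor_inclusion F B C U = (\<Union>x\<in>U. tensor_class F B C x)"

definition scalar_extension ::
  "'f ring \<Rightarrow> ('f \<Rightarrow> 'e) \<Rightarrow> 'e ring \<Rightarrow> ('f, 'a) module \<Rightarrow> ('e, ('e \<times> 'a \<Rightarrow>\<^sub>0 int) set) module" where
  "scalar_extension F \<phi> E A = tensor_algebra F (algebra_via \<phi> E) A"


section \<open>Etale algebras\<close>

text \<open>HOL-Algebra represents polynomials as coefficient lists with the leading coefficient
  first.\<close>

definition poly_derivative :: "('l, 'm) ring_scheme \<Rightarrow> 'l list \<Rightarrow> 'l list" where
  "poly_derivative R p =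
     ring.normalize R (map (\<lambda>i. [i] \<cdot>\<^bsub>R\<^esub> ring.coeff R p i) (rev [1..<length p]))"

definition separable_poly :: "('l, 'm) ring_scheme \<Rightarrow> 'l set \<Rightarrow> 'l list \<Rightarrow> bool" where
  "separable_poly R k p \<longleftrightarrow> (\<forall>d \<in> carrier (univ_poly R k).
     d divides\<^bsub>univ_poly R k\<^esub> p \<longrightarrow> d divides\<^bsub>univ_poly R k\<^esub> poly_derivative R p \<longrightarrow>
     d \<in> Units (univ_poly R k))"

definition finite_separable_extension :: "'f ring \<Rightarrow> ('f, 'l) module \<Rightarrow> bool" where
  "finite_separable_extension F L \<longleftrightarrow>
     unital_algebra F L \<and> field L \<and> vectorspace.fin_dim F L \<and>
     (\<forall>x\<in>carrier L. separable_poly L (scalars F L) (ring.Irr L (scalars F L) x))"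

text \<open>Each factor of a product isomorphic to \<open>K\<close> embeds into \<open>K\<close> as a set, so there is
  no loss of generality in taking the fields \<open>L i\<close> on the type of \<open>K\<close>.\<close>

definition etale_algebra :: "'f ring \<Rightarrow> ('f, 'k) module \<Rightarrow> bool" where
  "etale_algebra F K \<longleftrightarrow> (\<exists>(m::nat) (L :: nat \<Rightarrow> ('f, 'k) module).
     (\<forall>i<m. finite_separable_extension F (L i)) \<and>
     algebra_iso F K (product_algebra {..<m} L) \<noteq> {})"

definition splits_etale ::
  "'f ring \<Rightarrow> ('f \<Rightarrow> 'e) \<Rightarrow> 'e ring \<Rightarrow> ('f, 'k) module \<Rightarrow> bool" where
  "splits_etale F \<phi> E K \<longleftrightarrow>
     algebra_iso E (scalar_extension F \<phi> E K)
       (product_algebra {..<vectorspace.dim F K} (\<lambda>_. algebra_via id E)) \<noteq> {}"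


section \<open>Minimally faithful modules and semiassociative algebras\<close>

definition faithful_module :: "'r ring \<Rightarrow> ('r, 'm) module \<Rightarrow> bool" where
  "faithful_module R M \<longleftrightarrow>
     (\<forall>r\<in>carrier R. (\<forall>x\<in>carrier M. r \<odot>\<^bsub>M\<^esub> x = \<zero>\<^bsub>M\<^esub>) \<longrightarrow> r = \<zero>\<^bsub>R\<^esub>)"

text \<open>The multiplicative part of the record plays no role for modules.\<close>

definition quotient_module :: "('r, 'm) module \<Rightarrow> 'm set \<Rightarrow> ('r, 'm set) module" where
  "quotient_module M N =
     \<lparr>carrier = a_rcosets\<^bsub>M\<^esub> N, monoid.mult = undefined, one = undefined, ring.zero = N, add = set_add M,
      smult = (\<lambda>r U. \<Union>x\<in>U. N +>\<^bsub>M\<^esub> (r \<odot>\<^bsub>M\<^esub> x))\<rparr>"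

definition minimally_faithful :: "'r ring \<Rightarrow> ('r, 'm) module \<Rightarrow> bool" where
  "minimally_faithful R M \<longleftrightarrow> faithful_module R M \<and>
     (\<forall>N N'. LinearCombinations.submodule R N M \<and> LinearCombinations.submodule R N' (M\<lparr>carrier := N\<rparr>) \<and>
        faithful_module R (quotient_module (M\<lparr>carrier := N\<rparr>) N') \<longrightarrow>
        N = carrier M \<and> N' = {\<zero>\<^bsub>M\<^esub>})"

text \<open>For a commutative subalgebra \<open>K\<close> of the nucleus of \<open>A\<close>, \<open>A\<close> is a module over the ring
  \<open>K \<otimes>\<^sub>F K\<close> by \<open>(k \<otimes> k') a = (ka)k' = k(ak')\<close>. A coset acts through any of its
  representatives.\<close>

definition enveloping_ring ::
  "'f ring \<Rightarrow> ('f, 'a) module \<Rightarrow> 'a set \<Rightarrow> ('a \<times> 'a \<Rightarrow>\<^sub>0 int) set ring" where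
  "enveloping_ring F A K =
     ring.truncate (tensor_algebra F (A\<lparr>carrier := K\<rparr>) (A\<lparr>carrier := K\<rparr>))"

definition two_sided_action ::
  "('f, 'a) module \<Rightarrow> ('a \<times> 'a \<Rightarrow>\<^sub>0 int) \<Rightarrow> 'a \<Rightarrow> 'a" where
  "two_sided_action A x a =
     (\<Oplus>\<^bsub>A\<^esub>p\<in>Poly_Mapping.keys x.
        [Poly_Mapping.lookup x p] \<cdot>\<^bsub>A\<^esub> ((fst p \<otimes>\<^bsub>A\<^esub> a) \<otimes>\<^bsub>A\<^esub> snd p))"

definition enveloping_module :: "('f, 'a) module \<Rightarrow> (('a \<times> 'a \<Rightarrow>\<^sub>0 int) set, 'a) module" where
  "enveloping_module A =
     \<lparr>carrier = carrier A, monoid.mult = monoid.mult A, one = \<one>\<^bsub>A\<^esub>, ring.zero = \<zero>\<^bsub>A\<^esub>, add = add A,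
      smult = (\<lambda>U a. the_elem ((\<lambda>x. two_sided_action A x a) ` U))\<rparr>"

definition semiassociative_algebra :: "'f ring \<Rightarrow> ('f, 'a) module \<Rightarrow> bool" where
  "semiassociative_algebra F A \<longleftrightarrow>
     central_algebra F A \<and> vectorspace.fin_dim F A \<and>
     (\<exists>K. unital_subalgebra F A K \<and> K \<subseteq> nucleus A \<and> etale_algebra F (A\<lparr>carrier := K\<rparr>) \<and>
        minimally_faithful (enveloping_ring F A K) (enveloping_module A))"

definition semiassociative_of_degree :: "'f ring \<Rightarrow> ('f, 'a) module \<Rightarrow> nat \<Rightarrow> bool" where
  "semiassociative_of_degree F A n \<longleftrightarrow>
     semiassociative_algebra F A \<and> real n = sqrt (real (vectorspace.dim F A))"


section \<open>Skew matrix algebras\<close>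

text \<open>Indices run over \<open>0, \<dots>, n - 1\<close>.\<close>

definition reduced_skew_set :: "'e ring \<Rightarrow> nat \<Rightarrow> (nat \<Rightarrow> nat \<Rightarrow> nat \<Rightarrow> 'e) \<Rightarrow> bool" where
  "reduced_skew_set E n c \<longleftrightarrow>
     (\<forall>i<n. \<forall>j<n. \<forall>k<n. c i j k \<in> carrier E) \<and>
     (\<forall>i<n. \<forall>j<n. c i i j = \<one>\<^bsub>E\<^esub> \<and> c i j j = \<one>\<^bsub>E\<^esub>)"

text \<open>An element \<open>\<Sum> x\<^sub>i\<^sub>j e\<^sub>i\<^sub>j\<close> is represented by its coefficient function \<open>x\<close>. The
  product is the bilinear extension of \<open>e\<^sub>i\<^sub>j e\<^sub>k\<^sub>l = \<delta>\<^sub>j\<^sub>k c\<^sub>i\<^sub>j\<^sub>l e\<^sub>i\<^sub>l\<close>, and the unit is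
  \<open>\<Sum> e\<^sub>i\<^sub>i\<close>.\<close>

definition skew_matrix_algebra ::
  "'e ring \<Rightarrow> nat \<Rightarrow> (nat \<Rightarrow> nat \<Rightarrow> nat \<Rightarrow> 'e) \<Rightarrow> ('e, nat \<times> nat \<Rightarrow> 'e) module" where
  "skew_matrix_algebra E n c =
     \<lparr>carrier = {..<n} \<times> {..<n} \<rightarrow>\<^sub>E carrier E,
      monoid.mult = (\<lambda>x y. restrict
        (\<lambda>(i, l). \<Oplus>\<^bsub>E\<^esub>j\<in>{..<n}. c i j l \<otimes>\<^bsub>E\<^esub> (x (i, j) \<otimes>\<^bsub>E\<^esub> y (j, l))) ({..<n} \<times> {..<n})),
      one = restrict (\<lambda>(i, j). if i = j then \<one>\<^bsub>E\<^esub> else \<zero>\<^bsub>E\<^esub>) ({..<n} \<times> {..<n}),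
      ring.zero = restrict (\<lambda>_. \<zero>\<^bsub>E\<^esub>) ({..<n} \<times> {..<n}),
      add = (\<lambda>x y. restrict (\<lambda>p. x p \<oplus>\<^bsub>E\<^esub> y p) ({..<n} \<times> {..<n})),
      smult = (\<lambda>r x. restrict (\<lambda>p. r \<otimes>\<^bsub>E\<^esub> x p) ({..<n} \<times> {..<n}))\<rparr>"

definition matrix_unit :: "'e ring \<Rightarrow> nat \<Rightarrow> nat \<Rightarrow> nat \<Rightarrow> nat \<times> nat \<Rightarrow> 'e" where
  "matrix_unit E n i j = restrict (\<lambda>p. if p = (i, j) then \<one>\<^bsub>E\<^esub> else \<zero>\<^bsub>E\<^esub>) ({..<n} \<times> {..<n})"

definition diagonal_subalgebra ::
  "'e ring \<Rightarrow> nat \<Rightarrow> (nat \<Rightarrow> nat \<Rightarrow> nat \<Rightarrow> 'e) \<Rightarrow> (nat \<times> nat \<Rightarrow> 'e) set" where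
  "diagonal_subalgebra E n c =
     LinearCombinations.module.span E (skew_matrix_algebra E n c) {matrix_unit E n i i | i. i < n}"

definition split_algebra :: "'e ring \<Rightarrow> ('e, 'b) module \<Rightarrow> bool" where
  "split_algebra E B \<longleftrightarrow>
     (\<exists>n c. reduced_skew_set E n c \<and> algebra_iso E B (skew_matrix_algebra E n c) \<noteq> {})"

definition splits_algebra ::
  "'f ring \<Rightarrow> ('f \<Rightarrow> 'e) \<Rightarrow> 'e ring \<Rightarrow> ('f, 'a) module \<Rightarrow> bool" where
  "splits_algebra F \<phi> E A \<longleftrightarrow> split_algebra E (scalar_extension F \<phi> E A)"

end

theory Submission
  imports Defs "HOL-Algebra.Algebraic_Closure"
begin

text \<open>Let \<open>K\<^sub>0\<close> be the etale subalgebra that makes \<open>A\<close> minimally faithful and let \<open>\<Omega>\<close> be an algebraic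
  closure of \<open>E\<close>. Minimal faithfulness makes \<open>A\<close> a cyclic faithful \<open>K\<^sub>0 \<otimes> K\<^sub>0\<close>-module, and \<open>\<Omega>\<close> splits \<open>K\<^sub>0\<close>, so
  all corners of \<open>\<Omega> \<otimes> A\<close> cut out by the primitive idempotents of \<open>\<Omega> \<otimes> K\<^sub>0\<close> are one-dimensional. It follows
  that \<open>f (\<Omega> \<otimes> A) g \<noteq> 0\<close> for all nonzero idempotents \<open>f\<close>, \<open>g\<close> of the nucleus. Apply this to the \<open>n\<close>
  orthogonal idempotents \<open>e\<^sub>i\<close> of \<open>E \<otimes> K\<close>, where \<open>K\<close> need not be related to \<open>K\<^sub>0\<close>: the \<open>n\<^sup>2\<close> corners
  \<open>e\<^sub>i (E \<otimes> A) e\<^sub>j\<close> are nonzero and \<open>E \<otimes> A\<close> has dimension \<open>n\<^sup>2\<close>, so each of them is a line, and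
  generators \<open>v\<^sub>i\<^sub>j\<close> of these lines with \<open>v\<^sub>i\<^sub>i = e\<^sub>i\<close> are skew matrix units.\<close>

text \<open>The given \<open>K\<close> need not make \<open>A\<close> minimally faithful, and no
  attempt is made to conjugate it into the subalgebra of the definition. The only bridge between the
  two is the statement about idempotents. Its proof runs inside the nucleus, an associative ring,
  and uses the rest of the algebra only as a bimodule over it. The algebraic closure is needed
  because \<open>E\<close> splits \<open>K\<close> but perhaps not the other subalgebra. Cyclicity
  comes from the absence of nilpotents: an element of the enveloping ring acts on each corner over
  \<Omega> as a scalar, so if its square kills a vector, it kills the vector itself. This is what
  allows a vector with zero annihilator to be built; the submodule that it generates is faithful,
  hence everything. Over \<Omega> the unit is expanded in joint eigenvectors of the subalgebra. Up
  to scalars these are primitive idempotents, but some may be zero or proportional to each other, so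
  the argument avoids orthogonality. Linear independence is carried from \<open>F\<close> to
  extension fields by extending linear functionals.\<close>

text \<open>Sums over infinite index sets are zero by convention, so the induction covers them once
  \<open>h\<close> is known to fix zero. Only additivity enters; hence the lemma serves scalar
  multiplications, functionals, one-sided products and inclusions of carriers alike.\<close>

lemma finsum_hom:
  assumes "abelian_group G" and "abelian_group H"
    and closed: "\<And>x. x \<in> carrier G \<Longrightarrow> h x \<in> carrier H"
    and add: "\<And>x y. \<lbrakk>x \<in> carrier G; y \<in> carrier G\<rbrakk> \<Longrightarrow> h (x \<oplus>\<^bsub>G\<^esub> y) = h x \<oplus>\<^bsub>H\<^esub> h y"
    and "f \<in> I \<rightarrow> carrier G"
  shows "h (\<Oplus>\<^bsub>G\<^esub>i\<in>I. f i) = (\<Oplus>\<^bsub>H\<^esub>i\<in>I. h (f i))"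
proof -
  interpret G: abelian_group G by fact
  interpret H: abelian_group H by fact
  have zero: "h \<zero>\<^bsub>G\<^esub> = \<zero>\<^bsub>H\<^esub>"
    using add[of "\<zero>\<^bsub>G\<^esub>" "\<zero>\<^bsub>G\<^esub>"] closed[of "\<zero>\<^bsub>G\<^esub>"] by (metis G.l_zero G.zero_closed H.add.r_cancel_one')
  show ?thesis
    using assms(5)
  proof (induction I rule: infinite_finite_induct)
    case (insert i I)
    then show ?case
      by (simp add: add closed Pi_iff)
  qed (simp_all add: zero)
qed

text \<open>The operations on cosets in \<open>tensor_algebra\<close> are unions over all
  representatives; once every representative is shown to give the same coset, such a union collapses
  to it.\<close>

lemma UN_eq_const:
  assumes "x \<in> U" and "\<And>u. u \<in> U \<Longrightarrow> f u = c"
  shows "(\<Union>u\<in>U. f u) = c"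
  using assms by auto

section \<open>Sums over free abelian groups\<close>

text \<open>The homomorphism out of the free abelian group that extends \<open>g\<close>: a formal
  integer combination is evaluated in \<open>G\<close>. \<open>two_sided_action\<close> has this
  shape, with pairs acting by sandwiching.\<close>

definition frag_sum :: "('g, 'm) ring_scheme \<Rightarrow> ('p \<Rightarrow> 'g) \<Rightarrow> ('p \<Rightarrow>\<^sub>0 int) \<Rightarrow> 'g" where
  "frag_sum G g x = (\<Oplus>\<^bsub>G\<^esub>p\<in>Poly_Mapping.keys x. [Poly_Mapping.lookup x p] \<cdot>\<^bsub>G\<^esub> g p)"

context abelian_group
begin

lemma frag_sum_superset:
  assumes "finite S" and "Poly_Mapping.keys x \<subseteq> S" and "g \<in> S \<rightarrow> carrier G"
  shows "frag_sum G g x = (\<Oplus>p\<in>S. [Poly_Mapping.lookup x p] \<cdot> g p)"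
  unfolding frag_sum_def
proof (rule add.finprod_mono_neutral_cong_left[OF assms(1,2)])
  show "[Poly_Mapping.lookup x i] \<cdot> g i = \<zero>" if "i \<in> S - Poly_Mapping.keys x" for i
    using that assms(3) by (simp add: in_keys_iff add_pow_def int_pow_def2)
qed (use assms in auto)

lemma frag_sum_closed:
  assumes "g \<in> Poly_Mapping.keys x \<rightarrow> carrier G"
  shows "frag_sum G g x \<in> carrier G"
  unfolding frag_sum_def by (rule finsum_closed) (use assms in auto)

lemma frag_sum_0 [simp]: "frag_sum G g 0 = \<zero>"
  by (simp add: frag_sum_def)

lemma frag_sum_of [simp]: "g p \<in> carrier G \<Longrightarrow> frag_sum G g (frag_of p) = g p"
  by (simp add: frag_sum_def)

lemma frag_sum_add:
  assumes "g \<in> S \<rightarrow> carrier G" and "Poly_Mapping.keys x \<subseteq> S" and "Poly_Mapping.keys y \<subseteq> S"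
  shows "frag_sum G g (x + y) = frag_sum G g x \<oplus> frag_sum G g y"
proof -
  let ?S = "Poly_Mapping.keys x \<union> Poly_Mapping.keys y"
  have g: "g \<in> ?S \<rightarrow> carrier G" using assms by auto
  \<comment> \<open>Keys of \<open>x + y\<close> may cancel, so all three sums are first written
    over the union of both key sets.\<close>
  have "frag_sum G g (x + y) = (\<Oplus>p\<in>?S. [Poly_Mapping.lookup (x + y) p] \<cdot> g p)"
    by (rule frag_sum_superset) (use g keys_add[of x y] in auto)
  also have "\<dots> = (\<Oplus>p\<in>?S. [Poly_Mapping.lookup x p] \<cdot> g p \<oplus> [Poly_Mapping.lookup y p] \<cdot> g p)"
    by (rule finsum_cong') (use g in \<open>auto simp: lookup_add add.int_pow_mult Pi_iff\<close>)
  also have "\<dots> = (\<Oplus>p\<in>?S. [Poly_Mapping.lookup x p] \<cdot> g p) \<oplus> (\<Oplus>p\<in>?S. [Poly_Mapping.lookup y p] \<cdot> g p)"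
    by (rule finsum_addf) (use g in auto)
  also have "(\<Oplus>p\<in>?S. [Poly_Mapping.lookup x p] \<cdot> g p) = frag_sum G g x"
    by (rule frag_sum_superset[symmetric]) (use g in auto)
  also have "(\<Oplus>p\<in>?S. [Poly_Mapping.lookup y p] \<cdot> g p) = frag_sum G g y"
    by (rule frag_sum_superset[symmetric]) (use g in auto)
  finally show ?thesis .
qed

lemma frag_sum_diff:
  assumes "g \<in> S \<rightarrow> carrier G" and "Poly_Mapping.keys x \<subseteq> S" and "Poly_Mapping.keys y \<subseteq> S"
  shows "frag_sum G g (x - y) = frag_sum G g x \<ominus> frag_sum G g y"
proof -
  have k: "Poly_Mapping.keys (x - y) \<subseteq> S" using keys_diff[of x y] assms by blast
  have c: "frag_sum G g z \<in> carrier G" if "Poly_Mapping.keys z \<subseteq> S" for z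
    by (rule frag_sum_closed) (use that assms in auto)
  have "frag_sum G g (x - y) \<oplus> frag_sum G g y = frag_sum G g x"
    using frag_sum_add[OF assms(1) k assms(3)] by simp
  then show ?thesis
    using c k assms by (metis add.inv_closed add.inv_solve_right minus_eq)
qed

end

section \<open>Tensor products of algebras\<close>

lemma frag_extend_fun_diff:
  "frag_extend (\<lambda>p. f p - g p) x = frag_extend f x - frag_extend g x"
  by (rule frag_induction[where S = UNIV and c = x]) (simp_all add: frag_extend_diff)

lemma frag_extend_fun_0 [simp]: "frag_extend (\<lambda>p. 0) x = 0"
  by (simp add: frag_extend_eq_0)

text \<open>The product on formal sums before passing to cosets, in the very form that occurs in
  \<open>tensor_algebra\<close>, so that the coset product unfolds to it.\<close>

definition frag_mult ::
  "('f, 'b) module \<Rightarrow> ('f, 'c) module \<Rightarrow> ('b \<times> 'c \<Rightarrow>\<^sub>0 int) \<Rightarrow> ('b \<times> 'c \<Rightarrow>\<^sub>0 int) \<Rightarrow> ('b \<times> 'c \<Rightarrow>\<^sub>0 int)"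
  where "frag_mult B C x y =
    frag_extend (\<lambda>(b, c). frag_extend (\<lambda>(b', c'). frag_of (b \<otimes>\<^bsub>B\<^esub> b', c \<otimes>\<^bsub>C\<^esub> c')) y) x"

lemma frag_mult_of [simp]:
  "frag_mult B C (frag_of (b, c)) (frag_of (b', c')) = frag_of (b \<otimes>\<^bsub>B\<^esub> b', c \<otimes>\<^bsub>C\<^esub> c')"
  by (simp add: frag_mult_def)

lemma frag_mult_0 [simp]: "frag_mult B C 0 y = 0" "frag_mult B C x 0 = 0"
  by (simp_all add: frag_mult_def case_prod_unfold)

lemma frag_mult_diff_left: "frag_mult B C (x - x') y = frag_mult B C x y - frag_mult B C x' y"
  by (simp add: frag_mult_def frag_extend_diff)

lemma frag_mult_diff_right: "frag_mult B C x (y - y') = frag_mult B C x y - frag_mult B C x y'"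
  by (simp add: frag_mult_def frag_extend_diff case_prod_unfold frag_extend_fun_diff)

lemma frag_mult_add_left: "frag_mult B C (x + x') y = frag_mult B C x y + frag_mult B C x' y"
  using frag_mult_diff_left[of B C "x + x'" x' y] by (simp add: algebra_simps)

lemma frag_mult_add_right: "frag_mult B C x (y + y') = frag_mult B C x y + frag_mult B C x y'"
  using frag_mult_diff_right[of B C x "y + y'" y'] by (simp add: algebra_simps)

lemma (in unital_algebra) algebra_abelian_group: "abelian_group A" ..

locale algebra_pair = B: unital_algebra F B + C: unital_algebra F C
  for F :: "'f ring" and B :: "('f, 'b) module" and C :: "('f, 'c) module"
begin

abbreviation "pure \<equiv> carrier B \<times> carrier C"
abbreviation "ker \<equiv> tensor_kernel F B C"
abbreviation "cls \<equiv> tensor_class F B C"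
abbreviation "TA \<equiv> tensor_algebra F B C"

lemmas frag_induct = free_Abelian_group_induct[where S = pure, consumes 1, case_names zero diff of]

lemma frag_mult_keys:
  assumes "Poly_Mapping.keys x \<subseteq> pure" and "Poly_Mapping.keys y \<subseteq> pure"
  shows "Poly_Mapping.keys (frag_mult B C x y) \<subseteq> pure"
  using assms(1)
proof (induction x rule: frag_induct)
  case (diff x x')
  then show ?case using keys_diff by (fastforce simp: frag_mult_diff_left)
next
  case (of p)
  show ?case using assms(2)
  proof (induction y rule: frag_induct)
    case (diff y y')
    then show ?case using keys_diff by (fastforce simp: frag_mult_diff_right)
  next
    case (of q)
    with \<open>p \<in> pure\<close> show ?case
      by (cases p; cases q) (auto simp: B.mult_closed C.mult_closed)
  qed simp
qed simp

lemma relation_cases [consumes 1, case_names left right scalar]: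
  assumes "r \<in> tensor_relations F B C"
  obtains b b' c where "b \<in> carrier B" "b' \<in> carrier B" "c \<in> carrier C"
      "r = frag_of (b \<oplus>\<^bsub>B\<^esub> b', c) - frag_of (b, c) - frag_of (b', c)"
    | b c c' where "b \<in> carrier B" "c \<in> carrier C" "c' \<in> carrier C"
      "r = frag_of (b, c \<oplus>\<^bsub>C\<^esub> c') - frag_of (b, c) - frag_of (b, c')"
    | s b c where "s \<in> carrier F" "b \<in> carrier B" "c \<in> carrier C"
      "r = frag_of (s \<odot>\<^bsub>B\<^esub> b, c) - frag_of (b, s \<odot>\<^bsub>C\<^esub> c)"
  using assms unfolding tensor_relations_def
  by (elim UnE CollectE exE conjE) (erule (3) that)+

lemma relations_keys: "r \<in> tensor_relations F B C \<Longrightarrow> Poly_Mapping.keys r \<subseteq> pure"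
proof -
  have 1: "Poly_Mapping.keys (frag_of p - frag_of q - frag_of q') \<subseteq> pure"
    if "p \<in> pure" "q \<in> pure" "q' \<in> pure" for p q q'
    using that keys_diff[of "frag_of p - frag_of q" "frag_of q'"] keys_diff[of "frag_of p" "frag_of q"]
    by (auto simp del: mem_Sigma_iff)
  have 2: "Poly_Mapping.keys (frag_of p - frag_of q) \<subseteq> pure" if "p \<in> pure" "q \<in> pure" for p q
    using that keys_diff[of "frag_of p" "frag_of q"] by (auto simp del: mem_Sigma_iff)
  assume "r \<in> tensor_relations F B C"
  then show "Poly_Mapping.keys r \<subseteq> pure"
  proof (cases rule: relation_cases)
    case (left b b' c)
    then show ?thesis unfolding left(4) by (intro 1) auto
  next
    case (right b c c')
    then show ?thesis unfolding right(4) by (intro 1) auto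
  next
    case (scalar s b c)
    then show ?thesis unfolding scalar(4) by (intro 2) auto
  qed
qed

lemma kernel_subgroup: "subgroup ker (tensor_free B C)"
  unfolding tensor_kernel_def tensor_free_def
  by (rule group.generate_is_subgroup) (use relations_keys in auto)

lemma kernel_keys: "x \<in> ker \<Longrightarrow> Poly_Mapping.keys x \<subseteq> pure"
  using subgroup.mem_carrier[OF kernel_subgroup] by (simp add: tensor_free_def)

lemma kernel_0 [simp]: "0 \<in> ker"
  using subgroup.one_closed[OF kernel_subgroup] by (simp add: tensor_free_def)

lemma kernel_add: "\<lbrakk>x \<in> ker; y \<in> ker\<rbrakk> \<Longrightarrow> x + y \<in> ker"
  using subgroup.m_closed[OF kernel_subgroup] by (simp add: tensor_free_def)

lemma kernel_minus: "x \<in> ker \<Longrightarrow> - x \<in> ker"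
  using subgroup.m_inv_closed[OF kernel_subgroup, of x] kernel_keys[of x] by (simp add: tensor_free_def)

lemma kernel_diff: "\<lbrakk>x \<in> ker; y \<in> ker\<rbrakk> \<Longrightarrow> x - y \<in> ker"
  using kernel_add[OF _ kernel_minus] by fastforce

lemma relation_in_kernel: "r \<in> tensor_relations F B C \<Longrightarrow> r \<in> ker"
  unfolding tensor_kernel_def by (rule generate.incl)

text \<open>Sums and inverses are both differences starting from 0, so the closure rules of a
  generated subgroup shrink to one. Additive statements about the kernel then have to be proved on
  relations only.\<close>

lemma kernel_induct [consumes 1, case_names zero relation diff]:
  assumes "x \<in> ker" and "P 0" and "\<And>r. r \<in> tensor_relations F B C \<Longrightarrow> P r"
    and diff: "\<And>x y. \<lbrakk>x \<in> ker; y \<in> ker; P x; P y\<rbrakk> \<Longrightarrow> P (x - y)"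
  shows "P x"
proof -
  have "x \<in> ker \<and> P x"
    using assms(1) unfolding tensor_kernel_def
  proof (induction x rule: generate.induct)
    case one
    then show ?case using assms(2) kernel_0 by (simp add: tensor_kernel_def tensor_free_def generate.one)
  next
    case (incl r)
    then show ?case using assms(3) by (simp add: generate.incl)
  next
    case (inv r)
    have r: "r \<in> ker" "P r" using inv assms(3) relation_in_kernel by auto
    have "inv\<^bsub>tensor_free B C\<^esub> r = 0 - r" using kernel_keys[OF r(1)] by (simp add: tensor_free_def)
    then show ?case
      using diff[OF kernel_0 r(1) assms(2) r(2)] kernel_diff[OF kernel_0 r(1)] by (simp add: tensor_kernel_def)
  next
    case (eng x y)
    then have xy: "x \<in> ker" "y \<in> ker" "P x" "P y" by (simp_all add: tensor_kernel_def)
    have "P (0 - y)" using diff[OF kernel_0 xy(2) assms(2) xy(4)] .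
    then have "P (x - (0 - y))" using diff[OF xy(1) kernel_diff[OF kernel_0 xy(2)] xy(3)] by simp
    then show ?case using kernel_add[OF xy(1,2)] by (simp add: tensor_kernel_def tensor_free_def)
  qed
  then show ?thesis ..
qed

lemma kernel_left: "\<lbrakk>b \<in> carrier B; b' \<in> carrier B; c \<in> carrier C\<rbrakk> \<Longrightarrow>
    frag_of (b \<oplus>\<^bsub>B\<^esub> b', c) - frag_of (b, c) - frag_of (b', c) \<in> ker"
  by (rule relation_in_kernel, unfold tensor_relations_def, rule UnI1, rule UnI1, rule CollectI,
      intro exI conjI, rule refl)

lemma kernel_right: "\<lbrakk>b \<in> carrier B; c \<in> carrier C; c' \<in> carrier C\<rbrakk> \<Longrightarrow>
    frag_of (b, c \<oplus>\<^bsub>C\<^esub> c') - frag_of (b, c) - frag_of (b, c') \<in> ker"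
  by (rule relation_in_kernel, unfold tensor_relations_def, rule UnI1, rule UnI2, rule CollectI,
      intro exI conjI, rule refl)

lemma kernel_scalar: "\<lbrakk>s \<in> carrier F; b \<in> carrier B; c \<in> carrier C\<rbrakk> \<Longrightarrow>
    frag_of (s \<odot>\<^bsub>B\<^esub> b, c) - frag_of (b, s \<odot>\<^bsub>C\<^esub> c) \<in> ker"
  by (rule relation_in_kernel, unfold tensor_relations_def, rule UnI2, rule CollectI,
      intro exI conjI, rule refl)

text \<open>A relation times a pure tensor is a relation of the same type, by distributivity and by
  compatibility of scalars with products. Together with \<open>kernel_mult_right\<close> this makes
  \<open>ker\<close> a two-sided ideal of the nonassociative ring of formal sums, which is what lets
  the product descend to cosets.\<close>

lemma kernel_mult_left:
  assumes "x \<in> ker" and "Poly_Mapping.keys y \<subseteq> pure"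
  shows "frag_mult B C x y \<in> ker"
  using assms(1)
proof (induction x rule: kernel_induct)
  case (diff x x')
  then show ?case by (simp add: frag_mult_diff_left kernel_diff)
next
  case (relation r)
  show ?case using assms(2)
  proof (induction y rule: frag_induct)
    case (diff y y')
    then show ?case by (simp add: frag_mult_diff_right kernel_diff)
  next
    case (of p)
    obtain b1 c1 where p: "p = (b1, c1)" "b1 \<in> carrier B" "c1 \<in> carrier C" using of by auto
    show ?case using relation p
      by (cases rule: relation_cases)
        (auto simp: frag_mult_diff_left B.l_distr C.l_distr B.smult_mult_left C.smult_mult_left
          intro!: kernel_left kernel_right kernel_scalar B.mult_closed C.mult_closed)
  qed simp
qed simp

lemma kernel_mult_right:
  assumes "y \<in> ker" and "Poly_Mapping.keys x \<subseteq> pure"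
  shows "frag_mult B C x y \<in> ker"
  using assms(1)
proof (induction y rule: kernel_induct)
  case (diff x x')
  then show ?case by (simp add: frag_mult_diff_right kernel_diff)
next
  case (relation r)
  show ?case using assms(2)
  proof (induction x rule: frag_induct)
    case (diff y y')
    then show ?case by (simp add: frag_mult_diff_left kernel_diff)
  next
    case (of p)
    obtain b1 c1 where p: "p = (b1, c1)" "b1 \<in> carrier B" "c1 \<in> carrier C" using of by auto
    show ?case using relation p
      by (cases rule: relation_cases)
        (auto simp: frag_mult_diff_right B.r_distr C.r_distr B.smult_mult_right C.smult_mult_right
          intro!: kernel_left kernel_right kernel_scalar B.mult_closed C.mult_closed)
  qed simp
qed simp

lemma class_altdef: "cls x = (\<lambda>t. t + x) ` ker"
  unfolding tensor_class_def r_coset_def tensor_free_def by auto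

lemma class_eq_iff: "cls x = cls y \<longleftrightarrow> x - y \<in> ker"
proof
  assume "cls x = cls y"
  moreover have "x \<in> cls x" unfolding class_altdef by (rule image_eqI[where x = 0]) simp_all
  ultimately show "x - y \<in> ker" unfolding class_altdef by auto
next
  have sub: "cls u \<subseteq> cls v" if "u - v \<in> ker" for u v
  proof
    fix z assume "z \<in> cls u"
    then obtain t where t: "t \<in> ker" "z = t + u" unfolding class_altdef by auto
    then have "z = (t + (u - v)) + v" by simp
    then show "z \<in> cls v" unfolding class_altdef using kernel_add[OF t(1) that] by blast
  qed
  assume "x - y \<in> ker"
  then show "cls x = cls y" using sub[of x y] sub[of y x] kernel_minus[of "x - y"] by simp
qed

lemma class_eqI: "x - y \<in> ker \<Longrightarrow> cls x = cls y"
  by (simp add: class_eq_iff)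

lemma mem_class_iff: "z \<in> cls x \<longleftrightarrow> z - x \<in> ker"
  unfolding class_altdef by (auto intro!: image_eqI[where x = "z - x"])

lemma self_in_class: "x \<in> cls x"
  by (simp add: mem_class_iff)

lemma class_keys: "\<lbrakk>Poly_Mapping.keys x \<subseteq> pure; z \<in> cls x\<rbrakk> \<Longrightarrow> Poly_Mapping.keys z \<subseteq> pure"
  using kernel_keys keys_add[of "z - x" x] by (fastforce simp: mem_class_iff)

lemma carrier_tensor: "carrier TA = cls ` {x. Poly_Mapping.keys x \<subseteq> pure}"
  unfolding tensor_algebra_def FactGroup_def RCOSETS_def tensor_class_def
  by (auto simp: tensor_free_def)

lemma class_closed [intro, simp]: "Poly_Mapping.keys x \<subseteq> pure \<Longrightarrow> cls x \<in> carrier TA"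
  by (simp add: carrier_tensor)

lemma zero_tensor: "\<zero>\<^bsub>TA\<^esub> = cls 0"
  unfolding class_altdef by (simp add: tensor_algebra_def)

lemma one_tensor: "\<one>\<^bsub>TA\<^esub> = cls (frag_of (\<one>\<^bsub>B\<^esub>, \<one>\<^bsub>C\<^esub>))"
  by (simp add: tensor_algebra_def)

lemma add_tensor: "cls x \<oplus>\<^bsub>TA\<^esub> cls y = cls (x + y)"
proof -
  have "cls x \<oplus>\<^bsub>TA\<^esub> cls y = (\<Union>h\<in>cls x. \<Union>k\<in>cls y. {h + k})"
    by (simp add: tensor_algebra_def FactGroup_def set_mult_def tensor_free_def)
  also have "\<dots> = cls (x + y)"
  proof (intro equalityI subsetI)
    fix z assume "z \<in> (\<Union>h\<in>cls x. \<Union>k\<in>cls y. {h + k})"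
    then obtain h k where hk: "h - x \<in> ker" "k - y \<in> ker" "z = h + k" by (auto simp: mem_class_iff)
    have "z - (x + y) = (h - x) + (k - y)" using hk(3) by simp
    then show "z \<in> cls (x + y)" using kernel_add[OF hk(1,2)] by (simp only: mem_class_iff)
  next
    fix z assume "z \<in> cls (x + y)"
    then have "z - y \<in> cls x" "y \<in> cls y" by (simp_all add: mem_class_iff algebra_simps)
    then show "z \<in> (\<Union>h\<in>cls x. \<Union>k\<in>cls y. {h + k})" by force
  qed
  finally show ?thesis .
qed

lemma mult_tensor:
  assumes "Poly_Mapping.keys x \<subseteq> pure" and "Poly_Mapping.keys y \<subseteq> pure"
  shows "cls x \<otimes>\<^bsub>TA\<^esub> cls y = cls (frag_mult B C x y)"
proof -
  have "cls (frag_mult B C u v) = cls (frag_mult B C x y)" if "u \<in> cls x" "v \<in> cls y" for u v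
  proof (rule class_eqI)
    \<comment> \<open>One representative is replaced at a time,
      \<open>u v - x y = (u - x) v + x (v - y)\<close>, and each summand lies in the ideal.\<close>
    have "frag_mult B C u v - frag_mult B C x y = frag_mult B C (u - x) v + frag_mult B C x (v - y)"
      by (simp add: frag_mult_diff_left frag_mult_diff_right)
    moreover have "frag_mult B C (u - x) v \<in> ker"
      using that assms class_keys[of y v] by (intro kernel_mult_left) (simp_all only: mem_class_iff)
    moreover have "frag_mult B C x (v - y) \<in> ker"
      using that assms by (intro kernel_mult_right) (simp_all only: mem_class_iff)
    ultimately show "frag_mult B C u v - frag_mult B C x y \<in> ker"
      using kernel_add by (simp only:)
  qed
  moreover have "cls x \<otimes>\<^bsub>TA\<^esub> cls y = (\<Union>u\<in>cls x. \<Union>v\<in>cls y. cls (frag_mult B C u v))"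
    by (simp add: tensor_algebra_def frag_mult_def)
  ultimately show ?thesis
    by (metis (no_types, lifting) UN_eq_const[OF self_in_class])
qed

lemma frag_mult_one_left:
  assumes "Poly_Mapping.keys x \<subseteq> pure"
  shows "frag_mult B C (frag_of (\<one>\<^bsub>B\<^esub>, \<one>\<^bsub>C\<^esub>)) x = x"
  using assms
  by (induction x rule: frag_induct) (auto simp: frag_mult_diff_right B.l_one C.l_one)

lemma frag_mult_one_right:
  assumes "Poly_Mapping.keys x \<subseteq> pure"
  shows "frag_mult B C x (frag_of (\<one>\<^bsub>B\<^esub>, \<one>\<^bsub>C\<^esub>)) = x"
  using assms
  by (induction x rule: frag_induct) (auto simp: frag_mult_diff_left B.r_one C.r_one)

text \<open>The action on the left factor is multiplication by the pure tensor of \<open>b\<close>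
  and the unit, so its independence of the representative is inherited from the product. Both agree
  on formal sums over \<open>pure\<close>, where the unit law of \<open>C\<close> applies.\<close>

lemma smult_tensor:
  assumes "b \<in> carrier B" and "Poly_Mapping.keys x \<subseteq> pure"
  shows "b \<odot>\<^bsub>TA\<^esub> cls x = cls (frag_mult B C (frag_of (b, \<one>\<^bsub>C\<^esub>)) x)"
proof -
  have eq: "frag_extend (\<lambda>(b', c). frag_of (b \<otimes>\<^bsub>B\<^esub> b', c)) u = frag_mult B C (frag_of (b, \<one>\<^bsub>C\<^esub>)) u"
    if "Poly_Mapping.keys u \<subseteq> pure" for u
    using that
    by (induction u rule: frag_induct) (auto simp: frag_mult_diff_right frag_extend_diff C.l_one)
  have "cls (frag_extend (\<lambda>(b', c). frag_of (b \<otimes>\<^bsub>B\<^esub> b', c)) u)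
      = cls (frag_mult B C (frag_of (b, \<one>\<^bsub>C\<^esub>)) x)" if u: "u \<in> cls x" for u
  proof -
    have "frag_mult B C (frag_of (b, \<one>\<^bsub>C\<^esub>)) u - frag_mult B C (frag_of (b, \<one>\<^bsub>C\<^esub>)) x \<in> ker"
      using kernel_mult_right[of "u - x" "frag_of (b, \<one>\<^bsub>C\<^esub>)"] u assms(1) C.one_closed
      by (simp add: mem_class_iff frag_mult_diff_right)
    then show ?thesis using eq[OF class_keys[OF assms(2) u]] by (simp add: class_eqI)
  qed
  moreover have "b \<odot>\<^bsub>TA\<^esub> cls x = (\<Union>u\<in>cls x. cls (frag_extend (\<lambda>(b', c). frag_of (b \<otimes>\<^bsub>B\<^esub> b', c)) u))"
    by (simp add: tensor_algebra_def)
  ultimately show ?thesis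
    by (metis (no_types, lifting) UN_eq_const[OF self_in_class])
qed

lemma tensor_cases [cases set, consumes 1]:
  assumes "U \<in> carrier TA"
  obtains x where "U = cls x" "Poly_Mapping.keys x \<subseteq> pure"
  using assms unfolding carrier_tensor by auto

lemma keys_add': "\<lbrakk>Poly_Mapping.keys x \<subseteq> pure; Poly_Mapping.keys y \<subseteq> pure\<rbrakk> \<Longrightarrow> Poly_Mapping.keys (x + y) \<subseteq> pure"
  using keys_add[of x y] by blast

lemma tensor_abelian_group: "abelian_group TA"
proof (rule abelian_groupI)
  fix U assume "U \<in> carrier TA"
  then obtain x where x: "U = cls x" "Poly_Mapping.keys x \<subseteq> pure" by (cases rule: tensor_cases)
  show "\<exists>V\<in>carrier TA. V \<oplus>\<^bsub>TA\<^esub> U = \<zero>\<^bsub>TA\<^esub>"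
    by (rule bexI[where x = "cls (- x)"]) (use x in \<open>simp_all add: add_tensor zero_tensor\<close>)
qed (auto elim!: tensor_cases simp: add_tensor zero_tensor keys_add' ac_simps simp del: mem_Sigma_iff)

lemma tensor_minus: "Poly_Mapping.keys x \<subseteq> pure \<Longrightarrow> \<ominus>\<^bsub>TA\<^esub> cls x = cls (- x)"
  by (rule abelian_group.minus_equality[OF tensor_abelian_group]) (simp_all add: add_tensor zero_tensor)

lemma tensor_diff:
  "\<lbrakk>Poly_Mapping.keys x \<subseteq> pure; Poly_Mapping.keys y \<subseteq> pure\<rbrakk> \<Longrightarrow> cls x \<ominus>\<^bsub>TA\<^esub> cls y = cls (x - y)"
  by (simp add: a_minus_def tensor_minus add_tensor)

lemma tensor_induct [consumes 1, case_names zero diff pure]: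
  assumes "U \<in> carrier TA" and "P \<zero>\<^bsub>TA\<^esub>"
    and "\<And>U V. \<lbrakk>U \<in> carrier TA; V \<in> carrier TA; P U; P V\<rbrakk> \<Longrightarrow> P (U \<ominus>\<^bsub>TA\<^esub> V)"
    and "\<And>b c. \<lbrakk>b \<in> carrier B; c \<in> carrier C\<rbrakk> \<Longrightarrow> P (cls (frag_of (b, c)))"
  shows "P U"
proof -
  obtain x where x: "U = cls x" "Poly_Mapping.keys x \<subseteq> pure" using assms(1) by (cases rule: tensor_cases)
  have "P (cls x)" using x(2)
  proof (induction x rule: frag_induct)
    case (diff x y)
    then show ?case using assms(3)[of "cls x" "cls y"] by (simp add: tensor_diff)
  qed (use assms in \<open>auto simp: zero_tensor\<close>)
  then show ?thesis using x by simp
qed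

end

section \<open>The universal property of the tensor product\<close>

lemma image_eq_singleton:
  assumes "x \<in> U" and "\<And>u. u \<in> U \<Longrightarrow> f u = c"
  shows "f ` U = {c}"
  using assms by auto

text \<open>The additive form of the universal property: a biadditive map balanced over
  \<open>F\<close> factors through the tensor product. The target is just an abelian group, which
  allows values in \<open>A\<close> for the bimodule action and in a field for functionals.\<close>

locale balanced_map = algebra_pair F B C + G: abelian_group G
  for F :: "'f ring" and B :: "('f, 'b) module" and C :: "('f, 'c) module" and G :: "('g, 'm) ring_scheme" +
  fixes g :: "'b \<times> 'c \<Rightarrow> 'g"
  assumes map_closed: "\<lbrakk>b \<in> carrier B; c \<in> carrier C\<rbrakk> \<Longrightarrow> g (b, c) \<in> carrier G"
    and map_add_left: "\<lbrakk>b \<in> carrier B; b' \<in> carrier B; c \<in> carrier C\<rbrakk> \<Longrightarrow>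
      g (b \<oplus>\<^bsub>B\<^esub> b', c) = g (b, c) \<oplus>\<^bsub>G\<^esub> g (b', c)"
    and map_add_right: "\<lbrakk>b \<in> carrier B; c \<in> carrier C; c' \<in> carrier C\<rbrakk> \<Longrightarrow>
      g (b, c \<oplus>\<^bsub>C\<^esub> c') = g (b, c) \<oplus>\<^bsub>G\<^esub> g (b, c')"
    and map_balanced: "\<lbrakk>s \<in> carrier F; b \<in> carrier B; c \<in> carrier C\<rbrakk> \<Longrightarrow>
      g (s \<odot>\<^bsub>B\<^esub> b, c) = g (b, s \<odot>\<^bsub>C\<^esub> c)"
begin

text \<open>All representatives of a coset have the same value, so the image is a singleton and
  \<open>the_elem\<close> picks its element. The action in \<open>enveloping_module\<close> is
  encoded in the same way, which makes the two comparable by unfolding.\<close>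

definition lift :: "('b \<times> 'c \<Rightarrow>\<^sub>0 int) set \<Rightarrow> 'g" where
  "lift U = the_elem (frag_sum G g ` U)"

lemma map_Pi: "g \<in> pure \<rightarrow> carrier G"
  by (auto simp: map_closed)

lemmas sum_diff = G.frag_sum_diff[OF map_Pi]

lemma sum_closed: "Poly_Mapping.keys x \<subseteq> pure \<Longrightarrow> frag_sum G g x \<in> carrier G"
  by (rule G.frag_sum_closed) (use map_Pi in auto)

lemma sum_kernel: "x \<in> ker \<Longrightarrow> frag_sum G g x = \<zero>\<^bsub>G\<^esub>"
proof (induction x rule: kernel_induct)
  case (relation r)
  have k: "Poly_Mapping.keys (frag_of p - frag_of q) \<subseteq> pure" if "p \<in> pure" "q \<in> pure" for p q
    using that keys_diff[of "frag_of p" "frag_of q"] by (auto simp del: mem_Sigma_iff)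
  from relation show ?case
  proof (cases rule: relation_cases)
    case (left b b' c)
    then have "frag_sum G g r = g (b \<oplus>\<^bsub>B\<^esub> b', c) \<ominus>\<^bsub>G\<^esub> g (b, c) \<ominus>\<^bsub>G\<^esub> g (b', c)"
      using k by (simp add: sum_diff map_closed)
    also have "\<dots> = \<zero>\<^bsub>G\<^esub>"
      using left by (simp add: map_add_left map_closed G.minus_eq G.a_ac G.r_neg)
    finally show ?thesis .
  next
    case (right b c c')
    then have "frag_sum G g r = g (b, c \<oplus>\<^bsub>C\<^esub> c') \<ominus>\<^bsub>G\<^esub> g (b, c) \<ominus>\<^bsub>G\<^esub> g (b, c')"
      using k by (simp add: sum_diff map_closed)
    also have "\<dots> = \<zero>\<^bsub>G\<^esub>"
      using right by (simp add: map_add_right map_closed G.minus_eq G.a_ac G.r_neg)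
    finally show ?thesis .
  next
    case (scalar s b c)
    then have "frag_sum G g r = g (s \<odot>\<^bsub>B\<^esub> b, c) \<ominus>\<^bsub>G\<^esub> g (b, s \<odot>\<^bsub>C\<^esub> c)"
      by (simp add: sum_diff map_closed)
    also have "\<dots> = \<zero>\<^bsub>G\<^esub>"
      using scalar by (simp add: map_balanced map_closed G.minus_eq G.r_neg)
    finally show ?thesis .
  qed
next
  case (diff x y)
  then show ?case using sum_diff[OF kernel_keys kernel_keys, of x y] by (simp add: G.minus_eq)
qed simp

lemma lift_class:
  assumes "Poly_Mapping.keys x \<subseteq> pure"
  shows "lift (cls x) = frag_sum G g x"
proof -
  have "frag_sum G g u = frag_sum G g x" if "u \<in> cls x" for u
  proof -
    have u: "u - x \<in> ker" using that by (simp add: mem_class_iff)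
    have "frag_sum G g ((u - x) + x) = frag_sum G g (u - x) \<oplus>\<^bsub>G\<^esub> frag_sum G g x"
      by (rule G.frag_sum_add[OF map_Pi kernel_keys[OF u] assms])
    then show ?thesis using sum_kernel[OF u] sum_closed[OF assms] by simp
  qed
  then have "frag_sum G g ` cls x = {frag_sum G g x}" by (rule image_eq_singleton[OF self_in_class])
  then show ?thesis by (simp add: lift_def)
qed

lemma lift_pure: "\<lbrakk>b \<in> carrier B; c \<in> carrier C\<rbrakk> \<Longrightarrow> lift (cls (frag_of (b, c))) = g (b, c)"
  by (simp add: lift_class map_closed)

lemma lift_closed: "U \<in> carrier TA \<Longrightarrow> lift U \<in> carrier G"
  by (erule tensor_cases) (simp add: lift_class sum_closed)

lemma lift_add:
  assumes "U \<in> carrier TA" and "V \<in> carrier TA"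
  shows "lift (U \<oplus>\<^bsub>TA\<^esub> V) = lift U \<oplus>\<^bsub>G\<^esub> lift V"
proof -
  obtain x where x: "U = cls x" "Poly_Mapping.keys x \<subseteq> pure" using assms(1) by (rule tensor_cases)
  obtain y where y: "V = cls y" "Poly_Mapping.keys y \<subseteq> pure" using assms(2) by (rule tensor_cases)
  show ?thesis
    unfolding x(1) y(1) add_tensor lift_class[OF x(2)] lift_class[OF y(2)]
      lift_class[OF keys_add'[OF x(2) y(2)]] by (rule G.frag_sum_add[OF map_Pi x(2) y(2)])
qed

lemma lift_zero: "lift \<zero>\<^bsub>TA\<^esub> = \<zero>\<^bsub>G\<^esub>"
  by (simp add: zero_tensor lift_class)

lemma lift_diff:
  assumes "U \<in> carrier TA" and "V \<in> carrier TA"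
  shows "lift (U \<ominus>\<^bsub>TA\<^esub> V) = lift U \<ominus>\<^bsub>G\<^esub> lift V"
proof -
  interpret T: abelian_group TA by (rule tensor_abelian_group)
  have "lift (U \<ominus>\<^bsub>TA\<^esub> V) \<oplus>\<^bsub>G\<^esub> lift V = lift U"
    using lift_add[of "U \<ominus>\<^bsub>TA\<^esub> V" V] assms by (simp add: T.minus_eq T.a_assoc T.l_neg)
  then show ?thesis
    using lift_closed assms T.minus_closed
    by (metis G.add.inv_solve_right G.minus_eq G.a_inv_closed)
qed

end

section \<open>Tensor products with a commutative associative left factor\<close>

text \<open>The left factor supplies the scalars, while \<open>C\<close> is an arbitrary unital
  algebra. Both \<open>E \<otimes> A\<close> and \<open>K \<otimes> K\<close> are instances.\<close>

locale comm_algebra_pair = algebra_pair F B C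
  for F :: "'f ring" and B :: "('f, 'b) module" and C :: "('f, 'c) module" +
  assumes B_assoc: "\<lbrakk>x \<in> carrier B; y \<in> carrier B; z \<in> carrier B\<rbrakk> \<Longrightarrow>
      (x \<otimes>\<^bsub>B\<^esub> y) \<otimes>\<^bsub>B\<^esub> z = x \<otimes>\<^bsub>B\<^esub> (y \<otimes>\<^bsub>B\<^esub> z)"
    and B_comm: "\<lbrakk>x \<in> carrier B; y \<in> carrier B\<rbrakk> \<Longrightarrow> x \<otimes>\<^bsub>B\<^esub> y = y \<otimes>\<^bsub>B\<^esub> x"
begin

lemma keys_scalar [simp]: "b \<in> carrier B \<Longrightarrow> Poly_Mapping.keys (frag_of (b, \<one>\<^bsub>C\<^esub>)) \<subseteq> pure"
  by (simp add: C.one_closed)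

lemma B_lcomm: "\<lbrakk>x \<in> carrier B; y \<in> carrier B; z \<in> carrier B\<rbrakk> \<Longrightarrow>
    x \<otimes>\<^bsub>B\<^esub> (y \<otimes>\<^bsub>B\<^esub> z) = y \<otimes>\<^bsub>B\<^esub> (x \<otimes>\<^bsub>B\<^esub> z)"
  by (metis B_assoc B_comm)

text \<open>Pulling the scalar \<open>b\<close> out of the left factor is associativity of
  \<open>B\<close>. Out of the right factor it also has to pass an element of \<open>B\<close>,
  which is where commutativity enters.\<close>

lemma frag_scalar_assoc:
  assumes "b \<in> carrier B" and "Poly_Mapping.keys x \<subseteq> pure" and "Poly_Mapping.keys y \<subseteq> pure"
  shows "frag_mult B C (frag_mult B C (frag_of (b, \<one>\<^bsub>C\<^esub>)) x) y
      = frag_mult B C (frag_of (b, \<one>\<^bsub>C\<^esub>)) (frag_mult B C x y)"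
    and "frag_mult B C x (frag_mult B C (frag_of (b, \<one>\<^bsub>C\<^esub>)) y)
      = frag_mult B C (frag_of (b, \<one>\<^bsub>C\<^esub>)) (frag_mult B C x y)"
proof -
  have "frag_mult B C (frag_mult B C (frag_of (b, \<one>\<^bsub>C\<^esub>)) x) y
      = frag_mult B C (frag_of (b, \<one>\<^bsub>C\<^esub>)) (frag_mult B C x y) \<and>
     frag_mult B C x (frag_mult B C (frag_of (b, \<one>\<^bsub>C\<^esub>)) y)
      = frag_mult B C (frag_of (b, \<one>\<^bsub>C\<^esub>)) (frag_mult B C x y)"
    using assms(2)
  proof (induction x rule: frag_induct)
    case (of p)
    from assms(3) show ?case
    proof (induction y rule: frag_induct)
      case (of q)
      with \<open>p \<in> pure\<close> assms(1) show ?case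
        by (cases p; cases q) (simp add: B_assoc C.l_one C.mult_closed B_lcomm)
    qed (simp_all add: frag_mult_diff_left frag_mult_diff_right)
  qed (simp_all add: frag_mult_diff_left frag_mult_diff_right)
  then show "frag_mult B C (frag_mult B C (frag_of (b, \<one>\<^bsub>C\<^esub>)) x) y
      = frag_mult B C (frag_of (b, \<one>\<^bsub>C\<^esub>)) (frag_mult B C x y)"
    "frag_mult B C x (frag_mult B C (frag_of (b, \<one>\<^bsub>C\<^esub>)) y)
      = frag_mult B C (frag_of (b, \<one>\<^bsub>C\<^esub>)) (frag_mult B C x y)" by auto
qed

lemma smult_eq_mult: "\<lbrakk>b \<in> carrier B; U \<in> carrier TA\<rbrakk> \<Longrightarrow> b \<odot>\<^bsub>TA\<^esub> U = cls (frag_of (b, \<one>\<^bsub>C\<^esub>)) \<otimes>\<^bsub>TA\<^esub> U"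
  by (erule tensor_cases) (simp only: smult_tensor mult_tensor keys_scalar)

lemma tensor_mult_closed: "\<lbrakk>U \<in> carrier TA; V \<in> carrier TA\<rbrakk> \<Longrightarrow> U \<otimes>\<^bsub>TA\<^esub> V \<in> carrier TA"
  by (erule tensor_cases, erule tensor_cases) (simp only: mult_tensor frag_mult_keys class_closed)

lemma tensor_l_distr: "\<lbrakk>U \<in> carrier TA; V \<in> carrier TA; W \<in> carrier TA\<rbrakk> \<Longrightarrow>
    (U \<oplus>\<^bsub>TA\<^esub> V) \<otimes>\<^bsub>TA\<^esub> W = U \<otimes>\<^bsub>TA\<^esub> W \<oplus>\<^bsub>TA\<^esub> V \<otimes>\<^bsub>TA\<^esub> W"
  by (erule tensor_cases, erule tensor_cases, erule tensor_cases)
    (simp only: mult_tensor add_tensor keys_add' frag_mult_add_left)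

lemma tensor_r_distr: "\<lbrakk>U \<in> carrier TA; V \<in> carrier TA; W \<in> carrier TA\<rbrakk> \<Longrightarrow>
    W \<otimes>\<^bsub>TA\<^esub> (U \<oplus>\<^bsub>TA\<^esub> V) = W \<otimes>\<^bsub>TA\<^esub> U \<oplus>\<^bsub>TA\<^esub> W \<otimes>\<^bsub>TA\<^esub> V"
  by (erule tensor_cases, erule tensor_cases, erule tensor_cases)
    (simp only: mult_tensor add_tensor keys_add' frag_mult_add_right)

lemma keys_one: "Poly_Mapping.keys (frag_of (\<one>\<^bsub>B\<^esub>, \<one>\<^bsub>C\<^esub>)) \<subseteq> pure"
  by (simp add: B.one_closed C.one_closed)

lemma tensor_l_one: "U \<in> carrier TA \<Longrightarrow> \<one>\<^bsub>TA\<^esub> \<otimes>\<^bsub>TA\<^esub> U = U"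
  by (erule tensor_cases) (simp only: one_tensor mult_tensor keys_one frag_mult_one_left)

lemma tensor_r_one: "U \<in> carrier TA \<Longrightarrow> U \<otimes>\<^bsub>TA\<^esub> \<one>\<^bsub>TA\<^esub> = U"
  by (erule tensor_cases) (simp only: one_tensor mult_tensor keys_one frag_mult_one_right)

lemma tensor_smult_mult:
  assumes "b \<in> carrier B" and "U \<in> carrier TA" and "V \<in> carrier TA"
  shows "(b \<odot>\<^bsub>TA\<^esub> U) \<otimes>\<^bsub>TA\<^esub> V = b \<odot>\<^bsub>TA\<^esub> (U \<otimes>\<^bsub>TA\<^esub> V)"
    and "U \<otimes>\<^bsub>TA\<^esub> (b \<odot>\<^bsub>TA\<^esub> V) = b \<odot>\<^bsub>TA\<^esub> (U \<otimes>\<^bsub>TA\<^esub> V)"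
proof -
  obtain x where "U = cls x" "Poly_Mapping.keys x \<subseteq> pure" using assms(2) by (rule tensor_cases)
  moreover obtain y where "V = cls y" "Poly_Mapping.keys y \<subseteq> pure" using assms(3) by (rule tensor_cases)
  ultimately show "(b \<odot>\<^bsub>TA\<^esub> U) \<otimes>\<^bsub>TA\<^esub> V = b \<odot>\<^bsub>TA\<^esub> (U \<otimes>\<^bsub>TA\<^esub> V)"
    "U \<otimes>\<^bsub>TA\<^esub> (b \<odot>\<^bsub>TA\<^esub> V) = b \<odot>\<^bsub>TA\<^esub> (U \<otimes>\<^bsub>TA\<^esub> V)"
    using assms(1) by (simp_all only: mult_tensor smult_tensor frag_mult_keys keys_scalar frag_scalar_assoc)
qed

lemma tensor_module_laws:
  assumes "a \<in> carrier B" and "b \<in> carrier B" and "U \<in> carrier TA"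
  shows "a \<odot>\<^bsub>TA\<^esub> U \<in> carrier TA"
    and "(a \<oplus>\<^bsub>B\<^esub> b) \<odot>\<^bsub>TA\<^esub> U = a \<odot>\<^bsub>TA\<^esub> U \<oplus>\<^bsub>TA\<^esub> b \<odot>\<^bsub>TA\<^esub> U"
    and "(a \<otimes>\<^bsub>B\<^esub> b) \<odot>\<^bsub>TA\<^esub> U = a \<odot>\<^bsub>TA\<^esub> (b \<odot>\<^bsub>TA\<^esub> U)"
    and "\<one>\<^bsub>B\<^esub> \<odot>\<^bsub>TA\<^esub> U = U"
proof -
  obtain x where x: "U = cls x" "Poly_Mapping.keys x \<subseteq> pure"
    using assms(3) by (rule tensor_cases)
  show "a \<odot>\<^bsub>TA\<^esub> U \<in> carrier TA"
    using assms x by (simp only: smult_tensor frag_mult_keys class_closed keys_scalar)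
  have ab: "a \<oplus>\<^bsub>B\<^esub> b \<in> carrier B" using assms by simp
  have "cls (frag_of (a \<oplus>\<^bsub>B\<^esub> b, \<one>\<^bsub>C\<^esub>)) = cls (frag_of (a, \<one>\<^bsub>C\<^esub>)) \<oplus>\<^bsub>TA\<^esub> cls (frag_of (b, \<one>\<^bsub>C\<^esub>))"
    unfolding add_tensor by (rule class_eqI) (use kernel_left[OF assms(1,2) C.one_closed] in \<open>simp add: algebra_simps\<close>)
  then show "(a \<oplus>\<^bsub>B\<^esub> b) \<odot>\<^bsub>TA\<^esub> U = a \<odot>\<^bsub>TA\<^esub> U \<oplus>\<^bsub>TA\<^esub> b \<odot>\<^bsub>TA\<^esub> U"
    using assms by (simp only: smult_eq_mult[OF ab] smult_eq_mult tensor_l_distr class_closed keys_scalar)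
  have "frag_of (a \<otimes>\<^bsub>B\<^esub> b, \<one>\<^bsub>C\<^esub>) = frag_mult B C (frag_of (a, \<one>\<^bsub>C\<^esub>)) (frag_of (b, \<one>\<^bsub>C\<^esub>))"
    by (simp add: C.l_one C.one_closed)
  then show "(a \<otimes>\<^bsub>B\<^esub> b) \<odot>\<^bsub>TA\<^esub> U = a \<odot>\<^bsub>TA\<^esub> (b \<odot>\<^bsub>TA\<^esub> U)"
    using assms x by (simp only: smult_tensor B.mult_closed frag_mult_keys keys_scalar frag_scalar_assoc(1))
  show "\<one>\<^bsub>B\<^esub> \<odot>\<^bsub>TA\<^esub> U = U"
    using x by (simp only: smult_tensor B.one_closed frag_mult_one_left)
qed

text \<open>The source of the clause \<open>generated\<close> of \<open>base_change\<close>: over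
  the scalars of \<open>B\<close>, the tensors \<open>1 \<otimes> c\<close> are enough.\<close>

lemma frag_pure_eq_smult:
  assumes "b \<in> carrier B" and "c \<in> carrier C"
  shows "cls (frag_of (b, c)) = b \<odot>\<^bsub>TA\<^esub> cls (frag_of (\<one>\<^bsub>B\<^esub>, c))"
  using assms by (simp add: smult_tensor B.one_closed B.r_one C.l_one)

end

section \<open>Extension of scalars\<close>

lemma algebra_via_unital:
  assumes "field F" and "field E" and "\<phi> \<in> ring_hom F E"
  shows "unital_algebra F (algebra_via \<phi> E)"
proof -
  interpret F: field F by fact
  interpret E: field E by fact
  note h = ring_hom_closed[OF assms(3)] ring_hom_mult[OF assms(3)] ring_hom_add[OF assms(3)]
    ring_hom_one[OF assms(3)]
  have ab: "abelian_group (algebra_via \<phi> E)"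
    by (rule abelian_groupI) (auto simp: algebra_via_def E.a_ac intro: E.add.l_inv_ex)
  have "Module.module F (algebra_via \<phi> E)"
    by (rule moduleI[OF F.cring_axioms ab])
      (simp_all add: algebra_via_def h E.l_distr E.r_distr E.m_assoc)
  then have "vectorspace F (algebra_via \<phi> E)"
    by (simp add: vectorspace_def assms(1))
  then show ?thesis
    by (intro unital_algebra.intro unital_algebra_axioms.intro)
      (simp_all add: algebra_via_def h E.l_distr E.r_distr E.m_assoc E.m_lcomm)
qed

lemma algebra_via_simps [simp]:
  "carrier (algebra_via \<phi> E) = carrier E" "monoid.mult (algebra_via \<phi> E) = monoid.mult E"
  "\<one>\<^bsub>algebra_via \<phi> E\<^esub> = \<one>\<^bsub>E\<^esub>" "\<zero>\<^bsub>algebra_via \<phi> E\<^esub> = \<zero>\<^bsub>E\<^esub>"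
  "add (algebra_via \<phi> E) = add E" "r \<odot>\<^bsub>algebra_via \<phi> E\<^esub> x = \<phi> r \<otimes>\<^bsub>E\<^esub> x"
  by (simp_all add: algebra_via_def)

lemma scalar_extension_pair:
  assumes "field E" and "\<phi> \<in> ring_hom F E" and "unital_algebra F A"
  shows "comm_algebra_pair F (algebra_via \<phi> E) A"
proof -
  interpret A: unital_algebra F A by fact
  interpret E: field E by fact
  have "unital_algebra F (algebra_via \<phi> E)"
    by (rule algebra_via_unital[OF A.field_axioms assms(1,2)])
  then show ?thesis
    by (intro comm_algebra_pair.intro algebra_pair.intro comm_algebra_pair_axioms.intro assms(3))
      (simp_all add: E.m_assoc, rule E.m_comm)
qed

lemma scalar_extension_unital:
  assumes "field E" and "\<phi> \<in> ring_hom F E" and "unital_algebra F A"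
  shows "unital_algebra E (scalar_extension F \<phi> E A)"
proof -
  interpret comm_algebra_pair F "algebra_via \<phi> E" A by (rule scalar_extension_pair) fact+
  interpret E: field E by fact
  interpret T: abelian_group TA by (rule tensor_abelian_group)
  have "Module.module E TA"
  proof (rule moduleI[OF E.cring_axioms tensor_abelian_group])
    show "a \<odot>\<^bsub>TA\<^esub> (x \<oplus>\<^bsub>TA\<^esub> y) = a \<odot>\<^bsub>TA\<^esub> x \<oplus>\<^bsub>TA\<^esub> a \<odot>\<^bsub>TA\<^esub> y"
      if "a \<in> carrier E" "x \<in> carrier TA" "y \<in> carrier TA" for a x y
      using that class_closed[OF keys_scalar, of a] by (simp add: smult_eq_mult tensor_r_distr)
  qed (use tensor_module_laws tensor_module_laws(4)[OF B.one_closed B.one_closed] in simp_all)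
  then have "vectorspace E TA" by (simp add: vectorspace_def assms(1))
  then have "unital_algebra E TA"
    by (intro unital_algebra.intro unital_algebra_axioms.intro)
      (use tensor_mult_closed tensor_l_one tensor_r_one tensor_l_distr tensor_r_distr tensor_smult_mult
        class_closed[OF keys_one] one_tensor in simp_all)
  then show ?thesis by (simp add: scalar_extension_def)
qed

section \<open>Linearly independent families and dual functionals\<close>

text \<open>Independence is attached to the index set rather than to the image, so repeated vectors
  count as dependent. This fits families such as \<open>t p a\<close> or
  \<open>\<iota> (k i)\<close>, whose injectivity is a conclusion and not known beforehand.\<close>

definition indep_family :: "('r, 'k) ring_scheme \<Rightarrow> ('r, 'm, 'q) module_scheme \<Rightarrow> 'i set \<Rightarrow> ('i \<Rightarrow> 'm) \<Rightarrow> bool" where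
  "indep_family R M J v \<longleftrightarrow>
     (\<forall>d\<in>J \<rightarrow> carrier R. (\<Oplus>\<^bsub>M\<^esub>p\<in>J. d p \<odot>\<^bsub>M\<^esub> v p) = \<zero>\<^bsub>M\<^esub> \<longrightarrow> (\<forall>p\<in>J. d p = \<zero>\<^bsub>R\<^esub>))"

definition linear_functional :: "('r, 'k) ring_scheme \<Rightarrow> ('r, 'm, 'q) module_scheme \<Rightarrow> ('m \<Rightarrow> 'r) \<Rightarrow> bool" where
  "linear_functional R M g \<longleftrightarrow>
     (\<forall>x\<in>carrier M. g x \<in> carrier R) \<and>
     (\<forall>x\<in>carrier M. \<forall>y\<in>carrier M. g (x \<oplus>\<^bsub>M\<^esub> y) = g x \<oplus>\<^bsub>R\<^esub> g y) \<and>
     (\<forall>r\<in>carrier R. \<forall>x\<in>carrier M. g (r \<odot>\<^bsub>M\<^esub> x) = r \<otimes>\<^bsub>R\<^esub> g x)"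

context vectorspace
begin

lemma indep_family_inj:
  assumes "finite J" and v: "v \<in> J \<rightarrow> carrier V" and "indep_family K V J v"
  shows "inj_on v J"
proof (rule inj_onI, rule ccontr)
  fix p q assume pq: "p \<in> J" "q \<in> J" "v p = v q" "p \<noteq> q"
  \<comment> \<open>Two equal members would give the relation with coefficients \<open>1\<close> and
    \<open>-1\<close>.\<close>
  define d where "d = (\<lambda>r. if r = p then \<one>\<^bsub>K\<^esub> else if r = q then \<ominus>\<^bsub>K\<^esub> \<one>\<^bsub>K\<^esub> else \<zero>\<^bsub>K\<^esub>)"
  have d: "d \<in> J \<rightarrow> carrier K" by (auto simp: d_def)
  have J: "J = insert p (insert q (J - {p, q}))" using pq by auto
  have "(\<Oplus>\<^bsub>V\<^esub>r\<in>J - {p, q}. d r \<odot>\<^bsub>V\<^esub> v r) = (\<Oplus>\<^bsub>V\<^esub>r\<in>J - {p, q}. \<zero>\<^bsub>V\<^esub>)"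
    by (rule M.finsum_cong') (use v in \<open>auto simp: d_def Pi_iff\<close>)
  also have "\<dots> = \<zero>\<^bsub>V\<^esub>" by simp
  finally have rest: "(\<Oplus>\<^bsub>V\<^esub>r\<in>J - {p, q}. d r \<odot>\<^bsub>V\<^esub> v r) = \<zero>\<^bsub>V\<^esub>" .
  have vc: "v p \<in> carrier V" "v q \<in> carrier V" using pq v by auto
  have "(\<Oplus>\<^bsub>V\<^esub>r\<in>J. d r \<odot>\<^bsub>V\<^esub> v r) = d p \<odot>\<^bsub>V\<^esub> v p \<oplus>\<^bsub>V\<^esub> (d q \<odot>\<^bsub>V\<^esub> v q \<oplus>\<^bsub>V\<^esub> (\<Oplus>\<^bsub>V\<^esub>r\<in>J - {p, q}. d r \<odot>\<^bsub>V\<^esub> v r))"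
    by (subst J, subst M.finsum_insert, (use assms(1) v d pq in \<open>auto simp: Pi_iff\<close>)[4], subst M.finsum_insert)
      (use assms(1) v d pq in \<open>auto simp: Pi_iff\<close>)
  also have "\<dots> = \<zero>\<^bsub>V\<^esub>"
  proof -
    have "d p = \<one>\<^bsub>K\<^esub>" "d q = \<ominus>\<^bsub>K\<^esub> \<one>\<^bsub>K\<^esub>" using pq by (simp_all add: d_def)
    then show ?thesis using vc pq by (simp add: rest smult_l_minus M.r_neg)
  qed
  finally have "d p = \<zero>\<^bsub>K\<^esub>" using assms(3) d pq(1) unfolding indep_family_def by blast
  then show False by (simp add: d_def)
qed

lemma indep_family_lin_indpt:
  assumes "finite J" and v: "v \<in> J \<rightarrow> carrier V" and ind: "indep_family K V J v"
  shows "lin_indpt (v ` J)"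
proof (rule finite_lin_indpt2)
  show "finite (v ` J)" using assms(1) by simp
  show "v ` J \<subseteq> carrier V" using v by auto
  fix a assume a: "a \<in> v ` J \<rightarrow> carrier K" and z: "lincomb a (v ` J) = \<zero>\<^bsub>V\<^esub>"
  have "lincomb a (v ` J) = (\<Oplus>\<^bsub>V\<^esub>p\<in>J. a (v p) \<odot>\<^bsub>V\<^esub> v p)"
    unfolding lincomb_def
    by (rule M.add.finprod_reindex[OF _ indep_family_inj[OF assms]]) (use a v in auto)
  with z show "\<forall>x\<in>v ` J. a x = \<zero>\<^bsub>K\<^esub>"
    using ind a unfolding indep_family_def by (auto simp: Pi_iff dest!: bspec[where x = "\<lambda>p. a (v p)"])
qed

text \<open>A set maximal among the independent sets containing \<open>S\<close> is maximal among
  all independent sets; the bound by \<open>dim\<close> provides one.\<close>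

lemma extend_to_basis:
  assumes "fin_dim" and "S \<subseteq> carrier V" and "lin_indpt S"
  obtains \<beta> where "S \<subseteq> \<beta>" and "finite \<beta>" and "basis \<beta>"
proof -
  define P where "P B \<longleftrightarrow> S \<subseteq> B \<and> B \<subseteq> carrier V \<and> lin_indpt B" for B
  have "\<exists>B. finite B \<and> maximal B P"
    by (rule maximal_exists[where B = S and N = dim])
      (use assms li_le_dim in \<open>simp_all add: P_def\<close>)
  then obtain B where B: "finite B" "maximal B P" by blast
  then have "maximal B (\<lambda>S. S \<subseteq> carrier V \<and> lin_indpt S)"
    unfolding maximal_def P_def by blast
  then have "basis B" by (rule max_li_is_basis)
  with B show ?thesis using that unfolding maximal_def P_def by blast
qed

text \<open>The family is completed to a basis and the coordinate at \<open>v p\<close> is taken.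
  Such functionals survive extension of scalars, so a relation over a larger field can be probed
  coefficient by coefficient.\<close>

lemma dual_functional:
  assumes "fin_dim" and "finite J" and v: "v \<in> J \<rightarrow> carrier V" and ind: "indep_family K V J v" and p: "p \<in> J"
  obtains g where "linear_functional K V g" and "g (v p) = \<one>\<^bsub>K\<^esub>"
    and "\<And>q. \<lbrakk>q \<in> J; q \<noteq> p\<rbrakk> \<Longrightarrow> g (v q) = \<zero>\<^bsub>K\<^esub>"
proof -
  obtain \<beta> where \<beta>: "v ` J \<subseteq> \<beta>" "finite \<beta>" "basis \<beta>"
    by (rule extend_to_basis[OF assms(1) _ indep_family_lin_indpt[OF assms(2-4)]]) (use v in auto)
  have \<beta>c: "\<beta> \<subseteq> carrier V" using \<beta>(3) by (simp add: basis_def)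
  have ex1: "\<exists>!a. a \<in> \<beta> \<rightarrow>\<^sub>E carrier K \<and> lincomb a \<beta> = x" if "x \<in> carrier V" for x
    using basis_criterion[OF \<beta>(2) \<beta>c] \<beta>(3) that by blast
  define co where "co x = (THE a. a \<in> \<beta> \<rightarrow>\<^sub>E carrier K \<and> lincomb a \<beta> = x)" for x
  have co: "co x \<in> \<beta> \<rightarrow>\<^sub>E carrier K" "lincomb (co x) \<beta> = x" if "x \<in> carrier V" for x
    using theI'[OF ex1[OF that]] by (simp_all add: co_def)
  \<comment> \<open>Coordinate functions are unique only when normalised outside
    \<open>\<beta>\<close>, hence the passage through \<open>restrict a \<beta>\<close>.\<close>
  have uniq: "co (lincomb a \<beta>) b = a b" if a: "a \<in> \<beta> \<rightarrow> carrier K" and b: "b \<in> \<beta>" for a b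
  proof -
    have x: "lincomb a \<beta> \<in> carrier V" by (rule lincomb_closed[OF \<beta>c a])
    have "lincomb (restrict a \<beta>) \<beta> = lincomb a \<beta>"
      unfolding lincomb_def by (rule M.finsum_cong') (use a \<beta>c in auto)
    then have "co (lincomb a \<beta>) = restrict a \<beta>"
      using ex1[OF x] co[OF x] a by (metis PiE_restrict restrict_PiE_iff Pi_mem)
    with b show ?thesis by simp
  qed
  have vp: "v q \<in> \<beta>" if "q \<in> J" for q using \<beta>(1) that by auto
  have coC: "co x b \<in> carrier K" if "x \<in> carrier V" "b \<in> \<beta>" for x b using co(1)[OF that(1)] that(2) by auto
  have coP: "co x \<in> \<beta> \<rightarrow> carrier K" if "x \<in> carrier V" for x using co(1)[OF that] by auto
  have lin: "linear_functional K V (\<lambda>x. co x (v p))"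
    unfolding linear_functional_def
  proof (intro conjI ballI)
    fix x y assume x: "x \<in> carrier V" and y: "y \<in> carrier V"
    have "lincomb (\<lambda>b. co x b \<oplus>\<^bsub>K\<^esub> co y b) \<beta> = x \<oplus>\<^bsub>V\<^esub> y"
      using lincomb_sum[OF \<beta>(2) \<beta>c coP[OF x] coP[OF y]] co x y by simp
    then show "co (x \<oplus>\<^bsub>V\<^esub> y) (v p) = co x (v p) \<oplus>\<^bsub>K\<^esub> co y (v p)"
      using uniq[of "\<lambda>b. co x b \<oplus>\<^bsub>K\<^esub> co y b" "v p"] vp[OF p] coC x y by auto
  next
    fix r x assume r: "r \<in> carrier K" and x: "x \<in> carrier V"
    have "lincomb (\<lambda>b. r \<otimes>\<^bsub>K\<^esub> co x b) \<beta> = r \<odot>\<^bsub>V\<^esub> x"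
      using lincomb_smult[OF \<beta>c coP[OF x] r] co x by simp
    then show "co (r \<odot>\<^bsub>V\<^esub> x) (v p) = r \<otimes>\<^bsub>K\<^esub> co x (v p)"
      using uniq[of "\<lambda>b. r \<otimes>\<^bsub>K\<^esub> co x b" "v p"] vp[OF p] coC x r by auto
  qed (use coC vp[OF p] in auto)
  have co_v: "co (v q) b = (if b = v q then \<one>\<^bsub>K\<^esub> else \<zero>\<^bsub>K\<^esub>)" if q: "q \<in> J" and b: "b \<in> \<beta>" for q b
  proof -
    have vqc: "v q \<in> carrier V" using v q by auto
    have "lincomb (\<lambda>b. if b = v q then \<one>\<^bsub>K\<^esub> else \<zero>\<^bsub>K\<^esub>) \<beta> = (\<Oplus>\<^bsub>V\<^esub>b\<in>\<beta>. if v q = b then b else \<zero>\<^bsub>V\<^esub>)"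
      unfolding lincomb_def by (rule M.finsum_cong') (use \<beta>c in auto)
    also have "\<dots> = v q"
      by (rule M.finsum_singleton) (use vp[OF q] \<beta>(2) \<beta>c in auto)
    finally show ?thesis using uniq[of "\<lambda>b. if b = v q then \<one>\<^bsub>K\<^esub> else \<zero>\<^bsub>K\<^esub>" b] b by simp
  qed
  show ?thesis
  proof (rule that[OF lin])
    show "co (v p) (v p) = \<one>\<^bsub>K\<^esub>" using co_v[OF p vp[OF p]] by simp
    show "co (v q) (v p) = \<zero>\<^bsub>K\<^esub>" if "q \<in> J" "q \<noteq> p" for q
      using co_v[OF that(1) vp[OF p]] inj_onD[OF indep_family_inj[OF assms(2-4)]] that p by fastforce
  qed
qed

lemma finsum_span_submodule:
  assumes "submodule K N V" and "f \<in> I \<rightarrow> N"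
  shows "(\<Oplus>\<^bsub>V\<^esub>i\<in>I. f i) \<in> N"
proof -
  interpret N: submodule K N V by fact
  have N: "N \<subseteq> carrier V" by (rule N.subset)
  show ?thesis
    using assms(2)
  proof (induction I rule: infinite_finite_induct)
    case (insert i I)
    then show ?case using N by (subst M.finsum_insert) auto
  qed auto
qed

end

lemma linear_functional_sum:
  assumes "vectorspace K V" and "linear_functional K V g" and "v \<in> J \<rightarrow> carrier V" and "d \<in> J \<rightarrow> carrier K"
  shows "g (\<Oplus>\<^bsub>V\<^esub>p\<in>J. d p \<odot>\<^bsub>V\<^esub> v p) = (\<Oplus>\<^bsub>K\<^esub>p\<in>J. d p \<otimes>\<^bsub>K\<^esub> g (v p))"
proof -
  interpret vectorspace K V by fact
  have "g (\<Oplus>\<^bsub>V\<^esub>p\<in>J. d p \<odot>\<^bsub>V\<^esub> v p) = (\<Oplus>\<^bsub>K\<^esub>p\<in>J. g (d p \<odot>\<^bsub>V\<^esub> v p))"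
    by (rule finsum_hom[OF M.abelian_group_axioms R.abelian_group_axioms])
      (use assms in \<open>auto simp: linear_functional_def Pi_iff\<close>)
  also have "\<dots> = (\<Oplus>\<^bsub>K\<^esub>p\<in>J. d p \<otimes>\<^bsub>K\<^esub> g (v p))"
    by (rule R.finsum_cong') (use assms in \<open>auto simp: linear_functional_def Pi_iff\<close>)
  finally show ?thesis .
qed

section \<open>The nucleus\<close>

context unital_algebra
begin

lemma mem_nucleus_iff:
  "x \<in> nucleus A \<longleftrightarrow> x \<in> carrier A \<and> (\<forall>a\<in>carrier A. \<forall>b\<in>carrier A.
     (x \<otimes>\<^bsub>A\<^esub> a) \<otimes>\<^bsub>A\<^esub> b = x \<otimes>\<^bsub>A\<^esub> (a \<otimes>\<^bsub>A\<^esub> b) \<and> (a \<otimes>\<^bsub>A\<^esub> x) \<otimes>\<^bsub>A\<^esub> b = a \<otimes>\<^bsub>A\<^esub> (x \<otimes>\<^bsub>A\<^esub> b) \<and>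
     (a \<otimes>\<^bsub>A\<^esub> b) \<otimes>\<^bsub>A\<^esub> x = a \<otimes>\<^bsub>A\<^esub> (b \<otimes>\<^bsub>A\<^esub> x))"
proof -
  have eq: "u \<ominus>\<^bsub>A\<^esub> v = \<zero>\<^bsub>A\<^esub> \<longleftrightarrow> u = v" if "u \<in> carrier A" "v \<in> carrier A" for u v
    using that by (metis M.a_inv_closed M.minus_eq M.minus_equality M.minus_minus M.r_neg)
  show ?thesis
    unfolding nucleus_def associator_def by (simp add: mult_closed eq cong: conj_cong)
qed

lemma nucleus_closed [simp]: "x \<in> nucleus A \<Longrightarrow> x \<in> carrier A"
  by (simp add: mem_nucleus_iff)

lemma nucleus_assoc:
  assumes "x \<in> nucleus A" and "a \<in> carrier A" and "b \<in> carrier A"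
  shows "(x \<otimes>\<^bsub>A\<^esub> a) \<otimes>\<^bsub>A\<^esub> b = x \<otimes>\<^bsub>A\<^esub> (a \<otimes>\<^bsub>A\<^esub> b)"
    and "(a \<otimes>\<^bsub>A\<^esub> x) \<otimes>\<^bsub>A\<^esub> b = a \<otimes>\<^bsub>A\<^esub> (x \<otimes>\<^bsub>A\<^esub> b)"
    and "(a \<otimes>\<^bsub>A\<^esub> b) \<otimes>\<^bsub>A\<^esub> x = a \<otimes>\<^bsub>A\<^esub> (b \<otimes>\<^bsub>A\<^esub> x)"
  using assms unfolding mem_nucleus_iff by blast+

lemma nucleusI:
  assumes "x \<in> carrier A"
    and "\<And>a b. \<lbrakk>a \<in> carrier A; b \<in> carrier A\<rbrakk> \<Longrightarrow> (x \<otimes>\<^bsub>A\<^esub> a) \<otimes>\<^bsub>A\<^esub> b = x \<otimes>\<^bsub>A\<^esub> (a \<otimes>\<^bsub>A\<^esub> b)"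
    and "\<And>a b. \<lbrakk>a \<in> carrier A; b \<in> carrier A\<rbrakk> \<Longrightarrow> (a \<otimes>\<^bsub>A\<^esub> x) \<otimes>\<^bsub>A\<^esub> b = a \<otimes>\<^bsub>A\<^esub> (x \<otimes>\<^bsub>A\<^esub> b)"
    and "\<And>a b. \<lbrakk>a \<in> carrier A; b \<in> carrier A\<rbrakk> \<Longrightarrow> (a \<otimes>\<^bsub>A\<^esub> b) \<otimes>\<^bsub>A\<^esub> x = a \<otimes>\<^bsub>A\<^esub> (b \<otimes>\<^bsub>A\<^esub> x)"
  shows "x \<in> nucleus A"
  unfolding mem_nucleus_iff using assms by blast

lemma one_nucleus: "\<one>\<^bsub>A\<^esub> \<in> nucleus A"
  by (rule nucleusI) (simp_all add: one_closed l_one r_one mult_closed)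

lemma add_nucleus: "\<lbrakk>x \<in> nucleus A; y \<in> nucleus A\<rbrakk> \<Longrightarrow> x \<oplus>\<^bsub>A\<^esub> y \<in> nucleus A"
  by (rule nucleusI) (simp_all add: l_distr r_distr mult_closed nucleus_assoc)

lemma smult_nucleus: "\<lbrakk>r \<in> carrier F; x \<in> nucleus A\<rbrakk> \<Longrightarrow> r \<odot>\<^bsub>A\<^esub> x \<in> nucleus A"
  by (rule nucleusI) (simp_all add: smult_mult_left smult_mult_right mult_closed nucleus_assoc)

text \<open>Each of the three identities follows by moving one bracket at a time, always in a triple
  that contains \<open>x\<close> or \<open>y\<close>.\<close>

lemma mult_nucleus:
  assumes x: "x \<in> nucleus A" and y: "y \<in> nucleus A"
  shows "x \<otimes>\<^bsub>A\<^esub> y \<in> nucleus A"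
proof (rule nucleusI)
  fix a b assume ab: "a \<in> carrier A" "b \<in> carrier A"
  note c = nucleus_closed[OF x] nucleus_closed[OF y] ab mult_closed
  show "((x \<otimes>\<^bsub>A\<^esub> y) \<otimes>\<^bsub>A\<^esub> a) \<otimes>\<^bsub>A\<^esub> b = (x \<otimes>\<^bsub>A\<^esub> y) \<otimes>\<^bsub>A\<^esub> (a \<otimes>\<^bsub>A\<^esub> b)"
    by (simp only: nucleus_assoc(1)[OF x] nucleus_assoc(1)[OF y] c)
  have "(a \<otimes>\<^bsub>A\<^esub> (x \<otimes>\<^bsub>A\<^esub> y)) \<otimes>\<^bsub>A\<^esub> b = ((a \<otimes>\<^bsub>A\<^esub> x) \<otimes>\<^bsub>A\<^esub> y) \<otimes>\<^bsub>A\<^esub> b"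
    by (simp only: nucleus_assoc(3)[OF y] c)
  also have "\<dots> = a \<otimes>\<^bsub>A\<^esub> ((x \<otimes>\<^bsub>A\<^esub> y) \<otimes>\<^bsub>A\<^esub> b)"
    by (subst nucleus_assoc(2)[OF y]) (simp_all only: nucleus_assoc(2)[OF x] nucleus_assoc(1)[OF x] c)
  finally show "(a \<otimes>\<^bsub>A\<^esub> (x \<otimes>\<^bsub>A\<^esub> y)) \<otimes>\<^bsub>A\<^esub> b = a \<otimes>\<^bsub>A\<^esub> ((x \<otimes>\<^bsub>A\<^esub> y) \<otimes>\<^bsub>A\<^esub> b)" .
  have "(a \<otimes>\<^bsub>A\<^esub> b) \<otimes>\<^bsub>A\<^esub> (x \<otimes>\<^bsub>A\<^esub> y) = ((a \<otimes>\<^bsub>A\<^esub> b) \<otimes>\<^bsub>A\<^esub> x) \<otimes>\<^bsub>A\<^esub> y"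
    by (simp only: nucleus_assoc(3)[OF y] c)
  also have "\<dots> = (a \<otimes>\<^bsub>A\<^esub> (b \<otimes>\<^bsub>A\<^esub> x)) \<otimes>\<^bsub>A\<^esub> y"
    by (simp only: nucleus_assoc(3)[OF x] c)
  also have "\<dots> = a \<otimes>\<^bsub>A\<^esub> (b \<otimes>\<^bsub>A\<^esub> (x \<otimes>\<^bsub>A\<^esub> y))"
    by (simp only: nucleus_assoc(3)[OF y] c)
  finally show "(a \<otimes>\<^bsub>A\<^esub> b) \<otimes>\<^bsub>A\<^esub> (x \<otimes>\<^bsub>A\<^esub> y) = a \<otimes>\<^bsub>A\<^esub> (b \<otimes>\<^bsub>A\<^esub> (x \<otimes>\<^bsub>A\<^esub> y))" .
qed (use assms in \<open>simp add: mult_closed\<close>)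

lemma zero_nucleus: "\<zero>\<^bsub>A\<^esub> \<in> nucleus A"
  using smult_nucleus[OF R.zero_closed one_nucleus] one_closed by simp

lemma nucleus_submodule: "submodule F (nucleus A) A"
  by (intro submodule.intro) (use add_nucleus smult_nucleus zero_nucleus module_axioms in auto)

text \<open>Makes results on associative rings applicable to idempotents of a nonassociative
  algebra.\<close>

lemma nucleus_ring: "ring (A\<lparr>carrier := nucleus A\<rparr>)"
proof (rule ringI)
  show "abelian_group (A\<lparr>carrier := nucleus A\<rparr>)"
    by (rule Module.module.axioms(2)[OF submodule_is_module[OF nucleus_submodule]])
  show "monoid (A\<lparr>carrier := nucleus A\<rparr>)"
    by (rule monoidI) (simp_all add: mult_nucleus one_nucleus nucleus_assoc l_one r_one)
qed (simp_all add: l_distr r_distr)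

lemma mult_zero_left: "x \<in> carrier A \<Longrightarrow> \<zero>\<^bsub>A\<^esub> \<otimes>\<^bsub>A\<^esub> x = \<zero>\<^bsub>A\<^esub>"
  using smult_mult_left[OF R.zero_closed, of "\<zero>\<^bsub>A\<^esub>" x] by (simp add: mult_closed)

lemma mult_zero_right: "x \<in> carrier A \<Longrightarrow> x \<otimes>\<^bsub>A\<^esub> \<zero>\<^bsub>A\<^esub> = \<zero>\<^bsub>A\<^esub>"
  using smult_mult_right[OF R.zero_closed, of x "\<zero>\<^bsub>A\<^esub>"] by (simp add: mult_closed)

lemma finsum_mult_left:
  "\<lbrakk>f \<in> I \<rightarrow> carrier A; x \<in> carrier A\<rbrakk> \<Longrightarrow> (\<Oplus>\<^bsub>A\<^esub>i\<in>I. f i) \<otimes>\<^bsub>A\<^esub> x = (\<Oplus>\<^bsub>A\<^esub>i\<in>I. f i \<otimes>\<^bsub>A\<^esub> x)"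
  by (rule finsum_hom[OF algebra_abelian_group algebra_abelian_group, where h = "\<lambda>y. y \<otimes>\<^bsub>A\<^esub> x"])
    (simp_all add: mult_closed l_distr)

lemma finsum_mult_right:
  "\<lbrakk>f \<in> I \<rightarrow> carrier A; x \<in> carrier A\<rbrakk> \<Longrightarrow> x \<otimes>\<^bsub>A\<^esub> (\<Oplus>\<^bsub>A\<^esub>i\<in>I. f i) = (\<Oplus>\<^bsub>A\<^esub>i\<in>I. x \<otimes>\<^bsub>A\<^esub> f i)"
  by (rule finsum_hom[OF algebra_abelian_group algebra_abelian_group, where h = "\<lambda>y. x \<otimes>\<^bsub>A\<^esub> y"])
    (simp_all add: mult_closed r_distr)

end

section \<open>Base change\<close>

text \<open>An interface to \<open>V = E \<otimes> A\<close> that hides cosets: a homomorphism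
  \<open>\<iota>\<close> over \<open>\<phi>\<close> whose image generates \<open>V\<close> over
  \<open>E\<close>, and the extension of every functional along it. \<open>generated\<close> bounds
  \<open>V\<close> from above and \<open>functional\<close> from below: no further elements, no
  further relations. The interface is stable under composition, as an extension in two stages
  requires.\<close>

locale base_change = A: unital_algebra F A + V: unital_algebra E V
  for F :: "'f ring" and A :: "('f, 'a) module" and E :: "'e ring" and V :: "('e, 'v) module" +
  fixes \<phi> :: "'f \<Rightarrow> 'e" and \<iota> :: "'a \<Rightarrow> 'v"
  assumes scalar_hom: "\<phi> \<in> ring_hom F E"
    and incl_closed [simp]: "a \<in> carrier A \<Longrightarrow> \<iota> a \<in> carrier V"
    and incl_add: "\<lbrakk>a \<in> carrier A; b \<in> carrier A\<rbrakk> \<Longrightarrow> \<iota> (a \<oplus>\<^bsub>A\<^esub> b) = \<iota> a \<oplus>\<^bsub>V\<^esub> \<iota> b"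
    and incl_smult: "\<lbrakk>r \<in> carrier F; a \<in> carrier A\<rbrakk> \<Longrightarrow> \<iota> (r \<odot>\<^bsub>A\<^esub> a) = \<phi> r \<odot>\<^bsub>V\<^esub> \<iota> a"
    and incl_mult: "\<lbrakk>a \<in> carrier A; b \<in> carrier A\<rbrakk> \<Longrightarrow> \<iota> (a \<otimes>\<^bsub>A\<^esub> b) = \<iota> a \<otimes>\<^bsub>V\<^esub> \<iota> b"
    and incl_one: "\<iota> \<one>\<^bsub>A\<^esub> = \<one>\<^bsub>V\<^esub>"
    and generated: "\<And>P x. \<lbrakk>x \<in> carrier V; \<And>a. a \<in> carrier A \<Longrightarrow> P (\<iota> a);
        \<And>x y. \<lbrakk>x \<in> carrier V; y \<in> carrier V; P x; P y\<rbrakk> \<Longrightarrow> P (x \<oplus>\<^bsub>V\<^esub> y);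
        \<And>r x. \<lbrakk>r \<in> carrier E; x \<in> carrier V; P x\<rbrakk> \<Longrightarrow> P (r \<odot>\<^bsub>V\<^esub> x)\<rbrakk> \<Longrightarrow> P x"
    and functional: "linear_functional F A g \<Longrightarrow>
        \<exists>G. linear_functional E V G \<and> (\<forall>a\<in>carrier A. G (\<iota> a) = \<phi> (g a))"
begin

lemma scalar_closed [simp]: "r \<in> carrier F \<Longrightarrow> \<phi> r \<in> carrier E"
  by (rule ring_hom_closed[OF scalar_hom])

lemma scalar_zero: "\<phi> \<zero>\<^bsub>F\<^esub> = \<zero>\<^bsub>E\<^esub>"
  by (rule ring_hom_zero[OF scalar_hom A.R.ring_axioms V.R.ring_axioms])

lemma scalar_one: "\<phi> \<one>\<^bsub>F\<^esub> = \<one>\<^bsub>E\<^esub>"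
  by (rule ring_hom_one[OF scalar_hom])

lemma scalar_zero_iff: "r \<in> carrier F \<Longrightarrow> \<phi> r = \<zero>\<^bsub>E\<^esub> \<longleftrightarrow> r = \<zero>\<^bsub>F\<^esub>"
proof
  assume r: "r \<in> carrier F" "\<phi> r = \<zero>\<^bsub>E\<^esub>"
  show "r = \<zero>\<^bsub>F\<^esub>"
  proof (rule ccontr)
    assume "r \<noteq> \<zero>\<^bsub>F\<^esub>"
    then have u: "r \<in> Units F" using r A.field_Units by auto
    have "\<phi> r \<otimes>\<^bsub>E\<^esub> \<phi> (inv\<^bsub>F\<^esub> r) = \<one>\<^bsub>E\<^esub>"
      using ring_hom_mult[OF scalar_hom r(1) A.R.Units_inv_closed[OF u]] A.R.Units_r_inv[OF u] scalar_one by simp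
    with r u show False by simp
  qed
qed (simp add: scalar_zero)

lemma incl_zero: "\<iota> \<zero>\<^bsub>A\<^esub> = \<zero>\<^bsub>V\<^esub>"
  using incl_smult[of "\<zero>\<^bsub>F\<^esub>" "\<zero>\<^bsub>A\<^esub>"] by (simp add: scalar_zero)

lemma incl_finsum: "f \<in> I \<rightarrow> carrier A \<Longrightarrow> \<iota> (\<Oplus>\<^bsub>A\<^esub>i\<in>I. f i) = (\<Oplus>\<^bsub>V\<^esub>i\<in>I. \<iota> (f i))"
  by (rule finsum_hom[OF A.algebra_abelian_group V.algebra_abelian_group]) (simp_all add: incl_add)

text \<open>The three associator identities are linear in \<open>a\<close> and in \<open>b\<close>,
  so it is enough to check them on the image of \<open>\<iota>\<close>, one variable after the
  other.\<close>

lemma incl_nucleus: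
  assumes x: "x \<in> nucleus A"
  shows "\<iota> x \<in> nucleus V"
proof -
  have xc: "x \<in> carrier A" using x by simp
  have "(\<iota> x \<otimes>\<^bsub>V\<^esub> a) \<otimes>\<^bsub>V\<^esub> b = \<iota> x \<otimes>\<^bsub>V\<^esub> (a \<otimes>\<^bsub>V\<^esub> b) \<and> (a \<otimes>\<^bsub>V\<^esub> \<iota> x) \<otimes>\<^bsub>V\<^esub> b = a \<otimes>\<^bsub>V\<^esub> (\<iota> x \<otimes>\<^bsub>V\<^esub> b) \<and>
     (a \<otimes>\<^bsub>V\<^esub> b) \<otimes>\<^bsub>V\<^esub> \<iota> x = a \<otimes>\<^bsub>V\<^esub> (b \<otimes>\<^bsub>V\<^esub> \<iota> x)" if "a \<in> carrier V" "b \<in> carrier V" for a b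
    using that(1)
  proof (rule generated)
    fix a assume a: "a \<in> carrier A"
    show "(\<iota> x \<otimes>\<^bsub>V\<^esub> \<iota> a) \<otimes>\<^bsub>V\<^esub> b = \<iota> x \<otimes>\<^bsub>V\<^esub> (\<iota> a \<otimes>\<^bsub>V\<^esub> b) \<and> (\<iota> a \<otimes>\<^bsub>V\<^esub> \<iota> x) \<otimes>\<^bsub>V\<^esub> b = \<iota> a \<otimes>\<^bsub>V\<^esub> (\<iota> x \<otimes>\<^bsub>V\<^esub> b) \<and>
       (\<iota> a \<otimes>\<^bsub>V\<^esub> b) \<otimes>\<^bsub>V\<^esub> \<iota> x = \<iota> a \<otimes>\<^bsub>V\<^esub> (b \<otimes>\<^bsub>V\<^esub> \<iota> x)"
      using that(2)
    proof (rule generated)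
      fix b assume "b \<in> carrier A"
      then show "(\<iota> x \<otimes>\<^bsub>V\<^esub> \<iota> a) \<otimes>\<^bsub>V\<^esub> \<iota> b = \<iota> x \<otimes>\<^bsub>V\<^esub> (\<iota> a \<otimes>\<^bsub>V\<^esub> \<iota> b) \<and>
        (\<iota> a \<otimes>\<^bsub>V\<^esub> \<iota> x) \<otimes>\<^bsub>V\<^esub> \<iota> b = \<iota> a \<otimes>\<^bsub>V\<^esub> (\<iota> x \<otimes>\<^bsub>V\<^esub> \<iota> b) \<and>
        (\<iota> a \<otimes>\<^bsub>V\<^esub> \<iota> b) \<otimes>\<^bsub>V\<^esub> \<iota> x = \<iota> a \<otimes>\<^bsub>V\<^esub> (\<iota> b \<otimes>\<^bsub>V\<^esub> \<iota> x)"
        using a xc A.nucleus_assoc[OF x] by (simp add: incl_mult[symmetric] A.mult_closed)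
    qed (use a xc in \<open>simp_all add: V.l_distr V.r_distr V.smult_mult_left V.smult_mult_right V.mult_closed\<close>)
  qed (use that xc in \<open>simp_all add: V.l_distr V.r_distr V.smult_mult_left V.smult_mult_right V.mult_closed\<close>)
  then show ?thesis by (intro V.nucleusI incl_closed xc) blast+
qed

text \<open>A functional on \<open>A\<close> dual to \<open>v p\<close> extends to \<open>V\<close>;
  applied to a relation over \<open>E\<close> it leaves the single coefficient
  \<open>d p\<close>.\<close>

lemma incl_indep:
  assumes "A.fin_dim" and "finite J" and v: "v \<in> J \<rightarrow> carrier A" and "indep_family F A J v"
  shows "indep_family E V J (\<lambda>p. \<iota> (v p))"
  unfolding indep_family_def
proof (intro ballI impI)
  fix d p assume d: "d \<in> J \<rightarrow> carrier E" and z: "(\<Oplus>\<^bsub>V\<^esub>p\<in>J. d p \<odot>\<^bsub>V\<^esub> \<iota> (v p)) = \<zero>\<^bsub>V\<^esub>" and p: "p \<in> J"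
  obtain g where g: "linear_functional F A g" "g (v p) = \<one>\<^bsub>F\<^esub>" "\<And>q. \<lbrakk>q \<in> J; q \<noteq> p\<rbrakk> \<Longrightarrow> g (v q) = \<zero>\<^bsub>F\<^esub>"
    using A.dual_functional[OF assms p] by blast
  obtain G where G: "linear_functional E V G" "\<forall>a\<in>carrier A. G (\<iota> a) = \<phi> (g a)"
    using functional[OF g(1)] by blast
  have vq: "v q \<in> carrier A" if "q \<in> J" for q using v that by auto
  have "G (\<Oplus>\<^bsub>V\<^esub>p\<in>J. d p \<odot>\<^bsub>V\<^esub> \<iota> (v p)) = (\<Oplus>\<^bsub>E\<^esub>q\<in>J. d q \<otimes>\<^bsub>E\<^esub> G (\<iota> (v q)))"
    by (rule linear_functional_sum[OF V.vectorspace_axioms G(1) _ d]) (use vq in auto)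
  also have "\<dots> = (\<Oplus>\<^bsub>E\<^esub>q\<in>J. if p = q then d q else \<zero>\<^bsub>E\<^esub>)"
    by (rule V.R.finsum_cong') (use d vq G(2) g(2,3) scalar_zero scalar_one in \<open>auto simp: Pi_iff\<close>)
  also have "\<dots> = d p"
    by (rule V.R.finsum_singleton) (use assms(2) p d in auto)
  finally show "d p = \<zero>\<^bsub>E\<^esub>"
    using G(1) z V.M.zero_closed V.smult_r_null[OF V.R.zero_closed] V.R.l_null
    unfolding linear_functional_def by (metis V.R.zero_closed)
qed

text \<open>A nonzero vector is an independent family with one member, and \<open>incl_indep\<close>
  preserves this.\<close>

lemma incl_inj:
  assumes "A.fin_dim" and a: "a \<in> carrier A" and "\<iota> a = \<zero>\<^bsub>V\<^esub>"
  shows "a = \<zero>\<^bsub>A\<^esub>"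
proof (rule ccontr)
  assume nz: "a \<noteq> \<zero>\<^bsub>A\<^esub>"
  have "r = \<zero>\<^bsub>F\<^esub>" if r: "r \<in> carrier F" "r \<odot>\<^bsub>A\<^esub> a = \<zero>\<^bsub>A\<^esub>" for r
  proof (rule ccontr)
    assume "r \<noteq> \<zero>\<^bsub>F\<^esub>"
    then have u: "r \<in> Units F" using r A.field_Units by auto
    have "a = (inv\<^bsub>F\<^esub> r \<otimes>\<^bsub>F\<^esub> r) \<odot>\<^bsub>A\<^esub> a" using u a by simp
    also have "\<dots> = \<zero>\<^bsub>A\<^esub>" using r u a by (subst A.smult_assoc1) auto
    finally show False using nz by simp
  qed
  then have "indep_family F A {a} (\<lambda>x. x)"
    using a by (auto simp: indep_family_def)
  then have "indep_family E V {a} \<iota>"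
    using incl_indep[OF assms(1), of "{a}" "\<lambda>x. x"] a by simp
  moreover have "(\<Oplus>\<^bsub>V\<^esub>p\<in>{a}. \<one>\<^bsub>E\<^esub> \<odot>\<^bsub>V\<^esub> \<iota> p) = \<zero>\<^bsub>V\<^esub>" using assms(3) a by simp
  ultimately have "\<one>\<^bsub>E\<^esub> = \<zero>\<^bsub>E\<^esub>" unfolding indep_family_def by (auto dest: bspec[where x = "\<lambda>_. \<one>\<^bsub>E\<^esub>"])
  then show False by simp
qed

end

text \<open>Serves the tower from \<open>F\<close> over \<open>E\<close> to an algebraic closure of
  \<open>E\<close>: a scalar extension of a scalar extension is handled directly, without an
  isomorphism to a single tensor product.\<close>

lemma base_change_trans:
  assumes "base_change F A E V \<phi> \<iota>" and "base_change E V L W \<psi> \<kappa>"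
  shows "base_change F A L W (\<psi> \<circ> \<phi>) (\<kappa> \<circ> \<iota>)"
proof -
  interpret X: base_change F A E V \<phi> \<iota> by fact
  interpret Y: base_change E V L W \<psi> \<kappa> by fact
  show ?thesis
  proof (intro base_change.intro base_change_axioms.intro)
    show "unital_algebra F A" "unital_algebra L W" by unfold_locales
    show "\<psi> \<circ> \<phi> \<in> ring_hom F L"
      using ring_hom_trans[OF X.scalar_hom Y.scalar_hom] .
  next
    fix P x
    assume x: "x \<in> carrier W" and base: "\<And>a. a \<in> carrier A \<Longrightarrow> P ((\<kappa> \<circ> \<iota>) a)"
      and add: "\<And>x y. \<lbrakk>x \<in> carrier W; y \<in> carrier W; P x; P y\<rbrakk> \<Longrightarrow> P (x \<oplus>\<^bsub>W\<^esub> y)"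
      and smult: "\<And>r x. \<lbrakk>r \<in> carrier L; x \<in> carrier W; P x\<rbrakk> \<Longrightarrow> P (r \<odot>\<^bsub>W\<^esub> x)"
    from x show "P x"
    proof (rule Y.generated)
      fix v assume "v \<in> carrier V"
      then show "P (\<kappa> v)"
      proof (rule X.generated)
        show "P (\<kappa> (\<iota> a))" if "a \<in> carrier A" for a using base[OF that] by simp
      qed (use add smult in \<open>auto simp: Y.incl_add Y.incl_smult\<close>)
    qed (use add smult in auto)
  next
    fix g assume "linear_functional F A g"
    then obtain G where G: "linear_functional E V G" "\<forall>a\<in>carrier A. G (\<iota> a) = \<phi> (g a)"
      using X.functional by blast
    obtain H where "linear_functional L W H" "\<forall>a\<in>carrier V. H (\<kappa> a) = \<psi> (G a)"
      using Y.functional[OF G(1)] by blast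
    with G show "\<exists>G. linear_functional L W G \<and> (\<forall>a\<in>carrier A. G ((\<kappa> \<circ> \<iota>) a) = (\<psi> \<circ> \<phi>) (g a))"
      by auto
  qed (simp_all add: X.incl_add Y.incl_add X.incl_smult Y.incl_smult X.incl_mult Y.incl_mult X.incl_one Y.incl_one)
qed

definition scalar_incl :: "'f ring \<Rightarrow> ('f \<Rightarrow> 'e) \<Rightarrow> 'e ring \<Rightarrow> ('f, 'a) module \<Rightarrow> 'a \<Rightarrow> ('e \<times> 'a \<Rightarrow>\<^sub>0 int) set" where
  "scalar_incl F \<phi> E A a = tensor_class F (algebra_via \<phi> E) A (frag_of (\<one>\<^bsub>E\<^esub>, a))"

lemma base_change_scalar_extension:
  assumes "field E" and "\<phi> \<in> ring_hom F E" and "unital_algebra F A"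
  shows "base_change F A E (scalar_extension F \<phi> E A) \<phi> (scalar_incl F \<phi> E A)"
proof -
  interpret comm_algebra_pair F "algebra_via \<phi> E" A by (rule scalar_extension_pair) fact+
  interpret E: field E by fact
  interpret V: unital_algebra E TA
    using scalar_extension_unital[OF assms] by (simp add: scalar_extension_def)
  let ?\<iota> = "\<lambda>a. cls (frag_of (\<one>\<^bsub>E\<^esub>, a))"
  have cl: "?\<iota> a \<in> carrier TA" if "a \<in> carrier A" for a using that by (intro class_closed) simp
  have "base_change F A E TA \<phi> ?\<iota>"
  proof (intro base_change.intro base_change_axioms.intro)
    show "unital_algebra F A" by fact
    show "unital_algebra E TA" by unfold_locales
    show "\<phi> \<in> ring_hom F E" by fact
    show "?\<iota> a \<in> carrier TA" if "a \<in> carrier A" for a by (rule cl[OF that])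
    show "?\<iota> (a \<oplus>\<^bsub>A\<^esub> b) = ?\<iota> a \<oplus>\<^bsub>TA\<^esub> ?\<iota> b" if "a \<in> carrier A" "b \<in> carrier A" for a b
      unfolding add_tensor
      by (rule class_eqI) (use kernel_right[of "\<one>\<^bsub>E\<^esub>" a b] that in \<open>simp add: algebra_simps\<close>)
    show "?\<iota> (r \<odot>\<^bsub>A\<^esub> a) = \<phi> r \<odot>\<^bsub>TA\<^esub> ?\<iota> a" if "r \<in> carrier F" "a \<in> carrier A" for r a
    proof -
      have r: "\<phi> r \<in> carrier E" by (rule ring_hom_closed[OF assms(2) that(1)])
      have "?\<iota> (r \<odot>\<^bsub>A\<^esub> a) = cls (frag_of (\<phi> r, a))"
        by (rule class_eqI[symmetric]) (use kernel_scalar[of r "\<one>\<^bsub>E\<^esub>" a] that r in simp)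
      then show ?thesis using frag_pure_eq_smult[of "\<phi> r" a] r that by simp
    qed
    show "?\<iota> (a \<otimes>\<^bsub>A\<^esub> b) = ?\<iota> a \<otimes>\<^bsub>TA\<^esub> ?\<iota> b" if "a \<in> carrier A" "b \<in> carrier A" for a b
      using that by (subst mult_tensor) simp_all
    show "?\<iota> \<one>\<^bsub>A\<^esub> = \<one>\<^bsub>TA\<^esub>" by (simp add: one_tensor)
  next
    fix P x
    assume x: "x \<in> carrier TA" and base: "\<And>a. a \<in> carrier A \<Longrightarrow> P (?\<iota> a)"
      and add: "\<And>x y. \<lbrakk>x \<in> carrier TA; y \<in> carrier TA; P x; P y\<rbrakk> \<Longrightarrow> P (x \<oplus>\<^bsub>TA\<^esub> y)"
      and smult: "\<And>r x. \<lbrakk>r \<in> carrier E; x \<in> carrier TA; P x\<rbrakk> \<Longrightarrow> P (r \<odot>\<^bsub>TA\<^esub> x)"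
    from x show "P x"
    proof (induction x rule: tensor_induct)
      case zero
      \<comment> \<open>The closure rules at hand are sums and scalar multiples only: zero is
        reached as \<open>0\<close> times the image of the unit, and the difference below with the
        scalar \<open>-1\<close>.\<close>
      then show ?case using smult[OF E.zero_closed cl base] C.one_closed by fastforce
    next
      case (diff U V)
      then show ?case
        using add[of U "(\<ominus>\<^bsub>E\<^esub> \<one>\<^bsub>E\<^esub>) \<odot>\<^bsub>TA\<^esub> V"] smult[of "\<ominus>\<^bsub>E\<^esub> \<one>\<^bsub>E\<^esub>" V]
        by (simp add: V.smult_l_minus a_minus_def)
    next
      case (pure b c)
      then show ?case using smult[OF _ cl[OF pure(2)] base[OF pure(2)], of b] frag_pure_eq_smult[of b c] by simp
    qed
  next
    fix g assume g: "linear_functional F A g"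
    have gc: "g a \<in> carrier F" if "a \<in> carrier A" for a using g that by (simp add: linear_functional_def)
    have \<phi>gc: "\<phi> (g a) \<in> carrier E" if "a \<in> carrier A" for a using gc[OF that] ring_hom_closed[OF assms(2)] by blast
    note \<phi>s = ring_hom_add[OF assms(2)] ring_hom_mult[OF assms(2)] ring_hom_closed[OF assms(2)]
    \<comment> \<open>The extension of \<open>g\<close> sends \<open>b \<otimes> c\<close> to
      \<open>b \<phi>(g c)\<close>; it is balanced because \<open>g\<close> is linear and
      \<open>\<phi>\<close> multiplicative.\<close>
    interpret L: balanced_map F "algebra_via \<phi> E" A E "\<lambda>(b, c). b \<otimes>\<^bsub>E\<^esub> \<phi> (g c)"
      by unfold_locales
        (use g \<phi>gc gc in \<open>simp_all add: linear_functional_def \<phi>s E.l_distr E.r_distr E.m_assoc E.m_lcomm\<close>)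
    have lin: "linear_functional E TA L.lift"
      unfolding linear_functional_def
    proof (intro conjI ballI)
      fix r x assume r: "r \<in> carrier E" and x: "x \<in> carrier TA"
      from x show "L.lift (r \<odot>\<^bsub>TA\<^esub> x) = r \<otimes>\<^bsub>E\<^esub> L.lift x"
      proof (induction x rule: tensor_induct)
        case zero
        then show ?case using r by (simp add: L.lift_zero)
      next
        case (diff U V)
        have "r \<odot>\<^bsub>TA\<^esub> (U \<ominus>\<^bsub>TA\<^esub> V) = r \<odot>\<^bsub>TA\<^esub> U \<ominus>\<^bsub>TA\<^esub> r \<odot>\<^bsub>TA\<^esub> V"
          using diff r by (simp add: a_minus_def V.smult_r_distr V.smult_r_minus)
        then have "L.lift (r \<odot>\<^bsub>TA\<^esub> (U \<ominus>\<^bsub>TA\<^esub> V)) = L.lift (r \<odot>\<^bsub>TA\<^esub> U) \<ominus>\<^bsub>E\<^esub> L.lift (r \<odot>\<^bsub>TA\<^esub> V)"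
          using diff r by (simp only: L.lift_diff V.smult_closed)
        then show ?case
          using diff r L.lift_closed
          by (simp only: L.lift_diff) (simp add: E.r_minus E.r_distr a_minus_def)
      next
        case (pure b c)
        have "r \<odot>\<^bsub>TA\<^esub> cls (frag_of (b, c)) = cls (frag_of (r \<otimes>\<^bsub>E\<^esub> b, c))"
          using pure r by (simp add: smult_tensor C.l_one)
        then show ?case using pure r \<phi>gc by (simp add: L.lift_pure E.m_assoc)
      qed
    qed (simp_all add: L.lift_closed L.lift_add)
    have "L.lift (?\<iota> a) = \<phi> (g a)" if "a \<in> carrier A" for a
      using that \<phi>gc by (simp add: L.lift_pure)
    with lin show "\<exists>G. linear_functional E TA G \<and> (\<forall>a\<in>carrier A. G (?\<iota> a) = \<phi> (g a))" by blast
  qed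
  then show ?thesis by (simp add: scalar_extension_def scalar_incl_def[abs_def])
qed

section \<open>Split semisimple operators\<close>

text \<open>Polynomials are lists of coefficients, constant term first, in contrast to HOL-Algebra.\<close>

fun horner :: "('r, 'm, 'q) module_scheme \<Rightarrow> ('m \<Rightarrow> 'm) \<Rightarrow> 'r list \<Rightarrow> 'm \<Rightarrow> 'm" where
  "horner M T [] x = \<zero>\<^bsub>M\<^esub>"
| "horner M T (c # cs) x = c \<odot>\<^bsub>M\<^esub> x \<oplus>\<^bsub>M\<^esub> T (horner M T cs x)"

text \<open>The derivative of the polynomial, evaluated at \<open>T\<close>, from the product rule
  \<open>(c + X q)' = q + X q'\<close>. In this recursive form no integer multiples of coefficients
  occur; \<open>poly_derivative_rev\<close> makes the link with the usual derivative.\<close>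

fun horner_deriv :: "('r, 'm, 'q) module_scheme \<Rightarrow> ('m \<Rightarrow> 'm) \<Rightarrow> 'r list \<Rightarrow> 'm \<Rightarrow> 'm" where
  "horner_deriv M T [] x = \<zero>\<^bsub>M\<^esub>"
| "horner_deriv M T (c # cs) x = horner M T cs x \<oplus>\<^bsub>M\<^esub> T (horner_deriv M T cs x)"

fun peval :: "('r, 'q) ring_scheme \<Rightarrow> 'r list \<Rightarrow> 'r \<Rightarrow> 'r" where
  "peval R [] \<mu> = \<zero>\<^bsub>R\<^esub>"
| "peval R (c # cs) \<mu> = c \<oplus>\<^bsub>R\<^esub> \<mu> \<otimes>\<^bsub>R\<^esub> peval R cs \<mu>"

fun peval_deriv :: "('r, 'q) ring_scheme \<Rightarrow> 'r list \<Rightarrow> 'r \<Rightarrow> 'r" where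
  "peval_deriv R [] \<mu> = \<zero>\<^bsub>R\<^esub>"
| "peval_deriv R (c # cs) \<mu> = peval R cs \<mu> \<oplus>\<^bsub>R\<^esub> \<mu> \<otimes>\<^bsub>R\<^esub> peval_deriv R cs \<mu>"

text \<open>The quotient in \<open>p = (X - \<mu>) q + p(\<mu>)\<close> by Horner's scheme: if
  \<open>p = c + X r\<close> and \<open>s\<close> is the quotient of \<open>r\<close>, then
  \<open>q = r(\<mu>) + X s\<close>.\<close>

fun synthetic_div :: "('r, 'q) ring_scheme \<Rightarrow> 'r list \<Rightarrow> 'r \<Rightarrow> 'r list" where
  "synthetic_div R [] \<mu> = []"
| "synthetic_div R [c] \<mu> = []"
| "synthetic_div R (c # c' # cs) \<mu> = peval R (c' # cs) \<mu> # synthetic_div R (c' # cs) \<mu>"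

lemma length_synthetic_div: "length (synthetic_div R cs \<mu>) = length cs - 1"
  by (induction R cs \<mu> rule: synthetic_div.induct) auto

lemma (in cring) peval_closed: "\<lbrakk>set cs \<subseteq> carrier R; x \<in> carrier R\<rbrakk> \<Longrightarrow> peval R cs x \<in> carrier R"
  by (induction cs) auto

lemma (in cring) peval_deriv_closed: "\<lbrakk>set cs \<subseteq> carrier R; x \<in> carrier R\<rbrakk> \<Longrightarrow> peval_deriv R cs x \<in> carrier R"
  by (induction cs) (auto simp: peval_closed)

lemma (in cring) synthetic_div_closed:
  "\<lbrakk>set cs \<subseteq> carrier R; x \<in> carrier R\<rbrakk> \<Longrightarrow> set (synthetic_div R cs x) \<subseteq> carrier R"
  by (induction cs rule: induct_list012) (auto simp: peval_closed)

text \<open>Division keeps the leading coefficient while the length drops by one, so an induction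
  over annihilating polynomials never meets the zero polynomial.\<close>

lemma (in cring) last_synthetic_div:
  "\<lbrakk>set cs \<subseteq> carrier R; x \<in> carrier R; length cs \<ge> 2\<rbrakk> \<Longrightarrow> last (synthetic_div R cs x) = last cs"
proof (induction cs)
  case (Cons c cs)
  then obtain c' cs' where cs: "cs = c' # cs'" by (cases cs) auto
  show ?case
  proof (cases cs')
    case Nil
    then show ?thesis using Cons cs by simp
  next
    case (Cons c'' cs'')
    then have "synthetic_div R cs x \<noteq> []" using cs by simp
    then show ?thesis using Cons.IH Cons.prems cs Cons by simp
  qed
qed simp

text \<open>Linearity of \<open>T\<close> is demanded on the submodule \<open>U\<close> only. The
  intended case is multiplication by an element of the subalgebra, restricted to a joint eigenspace
  of other such elements.\<close>

locale linear_operator = vectorspace K V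
  for K :: "('k, 'n) ring_scheme" and V :: "('k, 'v, 'q) module_scheme" +
  fixes T :: "'v \<Rightarrow> 'v" and U :: "'v set"
  assumes sub: "submodule K U V"
    and op_closed: "u \<in> U \<Longrightarrow> T u \<in> U"
    and op_add: "\<lbrakk>u \<in> U; v \<in> U\<rbrakk> \<Longrightarrow> T (u \<oplus>\<^bsub>V\<^esub> v) = T u \<oplus>\<^bsub>V\<^esub> T v"
    and op_smult: "\<lbrakk>r \<in> carrier K; u \<in> U\<rbrakk> \<Longrightarrow> T (r \<odot>\<^bsub>V\<^esub> u) = r \<odot>\<^bsub>V\<^esub> T u"
begin

lemma U_subset: "U \<subseteq> carrier V" by (rule submodule.subset[OF sub])
lemma U_carrier [simp]: "u \<in> U \<Longrightarrow> u \<in> carrier V" using U_subset by blast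
lemma U_add [simp]: "\<lbrakk>u \<in> U; v \<in> U\<rbrakk> \<Longrightarrow> u \<oplus>\<^bsub>V\<^esub> v \<in> U" by (rule submodule.m_closed[OF sub])
lemma U_smult [simp]: "\<lbrakk>r \<in> carrier K; u \<in> U\<rbrakk> \<Longrightarrow> r \<odot>\<^bsub>V\<^esub> u \<in> U" by (rule submodule.smult_closed[OF sub])
lemma U_zero [simp]: "\<zero>\<^bsub>V\<^esub> \<in> U" by (rule submodule.zero_closed[OF sub])
lemma U_minus [simp]: "u \<in> U \<Longrightarrow> \<ominus>\<^bsub>V\<^esub> u \<in> U"
  using U_smult[of "\<ominus>\<^bsub>K\<^esub> \<one>\<^bsub>K\<^esub>" u] by (simp add: smult_l_minus)
lemma U_diff [simp]: "\<lbrakk>u \<in> U; v \<in> U\<rbrakk> \<Longrightarrow> u \<ominus>\<^bsub>V\<^esub> v \<in> U" by (simp add: a_minus_def)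

declare op_closed [simp]

lemma op_zero: "T \<zero>\<^bsub>V\<^esub> = \<zero>\<^bsub>V\<^esub>"
  using op_smult[of "\<zero>\<^bsub>K\<^esub>" "\<zero>\<^bsub>V\<^esub>"] by simp

lemma op_minus: "u \<in> U \<Longrightarrow> T (\<ominus>\<^bsub>V\<^esub> u) = \<ominus>\<^bsub>V\<^esub> T u"
  using op_smult[of "\<ominus>\<^bsub>K\<^esub> \<one>\<^bsub>K\<^esub>" u] by (simp add: smult_l_minus)

lemma horner_closed: "\<lbrakk>set cs \<subseteq> carrier K; u \<in> U\<rbrakk> \<Longrightarrow> horner V T cs u \<in> U"
  by (induction cs) auto

lemma horner_add: "\<lbrakk>set cs \<subseteq> carrier K; u \<in> U; v \<in> U\<rbrakk> \<Longrightarrow>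
    horner V T cs (u \<oplus>\<^bsub>V\<^esub> v) = horner V T cs u \<oplus>\<^bsub>V\<^esub> horner V T cs v"
  by (induction cs) (auto simp: smult_r_distr op_add horner_closed M.a_ac)

lemma horner_smult: "\<lbrakk>set cs \<subseteq> carrier K; u \<in> U; r \<in> carrier K\<rbrakk> \<Longrightarrow>
    horner V T cs (r \<odot>\<^bsub>V\<^esub> u) = r \<odot>\<^bsub>V\<^esub> horner V T cs u"
proof (induction cs)
  case (Cons c cs)
  then show ?case
    using horner_closed[of cs u]
    by (simp add: op_smult smult_r_distr smult_assoc1[symmetric] R.m_comm)
qed simp

lemma horner_op: "\<lbrakk>set cs \<subseteq> carrier K; u \<in> U\<rbrakk> \<Longrightarrow> horner V T cs (T u) = T (horner V T cs u)"
  by (induction cs) (auto simp: op_zero op_add op_smult horner_closed)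

lemma horner_eigen:
  assumes "u \<in> U" and "\<mu> \<in> carrier K" and "T u = \<mu> \<odot>\<^bsub>V\<^esub> u" and "set cs \<subseteq> carrier K"
  shows "horner V T cs u = peval K cs \<mu> \<odot>\<^bsub>V\<^esub> u"
    and "horner_deriv V T cs u = peval_deriv K cs \<mu> \<odot>\<^bsub>V\<^esub> u"
proof -
  have "horner V T cs u = peval K cs \<mu> \<odot>\<^bsub>V\<^esub> u \<and> horner_deriv V T cs u = peval_deriv K cs \<mu> \<odot>\<^bsub>V\<^esub> u"
    using assms(4)
  proof (induction cs)
    case (Cons c cs)
    have "T (r \<odot>\<^bsub>V\<^esub> u) = (\<mu> \<otimes>\<^bsub>K\<^esub> r) \<odot>\<^bsub>V\<^esub> u" if "r \<in> carrier K" for r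
      using assms that by (simp add: op_smult smult_assoc1[symmetric] R.m_comm)
    then show ?case
      using Cons assms by (simp add: R.peval_closed R.peval_deriv_closed smult_l_distr)
  qed (use assms in simp)
  then show "horner V T cs u = peval K cs \<mu> \<odot>\<^bsub>V\<^esub> u"
    "horner_deriv V T cs u = peval_deriv K cs \<mu> \<odot>\<^bsub>V\<^esub> u" by auto
qed

text \<open>A polynomial acts on a Jordan block of size two by its Taylor expansion to first order,
  with the derivative off the diagonal. This is how separability will exclude such blocks.\<close>

lemma horner_taylor:
  assumes "u \<in> U" and "w \<in> U" and l: "\<mu> \<in> carrier K" and Tu: "T u = \<mu> \<odot>\<^bsub>V\<^esub> u \<oplus>\<^bsub>V\<^esub> w"
    and Tw: "T w = \<mu> \<odot>\<^bsub>V\<^esub> w" and "set cs \<subseteq> carrier K"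
  shows "horner V T cs u = peval K cs \<mu> \<odot>\<^bsub>V\<^esub> u \<oplus>\<^bsub>V\<^esub> peval_deriv K cs \<mu> \<odot>\<^bsub>V\<^esub> w"
  using assms(6)
proof (induction cs)
  case (Cons c cs)
  define p d where "p = peval K cs \<mu>" and "d = peval_deriv K cs \<mu>"
  have pd: "p \<in> carrier K" "d \<in> carrier K" "c \<in> carrier K"
    using Cons.prems l by (simp_all add: p_def d_def R.peval_closed R.peval_deriv_closed)
  have "T (p \<odot>\<^bsub>V\<^esub> u \<oplus>\<^bsub>V\<^esub> d \<odot>\<^bsub>V\<^esub> w) = (\<mu> \<otimes>\<^bsub>K\<^esub> p) \<odot>\<^bsub>V\<^esub> u \<oplus>\<^bsub>V\<^esub> (p \<odot>\<^bsub>V\<^esub> w \<oplus>\<^bsub>V\<^esub> (\<mu> \<otimes>\<^bsub>K\<^esub> d) \<odot>\<^bsub>V\<^esub> w)"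
    using pd assms(1-3)
    by (simp add: op_add op_smult Tu Tw smult_r_distr smult_assoc1[symmetric] R.m_comm M.a_assoc)
  then show ?case
    using Cons pd assms(1-3) by (simp add: p_def[symmetric] d_def[symmetric] smult_l_distr M.a_assoc)
qed (use assms in simp)

lemma horner_synthetic_div:
  assumes "u \<in> U" and "\<mu> \<in> carrier K" and "set cs \<subseteq> carrier K"
  shows "horner V T cs u = (T (horner V T (synthetic_div K cs \<mu>) u) \<ominus>\<^bsub>V\<^esub>
      \<mu> \<odot>\<^bsub>V\<^esub> horner V T (synthetic_div K cs \<mu>) u) \<oplus>\<^bsub>V\<^esub> peval K cs \<mu> \<odot>\<^bsub>V\<^esub> u"
  using assms(3)
proof (induction cs)
  case (Cons c cs)
  show ?case
  proof (cases cs)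
    case Nil
    then show ?thesis using Cons assms by (simp add: op_zero a_minus_def)
  next
    case (Cons c' cs')
    define s v where "s = synthetic_div K cs \<mu>" and "v = peval K cs \<mu>"
    define h where "h = horner V T s u"
    have cs: "set cs \<subseteq> carrier K" and c: "c \<in> carrier K" using \<open>set (c # cs) \<subseteq> carrier K\<close> by auto
    have v: "v \<in> carrier K" and h: "h \<in> U" "T h \<in> U" "T (T h) \<in> U" "T u \<in> U"
      using cs assms by (simp_all add: v_def s_def h_def R.peval_closed horner_closed R.synthetic_div_closed)
    have div: "synthetic_div K (c # cs) \<mu> = v # s" using Cons by (simp add: v_def s_def)
    have IH: "horner V T cs u = (T h \<ominus>\<^bsub>V\<^esub> \<mu> \<odot>\<^bsub>V\<^esub> h) \<oplus>\<^bsub>V\<^esub> v \<odot>\<^bsub>V\<^esub> u"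
      using Cons.IH[OF cs] by (simp add: h_def s_def v_def)
    have vc: "T h \<in> carrier V" "h \<in> carrier V" "T (T h) \<in> carrier V" "u \<in> carrier V" "T u \<in> carrier V"
      using h assms(1) by auto
    have "horner V T (c # cs) u = c \<odot>\<^bsub>V\<^esub> u \<oplus>\<^bsub>V\<^esub> ((T (T h) \<oplus>\<^bsub>V\<^esub> (\<ominus>\<^bsub>V\<^esub> (\<mu> \<odot>\<^bsub>V\<^esub> T h))) \<oplus>\<^bsub>V\<^esub> v \<odot>\<^bsub>V\<^esub> T u)"
      using h v assms by (simp add: IH op_add op_smult a_minus_def op_minus)
    moreover have "T (horner V T (v # s) u) \<ominus>\<^bsub>V\<^esub> \<mu> \<odot>\<^bsub>V\<^esub> horner V T (v # s) u \<oplus>\<^bsub>V\<^esub> peval K (c # cs) \<mu> \<odot>\<^bsub>V\<^esub> u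
      = (v \<odot>\<^bsub>V\<^esub> T u \<oplus>\<^bsub>V\<^esub> T (T h)) \<oplus>\<^bsub>V\<^esub> (\<ominus>\<^bsub>V\<^esub> (\<mu> \<odot>\<^bsub>V\<^esub> (v \<odot>\<^bsub>V\<^esub> u)) \<oplus>\<^bsub>V\<^esub> \<ominus>\<^bsub>V\<^esub> (\<mu> \<odot>\<^bsub>V\<^esub> T h))
        \<oplus>\<^bsub>V\<^esub> (c \<odot>\<^bsub>V\<^esub> u \<oplus>\<^bsub>V\<^esub> \<mu> \<odot>\<^bsub>V\<^esub> (v \<odot>\<^bsub>V\<^esub> u))"
      using h v c assms vc
      by (simp add: h_def[symmetric] v_def[symmetric] op_add op_smult smult_r_distr smult_l_distr a_minus_def
          M.minus_add smult_assoc1)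
    moreover have "\<dots> = c \<odot>\<^bsub>V\<^esub> u \<oplus>\<^bsub>V\<^esub> ((T (T h) \<oplus>\<^bsub>V\<^esub> (\<ominus>\<^bsub>V\<^esub> (\<mu> \<odot>\<^bsub>V\<^esub> T h))) \<oplus>\<^bsub>V\<^esub> v \<odot>\<^bsub>V\<^esub> T u)"
    proof -
      \<comment> \<open>With names for the four vectors, what remains is commutativity of addition
        and the cancellation of \<open>r\<close>.\<close>
      define p q r s' where "p = v \<odot>\<^bsub>V\<^esub> T u" and "q = T (T h)" and "r = \<mu> \<odot>\<^bsub>V\<^esub> (v \<odot>\<^bsub>V\<^esub> u)" and "s' = \<ominus>\<^bsub>V\<^esub> (\<mu> \<odot>\<^bsub>V\<^esub> T h)"
      have pq: "p \<in> carrier V" "q \<in> carrier V" "r \<in> carrier V" "s' \<in> carrier V" "c \<odot>\<^bsub>V\<^esub> u \<in> carrier V"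
        using vc v c assms by (simp_all add: p_def q_def r_def s'_def)
      have "(p \<oplus>\<^bsub>V\<^esub> q) \<oplus>\<^bsub>V\<^esub> (\<ominus>\<^bsub>V\<^esub> r \<oplus>\<^bsub>V\<^esub> s') \<oplus>\<^bsub>V\<^esub> (c \<odot>\<^bsub>V\<^esub> u \<oplus>\<^bsub>V\<^esub> r) = (\<ominus>\<^bsub>V\<^esub> r \<oplus>\<^bsub>V\<^esub> r) \<oplus>\<^bsub>V\<^esub> (c \<odot>\<^bsub>V\<^esub> u \<oplus>\<^bsub>V\<^esub> ((q \<oplus>\<^bsub>V\<^esub> s') \<oplus>\<^bsub>V\<^esub> p))"
        using pq by (simp add: M.a_ac)
      also have "\<dots> = c \<odot>\<^bsub>V\<^esub> u \<oplus>\<^bsub>V\<^esub> ((q \<oplus>\<^bsub>V\<^esub> s') \<oplus>\<^bsub>V\<^esub> p)" using pq by (simp add: M.l_neg)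
      finally show ?thesis by (simp add: p_def q_def r_def s'_def)
    qed
    ultimately show ?thesis by (simp add: div del: horner.simps peval.simps)
  qed
next
  case Nil
  have "\<ominus>\<^bsub>V\<^esub> \<zero>\<^bsub>V\<^esub> = \<zero>\<^bsub>V\<^esub>" by (rule M.minus_equality) simp_all
  then show ?case using assms by (metis Nil.prems M.l_zero M.minus_eq M.zero_closed horner.simps(1)
        op_zero peval.simps(1) smult_l_null smult_r_null synthetic_div.simps(1) U_carrier)
qed

end

text \<open>\<open>semisimple\<close> forbids Jordan blocks of size two on \<open>U\<close>, and
  \<open>has_root\<close> gives every nonconstant polynomial a root. With an annihilating polynomial
  at hand they force diagonalisability, and the polynomial never has to be factored
  completely.\<close>

locale split_operator = linear_operator +
  assumes semisimple: "\<lbrakk>u \<in> U; w \<in> U; \<mu> \<in> carrier K; T u = \<mu> \<odot>\<^bsub>V\<^esub> u \<oplus>\<^bsub>V\<^esub> w; T w = \<mu> \<odot>\<^bsub>V\<^esub> w\<rbrakk> \<Longrightarrow> w = \<zero>\<^bsub>V\<^esub>"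
    and has_root: "\<lbrakk>set cs \<subseteq> carrier K; length cs \<ge> 2; last cs \<noteq> \<zero>\<^bsub>K\<^esub>\<rbrakk> \<Longrightarrow> \<exists>\<mu>\<in>carrier K. peval K cs \<mu> = \<zero>\<^bsub>K\<^esub>"
begin

definition "eigenvectors = {u \<in> U. \<exists>\<mu>\<in>carrier K. T u = \<mu> \<odot>\<^bsub>V\<^esub> u}"

lemma eigenvectors_subset: "eigenvectors \<subseteq> U" "eigenvectors \<subseteq> carrier V"
  using U_subset by (auto simp: eigenvectors_def)

lemma eigenspan_submodule: "submodule K (span eigenvectors) V"
  by (rule span_is_submodule[OF eigenvectors_subset(2)])

lemma eigenspan_subset: "span eigenvectors \<subseteq> U"
  by (rule span_is_subset[OF eigenvectors_subset(1) sub])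

text \<open>On the eigenspan, \<open>T - \<mu>\<close> is onto up to a vector of the eigenspace of
  \<open>\<mu>\<close>: \<open>y = (T - \<mu>) z + w\<close>, written without subtraction. For an
  eigenvector \<open>y\<close> with eigenvalue \<open>r \<noteq> \<mu>\<close> take
  \<open>z = y / (r - \<mu>)\<close> and \<open>w = 0\<close>; for \<open>r = \<mu>\<close> take
  \<open>z = 0\<close> and \<open>w = y\<close>. Such \<open>y\<close> form a submodule.\<close>

lemma eigenspan_shift:
  assumes y: "y \<in> span eigenvectors" and m: "\<mu> \<in> carrier K"
  obtains z w where "z \<in> span eigenvectors" and "w \<in> U" and "T w = \<mu> \<odot>\<^bsub>V\<^esub> w"
    and "y \<oplus>\<^bsub>V\<^esub> \<mu> \<odot>\<^bsub>V\<^esub> z = T z \<oplus>\<^bsub>V\<^esub> w"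
proof -
  interpret ES: submodule K "span eigenvectors" V by (rule eigenspan_submodule)
  define S where "S = {y \<in> U. \<exists>z\<in>span eigenvectors. \<exists>w\<in>U. T w = \<mu> \<odot>\<^bsub>V\<^esub> w \<and> y \<oplus>\<^bsub>V\<^esub> \<mu> \<odot>\<^bsub>V\<^esub> z = T z \<oplus>\<^bsub>V\<^esub> w}"
  have SI: "y \<in> S" if "y \<in> U" "z \<in> span eigenvectors" "w \<in> U" "T w = \<mu> \<odot>\<^bsub>V\<^esub> w"
      "y \<oplus>\<^bsub>V\<^esub> \<mu> \<odot>\<^bsub>V\<^esub> z = T z \<oplus>\<^bsub>V\<^esub> w" for y z w
    using that unfolding S_def by blast
  have zU: "z \<in> U" if "z \<in> span eigenvectors" for z using eigenspan_subset that by blast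
  have "submodule K S V"
  proof (intro submodule.intro)
    show "Module.module K V" by (rule module_axioms)
    show "S \<subseteq> carrier V" using U_subset by (auto simp: S_def)
    show "\<zero>\<^bsub>V\<^esub> \<in> S"
      by (rule SI[of _ "\<zero>\<^bsub>V\<^esub>" "\<zero>\<^bsub>V\<^esub>"]) (use m in \<open>simp_all add: op_zero\<close>)
  next
    fix y y' assume "y \<in> S" "y' \<in> S"
    then obtain z w z' w' where *: "y \<in> U" "z \<in> span eigenvectors" "w \<in> U" "T w = \<mu> \<odot>\<^bsub>V\<^esub> w" "y \<oplus>\<^bsub>V\<^esub> \<mu> \<odot>\<^bsub>V\<^esub> z = T z \<oplus>\<^bsub>V\<^esub> w"
        "y' \<in> U" "z' \<in> span eigenvectors" "w' \<in> U" "T w' = \<mu> \<odot>\<^bsub>V\<^esub> w'" "y' \<oplus>\<^bsub>V\<^esub> \<mu> \<odot>\<^bsub>V\<^esub> z' = T z' \<oplus>\<^bsub>V\<^esub> w'"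
      by (auto simp: S_def)
    have "y \<oplus>\<^bsub>V\<^esub> y' \<oplus>\<^bsub>V\<^esub> \<mu> \<odot>\<^bsub>V\<^esub> (z \<oplus>\<^bsub>V\<^esub> z') = (y \<oplus>\<^bsub>V\<^esub> \<mu> \<odot>\<^bsub>V\<^esub> z) \<oplus>\<^bsub>V\<^esub> (y' \<oplus>\<^bsub>V\<^esub> \<mu> \<odot>\<^bsub>V\<^esub> z')"
      using *(1,2,6,7) m zU by (simp add: smult_r_distr M.a_ac)
    also have "\<dots> = T (z \<oplus>\<^bsub>V\<^esub> z') \<oplus>\<^bsub>V\<^esub> (w \<oplus>\<^bsub>V\<^esub> w')"
      unfolding *(5) *(10) using *(2,3,7,8) zU by (simp add: op_add M.a_ac)
    finally show "y \<oplus>\<^bsub>V\<^esub> y' \<in> S"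
      by (intro SI[of _ "z \<oplus>\<^bsub>V\<^esub> z'" "w \<oplus>\<^bsub>V\<^esub> w'"])
        (use *(1-4) *(6-9) m in \<open>simp_all add: op_add smult_r_distr\<close>)
  next
    fix r y assume r: "r \<in> carrier K" and "y \<in> S"
    then obtain z w where *: "y \<in> U" "z \<in> span eigenvectors" "w \<in> U" "T w = \<mu> \<odot>\<^bsub>V\<^esub> w" "y \<oplus>\<^bsub>V\<^esub> \<mu> \<odot>\<^bsub>V\<^esub> z = T z \<oplus>\<^bsub>V\<^esub> w"
      by (auto simp: S_def)
    have "r \<odot>\<^bsub>V\<^esub> y \<oplus>\<^bsub>V\<^esub> \<mu> \<odot>\<^bsub>V\<^esub> (r \<odot>\<^bsub>V\<^esub> z) = r \<odot>\<^bsub>V\<^esub> (y \<oplus>\<^bsub>V\<^esub> \<mu> \<odot>\<^bsub>V\<^esub> z)"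
      using *(1-4) m r zU by (simp add: smult_r_distr smult_assoc1[symmetric] R.m_comm)
    also have "\<dots> = T (r \<odot>\<^bsub>V\<^esub> z) \<oplus>\<^bsub>V\<^esub> r \<odot>\<^bsub>V\<^esub> w"
      unfolding *(5) using *(1-4) r zU by (simp add: op_smult smult_r_distr)
    finally show "r \<odot>\<^bsub>V\<^esub> y \<in> S"
      by (intro SI[of _ "r \<odot>\<^bsub>V\<^esub> z" "r \<odot>\<^bsub>V\<^esub> w"])
        (use *(1-4) m r in \<open>simp_all add: op_smult smult_assoc1[symmetric] R.m_comm\<close>)
  qed
  moreover have "eigenvectors \<subseteq> S"
  proof
    fix v assume "v \<in> eigenvectors"
    then obtain r where v: "v \<in> U" "r \<in> carrier K" "T v = r \<odot>\<^bsub>V\<^esub> v" by (auto simp: eigenvectors_def)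
    have vE: "v \<in> span eigenvectors"
      using in_own_span[OF eigenvectors_subset(2)] \<open>v \<in> eigenvectors\<close> by blast
    show "v \<in> S"
    proof (cases "r = \<mu>")
      case True
      then show ?thesis
        by (intro SI[of _ "\<zero>\<^bsub>V\<^esub>" v]) (use v m in \<open>simp_all add: op_zero\<close>)
    next
      case False
      have nz: "r \<ominus>\<^bsub>K\<^esub> \<mu> \<noteq> \<zero>\<^bsub>K\<^esub>" using False v m by simp
      then have u: "r \<ominus>\<^bsub>K\<^esub> \<mu> \<in> Units K" using v m field_Units by auto
      define i where "i = inv\<^bsub>K\<^esub> (r \<ominus>\<^bsub>K\<^esub> \<mu>)"
      have i: "i \<in> carrier K" "(r \<ominus>\<^bsub>K\<^esub> \<mu>) \<otimes>\<^bsub>K\<^esub> i = \<one>\<^bsub>K\<^esub>" using u by (simp_all add: i_def)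
      have "r \<otimes>\<^bsub>K\<^esub> i = ((r \<ominus>\<^bsub>K\<^esub> \<mu>) \<oplus>\<^bsub>K\<^esub> \<mu>) \<otimes>\<^bsub>K\<^esub> i"
        using v m by (simp add: a_minus_def R.a_assoc R.l_neg)
      also have "\<dots> = \<one>\<^bsub>K\<^esub> \<oplus>\<^bsub>K\<^esub> \<mu> \<otimes>\<^bsub>K\<^esub> i" using i v m by (simp add: R.l_distr)
      finally have "T (i \<odot>\<^bsub>V\<^esub> v) = v \<oplus>\<^bsub>V\<^esub> \<mu> \<odot>\<^bsub>V\<^esub> (i \<odot>\<^bsub>V\<^esub> v)"
        using v i m by (simp add: op_smult smult_assoc1[symmetric] R.m_comm[of i] smult_l_distr)
      then show ?thesis
        by (intro SI[of _ "i \<odot>\<^bsub>V\<^esub> v" "\<zero>\<^bsub>V\<^esub>"])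
          (use v m i vE ES.smult_closed[OF i(1) vE] in \<open>simp_all add: op_zero\<close>)
    qed
  qed
  ultimately have "y \<in> S" using span_is_subset y by blast
  then show ?thesis using that by (auto simp: S_def)
qed

text \<open>Induction on the degree. For a root \<open>\<mu>\<close>, the vector
  \<open>(T - \<mu>) x\<close> is killed by the quotient, so it lies in the eigenspan and equals
  \<open>(T - \<mu>) z + w\<close>. Then \<open>T - \<mu>\<close> maps \<open>x - z\<close> to
  \<open>w\<close> and kills \<open>w\<close>, a Jordan block unless \<open>w = 0\<close>. So
  \<open>x - z\<close> satisfies the eigenvector equation for \<open>\<mu>\<close>.\<close>

theorem annihilated_in_eigenspan:
  assumes "set cs \<subseteq> carrier K" and "cs \<noteq> []" and "last cs \<noteq> \<zero>\<^bsub>K\<^esub>" and "x \<in> U" and "horner V T cs x = \<zero>\<^bsub>V\<^esub>"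
  shows "x \<in> span eigenvectors"
  using assms
proof (induction "length cs" arbitrary: cs x)
  case (Suc n)
  interpret ES: submodule K "span eigenvectors" V by (rule eigenspan_submodule)
  have zU: "z \<in> U" if "z \<in> span eigenvectors" for z using eigenspan_subset that by blast
  show ?case
  proof (cases n)
    case 0
    \<comment> \<open>A nonzero constant kills only the zero vector.\<close>
    then obtain c where c: "cs = [c]" using Suc.hyps(2) by (cases cs) auto
    then have cc: "c \<in> carrier K" "c \<noteq> \<zero>\<^bsub>K\<^esub>" "c \<odot>\<^bsub>V\<^esub> x = \<zero>\<^bsub>V\<^esub>" using Suc.prems by (simp_all add: op_zero)
    then have u: "c \<in> Units K" using field_Units by auto
    have "x = (inv\<^bsub>K\<^esub> c \<otimes>\<^bsub>K\<^esub> c) \<odot>\<^bsub>V\<^esub> x" using u Suc.prems by simp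
    also have "\<dots> = \<zero>\<^bsub>V\<^esub>" using cc u Suc.prems by (subst smult_assoc1) auto
    finally show ?thesis by simp
  next
    case (Suc n')
    then have len: "length cs \<ge> 2" using \<open>Suc n = length cs\<close> by simp
    obtain \<mu> where m: "\<mu> \<in> carrier K" "peval K cs \<mu> = \<zero>\<^bsub>K\<^esub>"
      using has_root[OF Suc.prems(1) len Suc.prems(3)] by blast
    define s where "s = synthetic_div K cs \<mu>"
    have s: "set s \<subseteq> carrier K" "last s \<noteq> \<zero>\<^bsub>K\<^esub>" "n = length s"
      using R.synthetic_div_closed[OF Suc.prems(1) m(1)] R.last_synthetic_div[OF Suc.prems(1) m(1) len]
        Suc.prems Suc.hyps(2) by (simp_all add: s_def length_synthetic_div)
    have sne: "s \<noteq> []" using s(3) Suc by auto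
    define y where "y = T x \<ominus>\<^bsub>V\<^esub> \<mu> \<odot>\<^bsub>V\<^esub> x"
    have xU: "x \<in> U" "T x \<in> U" using Suc.prems by auto
    have yU: "y \<in> U" using xU m by (simp add: y_def)
    have "horner V T s y = horner V T s (T x) \<oplus>\<^bsub>V\<^esub> horner V T s ((\<ominus>\<^bsub>K\<^esub> \<mu>) \<odot>\<^bsub>V\<^esub> x)"
      using xU m s(1) by (simp add: y_def a_minus_def smult_l_minus horner_add)
    also have "\<dots> = T (horner V T s x) \<ominus>\<^bsub>V\<^esub> \<mu> \<odot>\<^bsub>V\<^esub> horner V T s x"
      using xU m s(1) horner_closed[OF s(1) xU(1)]
      by (simp only: horner_op horner_smult R.a_inv_closed) (simp add: smult_l_minus a_minus_def)
    also have "\<dots> = horner V T cs x"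
      using horner_synthetic_div[OF xU(1) m(1) Suc.prems(1)] m xU horner_closed[OF s(1) xU(1)]
      by (simp add: s_def)
    finally have "horner V T s y = \<zero>\<^bsub>V\<^esub>" using Suc.prems by simp
    then have "y \<in> span eigenvectors" using Suc.hyps(1)[OF s(3) s(1) sne s(2) yU] by simp
    then obtain z w where zw: "z \<in> span eigenvectors" "w \<in> U" "T w = \<mu> \<odot>\<^bsub>V\<^esub> w" "y \<oplus>\<^bsub>V\<^esub> \<mu> \<odot>\<^bsub>V\<^esub> z = T z \<oplus>\<^bsub>V\<^esub> w"
      using eigenspan_shift[OF _ m(1)] by metis
    define v where "v = x \<ominus>\<^bsub>V\<^esub> z"
    have vU: "v \<in> U" using xU zU[OF zw(1)] by (simp add: v_def)
    have zc: "z \<in> U" "T z \<in> U" using zU[OF zw(1)] by auto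
    have "T x = y \<oplus>\<^bsub>V\<^esub> \<mu> \<odot>\<^bsub>V\<^esub> x" using xU m by (simp add: y_def a_minus_def M.a_assoc M.l_neg)
    then have "T v = (y \<oplus>\<^bsub>V\<^esub> \<mu> \<odot>\<^bsub>V\<^esub> x) \<oplus>\<^bsub>V\<^esub> \<ominus>\<^bsub>V\<^esub> T z" using xU zc by (simp add: v_def a_minus_def op_add op_minus)
    also have "\<dots> = (y \<oplus>\<^bsub>V\<^esub> \<mu> \<odot>\<^bsub>V\<^esub> z) \<oplus>\<^bsub>V\<^esub> (\<mu> \<odot>\<^bsub>V\<^esub> x \<oplus>\<^bsub>V\<^esub> \<ominus>\<^bsub>V\<^esub> (\<mu> \<odot>\<^bsub>V\<^esub> z)) \<oplus>\<^bsub>V\<^esub> \<ominus>\<^bsub>V\<^esub> T z"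
    proof -
      have "(y \<oplus>\<^bsub>V\<^esub> \<mu> \<odot>\<^bsub>V\<^esub> z) \<oplus>\<^bsub>V\<^esub> (\<mu> \<odot>\<^bsub>V\<^esub> x \<oplus>\<^bsub>V\<^esub> \<ominus>\<^bsub>V\<^esub> (\<mu> \<odot>\<^bsub>V\<^esub> z)) \<oplus>\<^bsub>V\<^esub> \<ominus>\<^bsub>V\<^esub> T z
          = (\<mu> \<odot>\<^bsub>V\<^esub> z \<oplus>\<^bsub>V\<^esub> \<ominus>\<^bsub>V\<^esub> (\<mu> \<odot>\<^bsub>V\<^esub> z)) \<oplus>\<^bsub>V\<^esub> ((y \<oplus>\<^bsub>V\<^esub> \<mu> \<odot>\<^bsub>V\<^esub> x) \<oplus>\<^bsub>V\<^esub> \<ominus>\<^bsub>V\<^esub> T z)"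
        using yU xU zc m by (simp add: M.a_ac)
      then show ?thesis using yU xU zc m by (simp add: M.r_neg)
    qed
    also have "\<dots> = (T z \<oplus>\<^bsub>V\<^esub> \<ominus>\<^bsub>V\<^esub> T z) \<oplus>\<^bsub>V\<^esub> (\<mu> \<odot>\<^bsub>V\<^esub> v \<oplus>\<^bsub>V\<^esub> w)"
      unfolding zw(4) using yU xU zc zw m
      by (simp add: v_def a_minus_def smult_r_distr smult_r_minus M.a_ac)
    also have "\<dots> = \<mu> \<odot>\<^bsub>V\<^esub> v \<oplus>\<^bsub>V\<^esub> w" using zc vU zw m by (simp add: M.r_neg)
    finally have Tv: "T v = \<mu> \<odot>\<^bsub>V\<^esub> v \<oplus>\<^bsub>V\<^esub> w" .
    have "w = \<zero>\<^bsub>V\<^esub>" by (rule semisimple[OF vU zw(2) m(1) Tv zw(3)])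
    then have "v \<in> eigenvectors" using Tv vU m by (auto simp: eigenvectors_def)
    then have "v \<in> span eigenvectors" using in_own_span[OF eigenvectors_subset(2)] by blast
    moreover have "x = v \<oplus>\<^bsub>V\<^esub> z" using xU zc by (simp add: v_def a_minus_def M.a_assoc M.l_neg)
    ultimately show ?thesis using zw(1) by simp
  qed
qed simp

end

section \<open>Idempotents\<close>

text \<open>If all \<open>e i f R e i\<close> vanished, then choosing \<open>x \<noteq> 0\<close> with \<open>x f = x\<close> such that
  \<open>x f R e i = 0\<close> for as many \<open>i\<close> as possible leads to a contradiction: some \<open>x e i f\<close> is
  nonzero, and it annihilates one more index.\<close>

lemma (in ring) idempotent_meets_decomposition:
  assumes fin: "finite I" and e: "e \<in> I \<rightarrow> carrier R" and sum: "(\<Oplus>i\<in>I. e i) = \<one>"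
    and f: "f \<in> carrier R" "f \<otimes> f = f" "f \<noteq> \<zero>"
  obtains i y where "i \<in> I" and "y \<in> carrier R" and "e i \<otimes> (f \<otimes> (y \<otimes> e i)) \<noteq> \<zero>"
proof (rule ccontr)
  assume "\<not> thesis"
  then have vanish: "e i \<otimes> (f \<otimes> (y \<otimes> e i)) = \<zero>" if "i \<in> I" "y \<in> carrier R" for i y
    using that(1,2) \<open>\<not> thesis\<close> \<open>\<And>y i. \<lbrakk>i \<in> I; y \<in> carrier R; e i \<otimes> (f \<otimes> (y \<otimes> e i)) \<noteq> \<zero>\<rbrakk> \<Longrightarrow> thesis\<close> by blast
  define Z where "Z x = {i \<in> I. \<forall>y\<in>carrier R. x \<otimes> (f \<otimes> (y \<otimes> e i)) = \<zero>}" for x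
  define Q where "Q x \<longleftrightarrow> x \<in> carrier R \<and> x \<otimes> f = x \<and> x \<noteq> \<zero>" for x
  have ZI: "finite (Z x)" "card (Z x) \<le> card I" for x
    using fin by (auto simp: Z_def intro: card_mono)
  have "Q f" using f by (simp add: Q_def)
  then obtain x where x: "Q x" "\<And>x'. Q x' \<Longrightarrow> card (Z x') \<le> card (Z x)"
    using ex_has_greatest_nat[of Q f "\<lambda>x. card (Z x)" "Suc (card I)"] ZI(2) by (metis le_imp_less_Suc)
  have xc: "x \<in> carrier R" "x \<otimes> f = x" "x \<noteq> \<zero>" using x(1) by (auto simp: Q_def)
  have "\<exists>i\<in>I. x \<otimes> e i \<otimes> f \<noteq> \<zero>"
  proof (rule ccontr)
    assume *: "\<not> ?thesis"
    have "x = x \<otimes> (\<Oplus>i\<in>I. e i) \<otimes> f" using xc by (simp add: sum)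
    also have "\<dots> = (\<Oplus>i\<in>I. x \<otimes> e i \<otimes> f)"
      using e xc f fin by (simp add: finsum_rdistr finsum_ldistr Pi_def)
    also have "\<dots> = (\<Oplus>i\<in>I. \<zero>)"
      by (rule finsum_cong') (use * in auto)
    finally show False using xc by simp
  qed
  then obtain i where i: "i \<in> I" "x \<otimes> e i \<otimes> f \<noteq> \<zero>" by blast
  define x' where "x' = x \<otimes> e i \<otimes> f"
  have ei: "e i \<in> carrier R" using i e by auto
  have x'c: "x' \<in> carrier R" using xc ei f by (simp add: x'_def)
  have Qx': "Q x'" using x'c i xc ei f by (simp add: Q_def x'_def m_assoc)
  \<comment> \<open>Since \<open>x f = x\<close> and \<open>f f = f\<close>, the factor
    \<open>e i\<close> appears between two copies of \<open>f\<close>. Indices killed by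
    \<open>x\<close> therefore remain killed by \<open>x'\<close>, with \<open>e i f y\<close> in
    place of \<open>y\<close>, and \<open>i\<close> itself becomes killed by
    \<open>vanish\<close>.\<close>
  have x'f: "x' \<otimes> (f \<otimes> z) = x \<otimes> (f \<otimes> (e i \<otimes> (f \<otimes> z)))" if "z \<in> carrier R" for z
  proof -
    have "x' \<otimes> (f \<otimes> z) = x \<otimes> (e i \<otimes> (f \<otimes> f \<otimes> z))"
      using xc ei f(1) that by (simp add: x'_def m_assoc)
    also have "\<dots> = (x \<otimes> f) \<otimes> (e i \<otimes> (f \<otimes> z))" using f xc by simp
    also have "\<dots> = x \<otimes> (f \<otimes> (e i \<otimes> (f \<otimes> z)))"
      by (rule m_assoc) (use xc ei f that in auto)
    finally show ?thesis .
  qed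
  have "Z x \<subseteq> Z x'"
  proof
    fix j assume j: "j \<in> Z x"
    then have "j \<in> I" and *: "\<And>y. y \<in> carrier R \<Longrightarrow> x \<otimes> (f \<otimes> (y \<otimes> e j)) = \<zero>" by (auto simp: Z_def)
    have ej: "e j \<in> carrier R" using \<open>j \<in> I\<close> e by auto
    have "x' \<otimes> (f \<otimes> (y \<otimes> e j)) = \<zero>" if y: "y \<in> carrier R" for y
      using x'f[of "y \<otimes> e j"] *[of "e i \<otimes> (f \<otimes> y)"] y ej ei f(1) by (simp add: m_assoc)
    then show "j \<in> Z x'" using \<open>j \<in> I\<close> by (simp add: Z_def)
  qed
  moreover have "i \<in> Z x'"
  proof -
    have "x' \<otimes> (f \<otimes> (y \<otimes> e i)) = \<zero>" if y: "y \<in> carrier R" for y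
      using x'f[of "y \<otimes> e i"] vanish[OF i(1) y] y ei f(1) xc(1) by simp
    then show ?thesis using i(1) by (simp add: Z_def)
  qed
  moreover have "i \<notin> Z x"
  proof
    assume "i \<in> Z x"
    \<comment> \<open>With \<open>y = 1\<close> this would give \<open>x e i = 0\<close>, against
      the choice of \<open>i\<close>.\<close>
    then have "x \<otimes> (f \<otimes> (\<one> \<otimes> e i)) = \<zero>" by (auto simp: Z_def)
    then have "(x \<otimes> f) \<otimes> e i = \<zero>" using m_assoc[OF xc(1) f(1) ei] ei by simp
    then show False using i(2) xc f(1) by simp
  qed
  ultimately have "card (Z x) < card (Z x')" using ZI(1)[of x'] by (intro psubset_card_mono) auto
  with x(2)[OF Qx'] show False by simp
qed

text \<open>By the previous lemma \<open>e k f A e k\<close> and \<open>e l g A e l\<close> contain nonzero multiples of \<open>e k\<close> and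
  \<open>e l\<close> for some \<open>k\<close>, \<open>l\<close>, so \<open>f A g\<close> inherits \<open>e k A e l \<noteq> 0\<close>.\<close>

lemma (in unital_algebra) nonzero_corner:
  assumes fin: "finite I" and e: "e \<in> I \<rightarrow> nucleus A" and sum: "(\<Oplus>\<^bsub>A\<^esub>i\<in>I. e i) = \<one>\<^bsub>A\<^esub>"
    and a: "a \<in> carrier A"
    and corner: "\<And>i j x. \<lbrakk>i \<in> I; j \<in> I; x \<in> carrier A\<rbrakk> \<Longrightarrow>
      \<exists>r\<in>carrier F. e i \<otimes>\<^bsub>A\<^esub> (x \<otimes>\<^bsub>A\<^esub> e j) = r \<odot>\<^bsub>A\<^esub> (e i \<otimes>\<^bsub>A\<^esub> (a \<otimes>\<^bsub>A\<^esub> e j))"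
    and nonzero: "\<And>i j. \<lbrakk>i \<in> I; j \<in> I; e i \<noteq> \<zero>\<^bsub>A\<^esub>; e j \<noteq> \<zero>\<^bsub>A\<^esub>\<rbrakk> \<Longrightarrow> e i \<otimes>\<^bsub>A\<^esub> (a \<otimes>\<^bsub>A\<^esub> e j) \<noteq> \<zero>\<^bsub>A\<^esub>"
    and idem: "\<And>i. i \<in> I \<Longrightarrow> \<exists>r\<in>carrier F. e i \<otimes>\<^bsub>A\<^esub> e i = r \<odot>\<^bsub>A\<^esub> e i \<and> (r = \<zero>\<^bsub>F\<^esub> \<longrightarrow> e i = \<zero>\<^bsub>A\<^esub>)"
    and f: "f \<in> nucleus A" "f \<otimes>\<^bsub>A\<^esub> f = f" "f \<noteq> \<zero>\<^bsub>A\<^esub>"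
    and g: "g \<in> nucleus A" "g \<otimes>\<^bsub>A\<^esub> g = g" "g \<noteq> \<zero>\<^bsub>A\<^esub>"
  obtains x where "x \<in> carrier A" and "f \<otimes>\<^bsub>A\<^esub> (x \<otimes>\<^bsub>A\<^esub> g) \<noteq> \<zero>\<^bsub>A\<^esub>"
proof -
  have ec: "e i \<in> nucleus A" if "i \<in> I" for i using e that by auto
  have smult_nz: "r \<odot>\<^bsub>A\<^esub> x \<noteq> \<zero>\<^bsub>A\<^esub>" if "r \<in> carrier F" "x \<in> carrier A" "r \<noteq> \<zero>\<^bsub>F\<^esub>" "x \<noteq> \<zero>\<^bsub>A\<^esub>" for r x
  proof
    assume z: "r \<odot>\<^bsub>A\<^esub> x = \<zero>\<^bsub>A\<^esub>"
    have u: "r \<in> Units F" using that field_Units by auto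
    have "x = (inv\<^bsub>F\<^esub> r \<otimes>\<^bsub>F\<^esub> r) \<odot>\<^bsub>A\<^esub> x" using u that by simp
    also have "\<dots> = \<zero>\<^bsub>A\<^esub>" using z u that by (subst smult_assoc1) auto
    finally show False using that by simp
  qed
  have meets: "\<exists>i\<in>I. \<exists>y\<in>nucleus A. \<exists>r\<in>carrier F. r \<noteq> \<zero>\<^bsub>F\<^esub> \<and> e i \<noteq> \<zero>\<^bsub>A\<^esub> \<and> e i \<otimes>\<^bsub>A\<^esub> (f \<otimes>\<^bsub>A\<^esub> (y \<otimes>\<^bsub>A\<^esub> e i)) = r \<odot>\<^bsub>A\<^esub> e i"
    if f: "f \<in> nucleus A" "f \<otimes>\<^bsub>A\<^esub> f = f" "f \<noteq> \<zero>\<^bsub>A\<^esub>" for f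
  proof -
    interpret N: ring "A\<lparr>carrier := nucleus A\<rparr>" by (rule nucleus_ring)
    have "(\<Oplus>\<^bsub>A\<lparr>carrier := nucleus A\<rparr>\<^esub>i\<in>I. e i) = (\<Oplus>\<^bsub>A\<^esub>i\<in>I. e i)"
      using finsum_hom[OF N.abelian_group_axioms algebra_abelian_group, where h = "\<lambda>x. x"] e by simp
    then obtain i y where iy: "i \<in> I" "y \<in> nucleus A" "e i \<otimes>\<^bsub>A\<^esub> (f \<otimes>\<^bsub>A\<^esub> (y \<otimes>\<^bsub>A\<^esub> e i)) \<noteq> \<zero>\<^bsub>A\<^esub>"
      using N.idempotent_meets_decomposition[OF fin, of e f] e sum f by auto
    have ei: "e i \<in> nucleus A" "e i \<noteq> \<zero>\<^bsub>A\<^esub>"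
      using iy ec f by (auto simp: mult_zero_left mult_closed)
    let ?b = "e i \<otimes>\<^bsub>A\<^esub> (a \<otimes>\<^bsub>A\<^esub> e i)"
    have bc: "?b \<in> carrier A" using ei a by (simp add: mult_closed)
    obtain r where r: "r \<in> carrier F" "e i \<otimes>\<^bsub>A\<^esub> ((f \<otimes>\<^bsub>A\<^esub> y) \<otimes>\<^bsub>A\<^esub> e i) = r \<odot>\<^bsub>A\<^esub> ?b"
      using corner[OF iy(1,1), of "f \<otimes>\<^bsub>A\<^esub> y"] f iy by (auto simp: mult_closed)
    obtain s where s: "s \<in> carrier F" "e i \<otimes>\<^bsub>A\<^esub> (\<one>\<^bsub>A\<^esub> \<otimes>\<^bsub>A\<^esub> e i) = s \<odot>\<^bsub>A\<^esub> ?b"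
      using corner[OF iy(1,1) one_closed] by auto
    obtain t where t: "t \<in> carrier F" "e i \<otimes>\<^bsub>A\<^esub> e i = t \<odot>\<^bsub>A\<^esub> e i" "t \<noteq> \<zero>\<^bsub>F\<^esub>"
      using idem[OF iy(1)] ei by auto
    \<comment> \<open>Both sides are \<open>e i 1 e i\<close>. As \<open>t e i\<close> is nonzero,
      so is \<open>s\<close>, and the generator of the diagonal corner is a multiple of
      \<open>e i\<close> itself. The factors \<open>s\<close> and \<open>t\<close> appear because
      \<open>e i\<close> may be merely proportional to an idempotent.\<close>
    have tb: "t \<odot>\<^bsub>A\<^esub> e i = s \<odot>\<^bsub>A\<^esub> ?b" using s t ei by (simp add: l_one)
    have "s \<noteq> \<zero>\<^bsub>F\<^esub>"
      using smult_nz[OF t(1) nucleus_closed[OF ei(1)] t(3) ei(2)] tb bc by auto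
    then have su: "s \<in> Units F" using s field_Units by auto
    have rb: "e i \<otimes>\<^bsub>A\<^esub> (f \<otimes>\<^bsub>A\<^esub> (y \<otimes>\<^bsub>A\<^esub> e i)) = r \<odot>\<^bsub>A\<^esub> ?b"
      using r f iy ei by (simp add: nucleus_assoc(1)[OF f(1)])
    have rnz: "r \<noteq> \<zero>\<^bsub>F\<^esub>" using rb iy(3) bc by auto
    have "?b = (inv\<^bsub>F\<^esub> s \<otimes>\<^bsub>F\<^esub> s) \<odot>\<^bsub>A\<^esub> ?b" using su bc by simp
    also have "\<dots> = inv\<^bsub>F\<^esub> s \<odot>\<^bsub>A\<^esub> (t \<odot>\<^bsub>A\<^esub> e i)"
      unfolding tb by (rule smult_assoc1) (use su s(1) bc in auto)
    also have "\<dots> = (inv\<^bsub>F\<^esub> s \<otimes>\<^bsub>F\<^esub> t) \<odot>\<^bsub>A\<^esub> e i" using su t ei by (simp add: smult_assoc1)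
    finally have b: "?b = (inv\<^bsub>F\<^esub> s \<otimes>\<^bsub>F\<^esub> t) \<odot>\<^bsub>A\<^esub> e i" .
    have "e i \<otimes>\<^bsub>A\<^esub> (f \<otimes>\<^bsub>A\<^esub> (y \<otimes>\<^bsub>A\<^esub> e i)) = (r \<otimes>\<^bsub>F\<^esub> (inv\<^bsub>F\<^esub> s \<otimes>\<^bsub>F\<^esub> t)) \<odot>\<^bsub>A\<^esub> e i"
      unfolding rb b using r su t ei by (simp add: smult_assoc1)
    moreover from this have "r \<otimes>\<^bsub>F\<^esub> (inv\<^bsub>F\<^esub> s \<otimes>\<^bsub>F\<^esub> t) \<noteq> \<zero>\<^bsub>F\<^esub>" using iy(3) ei by auto
    ultimately show ?thesis using iy ei r su t by (meson R.Units_inv_closed R.m_closed)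
  qed
  obtain k y r where k: "k \<in> I" "y \<in> nucleus A" "r \<in> carrier F" "r \<noteq> \<zero>\<^bsub>F\<^esub>" "e k \<noteq> \<zero>\<^bsub>A\<^esub>"
      "e k \<otimes>\<^bsub>A\<^esub> (f \<otimes>\<^bsub>A\<^esub> (y \<otimes>\<^bsub>A\<^esub> e k)) = r \<odot>\<^bsub>A\<^esub> e k" using meets[OF f] by blast
  obtain l z s where l: "l \<in> I" "z \<in> nucleus A" "s \<in> carrier F" "s \<noteq> \<zero>\<^bsub>F\<^esub>" "e l \<noteq> \<zero>\<^bsub>A\<^esub>"
      "e l \<otimes>\<^bsub>A\<^esub> (g \<otimes>\<^bsub>A\<^esub> (z \<otimes>\<^bsub>A\<^esub> e l)) = s \<odot>\<^bsub>A\<^esub> e l" using meets[OF g] by blast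
  have n: "e k \<in> nucleus A" "e l \<in> nucleus A" using k l ec by auto
  \<comment> \<open>Framing \<open>f x g\<close> by \<open>e k\<close> on the left and by
    \<open>z e l\<close> on the right gives \<open>(e k f y e k) a (e l g z e l)\<close>, that is
    \<open>r s (e k a e l)\<close>, which is nonzero. All factors but \<open>a\<close> are nuclear,
    so the brackets can be moved.\<close>
  define x where "x = y \<otimes>\<^bsub>A\<^esub> (e k \<otimes>\<^bsub>A\<^esub> (a \<otimes>\<^bsub>A\<^esub> e l))"
  have xc: "x \<in> carrier A" using k n a by (simp add: x_def mult_closed)
  have "f \<otimes>\<^bsub>A\<^esub> (x \<otimes>\<^bsub>A\<^esub> g) \<noteq> \<zero>\<^bsub>A\<^esub>"
  proof
    assume zero: "f \<otimes>\<^bsub>A\<^esub> (x \<otimes>\<^bsub>A\<^esub> g) = \<zero>\<^bsub>A\<^esub>"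
    define q where "q = e l \<otimes>\<^bsub>A\<^esub> (g \<otimes>\<^bsub>A\<^esub> (z \<otimes>\<^bsub>A\<^esub> e l))"
    define p where "p = e k \<otimes>\<^bsub>A\<^esub> (f \<otimes>\<^bsub>A\<^esub> (y \<otimes>\<^bsub>A\<^esub> e k))"
    have qc: "q \<in> carrier A" using l n g by (simp add: q_def mult_closed)
    have zl: "z \<otimes>\<^bsub>A\<^esub> e l \<in> nucleus A" using l n by (simp add: mult_nucleus)
    have "(e k \<otimes>\<^bsub>A\<^esub> (f \<otimes>\<^bsub>A\<^esub> (x \<otimes>\<^bsub>A\<^esub> g))) \<otimes>\<^bsub>A\<^esub> (z \<otimes>\<^bsub>A\<^esub> e l) = e k \<otimes>\<^bsub>A\<^esub> (f \<otimes>\<^bsub>A\<^esub> ((x \<otimes>\<^bsub>A\<^esub> g) \<otimes>\<^bsub>A\<^esub> (z \<otimes>\<^bsub>A\<^esub> e l)))"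
      using n f g xc zl by (simp add: nucleus_assoc(1)[OF n(1)] nucleus_assoc(1)[OF f(1)] mult_closed)
    also have "(x \<otimes>\<^bsub>A\<^esub> g) \<otimes>\<^bsub>A\<^esub> (z \<otimes>\<^bsub>A\<^esub> e l) = x \<otimes>\<^bsub>A\<^esub> (g \<otimes>\<^bsub>A\<^esub> (z \<otimes>\<^bsub>A\<^esub> e l))"
      using nucleus_assoc(2)[OF g(1) xc] zl by simp
    also have "x \<otimes>\<^bsub>A\<^esub> (g \<otimes>\<^bsub>A\<^esub> (z \<otimes>\<^bsub>A\<^esub> e l)) = y \<otimes>\<^bsub>A\<^esub> (e k \<otimes>\<^bsub>A\<^esub> (a \<otimes>\<^bsub>A\<^esub> q))"
      unfolding x_def q_def using k(2) n g l(2) a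
      by (simp add: nucleus_assoc(1)[OF k(2)] nucleus_assoc(1)[OF n(1)] nucleus_assoc(2)[OF n(2)] mult_closed)
    also have "e k \<otimes>\<^bsub>A\<^esub> (f \<otimes>\<^bsub>A\<^esub> (y \<otimes>\<^bsub>A\<^esub> (e k \<otimes>\<^bsub>A\<^esub> (a \<otimes>\<^bsub>A\<^esub> q)))) = p \<otimes>\<^bsub>A\<^esub> (a \<otimes>\<^bsub>A\<^esub> q)"
      unfolding p_def using k(2) n f a qc
      by (simp add: nucleus_assoc(1)[OF k(2)] nucleus_assoc(1)[OF n(1)] nucleus_assoc(1)[OF f(1)] mult_closed)
    also have "\<dots> = s \<odot>\<^bsub>A\<^esub> (r \<odot>\<^bsub>A\<^esub> (e k \<otimes>\<^bsub>A\<^esub> (a \<otimes>\<^bsub>A\<^esub> e l)))"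
      unfolding p_def q_def k(6) l(6) using k l n a by (simp add: smult_mult_left smult_mult_right mult_closed)
    finally have "(e k \<otimes>\<^bsub>A\<^esub> (f \<otimes>\<^bsub>A\<^esub> (x \<otimes>\<^bsub>A\<^esub> g))) \<otimes>\<^bsub>A\<^esub> (z \<otimes>\<^bsub>A\<^esub> e l) \<noteq> \<zero>\<^bsub>A\<^esub>"
      using smult_nz[OF l(3) _ l(4) smult_nz[OF k(3) _ k(4) nonzero[OF k(1) l(1) k(5) l(5)]]] n a k(3)
      by (simp add: mult_closed)
    then show False
      using zero n zl by (simp add: mult_zero_left mult_zero_right)
  qed
  with xc show ?thesis by (rule that)
qed

section \<open>Etale algebras\<close>

text \<open>Coefficients of \<open>s q + X q'\<close>. For \<open>p = c + X q\<close> the case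
  \<open>s = 1\<close> is the derivative of \<open>p\<close>; the offset \<open>s\<close> is what
  makes the recursion close.\<close>

fun deriv_coeffs :: "('r, 'q) ring_scheme \<Rightarrow> nat \<Rightarrow> 'r list \<Rightarrow> 'r list" where
  "deriv_coeffs R s [] = []"
| "deriv_coeffs R s (c # cs) = ([s] \<cdot>\<^bsub>R\<^esub> c) # deriv_coeffs R (Suc s) cs"

lemma deriv_coeffs_eq_map: "map (\<lambda>i. [(s + i)] \<cdot>\<^bsub>R\<^esub> (q ! i)) [0..<length q] = deriv_coeffs R s q"
proof (induction q arbitrary: s)
  case (Cons c q)
  have "map (\<lambda>i. [(s + i)] \<cdot>\<^bsub>R\<^esub> ((c # q) ! i)) [0..<length (c # q)]
      = ([s] \<cdot>\<^bsub>R\<^esub> c) # map (\<lambda>i. [(Suc s + i)] \<cdot>\<^bsub>R\<^esub> (q ! i)) [0..<length q]"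
    by (simp only: length_Cons upt_conv_Cons[OF zero_less_Suc] map_Suc_upt[symmetric]) simp
  then show ?case by (simp only: Cons deriv_coeffs.simps)
qed simp

context cring
begin

text \<open>The bridge between the two orders of coefficient lists.\<close>

lemma eval_rev: "\<lbrakk>set q \<subseteq> carrier R; x \<in> carrier R\<rbrakk> \<Longrightarrow> eval (rev q) x = peval R q x"
proof (induction q)
  case (Cons c q)
  then show ?case
    using eval_append_aux[of "rev q" c x] peval_closed[of q x] by (simp add: a_comm m_comm)
qed simp

lemma peval_deriv_coeffs:
  "\<lbrakk>set q \<subseteq> carrier R; x \<in> carrier R\<rbrakk> \<Longrightarrow>
    peval R (deriv_coeffs R s q) x = [s] \<cdot> peval R q x \<oplus> x \<otimes> peval_deriv R q x"
proof (induction q arbitrary: s)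
  case (Cons c q)
  define p d where "p = peval R q x" and "d = peval_deriv R q x"
  have pd: "p \<in> carrier R" "d \<in> carrier R" "c \<in> carrier R" "x \<in> carrier R" "x \<otimes> p \<in> carrier R"
    using Cons.prems by (simp_all add: p_def d_def peval_closed peval_deriv_closed)
  have "peval R (deriv_coeffs R s (c # q)) x = [s] \<cdot> c \<oplus> x \<otimes> ([Suc s] \<cdot> p \<oplus> x \<otimes> d)"
    using Cons by (simp add: p_def d_def)
  also have "\<dots> = [s] \<cdot> c \<oplus> (x \<otimes> ([s] \<cdot> p) \<oplus> x \<otimes> p \<oplus> x \<otimes> (x \<otimes> d))"
    using pd by (simp add: r_distr)
  also have "x \<otimes> ([s] \<cdot> p) = [s] \<cdot> (x \<otimes> p)" using pd by (simp add: add_pow_rdistr)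
  also have "[s] \<cdot> c \<oplus> ([s] \<cdot> (x \<otimes> p) \<oplus> x \<otimes> p \<oplus> x \<otimes> (x \<otimes> d)) = ([s] \<cdot> c \<oplus> [s] \<cdot> (x \<otimes> p)) \<oplus> (x \<otimes> p \<oplus> x \<otimes> (x \<otimes> d))"
    using pd by (simp add: a_assoc)
  also have "[s] \<cdot> c \<oplus> [s] \<cdot> (x \<otimes> p) = [s] \<cdot> (c \<oplus> x \<otimes> p)"
    using pd by (simp add: add.nat_pow_distrib)
  also have "x \<otimes> p \<oplus> x \<otimes> (x \<otimes> d) = x \<otimes> (p \<oplus> x \<otimes> d)" using pd by (simp add: r_distr)
  finally show ?case by (simp add: p_def d_def)
qed simp

lemma poly_derivative_rev:
  assumes "set q \<subseteq> carrier R" and "x \<in> carrier R" and "q \<noteq> []"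
  shows "eval (poly_derivative R (rev q)) x = peval_deriv R q x"
proof -
  obtain c q' where q: "q = c # q'" using assms(3) by (cases q) auto
  have co: "coeff (rev q) i = q ! i" if "i < length q" for i
    using that coeff_nth[of i "rev q"] by (simp add: rev_nth)
  have "map (\<lambda>i. [i] \<cdot> coeff (rev q) i) (rev [1..<length (rev q)]) = rev (map (\<lambda>i. [i] \<cdot> (q ! i)) [1..<length q])"
    unfolding rev_map by (rule map_cong) (auto simp: co)
  \<comment> \<open>The range starts at 1 because the constant term drops out; shifted by one, it
    runs over the tail \<open>q'\<close> with weights \<open>1 + i\<close>.\<close>
  also have "map (\<lambda>i. [i] \<cdot> (q ! i)) [1..<length q] = map (\<lambda>i. [(1 + i)] \<cdot> (q' ! i)) [0..<length q']"
  proof -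
    have "[1..<length q] = map Suc [0..<length q']" unfolding q by (simp only: map_Suc_upt length_Cons One_nat_def)
    then show ?thesis by (simp only: map_map) (simp add: q comp_def)
  qed
  also have "\<dots> = deriv_coeffs R 1 q'" by (rule deriv_coeffs_eq_map)
  finally have d: "poly_derivative R (rev q) = normalize (rev (deriv_coeffs R 1 q'))"
    by (simp add: poly_derivative_def)
  have q'c: "set q' \<subseteq> carrier R" using assms(1) q by auto
  have dc: "set (deriv_coeffs R s q') \<subseteq> carrier R" for s
    using q'c by (induction q' arbitrary: s) auto
  show ?thesis
    unfolding d using dc[of 1] assms(2) q'c
    by (simp add: eval_normalize eval_rev peval_deriv_coeffs q peval_closed del: One_nat_def)
qed

end

lemma (in unital_algebra) horner_one_eq_peval:
  assumes "set cs \<subseteq> carrier F" and "x \<in> carrier A" and "cring A"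
  shows "horner A (\<lambda>y. x \<otimes>\<^bsub>A\<^esub> y) cs \<one>\<^bsub>A\<^esub> = peval A (map (\<lambda>r. r \<odot>\<^bsub>A\<^esub> \<one>\<^bsub>A\<^esub>) cs) x"
    and "horner_deriv A (\<lambda>y. x \<otimes>\<^bsub>A\<^esub> y) cs \<one>\<^bsub>A\<^esub> = peval_deriv A (map (\<lambda>r. r \<odot>\<^bsub>A\<^esub> \<one>\<^bsub>A\<^esub>) cs) x"
proof -
  have h: "horner A (\<lambda>y. x \<otimes>\<^bsub>A\<^esub> y) cs \<one>\<^bsub>A\<^esub> = peval A (map (\<lambda>r. r \<odot>\<^bsub>A\<^esub> \<one>\<^bsub>A\<^esub>) cs) x" for cs
    by (induction cs) auto
  show "horner A (\<lambda>y. x \<otimes>\<^bsub>A\<^esub> y) cs \<one>\<^bsub>A\<^esub> = peval A (map (\<lambda>r. r \<odot>\<^bsub>A\<^esub> \<one>\<^bsub>A\<^esub>) cs) x" by (rule h)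
  show "horner_deriv A (\<lambda>y. x \<otimes>\<^bsub>A\<^esub> y) cs \<one>\<^bsub>A\<^esub> = peval_deriv A (map (\<lambda>r. r \<odot>\<^bsub>A\<^esub> \<one>\<^bsub>A\<^esub>) cs) x"
    by (induction cs) (auto simp: h)
qed

text \<open>The polynomial is the minimal polynomial \<open>p\<close> of \<open>x\<close>. If its
  derivative vanished at \<open>x\<close>, minimality would make \<open>p\<close> a common divisor
  of itself and its derivative, hence a unit by separability, whereas \<open>p\<close> is
  irreducible.\<close>

lemma finite_separable_annihilator:
  assumes sep: "finite_separable_extension F L" and x: "x \<in> carrier L"
  obtains cs where "set cs \<subseteq> carrier F" and "cs \<noteq> []" and "last cs \<noteq> \<zero>\<^bsub>F\<^esub>"
    and "horner L (\<lambda>y. x \<otimes>\<^bsub>L\<^esub> y) cs \<one>\<^bsub>L\<^esub> = \<zero>\<^bsub>L\<^esub>"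
    and "horner_deriv L (\<lambda>y. x \<otimes>\<^bsub>L\<^esub> y) cs \<one>\<^bsub>L\<^esub> \<noteq> \<zero>\<^bsub>L\<^esub>"
proof -
  interpret L: unital_algebra F L using sep by (simp add: finite_separable_extension_def)
  interpret Lf: field L using sep by (simp add: finite_separable_extension_def)
  define S where "S = scalars F L"
  define \<sigma> where "\<sigma> r = r \<odot>\<^bsub>L\<^esub> \<one>\<^bsub>L\<^esub>" for r
  have S: "S = \<sigma> ` carrier F" by (simp add: S_def scalars_def \<sigma>_def)
  have \<sigma>c: "\<sigma> r \<in> carrier L" if "r \<in> carrier F" for r using that by (simp add: \<sigma>_def)
  have "\<sigma> \<in> ring_hom F L"
    by (rule ring_hom_memI)
      (simp_all add: \<sigma>_def L.smult_l_distr L.smult_mult_left L.smult_assoc1)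
  then interpret \<sigma>: ring_hom_ring F L \<sigma>
    by (intro ring_hom_ringI2 L.R.ring_axioms Lf.ring_axioms)
  have sub: "subfield S L" and inj: "inj_on \<sigma> (carrier F)"
    using \<sigma>.img_is_subfield[OF L.carrier_is_subfield] Lf.one_not_zero by (simp_all add: S)
  obtain B where B: "finite B" "B \<subseteq> carrier L" "L.span B = carrier L"
    using sep by (auto simp: finite_separable_extension_def L.fin_dim_def)
  obtain Us where Us: "set Us = B" using finite_list[OF B(1)] by blast
  have UsC: "set Us \<subseteq> carrier L" using Us B by simp
  \<comment> \<open>Two notions of finite dimension meet here: a finite spanning set over
    \<open>F\<close>, and dimension over the subfield \<open>S\<close> of \<open>L\<close>. The
    \<open>S\<close>-span of the spanning set is an \<open>F\<close>-submodule, so it is all of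
    \<open>L\<close>, and \<open>x\<close> is algebraic over \<open>S\<close>.\<close>
  have "submodule F (Lf.Span S Us) L"
  proof (intro submodule.intro)
    show "Module.module F L" by (rule L.module_axioms)
    fix r v assume "r \<in> carrier F" "v \<in> Lf.Span S Us"
    moreover have "r \<odot>\<^bsub>L\<^esub> v = \<sigma> r \<otimes>\<^bsub>L\<^esub> v" if "r \<in> carrier F" "v \<in> carrier L"
      using that by (simp add: \<sigma>_def L.smult_mult_left)
    ultimately show "r \<odot>\<^bsub>L\<^esub> v \<in> Lf.Span S Us"
      using Lf.Span_smult_closed[OF sub UsC] Lf.Span_subgroup_props(1)[OF sub UsC] S by auto
  qed (use Lf.Span_subgroup_props[OF sub UsC] in auto)
  then have "carrier L \<subseteq> Lf.Span S Us"
    using L.span_is_subset[of B] Lf.Span_base_incl[OF sub UsC] B Us by simp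
  then have "Lf.Span S Us = carrier L" using Lf.Span_subgroup_props(1)[OF sub UsC] by auto
  then have "Lf.finite_dimension S (carrier L)"
    using Lf.Span_finite_dimension[OF sub UsC] by simp
  then have alg: "(Lf.algebraic over S) x"
    using Lf.finite_dimension_imp_algebraic[OF sub Lf.carrier_is_subring] x by simp
  define p where "p = Lf.Irr S x"
  have p: "p \<in> carrier (S[X]\<^bsub>L\<^esub>)" "ring_irreducible\<^bsub>(S[X]\<^bsub>L\<^esub>)\<^esub> p" "lead_coeff p = \<one>\<^bsub>L\<^esub>" "Lf.eval p x = \<zero>\<^bsub>L\<^esub>"
    unfolding p_def by (rule Lf.IrrE[OF sub x alg])+
  interpret UP: domain "S[X]\<^bsub>L\<^esub>"
    by (rule Lf.univ_poly_is_domain[OF subfieldE(1)[OF sub]])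
  have nunit: "p \<notin> Units (S[X]\<^bsub>L\<^esub>)" and pne: "p \<noteq> []"
    using UP.ring_irreducibleE[OF p(1,2)] p(2)
    by (auto simp: ring_irreducible_def univ_poly_zero)
  have pS: "set p \<subseteq> S" using p(1) by (auto simp: univ_poly_carrier[symmetric] polynomial_def)
  \<comment> \<open>The coefficients are pulled back to \<open>F\<close> by preimages under
    \<open>\<sigma>\<close>, and reversed because \<open>p\<close> has its leading coefficient
    first.\<close>
  define cs where "cs = rev (map (inv_into (carrier F) \<sigma>) p)"
  have \<sigma>inv: "\<sigma> (inv_into (carrier F) \<sigma> y) = y" if "y \<in> S" for y
    using that S by (simp add: f_inv_into_f)
  have mp: "map \<sigma> cs = rev p"
    unfolding cs_def rev_map[symmetric] map_map
    by (rule arg_cong[where f = rev], rule map_idI) (use \<sigma>inv pS in auto)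
  have csF: "set cs \<subseteq> carrier F"
    using pS S by (auto simp: cs_def inv_into_into)
  have csne: "cs \<noteq> []" using pne by (simp add: cs_def)
  have qC: "set (map \<sigma> cs) \<subseteq> carrier L" using csF \<sigma>c by auto
  have revq: "rev (map \<sigma> cs) = p" by (simp add: mp)
  show thesis
  proof (rule that[OF csF csne])
    show "last cs \<noteq> \<zero>\<^bsub>F\<^esub>"
    proof
      assume "last cs = \<zero>\<^bsub>F\<^esub>"
      moreover have "\<sigma> (last cs) = lead_coeff p"
        using csne by (simp add: last_map[symmetric] mp last_rev)
      ultimately show False using p(3) \<sigma>.hom_zero Lf.one_not_zero by simp
    qed
    show "horner L (\<lambda>y. x \<otimes>\<^bsub>L\<^esub> y) cs \<one>\<^bsub>L\<^esub> = \<zero>\<^bsub>L\<^esub>"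
      using L.horner_one_eq_peval(1)[OF csF x Lf.cring_axioms] Lf.eval_rev[OF qC x] p(4) revq
      by (simp add: \<sigma>_def[abs_def])
    show "horner_deriv L (\<lambda>y. x \<otimes>\<^bsub>L\<^esub> y) cs \<one>\<^bsub>L\<^esub> \<noteq> \<zero>\<^bsub>L\<^esub>"
    proof
      assume "horner_deriv L (\<lambda>y. x \<otimes>\<^bsub>L\<^esub> y) cs \<one>\<^bsub>L\<^esub> = \<zero>\<^bsub>L\<^esub>"
      then have z: "Lf.eval (poly_derivative L p) x = \<zero>\<^bsub>L\<^esub>"
        using L.horner_one_eq_peval(2)[OF csF x Lf.cring_axioms] Lf.poly_derivative_rev[OF qC x] csne revq
        by (simp add: \<sigma>_def[abs_def])
      interpret S: subring S L by (rule subfieldE(1)[OF sub])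
      have powS: "[i] \<cdot>\<^bsub>L\<^esub> y \<in> S" if "y \<in> S" for i :: nat and y
        using that subringE(2,7)[OF subfieldE(1)[OF sub]] by (induction i) auto
      have coS: "Lf.coeff p i \<in> S" for i
        using pS subringE(2)[OF subfieldE(1)[OF sub]] by (induction p) auto
      have dS: "poly_derivative L p \<in> carrier (S[X]\<^bsub>L\<^esub>)"
        unfolding poly_derivative_def univ_poly_carrier[symmetric]
        by (rule Lf.normalize_gives_polynomial) (use powS coS in auto)
      have "p divides\<^bsub>(S[X]\<^bsub>L\<^esub>)\<^esub> poly_derivative L p"
        using Lf.Irr_minimal[OF sub x alg dS z] Lf.pdivides_iff_shell[OF sub p(1) dS]
        by (simp add: p_def)
      moreover have "p divides\<^bsub>(S[X]\<^bsub>L\<^esub>)\<^esub> p" using p(1) by (rule UP.divides_refl)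
      moreover have "separable_poly L S p"
        using sep x unfolding finite_separable_extension_def S_def p_def by blast
      ultimately show False using nunit p(1) unfolding separable_poly_def by blast
    qed
  qed
qed

text \<open>Separability is recorded as an identity in \<open>K\<close>: on each factor,
  \<open>x\<close> is killed by a polynomial whose derivative at \<open>x\<close> is invertible
  there, with inverse \<open>z\<close>. Such identities pass to every extension of scalars. Working
  with one idempotent \<open>\<epsilon> i\<close> at a time avoids common multiples of the minimal
  polynomials of the components of \<open>x\<close>.\<close>

lemma etale_decomposition:
  fixes F :: "'f ring" and K :: "('f, 'k) module"
  assumes et: "etale_algebra F K" and "unital_algebra F K"
  shows "cring K"
    and "\<exists>(m :: nat) \<epsilon>. (\<forall>i<m. \<epsilon> i \<in> carrier K) \<and> (\<Oplus>\<^bsub>K\<^esub>i\<in>{..<m}. \<epsilon> i) = \<one>\<^bsub>K\<^esub> \<and>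
      (\<forall>i<m. \<epsilon> i \<otimes>\<^bsub>K\<^esub> \<epsilon> i = \<epsilon> i) \<and>
      (\<forall>i<m. \<forall>x\<in>carrier K. \<exists>cs. set cs \<subseteq> carrier F \<and> cs \<noteq> [] \<and> last cs \<noteq> \<zero>\<^bsub>F\<^esub> \<and>
        horner K (\<lambda>y. x \<otimes>\<^bsub>K\<^esub> y) cs (\<epsilon> i) = \<zero>\<^bsub>K\<^esub> \<and>
        (\<exists>z\<in>carrier K. z \<otimes>\<^bsub>K\<^esub> horner_deriv K (\<lambda>y. x \<otimes>\<^bsub>K\<^esub> y) cs (\<epsilon> i) = \<epsilon> i))" (is "\<exists>m \<epsilon>. ?P m \<epsilon>")
proof -
  interpret K: unital_algebra F K by fact
  obtain m and L :: "nat \<Rightarrow> ('f, 'k) module" and h where L: "\<forall>i<m. finite_separable_extension F (L i)"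
    and "h \<in> algebra_iso F K (product_algebra {..<m} L)"
    using et unfolding etale_algebra_def by blast
  then have ring: "h \<in> ring_hom K (product_algebra {..<m} L)"
    and bij: "bij_betw h (carrier K) (carrier (product_algebra {..<m} L))"
    and sm: "\<And>r x. \<lbrakk>r \<in> carrier F; x \<in> carrier K\<rbrakk> \<Longrightarrow> h (r \<odot>\<^bsub>K\<^esub> x) = r \<odot>\<^bsub>product_algebra {..<m} L\<^esub> h x"
    by (auto simp: algebra_iso_def ring_iso_def)
  have alg: "unital_algebra F (L i)" and fld: "field (L i)" if "i < m" for i
    using L that by (auto simp: finite_separable_extension_def)
  note cr = fieldE(1)[OF fld]
  have crL: "cring (L i)" if "i < m" for i using fld[OF that] by (simp add: field_def domain_def)
  have hP: "h x \<in> (\<Pi>\<^sub>E i\<in>{..<m}. carrier (L i))" if "x \<in> carrier K" for x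
    using bij_betwE[OF bij] that by (simp add: product_algebra_def)
  have hc: "h x i \<in> carrier (L i)" if "x \<in> carrier K" "i < m" for x i using hP[OF that(1)] that(2) by auto
  have ho: "h \<one>\<^bsub>K\<^esub> i = \<one>\<^bsub>L i\<^esub>" if "i < m" for i
    using ring_hom_one[OF ring] that by (simp add: product_algebra_def)
  have hm: "h (x \<otimes>\<^bsub>K\<^esub> y) i = h x i \<otimes>\<^bsub>L i\<^esub> h y i" if "x \<in> carrier K" "y \<in> carrier K" "i < m" for x y i
    using ring_hom_mult[OF ring that(1,2)] that(3) by (simp add: product_algebra_def)
  have ha: "h (x \<oplus>\<^bsub>K\<^esub> y) i = h x i \<oplus>\<^bsub>L i\<^esub> h y i" if "x \<in> carrier K" "y \<in> carrier K" "i < m" for x y i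
    using ring_hom_add[OF ring that(1,2)] that(3) by (simp add: product_algebra_def)
  have hs: "h (r \<odot>\<^bsub>K\<^esub> x) i = r \<odot>\<^bsub>L i\<^esub> h x i" if "r \<in> carrier F" "x \<in> carrier K" "i < m" for r x i
    using sm[OF that(1,2)] that(3) by (simp add: product_algebra_def)
  have hz: "h \<zero>\<^bsub>K\<^esub> i = \<zero>\<^bsub>L i\<^esub>" if "i < m" for i
  proof -
    interpret Li: unital_algebra F "L i" by (rule alg[OF that])
    show ?thesis using hs[of "\<zero>\<^bsub>F\<^esub>" "\<zero>\<^bsub>K\<^esub>" i] hc[of "\<zero>\<^bsub>K\<^esub>" i] that by simp
  qed
  have heq: "x = y" if "x \<in> carrier K" "y \<in> carrier K" "\<And>i. i < m \<Longrightarrow> h x i = h y i" for x y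
  proof -
    have "h x = h y" by (rule PiE_ext[OF hP[OF that(1)] hP[OF that(2)]]) (use that(3) in simp)
    then show ?thesis using bij that(1,2) by (meson bij_betw_def inj_onD)
  qed
  have surj: "\<exists>x\<in>carrier K. \<forall>j<m. h x j = f j" if "\<And>j. j < m \<Longrightarrow> f j \<in> carrier (L j)" for f
  proof -
    have "restrict f {..<m} \<in> carrier (product_algebra {..<m} L)"
      using that by (simp add: product_algebra_def)
    then obtain x where "x \<in> carrier K" "h x = restrict f {..<m}" using bij by (metis bij_betw_def imageE)
    then show ?thesis by (intro bexI[of _ x]) auto
  qed
  \<comment> \<open>Preimages of the unit vectors of the product become the idempotents
    \<open>\<epsilon> i\<close>.\<close>
  have "\<forall>i. \<exists>x\<in>carrier K. \<forall>j<m. h x j = (if j = i then \<one>\<^bsub>L j\<^esub> else \<zero>\<^bsub>L j\<^esub>)"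
  proof
    fix i
    have "(if j = i then \<one>\<^bsub>L j\<^esub> else \<zero>\<^bsub>L j\<^esub>) \<in> carrier (L j)" if "j < m" for j
    proof -
      interpret cring "L j" by (rule crL[OF that])
      show ?thesis by (cases "j = i") (use one_closed zero_closed in simp_all)
    qed
    from surj[OF this] show "\<exists>x\<in>carrier K. \<forall>j<m. h x j = (if j = i then \<one>\<^bsub>L j\<^esub> else \<zero>\<^bsub>L j\<^esub>)" .
  qed
  then obtain \<epsilon> where \<epsilon>: "\<And>i. \<epsilon> i \<in> carrier K" "\<And>i j. j < m \<Longrightarrow> h (\<epsilon> i) j = (if j = i then \<one>\<^bsub>L j\<^esub> else \<zero>\<^bsub>L j\<^esub>)"
    by metis
  have horK: "horner K (\<lambda>y. x \<otimes>\<^bsub>K\<^esub> y) cs y \<in> carrier K \<and> horner_deriv K (\<lambda>y. x \<otimes>\<^bsub>K\<^esub> y) cs y \<in> carrier K"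
    if "set cs \<subseteq> carrier F" "x \<in> carrier K" "y \<in> carrier K" for cs x y
    using that by (induction cs) (auto simp: K.mult_closed)
  have hhor: "h (horner K (\<lambda>y. x \<otimes>\<^bsub>K\<^esub> y) cs y) j = horner (L j) (\<lambda>y. h x j \<otimes>\<^bsub>L j\<^esub> y) cs (h y j) \<and>
      h (horner_deriv K (\<lambda>y. x \<otimes>\<^bsub>K\<^esub> y) cs y) j = horner_deriv (L j) (\<lambda>y. h x j \<otimes>\<^bsub>L j\<^esub> y) cs (h y j)"
    if "set cs \<subseteq> carrier F" "x \<in> carrier K" "y \<in> carrier K" "j < m" for cs x y j
    using that by (induction cs) (simp_all add: hz ha hm hs horK K.mult_closed)
  \<comment> \<open>For the components \<open>j \<noteq> i\<close>, where
    \<open>\<epsilon> i\<close> vanishes.\<close>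
  have horz: "horner (L j) (\<lambda>y. x \<otimes>\<^bsub>L j\<^esub> y) cs \<zero>\<^bsub>L j\<^esub> = \<zero>\<^bsub>L j\<^esub> \<and> horner_deriv (L j) (\<lambda>y. x \<otimes>\<^bsub>L j\<^esub> y) cs \<zero>\<^bsub>L j\<^esub> = \<zero>\<^bsub>L j\<^esub>"
    if "set cs \<subseteq> carrier F" "x \<in> carrier (L j)" "j < m" for cs x j
  proof -
    interpret Lj: unital_algebra F "L j" by (rule alg[OF that(3)])
    show ?thesis using that(1,2) by (induction cs) (auto simp: Lj.mult_zero_right)
  qed
  show "cring K"
  proof (rule cringI)
    show "abelian_group K" by (rule K.algebra_abelian_group)
    have assoc: "(x \<otimes>\<^bsub>K\<^esub> y) \<otimes>\<^bsub>K\<^esub> z = x \<otimes>\<^bsub>K\<^esub> (y \<otimes>\<^bsub>K\<^esub> z)" if "x \<in> carrier K" "y \<in> carrier K" "z \<in> carrier K" for x y z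
    proof (rule heq)
      fix j assume j: "j < m"
      interpret cring "L j" by (rule crL[OF j])
      show "h ((x \<otimes>\<^bsub>K\<^esub> y) \<otimes>\<^bsub>K\<^esub> z) j = h (x \<otimes>\<^bsub>K\<^esub> (y \<otimes>\<^bsub>K\<^esub> z)) j"
        using that j hc by (simp add: hm K.mult_closed m_assoc)
    qed (use that K.mult_closed in auto)
    have comm: "x \<otimes>\<^bsub>K\<^esub> y = y \<otimes>\<^bsub>K\<^esub> x" if "x \<in> carrier K" "y \<in> carrier K" for x y
    proof (rule heq)
      fix j assume j: "j < m"
      interpret cring "L j" by (rule crL[OF j])
      show "h (x \<otimes>\<^bsub>K\<^esub> y) j = h (y \<otimes>\<^bsub>K\<^esub> x) j"
        using that j hc by (simp add: hm K.mult_closed m_comm)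
    qed (use that K.mult_closed in auto)
    show "Group.comm_monoid K"
      by (rule comm_monoidI) (use assoc comm K.mult_closed K.one_closed K.l_one in auto)
  qed (rule K.l_distr)
  show "\<exists>(m :: nat) \<epsilon>. ?P m \<epsilon>"
  proof (rule exI[of _ m], rule exI[of _ \<epsilon>], intro conjI allI impI ballI)
    show "\<epsilon> i \<in> carrier K" for i by (rule \<epsilon>(1))
    show "\<epsilon> i \<otimes>\<^bsub>K\<^esub> \<epsilon> i = \<epsilon> i" for i
    proof (rule heq)
      fix j assume j: "j < m"
      interpret cring "L j" by (rule crL[OF j])
      show "h (\<epsilon> i \<otimes>\<^bsub>K\<^esub> \<epsilon> i) j = h (\<epsilon> i) j"
        by (cases "j = i") (use j l_one[OF one_closed] in \<open>simp_all add: hm \<epsilon>\<close>)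
    qed (use \<epsilon> K.mult_closed in auto)
    show "(\<Oplus>\<^bsub>K\<^esub>i\<in>{..<m}. \<epsilon> i) = \<one>\<^bsub>K\<^esub>"
    proof (rule heq)
      fix j assume j: "j < m"
      interpret Lj: cring "L j" by (rule crL[OF j])
      have "h (\<Oplus>\<^bsub>K\<^esub>i\<in>{..<m}. \<epsilon> i) j = (\<Oplus>\<^bsub>L j\<^esub>i\<in>{..<m}. h (\<epsilon> i) j)"
        by (rule finsum_hom[OF K.algebra_abelian_group Lj.abelian_group_axioms, where h = "\<lambda>x. h x j"])
          (use \<epsilon>(1) hc ha j in auto)
      also have "\<dots> = (\<Oplus>\<^bsub>L j\<^esub>i\<in>{..<m}. if j = i then \<one>\<^bsub>L j\<^esub> else \<zero>\<^bsub>L j\<^esub>)"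
        by (rule Lj.finsum_cong') (use \<epsilon>(2) j in auto)
      also have "\<dots> = \<one>\<^bsub>L j\<^esub>" by (rule Lj.finsum_singleton) (use j in auto)
      finally show "h (\<Oplus>\<^bsub>K\<^esub>i\<in>{..<m}. \<epsilon> i) j = h \<one>\<^bsub>K\<^esub> j" using ho j by simp
    qed (use \<epsilon>(1) K.one_closed in auto)
    fix i x assume i: "i < m" and x: "x \<in> carrier K"
    obtain cs where cs: "set cs \<subseteq> carrier F" "cs \<noteq> []" "last cs \<noteq> \<zero>\<^bsub>F\<^esub>"
      "horner (L i) (\<lambda>y. h x i \<otimes>\<^bsub>L i\<^esub> y) cs \<one>\<^bsub>L i\<^esub> = \<zero>\<^bsub>L i\<^esub>"
      "horner_deriv (L i) (\<lambda>y. h x i \<otimes>\<^bsub>L i\<^esub> y) cs \<one>\<^bsub>L i\<^esub> \<noteq> \<zero>\<^bsub>L i\<^esub>"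
      using finite_separable_annihilator[of F "L i" "h x i"] L i hc[OF x i] by blast
    interpret Li: field "L i" by (rule fld[OF i])
    define d where "d = horner_deriv (L i) (\<lambda>y. h x i \<otimes>\<^bsub>L i\<^esub> y) cs \<one>\<^bsub>L i\<^esub>"
    have dh: "h (horner_deriv K (\<lambda>y. x \<otimes>\<^bsub>K\<^esub> y) cs (\<epsilon> i)) i = d"
      using hhor[OF cs(1) x \<epsilon>(1) i] \<epsilon>(2)[OF i] by (simp add: d_def)
    then have "d \<in> carrier (L i)" using hc[OF _ i] horK[OF cs(1) x \<epsilon>(1)] by metis
    then have du: "d \<in> Units (L i)" using cs(5) Li.field_Units by (simp add: d_def)
    \<comment> \<open>\<open>z\<close> is supported on the component \<open>i\<close>, where it
      inverts the derivative, a nonzero element of a field.\<close>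
    have "(if j = i then inv\<^bsub>L i\<^esub> d else \<zero>\<^bsub>L j\<^esub>) \<in> carrier (L j)" if "j < m" for j
    proof -
      interpret cring "L j" by (rule crL[OF that])
      show ?thesis by (cases "j = i") (use zero_closed du in simp_all)
    qed
    from surj[OF this] obtain z where z: "z \<in> carrier K" "\<And>j. j < m \<Longrightarrow> h z j = (if j = i then inv\<^bsub>L i\<^esub> d else \<zero>\<^bsub>L j\<^esub>)"
      by blast
    have hd: "horner_deriv K (\<lambda>y. x \<otimes>\<^bsub>K\<^esub> y) cs (\<epsilon> i) \<in> carrier K" "horner K (\<lambda>y. x \<otimes>\<^bsub>K\<^esub> y) cs (\<epsilon> i) \<in> carrier K"
      using horK[OF cs(1) x \<epsilon>(1)] by auto
    have "z \<otimes>\<^bsub>K\<^esub> horner_deriv K (\<lambda>y. x \<otimes>\<^bsub>K\<^esub> y) cs (\<epsilon> i) = \<epsilon> i"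
    proof (rule heq)
      fix j assume j: "j < m"
      interpret cring "L j" by (rule crL[OF j])
      show "h (z \<otimes>\<^bsub>K\<^esub> horner_deriv K (\<lambda>y. x \<otimes>\<^bsub>K\<^esub> y) cs (\<epsilon> i)) j = h (\<epsilon> i) j"
        using hc[OF hd(1) j] j z dh du by (cases "j = i") (simp_all add: hm hd \<epsilon>)
    qed (use z hd \<epsilon> K.mult_closed in auto)
    moreover have "horner K (\<lambda>y. x \<otimes>\<^bsub>K\<^esub> y) cs (\<epsilon> i) = \<zero>\<^bsub>K\<^esub>"
    proof (rule heq)
      fix j assume j: "j < m"
      show "h (horner K (\<lambda>y. x \<otimes>\<^bsub>K\<^esub> y) cs (\<epsilon> i)) j = h \<zero>\<^bsub>K\<^esub> j"
        using hhor[OF cs(1) x \<epsilon>(1) j] horz[OF cs(1) hc[OF x j] j] cs(4) j by (simp add: hz \<epsilon>)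
    qed (use hd in auto)
    ultimately show "\<exists>cs. set cs \<subseteq> carrier F \<and> cs \<noteq> [] \<and> last cs \<noteq> \<zero>\<^bsub>F\<^esub> \<and>
      horner K (\<lambda>y. x \<otimes>\<^bsub>K\<^esub> y) cs (\<epsilon> i) = \<zero>\<^bsub>K\<^esub> \<and>
      (\<exists>z\<in>carrier K. z \<otimes>\<^bsub>K\<^esub> horner_deriv K (\<lambda>y. x \<otimes>\<^bsub>K\<^esub> y) cs (\<epsilon> i) = \<epsilon> i)"
      using cs z by blast
  qed
qed

section \<open>Cyclic vectors\<close>

context vectorspace
begin

lemma nonzero_smult:
  assumes "r \<in> carrier K" and "x \<in> carrier V" and "r \<odot>\<^bsub>V\<^esub> x = \<zero>\<^bsub>V\<^esub>"
  shows "r = \<zero>\<^bsub>K\<^esub> \<or> x = \<zero>\<^bsub>V\<^esub>"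
proof (rule disjCI)
  assume nz: "x \<noteq> \<zero>\<^bsub>V\<^esub>"
  show "r = \<zero>\<^bsub>K\<^esub>"
  proof (rule ccontr)
    assume "r \<noteq> \<zero>\<^bsub>K\<^esub>"
    then have u: "r \<in> Units K" using assms field_Units by auto
    have "x = (inv\<^bsub>K\<^esub> r \<otimes>\<^bsub>K\<^esub> r) \<odot>\<^bsub>V\<^esub> x" using u assms by simp
    also have "\<dots> = \<zero>\<^bsub>V\<^esub>" using u assms by (subst smult_assoc1) auto
    finally show False using nz by simp
  qed
qed

end

text \<open>An abstraction of the action of \<open>K \<otimes> K\<close> on \<open>A\<close>: the
  \<open>t p\<close> stand for the basis tensors \<open>k i \<otimes> k j\<close>, and a coefficient
  function stands for an element of the ring. The argument works with the span of the
  \<open>t p\<close> and never multiplies in it.\<close>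

locale commuting_operators = vectorspace K V
  for K :: "('k, 'n) ring_scheme" and V :: "('k, 'v, 'q) module_scheme" +
  fixes J :: "'i set" and t :: "'i \<Rightarrow> 'v \<Rightarrow> 'v"
  assumes finite_index: "finite J"
    and t_closed: "\<lbrakk>p \<in> J; x \<in> carrier V\<rbrakk> \<Longrightarrow> t p x \<in> carrier V"
    and t_add: "\<lbrakk>p \<in> J; x \<in> carrier V; y \<in> carrier V\<rbrakk> \<Longrightarrow> t p (x \<oplus>\<^bsub>V\<^esub> y) = t p x \<oplus>\<^bsub>V\<^esub> t p y"
    and t_smult: "\<lbrakk>p \<in> J; r \<in> carrier K; x \<in> carrier V\<rbrakk> \<Longrightarrow> t p (r \<odot>\<^bsub>V\<^esub> x) = r \<odot>\<^bsub>V\<^esub> t p x"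
    and t_commute: "\<lbrakk>p \<in> J; q \<in> J; x \<in> carrier V\<rbrakk> \<Longrightarrow> t p (t q x) = t q (t p x)"
begin

definition act :: "('i \<Rightarrow> 'k) \<Rightarrow> 'v \<Rightarrow> 'v" where
  "act c x = (\<Oplus>\<^bsub>V\<^esub>p\<in>J. c p \<odot>\<^bsub>V\<^esub> t p x)"

lemma summand_closed:
  "\<lbrakk>c \<in> J \<rightarrow> carrier K; x \<in> carrier V\<rbrakk> \<Longrightarrow> (\<lambda>p. c p \<odot>\<^bsub>V\<^esub> t p x) \<in> J \<rightarrow> carrier V"
  by (auto simp: t_closed Pi_iff)

lemma act_closed: "\<lbrakk>c \<in> J \<rightarrow> carrier K; x \<in> carrier V\<rbrakk> \<Longrightarrow> act c x \<in> carrier V"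
  unfolding act_def by (rule M.finsum_closed) (rule summand_closed)

lemma act_add:
  assumes "c \<in> J \<rightarrow> carrier K" and "x \<in> carrier V" and "y \<in> carrier V"
  shows "act c (x \<oplus>\<^bsub>V\<^esub> y) = act c x \<oplus>\<^bsub>V\<^esub> act c y"
proof -
  have "act c (x \<oplus>\<^bsub>V\<^esub> y) = (\<Oplus>\<^bsub>V\<^esub>p\<in>J. c p \<odot>\<^bsub>V\<^esub> t p x \<oplus>\<^bsub>V\<^esub> c p \<odot>\<^bsub>V\<^esub> t p y)"
    unfolding act_def by (rule M.finsum_cong') (use assms in \<open>auto simp: t_add t_closed smult_r_distr Pi_iff\<close>)
  also have "\<dots> = act c x \<oplus>\<^bsub>V\<^esub> act c y"
    unfolding act_def by (rule M.finsum_addf) (use assms summand_closed in auto)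
  finally show ?thesis .
qed

lemma act_smult:
  assumes "c \<in> J \<rightarrow> carrier K" and "x \<in> carrier V" and "r \<in> carrier K"
  shows "act c (r \<odot>\<^bsub>V\<^esub> x) = r \<odot>\<^bsub>V\<^esub> act c x"
proof -
  have "act c (r \<odot>\<^bsub>V\<^esub> x) = (\<Oplus>\<^bsub>V\<^esub>p\<in>J. r \<odot>\<^bsub>V\<^esub> (c p \<odot>\<^bsub>V\<^esub> t p x))"
    unfolding act_def
    by (rule M.finsum_cong')
      (use assms in \<open>auto simp: t_smult t_closed smult_assoc1[symmetric] R.m_comm Pi_iff\<close>)
  also have "\<dots> = r \<odot>\<^bsub>V\<^esub> act c x"
    unfolding act_def
    by (rule finsum_hom[OF M.abelian_group_axioms M.abelian_group_axioms, symmetric])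
      (use assms summand_closed in \<open>auto simp: smult_r_distr\<close>)
  finally show ?thesis .
qed

lemma act_zero: "c \<in> J \<rightarrow> carrier K \<Longrightarrow> act c \<zero>\<^bsub>V\<^esub> = \<zero>\<^bsub>V\<^esub>"
  using act_smult[of c "\<zero>\<^bsub>V\<^esub>" "\<zero>\<^bsub>K\<^esub>"] act_closed[of c "\<zero>\<^bsub>V\<^esub>"] by simp

lemma act_commute:
  assumes c: "c \<in> J \<rightarrow> carrier K" and d: "d \<in> J \<rightarrow> carrier K" and x: "x \<in> carrier V"
  shows "act c (act d x) = act d (act c x)"
proof -
  have q: "act c (t q x) = t q (act c x)" if "q \<in> J" for q
  proof -
    have "t q (act c x) = (\<Oplus>\<^bsub>V\<^esub>p\<in>J. t q (c p \<odot>\<^bsub>V\<^esub> t p x))"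
      unfolding act_def
      by (rule finsum_hom[OF M.abelian_group_axioms M.abelian_group_axioms])
        (use that c x summand_closed t_closed t_add in auto)
    also have "\<dots> = act c (t q x)"
      unfolding act_def
      by (rule M.finsum_cong') (use that c x in \<open>auto simp: t_smult t_closed t_commute Pi_iff\<close>)
    finally show ?thesis by simp
  qed
  have "act c (act d x) = (\<Oplus>\<^bsub>V\<^esub>q\<in>J. act c (d q \<odot>\<^bsub>V\<^esub> t q x))"
    unfolding act_def[of d]
    by (rule finsum_hom[OF M.abelian_group_axioms M.abelian_group_axioms])
      (use c d x summand_closed act_closed act_add in auto)
  also have "\<dots> = act d (act c x)"
    unfolding act_def[of d]
    by (rule M.finsum_cong') (use c d x act_closed in \<open>auto simp: act_smult t_closed q Pi_iff\<close>)
  finally show ?thesis .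
qed

lemma act_lin_coeff:
  assumes c: "c \<in> J \<rightarrow> carrier K" and d: "d \<in> J \<rightarrow> carrier K" and x: "x \<in> carrier V" and r: "r \<in> carrier K"
  shows "act (\<lambda>p. d p \<oplus>\<^bsub>K\<^esub> r \<otimes>\<^bsub>K\<^esub> c p) x = act d x \<oplus>\<^bsub>V\<^esub> r \<odot>\<^bsub>V\<^esub> act c x"
proof -
  have "act (\<lambda>p. d p \<oplus>\<^bsub>K\<^esub> r \<otimes>\<^bsub>K\<^esub> c p) x = (\<Oplus>\<^bsub>V\<^esub>p\<in>J. d p \<odot>\<^bsub>V\<^esub> t p x \<oplus>\<^bsub>V\<^esub> r \<odot>\<^bsub>V\<^esub> (c p \<odot>\<^bsub>V\<^esub> t p x))"
    unfolding act_def
    by (rule M.finsum_cong') (use assms in \<open>auto simp: t_closed smult_l_distr smult_assoc1 Pi_iff\<close>)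
  also have "\<dots> = act d x \<oplus>\<^bsub>V\<^esub> (\<Oplus>\<^bsub>V\<^esub>p\<in>J. r \<odot>\<^bsub>V\<^esub> (c p \<odot>\<^bsub>V\<^esub> t p x))"
    unfolding act_def by (rule M.finsum_addf) (use assms summand_closed t_closed in \<open>auto simp: Pi_iff\<close>)
  also have "(\<Oplus>\<^bsub>V\<^esub>p\<in>J. r \<odot>\<^bsub>V\<^esub> (c p \<odot>\<^bsub>V\<^esub> t p x)) = r \<odot>\<^bsub>V\<^esub> act c x"
    unfolding act_def
    by (rule finsum_hom[OF M.abelian_group_axioms M.abelian_group_axioms, symmetric])
      (use assms summand_closed in \<open>auto simp: smult_r_distr\<close>)
  finally show ?thesis .
qed

text \<open>Take \<open>J'\<close> maximal such that some vector \<open>a\<close> has independent \<open>t p a\<close>, \<open>p \<in> J'\<close>. If \<open>q \<notin> J'\<close>, a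
  relation \<open>c\<close> on \<open>J' \<union> {q}\<close> kills \<open>a\<close> but not some \<open>b\<close>, and \<open>a + act c b\<close> contradicts maximality.\<close>

theorem cyclic_vector:
  assumes faithful: "\<And>c. \<lbrakk>c \<in> J \<rightarrow> carrier K; \<And>x. x \<in> carrier V \<Longrightarrow> act c x = \<zero>\<^bsub>V\<^esub>\<rbrakk> \<Longrightarrow> \<forall>p\<in>J. c p = \<zero>\<^bsub>K\<^esub>"
    and reduced: "\<And>c x. \<lbrakk>c \<in> J \<rightarrow> carrier K; x \<in> carrier V; act c (act c x) = \<zero>\<^bsub>V\<^esub>\<rbrakk> \<Longrightarrow> act c x = \<zero>\<^bsub>V\<^esub>"
  obtains a where "a \<in> carrier V" and "indep_family K V J (\<lambda>p. t p a)"
proof -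
  \<comment> \<open>Independence of the \<open>t p a\<close> with \<open>p \<in> J'\<close>, phrased
    for coefficient functions on all of \<open>J\<close> that vanish outside \<open>J'\<close>, so
    that \<open>act\<close> applies unchanged.\<close>
  define ind where "ind J' a \<longleftrightarrow> (\<forall>d\<in>J \<rightarrow> carrier K. (\<forall>p\<in>J - J'. d p = \<zero>\<^bsub>K\<^esub>) \<longrightarrow> act d a = \<zero>\<^bsub>V\<^esub> \<longrightarrow>
      (\<forall>p\<in>J. d p = \<zero>\<^bsub>K\<^esub>))" for J' a
  define P where "P J' \<longleftrightarrow> J' \<subseteq> J \<and> (\<exists>a\<in>carrier V. ind J' a)" for J'
  have "P {}" by (auto simp: P_def ind_def intro!: bexI[of _ "\<zero>\<^bsub>V\<^esub>"])
  moreover have "\<forall>J'. P J' \<longrightarrow> card J' < Suc (card J)"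
    using finite_index by (auto simp: P_def less_Suc_eq_le intro: card_mono)
  ultimately obtain J' where J': "P J'" "\<And>J''. P J'' \<Longrightarrow> card J'' \<le> card J'"
    using ex_has_greatest_nat[of P "{}" card "Suc (card J)"] by blast
  obtain a where a: "a \<in> carrier V" "ind J' a" and sub: "J' \<subseteq> J" using J'(1) by (auto simp: P_def)
  have "J' = J"
  proof (rule ccontr)
    assume "J' \<noteq> J"
    then obtain q where q: "q \<in> J" "q \<notin> J'" using sub by blast
    have fJ': "finite J'" using finite_subset[OF sub finite_index] .
    have not: "\<not> ind (insert q J') x" if "x \<in> carrier V" for x
      using J'(2)[of "insert q J'"] q sub that fJ' by (auto simp: P_def)
    then obtain c where c: "c \<in> J \<rightarrow> carrier K" "\<forall>p\<in>J - insert q J'. c p = \<zero>\<^bsub>K\<^esub>" "act c a = \<zero>\<^bsub>V\<^esub>"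
      "\<not> (\<forall>p\<in>J. c p = \<zero>\<^bsub>K\<^esub>)" using a(1) unfolding ind_def by blast
    \<comment> \<open>Otherwise \<open>c\<close> would be a nontrivial relation supported on
      \<open>J'\<close>, excluded by the choice of \<open>a\<close>.\<close>
    have cq: "c q \<noteq> \<zero>\<^bsub>K\<^esub>"
    proof
      assume "c q = \<zero>\<^bsub>K\<^esub>"
      then have "\<forall>p\<in>J - J'. c p = \<zero>\<^bsub>K\<^esub>" using c(2) by auto
      then show False using a(2) c unfolding ind_def by blast
    qed
    have cqc: "c q \<in> carrier K" using c(1) q by auto
    then have cu: "c q \<in> Units K" using cq field_Units by auto
    obtain b where b: "b \<in> carrier V" "act c b \<noteq> \<zero>\<^bsub>V\<^esub>" using faithful[OF c(1)] c(4) by blast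
    have cb: "act c b \<in> carrier V" by (rule act_closed[OF c(1) b(1)])
    define a' where "a' = a \<oplus>\<^bsub>V\<^esub> act c b"
    have a'c: "a' \<in> carrier V" using a cb by (simp add: a'_def)
    have "ind (insert q J') a'"
      unfolding ind_def
    proof (intro ballI impI)
      fix d p assume d: "d \<in> J \<rightarrow> carrier K" and d0: "\<forall>p\<in>J - insert q J'. d p = \<zero>\<^bsub>K\<^esub>"
        and da': "act d a' = \<zero>\<^bsub>V\<^esub>" and p: "p \<in> J"
      have db: "act d b \<in> carrier V" "act d a \<in> carrier V" by (rule act_closed[OF d b(1)], rule act_closed[OF d a(1)])
      have split: "act d a \<oplus>\<^bsub>V\<^esub> act d (act c b) = \<zero>\<^bsub>V\<^esub>"
        using da' act_add[OF d a(1) cb] by (simp add: a'_def)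
      have dcb: "act d (act c b) = act c (act d b)" by (rule act_commute[OF d c(1) b(1)])
      \<comment> \<open>Applying \<open>act c\<close> to \<open>split\<close> removes the part with
        \<open>a\<close>, because \<open>act c a = 0\<close> and the operators commute. Reducedness
        then lowers \<open>act c (act c (act d b)) = 0\<close> to
        \<open>act c (act d b) = 0\<close>, so both parts of \<open>split\<close> vanish
        separately.\<close>
      have "act c (act d a) \<oplus>\<^bsub>V\<^esub> act c (act c (act d b)) = \<zero>\<^bsub>V\<^esub>"
        using arg_cong[OF split, of "act c"] act_add[OF c(1) db(2) act_closed[OF c(1) db(1)]] act_zero[OF c(1)]
        by (simp add: dcb)
      moreover have "act c (act d a) = \<zero>\<^bsub>V\<^esub>"
        using act_commute[OF c(1) d a(1)] c(3) act_zero[OF d] by simp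
      ultimately have "act c (act c (act d b)) = \<zero>\<^bsub>V\<^esub>"
        using act_closed[OF c(1) act_closed[OF c(1) db(1)]] by simp
      then have cdb: "act c (act d b) = \<zero>\<^bsub>V\<^esub>" by (rule reduced[OF c(1) db(1)])
      then have da: "act d a = \<zero>\<^bsub>V\<^esub>" using split dcb db by simp
      \<comment> \<open>Chosen so that \<open>d + r c\<close> vanishes at \<open>q\<close>; this
        combination is then a relation of \<open>a\<close> supported on \<open>J'\<close>, hence
        zero.\<close>
      define r where "r = \<ominus>\<^bsub>K\<^esub> (d q \<otimes>\<^bsub>K\<^esub> inv\<^bsub>K\<^esub> c q)"
      have dq: "d q \<in> carrier K" using d q by auto
      have r: "r \<in> carrier K" using dq cu by (simp add: r_def)
      define g where "g = (\<lambda>p. d p \<oplus>\<^bsub>K\<^esub> r \<otimes>\<^bsub>K\<^esub> c p)"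
      have gc: "g \<in> J \<rightarrow> carrier K" using d c(1) r by (auto simp: g_def Pi_iff)
      have "g q = d q \<oplus>\<^bsub>K\<^esub> \<ominus>\<^bsub>K\<^esub> (d q \<otimes>\<^bsub>K\<^esub> (inv\<^bsub>K\<^esub> c q \<otimes>\<^bsub>K\<^esub> c q))"
        using dq cu cqc by (simp add: g_def r_def R.l_minus R.m_assoc del: R.Units_l_inv)
      then have gq: "g q = \<zero>\<^bsub>K\<^esub>" using dq cu by (simp add: R.r_neg)
      have "\<forall>p\<in>J - J'. g p = \<zero>\<^bsub>K\<^esub>"
      proof
        fix p assume "p \<in> J - J'"
        then show "g p = \<zero>\<^bsub>K\<^esub>"
          by (cases "p = q") (use gq d0 c(2) r in \<open>simp_all add: g_def\<close>)
      qed
      moreover have "act g a = \<zero>\<^bsub>V\<^esub>"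
        unfolding g_def using act_lin_coeff[OF c(1) d a(1) r] da c(3) r by simp
      ultimately have g0: "\<forall>p\<in>J. g p = \<zero>\<^bsub>K\<^esub>" using a(2) gc unfolding ind_def by blast
      \<comment> \<open>Evaluating the trivial combination \<open>g\<close> at
        \<open>act c b\<close> leaves \<open>r\<close> times \<open>act c (act c b)\<close>. That
        vector is nonzero by reducedness and the choice of \<open>b\<close>, so \<open>r = 0\<close>
        and \<open>d = g = 0\<close>.\<close>
      have "act g (act c b) = (\<Oplus>\<^bsub>V\<^esub>p\<in>J. \<zero>\<^bsub>V\<^esub>)"
        unfolding act_def[of g] by (rule M.finsum_cong') (use g0 cb t_closed in auto)
      then have "act d (act c b) \<oplus>\<^bsub>V\<^esub> r \<odot>\<^bsub>V\<^esub> act c (act c b) = \<zero>\<^bsub>V\<^esub>"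
        using act_lin_coeff[OF c(1) d cb r] by (simp add: g_def)
      then have "r \<odot>\<^bsub>V\<^esub> act c (act c b) = \<zero>\<^bsub>V\<^esub>"
        using r act_closed[OF c(1) cb] by (simp add: dcb cdb)
      then have "r = \<zero>\<^bsub>K\<^esub>"
        using nonzero_smult[OF r act_closed[OF c(1) cb]] reduced[OF c(1) b(1)] b(2) by blast
      then show "d p = \<zero>\<^bsub>K\<^esub>"
        using g0 p d c(1) by (auto simp: g_def Pi_iff)
    qed
    then show False using not[OF a'c] by simp
  qed
  then have "indep_family K V J (\<lambda>p. t p a)"
    using a(2) by (auto simp: indep_family_def ind_def act_def)
  with a(1) show ?thesis by (rule that)
qed

end

section \<open>The bimodule structure over a commutative nuclear subalgebra\<close>

context comm_algebra_pair
begin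

lemma tensor_assoc:
  assumes C_assoc: "\<And>x y z. \<lbrakk>x \<in> carrier C; y \<in> carrier C; z \<in> carrier C\<rbrakk> \<Longrightarrow>
      (x \<otimes>\<^bsub>C\<^esub> y) \<otimes>\<^bsub>C\<^esub> z = x \<otimes>\<^bsub>C\<^esub> (y \<otimes>\<^bsub>C\<^esub> z)"
    and U: "U \<in> carrier TA" and V: "V \<in> carrier TA" and W: "W \<in> carrier TA"
  shows "(U \<otimes>\<^bsub>TA\<^esub> V) \<otimes>\<^bsub>TA\<^esub> W = U \<otimes>\<^bsub>TA\<^esub> (V \<otimes>\<^bsub>TA\<^esub> W)"
proof -
  obtain x where x: "U = cls x" "Poly_Mapping.keys x \<subseteq> pure" using U by (rule tensor_cases)
  obtain y where y: "V = cls y" "Poly_Mapping.keys y \<subseteq> pure" using V by (rule tensor_cases)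
  obtain z where z: "W = cls z" "Poly_Mapping.keys z \<subseteq> pure" using W by (rule tensor_cases)
  have "frag_mult B C (frag_mult B C x y) z = frag_mult B C x (frag_mult B C y z)"
    using x(2)
  proof (induction x rule: frag_induct)
    case (of p)
    from y(2) show ?case
    proof (induction y rule: frag_induct)
      case (of q)
      from z(2) show ?case
      proof (induction z rule: frag_induct)
        case (of r)
        with \<open>p \<in> pure\<close> \<open>q \<in> pure\<close> show ?case
          by (cases p; cases q; cases r) (simp add: B_assoc C_assoc)
      qed (simp_all add: frag_mult_diff_right)
    qed (simp_all add: frag_mult_diff_left frag_mult_diff_right)
  qed (simp_all add: frag_mult_diff_left)
  then show ?thesis
    unfolding x(1) y(1) z(1) using x(2) y(2) z(2) by (simp only: mult_tensor frag_mult_keys)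
qed

lemma tensor_comm:
  assumes C_comm: "\<And>x y. \<lbrakk>x \<in> carrier C; y \<in> carrier C\<rbrakk> \<Longrightarrow> x \<otimes>\<^bsub>C\<^esub> y = y \<otimes>\<^bsub>C\<^esub> x"
    and U: "U \<in> carrier TA" and V: "V \<in> carrier TA"
  shows "U \<otimes>\<^bsub>TA\<^esub> V = V \<otimes>\<^bsub>TA\<^esub> U"
proof -
  obtain x where x: "U = cls x" "Poly_Mapping.keys x \<subseteq> pure" using U by (rule tensor_cases)
  obtain y where y: "V = cls y" "Poly_Mapping.keys y \<subseteq> pure" using V by (rule tensor_cases)
  have "frag_mult B C x y = frag_mult B C y x"
    using x(2)
  proof (induction x rule: frag_induct)
    case (of p)
    from y(2) show ?case
    proof (induction y rule: frag_induct)
      case (of q)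
      with \<open>p \<in> pure\<close> show ?case
        by (cases p; cases q) (simp, metis B_comm C_comm)
    qed (simp_all add: frag_mult_diff_left frag_mult_diff_right)
  qed (simp_all add: frag_mult_diff_left frag_mult_diff_right)
  then show ?thesis
    unfolding x(1) y(1) using x(2) y(2) by (simp only: mult_tensor)
qed

end

text \<open>\<open>enveloping_ring\<close> and \<open>enveloping_module\<close> are rebuilt records;
  they agree with a known structure in the fields that matter for addition.\<close>

lemma abelian_group_cong:
  assumes "abelian_group R" and eq: "carrier S = carrier R" "\<zero>\<^bsub>S\<^esub> = \<zero>\<^bsub>R\<^esub>" "add S = add R"
  shows "abelian_group S"
proof -
  interpret abelian_group R by fact
  show ?thesis by (rule abelian_groupI) (auto simp: eq a_ac intro: add.l_inv_ex)
qed

lemma (in unital_algebra) subalgebra_unital: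
  assumes "unital_subalgebra F A K"
  shows "unital_algebra F (A\<lparr>carrier := K\<rparr>)"
proof -
  have sub: "VectorSpace.subspace F K A" and one: "\<one>\<^bsub>A\<^esub> \<in> K" and mult: "\<And>x y. \<lbrakk>x \<in> K; y \<in> K\<rbrakk> \<Longrightarrow> x \<otimes>\<^bsub>A\<^esub> y \<in> K"
    using assms by (auto simp: unital_subalgebra_def)
  have K: "x \<in> carrier A" if "x \<in> K" for x
    using submodule.subset[OF subspace.submod[OF sub]] that by blast
  show ?thesis
    by (intro unital_algebra.intro unital_algebra_axioms.intro subspace_is_vs[OF sub])
      (simp_all add: mult one K l_one r_one l_distr r_distr smult_mult_left smult_mult_right)
qed

text \<open>\<open>K\<close> comes with a finite \<open>F\<close>-basis \<open>k\<close>, kept as a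
  family to suit \<open>indep_family\<close>. Commutativity turns the sandwich maps
  \<open>a \<mapsto> k a k'\<close> into the action of a commutative ring; etale algebras will
  provide it.\<close>

locale nuclear_subalgebra = unital_algebra F A
  for F :: "'f ring" and A :: "('f, 'a) module" +
  fixes K :: "'a set" and I :: "'i set" and k :: "'i \<Rightarrow> 'a"
  assumes fin_dim: "fin_dim"
    and subalgebra: "unital_subalgebra F A K"
    and K_nucleus: "K \<subseteq> nucleus A"
    and K_comm: "\<lbrakk>x \<in> K; y \<in> K\<rbrakk> \<Longrightarrow> x \<otimes>\<^bsub>A\<^esub> y = y \<otimes>\<^bsub>A\<^esub> x"
    and finite_I: "finite I"
    and k_closed: "k \<in> I \<rightarrow> K"
    and k_span: "x \<in> K \<Longrightarrow> \<exists>r\<in>I \<rightarrow> carrier F. x = (\<Oplus>\<^bsub>A\<^esub>i\<in>I. r i \<odot>\<^bsub>A\<^esub> k i)"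
    and k_indep: "indep_family F A I k"
begin

abbreviation "KA \<equiv> A\<lparr>carrier := K\<rparr>"

lemma K_submodule: "submodule F K A"
  using subalgebra by (auto simp: unital_subalgebra_def subspace_def)

lemma K_carrier [simp]: "x \<in> K \<Longrightarrow> x \<in> carrier A"
  using submodule.subset[OF K_submodule] by blast

lemma K_one [simp]: "\<one>\<^bsub>A\<^esub> \<in> K" and K_mult [simp]: "\<lbrakk>x \<in> K; y \<in> K\<rbrakk> \<Longrightarrow> x \<otimes>\<^bsub>A\<^esub> y \<in> K"
  using subalgebra by (auto simp: unital_subalgebra_def)

lemma K_nuc: "x \<in> K \<Longrightarrow> x \<in> nucleus A"
  using K_nucleus by blast

lemma k_K: "i \<in> I \<Longrightarrow> k i \<in> K"
  using k_closed by auto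

lemma K_assoc_left: "\<lbrakk>x \<in> K; y \<in> K; a \<in> carrier A\<rbrakk> \<Longrightarrow> x \<otimes>\<^bsub>A\<^esub> (y \<otimes>\<^bsub>A\<^esub> a) = (x \<otimes>\<^bsub>A\<^esub> y) \<otimes>\<^bsub>A\<^esub> a"
  by (simp add: nucleus_assoc(1) K_nuc)

lemma K_assoc_right: "\<lbrakk>x \<in> K; y \<in> K; a \<in> carrier A\<rbrakk> \<Longrightarrow> (a \<otimes>\<^bsub>A\<^esub> x) \<otimes>\<^bsub>A\<^esub> y = a \<otimes>\<^bsub>A\<^esub> (x \<otimes>\<^bsub>A\<^esub> y)"
  by (simp add: nucleus_assoc(2) K_nuc)

definition t :: "'i \<times> 'i \<Rightarrow> 'a \<Rightarrow> 'a" where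
  "t p a = (k (fst p) \<otimes>\<^bsub>A\<^esub> a) \<otimes>\<^bsub>A\<^esub> k (snd p)"

text \<open>The right factors come out in the order \<open>y' x'\<close>; commutativity of
  \<open>K\<close> restores the order in which \<open>K \<otimes> K\<close> multiplies. All brackets
  move because \<open>K\<close> is nuclear.\<close>

lemma sandwich:
  assumes "x \<in> K" "x' \<in> K" "y \<in> K" "y' \<in> K" "a \<in> carrier A"
  shows "(x \<otimes>\<^bsub>A\<^esub> ((y \<otimes>\<^bsub>A\<^esub> a) \<otimes>\<^bsub>A\<^esub> y')) \<otimes>\<^bsub>A\<^esub> x' = ((x \<otimes>\<^bsub>A\<^esub> y) \<otimes>\<^bsub>A\<^esub> a) \<otimes>\<^bsub>A\<^esub> (x' \<otimes>\<^bsub>A\<^esub> y')"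
proof -
  have "(x \<otimes>\<^bsub>A\<^esub> ((y \<otimes>\<^bsub>A\<^esub> a) \<otimes>\<^bsub>A\<^esub> y')) \<otimes>\<^bsub>A\<^esub> x' = ((x \<otimes>\<^bsub>A\<^esub> (y \<otimes>\<^bsub>A\<^esub> a)) \<otimes>\<^bsub>A\<^esub> y') \<otimes>\<^bsub>A\<^esub> x'"
    using assms by (simp add: nucleus_assoc(1)[OF K_nuc[OF assms(1)]] mult_closed)
  also have "\<dots> = ((x \<otimes>\<^bsub>A\<^esub> y) \<otimes>\<^bsub>A\<^esub> a) \<otimes>\<^bsub>A\<^esub> (y' \<otimes>\<^bsub>A\<^esub> x')"
    using assms by (simp add: K_assoc_left K_assoc_right mult_closed)
  finally show ?thesis using K_comm assms by simp
qed

sublocale T: commuting_operators F A "I \<times> I" t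
proof (unfold_locales)
  show "finite (I \<times> I)" using finite_I by simp
  fix p q x assume "p \<in> I \<times> I" "q \<in> I \<times> I" and x: "x \<in> carrier A"
  then have "k (fst p) \<in> K" "k (snd p) \<in> K" "k (fst q) \<in> K" "k (snd q) \<in> K" using k_K by auto
  then show "t p (t q x) = t q (t p x)"
    using x by (simp add: t_def sandwich K_comm)
qed (use k_K in \<open>auto simp: t_def mult_closed l_distr r_distr smult_mult_left smult_mult_right\<close>)

text \<open>Expanding \<open>x\<close> and \<open>y\<close> in the basis gives the coefficients
  \<open>r i s j\<close>.\<close>

lemma pure_act:
  assumes x: "x \<in> K" and y: "y \<in> K"
  obtains c where "c \<in> I \<times> I \<rightarrow> carrier F" and "\<And>a. a \<in> carrier A \<Longrightarrow> (x \<otimes>\<^bsub>A\<^esub> a) \<otimes>\<^bsub>A\<^esub> y = T.act c a"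
proof -
  obtain r where r: "r \<in> I \<rightarrow> carrier F" "x = (\<Oplus>\<^bsub>A\<^esub>i\<in>I. r i \<odot>\<^bsub>A\<^esub> k i)" using k_span[OF x] by blast
  obtain s where s: "s \<in> I \<rightarrow> carrier F" "y = (\<Oplus>\<^bsub>A\<^esub>i\<in>I. s i \<odot>\<^bsub>A\<^esub> k i)" using k_span[OF y] by blast
  define c where "c = (\<lambda>p. r (fst p) \<otimes>\<^bsub>F\<^esub> s (snd p))"
  have c: "c \<in> I \<times> I \<rightarrow> carrier F" using r(1) s(1) by (auto simp: c_def Pi_iff)
  have "(x \<otimes>\<^bsub>A\<^esub> a) \<otimes>\<^bsub>A\<^esub> y = T.act c a" if a: "a \<in> carrier A" for a
  proof -
    have ki: "k i \<in> carrier A" "r i \<in> carrier F" "s i \<in> carrier F" if "i \<in> I" for i using that k_K r s by auto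
    have xa: "x \<otimes>\<^bsub>A\<^esub> a = (\<Oplus>\<^bsub>A\<^esub>i\<in>I. r i \<odot>\<^bsub>A\<^esub> (k i \<otimes>\<^bsub>A\<^esub> a))"
    proof -
      have "x \<otimes>\<^bsub>A\<^esub> a = (\<Oplus>\<^bsub>A\<^esub>i\<in>I. (r i \<odot>\<^bsub>A\<^esub> k i) \<otimes>\<^bsub>A\<^esub> a)"
        unfolding r(2) by (rule finsum_mult_left) (use ki a in auto)
      also have "\<dots> = (\<Oplus>\<^bsub>A\<^esub>i\<in>I. r i \<odot>\<^bsub>A\<^esub> (k i \<otimes>\<^bsub>A\<^esub> a))"
        by (rule M.finsum_cong') (use ki a in \<open>auto simp: smult_mult_left mult_closed\<close>)
      finally show ?thesis .
    qed
    have "(x \<otimes>\<^bsub>A\<^esub> a) \<otimes>\<^bsub>A\<^esub> y = (\<Oplus>\<^bsub>A\<^esub>i\<in>I. (r i \<odot>\<^bsub>A\<^esub> (k i \<otimes>\<^bsub>A\<^esub> a)) \<otimes>\<^bsub>A\<^esub> y)"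
      unfolding xa by (rule finsum_mult_left) (use ki a y in \<open>auto simp: mult_closed\<close>)
    also have "\<dots> = (\<Oplus>\<^bsub>A\<^esub>i\<in>I. \<Oplus>\<^bsub>A\<^esub>j\<in>I. c (i, j) \<odot>\<^bsub>A\<^esub> t (i, j) a)"
    proof (rule M.finsum_cong'[OF refl])
      fix i assume i: "i \<in> I"
      have b: "r i \<odot>\<^bsub>A\<^esub> (k i \<otimes>\<^bsub>A\<^esub> a) \<in> carrier A" using ki[OF i] a by (simp add: mult_closed)
      have "(r i \<odot>\<^bsub>A\<^esub> (k i \<otimes>\<^bsub>A\<^esub> a)) \<otimes>\<^bsub>A\<^esub> y = (\<Oplus>\<^bsub>A\<^esub>j\<in>I. (r i \<odot>\<^bsub>A\<^esub> (k i \<otimes>\<^bsub>A\<^esub> a)) \<otimes>\<^bsub>A\<^esub> (s j \<odot>\<^bsub>A\<^esub> k j))"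
        unfolding s(2) by (rule finsum_mult_right[OF _ b]) (use ki in auto)
      also have "\<dots> = (\<Oplus>\<^bsub>A\<^esub>j\<in>I. c (i, j) \<odot>\<^bsub>A\<^esub> t (i, j) a)"
        by (rule M.finsum_cong')
          (use ki i a in \<open>auto simp: c_def t_def smult_mult_left smult_mult_right mult_closed smult_assoc1[symmetric] R.m_comm\<close>)
      finally show "(r i \<odot>\<^bsub>A\<^esub> (k i \<otimes>\<^bsub>A\<^esub> a)) \<otimes>\<^bsub>A\<^esub> y = (\<Oplus>\<^bsub>A\<^esub>j\<in>I. c (i, j) \<odot>\<^bsub>A\<^esub> t (i, j) a)" .
    qed (use c a in \<open>auto intro!: M.finsum_closed simp: T.t_closed Pi_iff\<close>)
    also have "\<dots> = (\<Oplus>\<^bsub>A\<^esub>p\<in>I \<times> I. c p \<odot>\<^bsub>A\<^esub> t p a)"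
      using M.add.finprod_finprod[OF finite_I finite_I, of "\<lambda>i j. c (i, j) \<odot>\<^bsub>A\<^esub> t (i, j) a"] c a
      by (auto simp: T.t_closed Pi_iff case_prod_unfold)
    finally show ?thesis by (simp add: T.act_def)
  qed
  with c show ?thesis by (rule that)
qed

sublocale KP: comm_algebra_pair F KA KA
proof -
  have "unital_algebra F KA" by (rule subalgebra_unital[OF subalgebra])
  then show "comm_algebra_pair F KA KA"
    by (intro comm_algebra_pair.intro algebra_pair.intro comm_algebra_pair_axioms.intro)
      (simp_all add: nucleus_assoc(1)[OF K_nuc], rule K_comm)
qed

abbreviation "ER \<equiv> enveloping_ring F A K"

lemma ER_simps: "carrier ER = carrier KP.TA" "monoid.mult ER = monoid.mult KP.TA" "\<one>\<^bsub>ER\<^esub> = \<one>\<^bsub>KP.TA\<^esub>"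
  "\<zero>\<^bsub>ER\<^esub> = \<zero>\<^bsub>KP.TA\<^esub>" "add ER = add KP.TA"
  by (simp_all add: enveloping_ring_def ring.truncate_def)

lemma ER_cring: "cring ER"
proof (rule cringI)
  show "abelian_group ER"
    by (rule abelian_group_cong[OF KP.tensor_abelian_group]) (simp_all add: ER_simps)
  have assoc: "\<And>x y z. \<lbrakk>x \<in> K; y \<in> K; z \<in> K\<rbrakk> \<Longrightarrow> (x \<otimes>\<^bsub>A\<^esub> y) \<otimes>\<^bsub>A\<^esub> z = x \<otimes>\<^bsub>A\<^esub> (y \<otimes>\<^bsub>A\<^esub> z)"
    by (simp add: nucleus_assoc(1)[OF K_nuc])
  show "Group.comm_monoid ER"
    by (rule comm_monoidI)
      (use KP.tensor_mult_closed KP.one_tensor KP.class_closed[OF KP.keys_one] KP.tensor_assoc assoc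
        KP.tensor_comm K_comm KP.tensor_l_one in \<open>simp_all add: ER_simps\<close>)
qed (simp add: ER_simps KP.tensor_l_distr)

lemma balanced: "a \<in> carrier A \<Longrightarrow> balanced_map F KA KA A (\<lambda>p. (fst p \<otimes>\<^bsub>A\<^esub> a) \<otimes>\<^bsub>A\<^esub> snd p)"
  by (intro balanced_map.intro balanced_map_axioms.intro KP.algebra_pair_axioms algebra_abelian_group)
    (simp_all add: mult_closed l_distr r_distr smult_mult_left smult_mult_right)

abbreviation env (infixl "\<bullet>" 70) where "U \<bullet> a \<equiv> U \<odot>\<^bsub>enveloping_module A\<^esub> a"

text \<open>For fixed \<open>a\<close>, a coset acts through the lift of a balanced map. Additivity
  in the coset and the value on pure tensors then come from the universal property rather than from
  representatives.\<close>

lemma env_eq_lift: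
  "a \<in> carrier A \<Longrightarrow> U \<bullet> a = balanced_map.lift A (\<lambda>p. (fst p \<otimes>\<^bsub>A\<^esub> a) \<otimes>\<^bsub>A\<^esub> snd p) U"
  by (simp add: balanced_map.lift_def[OF balanced] enveloping_module_def two_sided_action_def[abs_def]
      frag_sum_def[abs_def])

lemma env_closed: "\<lbrakk>U \<in> carrier KP.TA; a \<in> carrier A\<rbrakk> \<Longrightarrow> U \<bullet> a \<in> carrier A"
  by (simp add: env_eq_lift balanced_map.lift_closed[OF balanced])

lemma env_zero: "a \<in> carrier A \<Longrightarrow> \<zero>\<^bsub>KP.TA\<^esub> \<bullet> a = \<zero>\<^bsub>A\<^esub>"
  by (simp add: env_eq_lift balanced_map.lift_zero[OF balanced])

lemma env_add: "\<lbrakk>U \<in> carrier KP.TA; V \<in> carrier KP.TA; a \<in> carrier A\<rbrakk> \<Longrightarrow> (U \<oplus>\<^bsub>KP.TA\<^esub> V) \<bullet> a = U \<bullet> a \<oplus>\<^bsub>A\<^esub> V \<bullet> a"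
  by (simp add: env_eq_lift balanced_map.lift_add[OF balanced])

lemma env_diff: "\<lbrakk>U \<in> carrier KP.TA; V \<in> carrier KP.TA; a \<in> carrier A\<rbrakk> \<Longrightarrow> (U \<ominus>\<^bsub>KP.TA\<^esub> V) \<bullet> a = U \<bullet> a \<ominus>\<^bsub>A\<^esub> V \<bullet> a"
  by (simp add: env_eq_lift balanced_map.lift_diff[OF balanced])

lemma env_pure: "\<lbrakk>x \<in> K; y \<in> K; a \<in> carrier A\<rbrakk> \<Longrightarrow> KP.cls (frag_of (x, y)) \<bullet> a = (x \<otimes>\<^bsub>A\<^esub> a) \<otimes>\<^bsub>A\<^esub> y"
  by (simp add: env_eq_lift balanced_map.lift_pure[OF balanced])

text \<open>Translates elements of the enveloping ring into coefficient functions, the language of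
  \<open>commuting_operators\<close>; linearity in \<open>a\<close> is then inherited from
  \<open>act\<close>.\<close>

lemma env_act:
  assumes "U \<in> carrier KP.TA"
  shows "\<exists>c\<in>I \<times> I \<rightarrow> carrier F. \<forall>a\<in>carrier A. U \<bullet> a = T.act c a"
  using assms
proof (induction U rule: KP.tensor_induct)
  case zero
  have "T.act (\<lambda>_. \<zero>\<^bsub>F\<^esub>) a = \<zero>\<^bsub>A\<^esub>" if "a \<in> carrier A" for a
  proof -
    have "T.act (\<lambda>_. \<zero>\<^bsub>F\<^esub>) a = (\<Oplus>\<^bsub>A\<^esub>p\<in>I \<times> I. \<zero>\<^bsub>A\<^esub>)"
      unfolding T.act_def by (rule M.finsum_cong') (use that T.t_closed in auto)
    then show ?thesis by simp
  qed
  then show ?case by (intro bexI[of _ "\<lambda>_. \<zero>\<^bsub>F\<^esub>"]) (auto simp: env_zero)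
next
  case (diff U V)
  then obtain c d where c: "c \<in> I \<times> I \<rightarrow> carrier F" "\<forall>a\<in>carrier A. U \<bullet> a = T.act c a"
    and d: "d \<in> I \<times> I \<rightarrow> carrier F" "\<forall>a\<in>carrier A. V \<bullet> a = T.act d a" by blast
  let ?e = "\<lambda>p. c p \<oplus>\<^bsub>F\<^esub> (\<ominus>\<^bsub>F\<^esub> \<one>\<^bsub>F\<^esub>) \<otimes>\<^bsub>F\<^esub> d p"
  have "(U \<ominus>\<^bsub>KP.TA\<^esub> V) \<bullet> a = T.act ?e a" if a: "a \<in> carrier A" for a
    using T.act_lin_coeff[OF d(1) c(1) a, of "\<ominus>\<^bsub>F\<^esub> \<one>\<^bsub>F\<^esub>"] c d a diff T.act_closed[OF d(1) a]
    by (simp only: env_diff) (simp add: smult_l_minus a_minus_def)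
  moreover have "?e \<in> I \<times> I \<rightarrow> carrier F" using c d by (auto simp: Pi_iff)
  ultimately show ?case by blast
next
  case (pure x y)
  then obtain c where "c \<in> I \<times> I \<rightarrow> carrier F" "\<And>a. a \<in> carrier A \<Longrightarrow> (x \<otimes>\<^bsub>A\<^esub> a) \<otimes>\<^bsub>A\<^esub> y = T.act c a"
    using pure_act[of x y] by auto
  then show ?case using pure by (intro bexI[of _ c]) (auto simp: env_pure)
qed

lemma env_add_right:
  assumes "U \<in> carrier KP.TA" and "a \<in> carrier A" and "b \<in> carrier A"
  shows "U \<bullet> (a \<oplus>\<^bsub>A\<^esub> b) = U \<bullet> a \<oplus>\<^bsub>A\<^esub> U \<bullet> b"
  using env_act[OF assms(1)] assms by (auto simp: T.act_add)

text \<open>By additivity in both ring elements only pure tensors remain, where the claim is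
  \<open>sandwich\<close>.\<close>

lemma env_mult:
  assumes U: "U \<in> carrier KP.TA" and V: "V \<in> carrier KP.TA" and a: "a \<in> carrier A"
  shows "(U \<otimes>\<^bsub>KP.TA\<^esub> V) \<bullet> a = U \<bullet> (V \<bullet> a)"
proof -
  interpret TA: abelian_group KP.TA by (rule KP.tensor_abelian_group)
  have mz: "\<zero>\<^bsub>KP.TA\<^esub> \<otimes>\<^bsub>KP.TA\<^esub> P = \<zero>\<^bsub>KP.TA\<^esub>" "P \<otimes>\<^bsub>KP.TA\<^esub> \<zero>\<^bsub>KP.TA\<^esub> = \<zero>\<^bsub>KP.TA\<^esub>"
    if "P \<in> carrier KP.TA" for P
    using ring.ring_simprules(24,25)[OF cring.axioms(1)[OF ER_cring], of P] that by (simp_all add: ER_simps)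
  have md: "(P \<ominus>\<^bsub>KP.TA\<^esub> Q) \<otimes>\<^bsub>KP.TA\<^esub> S = P \<otimes>\<^bsub>KP.TA\<^esub> S \<ominus>\<^bsub>KP.TA\<^esub> Q \<otimes>\<^bsub>KP.TA\<^esub> S"
    "S \<otimes>\<^bsub>KP.TA\<^esub> (P \<ominus>\<^bsub>KP.TA\<^esub> Q) = S \<otimes>\<^bsub>KP.TA\<^esub> P \<ominus>\<^bsub>KP.TA\<^esub> S \<otimes>\<^bsub>KP.TA\<^esub> Q"
    if "P \<in> carrier KP.TA" "Q \<in> carrier KP.TA" "S \<in> carrier KP.TA" for P Q S
  proof -
    have PQ: "P \<ominus>\<^bsub>KP.TA\<^esub> Q \<in> carrier KP.TA" using that by simp
    have "(P \<ominus>\<^bsub>KP.TA\<^esub> Q) \<oplus>\<^bsub>KP.TA\<^esub> Q = P" using that by (simp add: TA.minus_eq TA.a_assoc TA.l_neg)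
    then have "(P \<ominus>\<^bsub>KP.TA\<^esub> Q) \<otimes>\<^bsub>KP.TA\<^esub> S \<oplus>\<^bsub>KP.TA\<^esub> Q \<otimes>\<^bsub>KP.TA\<^esub> S = P \<otimes>\<^bsub>KP.TA\<^esub> S"
      "S \<otimes>\<^bsub>KP.TA\<^esub> (P \<ominus>\<^bsub>KP.TA\<^esub> Q) \<oplus>\<^bsub>KP.TA\<^esub> S \<otimes>\<^bsub>KP.TA\<^esub> Q = S \<otimes>\<^bsub>KP.TA\<^esub> P"
      using KP.tensor_l_distr[OF PQ that(2,3)] KP.tensor_r_distr[OF PQ that(2,3)] by simp_all
    then show "(P \<ominus>\<^bsub>KP.TA\<^esub> Q) \<otimes>\<^bsub>KP.TA\<^esub> S = P \<otimes>\<^bsub>KP.TA\<^esub> S \<ominus>\<^bsub>KP.TA\<^esub> Q \<otimes>\<^bsub>KP.TA\<^esub> S"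
      "S \<otimes>\<^bsub>KP.TA\<^esub> (P \<ominus>\<^bsub>KP.TA\<^esub> Q) = S \<otimes>\<^bsub>KP.TA\<^esub> P \<ominus>\<^bsub>KP.TA\<^esub> S \<otimes>\<^bsub>KP.TA\<^esub> Q"
      using that PQ KP.tensor_mult_closed by (metis TA.add.inv_solve_right TA.minus_eq TA.a_inv_closed)+
  qed
  have Uz: "W \<bullet> \<zero>\<^bsub>A\<^esub> = \<zero>\<^bsub>A\<^esub>" if "W \<in> carrier KP.TA" for W
    using env_act[OF that] T.act_zero by auto
  have Ud: "W \<bullet> (x \<ominus>\<^bsub>A\<^esub> y) = W \<bullet> x \<ominus>\<^bsub>A\<^esub> W \<bullet> y" if "W \<in> carrier KP.TA" "x \<in> carrier A" "y \<in> carrier A" for W x y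
  proof -
    have "W \<bullet> (x \<ominus>\<^bsub>A\<^esub> y) \<oplus>\<^bsub>A\<^esub> W \<bullet> y = W \<bullet> x"
      using env_add_right[OF that(1), of "x \<ominus>\<^bsub>A\<^esub> y" y] that by (simp add: M.minus_eq M.a_assoc M.l_neg)
    then show ?thesis
      using that env_closed M.minus_closed by (metis M.add.inv_solve_right M.minus_eq M.a_inv_closed)
  qed
  show ?thesis
    using U
  proof (induction U rule: KP.tensor_induct)
    case zero
    then show ?case using V a by (simp add: mz env_zero env_closed)
  next
    case (diff P Q)
    then show ?case using V a by (simp add: md env_diff env_closed KP.tensor_mult_closed)
  next
    case (pure x y)
    have p: "KP.cls (frag_of (x, y)) \<in> carrier KP.TA" using pure by (intro KP.class_closed) simp
    show ?case
      using V
    proof (induction V rule: KP.tensor_induct)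
      case zero
      then show ?case using a p by (simp add: mz env_zero Uz)
    next
      case (diff P Q)
      then show ?case using a p by (simp add: md env_diff env_closed KP.tensor_mult_closed Ud)
    next
      case (pure x' y')
      have "KP.cls (frag_of (x, y)) \<otimes>\<^bsub>KP.TA\<^esub> KP.cls (frag_of (x', y')) = KP.cls (frag_of (x \<otimes>\<^bsub>A\<^esub> x', y \<otimes>\<^bsub>A\<^esub> y'))"
        using pure \<open>x \<in> carrier KA\<close> \<open>y \<in> carrier KA\<close> by (subst KP.mult_tensor) simp_all
      then show ?case
        using pure \<open>x \<in> carrier KA\<close> \<open>y \<in> carrier KA\<close> a by (simp add: env_pure mult_closed sandwich)
    qed
  qed
qed

lemma EM_simps: "carrier (enveloping_module A) = carrier A" "\<zero>\<^bsub>enveloping_module A\<^esub> = \<zero>\<^bsub>A\<^esub>"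
  "add (enveloping_module A) = add A"
  by (simp_all add: enveloping_module_def)

lemma EM_module: "Module.module ER (enveloping_module A)"
proof (rule moduleI[OF ER_cring])
  show "abelian_group (enveloping_module A)"
    by (rule abelian_group_cong[OF algebra_abelian_group]) (simp_all add: EM_simps)
  show "\<one>\<^bsub>ER\<^esub> \<bullet> a = a" if "a \<in> carrier (enveloping_module A)" for a
    using that env_pure[of "\<one>\<^bsub>A\<^esub>" "\<one>\<^bsub>A\<^esub>" a] by (simp add: ER_simps EM_simps KP.one_tensor l_one r_one)
qed (simp_all add: ER_simps EM_simps env_closed env_add env_add_right env_mult)

end

section \<open>From minimal faithfulness to a cyclic vector\<close>

context nuclear_subalgebra
begin

text \<open>Turns faithfulness of the module into the coefficient form required by
  \<open>cyclic_vector\<close>. The element \<open>U\<close>, the sum of the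
  \<open>c p (k i \<otimes> k j)\<close>, acts as \<open>act c\<close>, hence is zero; a product of
  two dual functionals then reads off each coefficient. In effect the basis tensors are shown to be
  independent.\<close>

lemma ER_faithful_coeffs:
  assumes faithful: "faithful_module ER (enveloping_module A)"
    and c: "c \<in> I \<times> I \<rightarrow> carrier F" and zero: "\<And>x. x \<in> carrier A \<Longrightarrow> T.act c x = \<zero>\<^bsub>A\<^esub>"
  shows "\<forall>p\<in>I \<times> I. c p = \<zero>\<^bsub>F\<^esub>"
proof
  fix p0 assume p0: "p0 \<in> I \<times> I"
  have pI: "fst p \<in> I" "snd p \<in> I" if "p \<in> I \<times> I" for p using that by auto
  have cp: "c p \<in> carrier F" if "p \<in> I \<times> I" for p using c that by auto
  have cK: "c p \<odot>\<^bsub>A\<^esub> k (fst p) \<in> K" if "p \<in> I \<times> I" for p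
    using submodule.smult_closed[OF K_submodule cp[OF that] k_K] pI[OF that] by simp
  define f where "f p = KP.cls (frag_of (c p \<odot>\<^bsub>A\<^esub> k (fst p), k (snd p)))" for p
  have f: "f p \<in> carrier KP.TA" if "p \<in> I \<times> I" for p
    unfolding f_def by (rule KP.class_closed) (use cK k_K pI that in auto)
  define U where "U = (\<Oplus>\<^bsub>KP.TA\<^esub>p\<in>I \<times> I. f p)"
  interpret TA: abelian_group KP.TA by (rule KP.tensor_abelian_group)
  have U: "U \<in> carrier KP.TA" unfolding U_def by (rule TA.finsum_closed) (use f in auto)
  have "U \<bullet> x = T.act c x" if x: "x \<in> carrier A" for x
  proof -
    have "U \<bullet> x = (\<Oplus>\<^bsub>A\<^esub>p\<in>I \<times> I. f p \<bullet> x)"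
      unfolding U_def
      by (rule finsum_hom[OF KP.tensor_abelian_group algebra_abelian_group, where h = "\<lambda>U. U \<bullet> x"])
        (use f x env_closed env_add in auto)
    also have "\<dots> = T.act c x"
      unfolding T.act_def
    proof (rule M.finsum_cong'[OF refl])
      fix p assume p: "p \<in> I \<times> I"
      then show "f p \<bullet> x = c p \<odot>\<^bsub>A\<^esub> t p x"
        using cK[OF p] k_K pI[OF p] cp[OF p] x
        by (simp add: f_def env_pure t_def smult_mult_left mult_closed)
    qed (use T.summand_closed[OF c x] in auto)
    finally show ?thesis .
  qed
  then have U0: "U = \<zero>\<^bsub>KP.TA\<^esub>"
    using faithful U zero unfolding faithful_module_def by (simp add: ER_simps EM_simps)
  have kA: "k \<in> I \<rightarrow> carrier A" using k_K by auto
  obtain g where g: "linear_functional F A g" "g (k (fst p0)) = \<one>\<^bsub>F\<^esub>"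
      "\<And>q. \<lbrakk>q \<in> I; q \<noteq> fst p0\<rbrakk> \<Longrightarrow> g (k q) = \<zero>\<^bsub>F\<^esub>"
    using dual_functional[OF fin_dim finite_I kA k_indep pI(1)[OF p0]] by blast
  obtain g' where g': "linear_functional F A g'" "g' (k (snd p0)) = \<one>\<^bsub>F\<^esub>"
      "\<And>q. \<lbrakk>q \<in> I; q \<noteq> snd p0\<rbrakk> \<Longrightarrow> g' (k q) = \<zero>\<^bsub>F\<^esub>"
    using dual_functional[OF fin_dim finite_I kA k_indep pI(2)[OF p0]] by blast
  have gc: "g x \<in> carrier F" "g' x \<in> carrier F" if "x \<in> carrier A" for x
    using g(1) g'(1) that by (auto simp: linear_functional_def)
  have gl: "g (x \<oplus>\<^bsub>A\<^esub> y) = g x \<oplus>\<^bsub>F\<^esub> g y"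
    "g' (x \<oplus>\<^bsub>A\<^esub> y) = g' x \<oplus>\<^bsub>F\<^esub> g' y"
    if "x \<in> carrier A" "y \<in> carrier A" for x y
    using g(1) g'(1) that by (auto simp: linear_functional_def)
  have gs: "g (r \<odot>\<^bsub>A\<^esub> x) = r \<otimes>\<^bsub>F\<^esub> g x" "g' (r \<odot>\<^bsub>A\<^esub> x) = r \<otimes>\<^bsub>F\<^esub> g' x"
    if "r \<in> carrier F" "x \<in> carrier A" for r x
    using g(1) g'(1) that by (auto simp: linear_functional_def)
  \<comment> \<open>This functional is one on the basis tensor with index \<open>p0\<close> and zero
    on all others.\<close>
  interpret L: balanced_map F KA KA F "\<lambda>p. g (fst p) \<otimes>\<^bsub>F\<^esub> g' (snd p)"
    by (intro balanced_map.intro balanced_map_axioms.intro KP.algebra_pair_axioms R.abelian_group_axioms)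
      (simp_all add: gc gl gs R.l_distr R.r_distr R.m_ac)
  have "L.lift U = (\<Oplus>\<^bsub>F\<^esub>p\<in>I \<times> I. L.lift (f p))"
    unfolding U_def
    by (rule finsum_hom[OF KP.tensor_abelian_group R.abelian_group_axioms])
      (use f L.lift_closed L.lift_add in auto)
  also have "\<dots> = (\<Oplus>\<^bsub>F\<^esub>p\<in>I \<times> I. if p0 = p then c p else \<zero>\<^bsub>F\<^esub>)"
  proof (rule R.finsum_cong'[OF refl])
    fix p assume p: "p \<in> I \<times> I"
    have "L.lift (f p) = c p \<otimes>\<^bsub>F\<^esub> g (k (fst p)) \<otimes>\<^bsub>F\<^esub> g' (k (snd p))"
      unfolding f_def using cK[OF p] k_K pI[OF p] cp[OF p] by (subst L.lift_pure) (simp_all add: gs gc)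
    also have "\<dots> = (if p0 = p then c p else \<zero>\<^bsub>F\<^esub>)"
    proof (cases "p0 = p")
      case False
      then have "fst p \<noteq> fst p0 \<or> snd p \<noteq> snd p0" by (auto simp: prod_eq_iff)
      then show ?thesis
        using g(3) g'(3) gc[of "k (fst p)"] gc[of "k (snd p)"] k_K pI[OF p] cp[OF p] False by auto
    qed (use g g' cp p in auto)
    finally show "L.lift (f p) = (if p0 = p then c p else \<zero>\<^bsub>F\<^esub>)" .
  qed (use cp in auto)
  also have "\<dots> = c p0"
    by (rule R.finsum_singleton) (use p0 finite_I c in auto)
  finally show "c p0 = \<zero>\<^bsub>F\<^esub>" using L.lift_zero U0 by simp
qed

text \<open>\<open>cyclic_vector\<close> provides \<open>a\<close> with trivial annihilator. The
  submodule \<open>N\<close>, spanned by \<open>K a K\<close>, is then already faithful, so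
  minimality, applied to the section \<open>N / 0\<close>, gives \<open>N = A\<close>.\<close>

theorem minimal_cyclic:
  assumes mf: "minimally_faithful ER (enveloping_module A)"
    and reduced: "\<And>c x. \<lbrakk>c \<in> I \<times> I \<rightarrow> carrier F; x \<in> carrier A; T.act c (T.act c x) = \<zero>\<^bsub>A\<^esub>\<rbrakk> \<Longrightarrow> T.act c x = \<zero>\<^bsub>A\<^esub>"
  obtains a where "a \<in> carrier A" and "indep_family F A (I \<times> I) (\<lambda>p. t p a)"
    and "\<And>x. x \<in> carrier A \<Longrightarrow> \<exists>c\<in>I \<times> I \<rightarrow> carrier F. x = T.act c a"
proof -
  have faithful: "faithful_module ER (enveloping_module A)" using mf by (simp add: minimally_faithful_def)
  obtain a where a: "a \<in> carrier A" "indep_family F A (I \<times> I) (\<lambda>p. t p a)"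
  proof (rule T.cyclic_vector)
    show "\<forall>p\<in>I \<times> I. c p = \<zero>\<^bsub>F\<^esub>"
      if "c \<in> I \<times> I \<rightarrow> carrier F" "\<And>x. x \<in> carrier A \<Longrightarrow> T.act c x = \<zero>\<^bsub>A\<^esub>" for c
      by (rule ER_faithful_coeffs[OF faithful that])
  qed (use reduced in auto)
  define G where "G = (\<lambda>(x, y). (x \<otimes>\<^bsub>A\<^esub> a) \<otimes>\<^bsub>A\<^esub> y) ` (K \<times> K)"
  have Gc: "G \<subseteq> carrier A" using a by (auto simp: G_def mult_closed)
  define N where "N = span G"
  have N: "submodule F N A" unfolding N_def by (rule span_is_submodule[OF Gc])
  interpret N: submodule F N A by (rule N)
  have GN: "G \<subseteq> N" unfolding N_def by (rule in_own_span[OF Gc])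
  have Nc: "x \<in> carrier A" if "x \<in> N" for x using N.subset that by blast
  have Nm: "x \<ominus>\<^bsub>A\<^esub> y \<in> N" if "x \<in> N" "y \<in> N" for x y
    using N.m_closed[OF that(1) N.smult_closed[of "\<ominus>\<^bsub>F\<^esub> \<one>\<^bsub>F\<^esub>" y]] that Nc
    by (simp add: smult_l_minus a_minus_def)
  \<comment> \<open>Stability under sandwiching is a linear condition on \<open>v\<close>, so the
    generators suffice.\<close>
  have NK: "(x \<otimes>\<^bsub>A\<^esub> v) \<otimes>\<^bsub>A\<^esub> y \<in> N" if x: "x \<in> K" and y: "y \<in> K" and v: "v \<in> N" for x y v
  proof -
    define S where "S = {v \<in> carrier A. (x \<otimes>\<^bsub>A\<^esub> v) \<otimes>\<^bsub>A\<^esub> y \<in> N}"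
    have "submodule F S A"
      by (intro submodule.intro module_axioms)
        (use x y N.zero_closed in \<open>auto simp: S_def l_distr r_distr smult_mult_left smult_mult_right mult_closed
          mult_zero_left mult_zero_right\<close>)
    moreover have "G \<subseteq> S"
    proof
      fix g assume "g \<in> G"
      then obtain x' y' where g: "g = (x' \<otimes>\<^bsub>A\<^esub> a) \<otimes>\<^bsub>A\<^esub> y'" "x' \<in> K" "y' \<in> K" by (auto simp: G_def)
      have "(x \<otimes>\<^bsub>A\<^esub> g) \<otimes>\<^bsub>A\<^esub> y = ((x \<otimes>\<^bsub>A\<^esub> x') \<otimes>\<^bsub>A\<^esub> a) \<otimes>\<^bsub>A\<^esub> (y \<otimes>\<^bsub>A\<^esub> y')"
        unfolding g(1) by (rule sandwich) (use g x y a in auto)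
      also have "\<dots> \<in> G" using g x y by (auto simp: G_def)
      finally show "g \<in> S" using GN Gc \<open>g \<in> G\<close> by (auto simp: S_def)
    qed
    ultimately have "v \<in> S" using span_is_subset v unfolding N_def by blast
    then show ?thesis by (simp add: S_def)
  qed
  have NU: "U \<bullet> v \<in> N" if "U \<in> carrier KP.TA" and v: "v \<in> N" for U v
    using that(1)
  proof (induction U rule: KP.tensor_induct)
    case zero
    then show ?case using v Nc by (simp add: env_zero)
  next
    case (diff U V)
    then show ?case using v Nc Nm by (simp only: env_diff)
  next
    case (pure x y)
    then show ?case using v Nc NK by (simp add: env_pure)
  qed
  \<comment> \<open>Minimality speaks of sections; \<open>N\<close> enters as its quotient by zero,
    whose elements are the singletons \<open>{x}\<close>.\<close>
  let ?M = "enveloping_module A" and ?Q = "quotient_module (enveloping_module A\<lparr>carrier := N\<rparr>) {\<zero>\<^bsub>A\<^esub>}"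
  have subN: "submodule ER N ?M"
    by (intro submodule.intro EM_module) (use N.subset NU in \<open>simp_all add: EM_simps ER_simps\<close>)
  have MN: "Module.module ER (?M\<lparr>carrier := N\<rparr>)"
    by (rule LinearCombinations.module.submodule_is_module[OF EM_module subN])
  have Uz: "U \<bullet> \<zero>\<^bsub>A\<^esub> = \<zero>\<^bsub>A\<^esub>" if "U \<in> carrier KP.TA" for U
    using env_act[OF that] T.act_zero by auto
  have sub0: "submodule ER {\<zero>\<^bsub>A\<^esub>} (?M\<lparr>carrier := N\<rparr>)"
    by (intro submodule.intro MN) (use Uz in \<open>simp_all add: EM_simps ER_simps\<close>)
  have coset: "{\<zero>\<^bsub>A\<^esub>} +>\<^bsub>?M\<lparr>carrier := N\<rparr>\<^esub> x = {x}" if "x \<in> carrier A" for x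
    using that by (simp add: a_r_coset_def r_coset_def EM_simps)
  have faithQ: "faithful_module ER ?Q"
    unfolding faithful_module_def
  proof (intro ballI impI)
    fix r assume r: "r \<in> carrier ER" and z: "\<forall>x\<in>carrier ?Q. r \<odot>\<^bsub>?Q\<^esub> x = \<zero>\<^bsub>?Q\<^esub>"
    have rT: "r \<in> carrier KP.TA" using r by (simp add: ER_simps)
    have aN: "a \<in> N"
    proof -
      have "(\<one>\<^bsub>A\<^esub> \<otimes>\<^bsub>A\<^esub> a) \<otimes>\<^bsub>A\<^esub> \<one>\<^bsub>A\<^esub> \<in> G" by (auto simp: G_def)
      then show ?thesis using GN a by (auto simp: l_one r_one)
    qed
    \<comment> \<open>An element that kills the quotient kills \<open>a\<close>, so its coefficients
      vanish by independence of the \<open>t p a\<close>, and it acts as zero on all of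
      \<open>A\<close>.\<close>
    have "{a} \<in> carrier ?Q"
      unfolding quotient_module_def A_RCOSETS_def' using coset[OF a(1)] aN by force
    then have "r \<odot>\<^bsub>?Q\<^esub> {a} = \<zero>\<^bsub>?Q\<^esub>" using z by blast
    moreover have "r \<odot>\<^bsub>?Q\<^esub> {a} = {r \<bullet> a}"
      using coset[OF env_closed[OF rT a(1)]] by (simp add: quotient_module_def)
    moreover have "\<zero>\<^bsub>?Q\<^esub> = {\<zero>\<^bsub>A\<^esub>}" by (simp add: quotient_module_def)
    ultimately have ra: "r \<bullet> a = \<zero>\<^bsub>A\<^esub>" by simp
    obtain c where c: "c \<in> I \<times> I \<rightarrow> carrier F" "\<forall>b\<in>carrier A. r \<bullet> b = T.act c b" using env_act[OF rT] by blast
    have c0: "\<forall>p\<in>I \<times> I. c p = \<zero>\<^bsub>F\<^esub>"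
    proof -
      have "(\<Oplus>\<^bsub>A\<^esub>p\<in>I \<times> I. c p \<odot>\<^bsub>A\<^esub> t p a) = \<zero>\<^bsub>A\<^esub>"
        using c(2) a(1) ra by (simp add: T.act_def)
      then show ?thesis using a(2) c(1) unfolding indep_family_def by blast
    qed
    have "r \<bullet> b = \<zero>\<^bsub>A\<^esub>" if b: "b \<in> carrier A" for b
    proof -
      have "T.act c b = (\<Oplus>\<^bsub>A\<^esub>p\<in>I \<times> I. \<zero>\<^bsub>A\<^esub>)"
        unfolding T.act_def by (rule M.finsum_cong') (use c0 b T.t_closed in auto)
      then show ?thesis using c b by simp
    qed
    then show "r = \<zero>\<^bsub>ER\<^esub>" using faithful r unfolding faithful_module_def by (simp add: EM_simps)
  qed
  have "N = carrier ?M"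
    using mf subN sub0 faithQ unfolding minimally_faithful_def by blast
  then have NA: "N = carrier A" by (simp add: EM_simps)
  \<comment> \<open>\<open>N\<close> was generated by sandwiches with arbitrary elements of
    \<open>K\<close>; the combinations \<open>act c a\<close> of basis sandwiches form a submodule
    that contains them.\<close>
  define S where "S = {x. \<exists>c\<in>I \<times> I \<rightarrow> carrier F. x = T.act c a}"
  have "submodule F S A"
  proof (intro submodule.intro module_axioms)
    show "S \<subseteq> carrier A" using T.act_closed a by (auto simp: S_def)
    have "T.act (\<lambda>_. \<zero>\<^bsub>F\<^esub>) a = (\<Oplus>\<^bsub>A\<^esub>p\<in>I \<times> I. \<zero>\<^bsub>A\<^esub>)"
      unfolding T.act_def by (rule M.finsum_cong') (use a T.t_closed in auto)
    then show zS: "\<zero>\<^bsub>A\<^esub> \<in> S" by (auto simp: S_def intro!: bexI[of _ "\<lambda>_. \<zero>\<^bsub>F\<^esub>"])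
    have lin: "x \<oplus>\<^bsub>A\<^esub> r \<odot>\<^bsub>A\<^esub> y \<in> S" if "x \<in> S" "y \<in> S" "r \<in> carrier F" for x y r
    proof -
      obtain c d where cd: "c \<in> I \<times> I \<rightarrow> carrier F" "x = T.act c a" "d \<in> I \<times> I \<rightarrow> carrier F" "y = T.act d a"
        using \<open>x \<in> S\<close> \<open>y \<in> S\<close> unfolding S_def by blast
      have "(\<lambda>p. c p \<oplus>\<^bsub>F\<^esub> r \<otimes>\<^bsub>F\<^esub> d p) \<in> I \<times> I \<rightarrow> carrier F" using cd(1,3) that(3) by (auto simp: Pi_iff)
      moreover have "T.act (\<lambda>p. c p \<oplus>\<^bsub>F\<^esub> r \<otimes>\<^bsub>F\<^esub> d p) a = x \<oplus>\<^bsub>A\<^esub> r \<odot>\<^bsub>A\<^esub> y"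
        using T.act_lin_coeff[OF cd(3,1) a(1) that(3)] cd(2,4) by simp
      ultimately show ?thesis unfolding S_def by (metis (mono_tags, lifting) mem_Collect_eq)
    qed
    have Sc: "x \<in> carrier A" if "x \<in> S" for x using that T.act_closed a by (auto simp: S_def)
    show "x \<oplus>\<^bsub>A\<^esub> y \<in> S" if "x \<in> S" "y \<in> S" for x y using lin[OF that R.one_closed] Sc that by simp
    show "r \<odot>\<^bsub>A\<^esub> x \<in> S" if "r \<in> carrier F" "x \<in> S" for r x using lin[OF zS that(2,1)] Sc that by simp
  qed
  moreover have "G \<subseteq> S"
  proof
    fix g assume "g \<in> G"
    then obtain x y where xy: "g = (x \<otimes>\<^bsub>A\<^esub> a) \<otimes>\<^bsub>A\<^esub> y" "x \<in> K" "y \<in> K" by (auto simp: G_def)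
    obtain c where "c \<in> I \<times> I \<rightarrow> carrier F" "\<And>a. a \<in> carrier A \<Longrightarrow> (x \<otimes>\<^bsub>A\<^esub> a) \<otimes>\<^bsub>A\<^esub> y = T.act c a"
      by (rule pure_act[OF xy(2,3)]) (rule that)
    then show "g \<in> S" unfolding S_def xy(1) using a(1) by blast
  qed
  ultimately have "N \<subseteq> S" unfolding N_def by (intro span_is_subset)
  then have "\<And>x. x \<in> carrier A \<Longrightarrow> \<exists>c\<in>I \<times> I \<rightarrow> carrier F. x = T.act c a"
    using NA by (auto simp: S_def)
  with a show ?thesis by (rule that)
qed

end

section \<open>Splitting an etale subalgebra\<close>

text \<open>The field \<open>E\<close> of this locale will be an algebraic closure. Etaleness
  remains a property over \<open>F\<close>: its identities are pushed forward along
  \<open>\<iota>\<close> and combined with the roots that \<open>E\<close> provides.\<close>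

locale split_subalgebra = nuclear_subalgebra F A K I k + base_change F A E V \<phi> \<iota>
  for F :: "'f ring" and A :: "('f, 'a) module" and K :: "'a set" and I :: "'i set" and k :: "'i \<Rightarrow> 'a"
    and E :: "'e ring" and V :: "('e, 'v) module" and \<phi> :: "'f \<Rightarrow> 'e" and \<iota> :: "'a \<Rightarrow> 'v" +
  assumes etale: "etale_algebra F (A\<lparr>carrier := K\<rparr>)"
    and has_root: "\<lbrakk>set cs \<subseteq> carrier E; length cs \<ge> 2; last cs \<noteq> \<zero>\<^bsub>E\<^esub>\<rbrakk> \<Longrightarrow>
      \<exists>\<mu>\<in>carrier E. peval E cs \<mu> = \<zero>\<^bsub>E\<^esub>"
begin

text \<open>The image of \<open>E \<otimes> K\<close>, taken as a span inside \<open>V\<close>, so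
  that linear conditions on it need checking on the image of \<open>K\<close> only.\<close>

definition KE :: "'v set" where
  "KE = V.span (\<iota> ` K)"

lemma incl_K_carrier: "\<iota> ` K \<subseteq> carrier V"
  by auto

lemma KE_submodule: "submodule E KE V"
  unfolding KE_def by (rule V.span_is_submodule[OF incl_K_carrier])

lemma KE_carrier [simp]: "c \<in> KE \<Longrightarrow> c \<in> carrier V"
  using submodule.subset[OF KE_submodule] by blast

lemma incl_KE: "x \<in> K \<Longrightarrow> \<iota> x \<in> KE"
  unfolding KE_def using V.in_own_span[OF incl_K_carrier] by blast

lemma KE_induct: "\<lbrakk>c \<in> KE; submodule E S V; \<And>x. x \<in> K \<Longrightarrow> \<iota> x \<in> S\<rbrakk> \<Longrightarrow> c \<in> S"
  using V.span_is_subset[of "\<iota> ` K" S] unfolding KE_def by blast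

lemma incl_K_nuc: "x \<in> K \<Longrightarrow> \<iota> x \<in> nucleus V"
  by (rule incl_nucleus[OF K_nuc])

lemma KE_nucleus: "c \<in> KE \<Longrightarrow> c \<in> nucleus V"
  by (rule KE_induct[OF _ V.nucleus_submodule incl_K_nuc])

lemma KE_comm:
  assumes c: "c \<in> KE" and x: "x \<in> K"
  shows "\<iota> x \<otimes>\<^bsub>V\<^esub> c = c \<otimes>\<^bsub>V\<^esub> \<iota> x"
proof -
  have "submodule E {c \<in> carrier V. \<iota> x \<otimes>\<^bsub>V\<^esub> c = c \<otimes>\<^bsub>V\<^esub> \<iota> x} V"
    by (intro submodule.intro V.module_axioms)
      (use x in \<open>auto simp: V.l_distr V.r_distr V.smult_mult_left V.smult_mult_right V.mult_zero_left V.mult_zero_right\<close>)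
  from KE_induct[OF c this] show ?thesis
    using x K_comm by (simp add: incl_mult[symmetric])
qed

lemma KE_mult:
  assumes c: "c \<in> KE" and x: "x \<in> K"
  shows "\<iota> x \<otimes>\<^bsub>V\<^esub> c \<in> KE"
proof -
  interpret KE: submodule E KE V by (rule KE_submodule)
  have "submodule E {c \<in> carrier V. \<iota> x \<otimes>\<^bsub>V\<^esub> c \<in> KE} V"
    by (intro submodule.intro V.module_axioms)
      (use x in \<open>auto simp: V.r_distr V.smult_mult_right V.mult_zero_right\<close>)
  from KE_induct[OF c this] show ?thesis
    using x by (simp add: incl_mult[symmetric] incl_KE)
qed

lemma KE_comb:
  assumes c: "c \<in> KE"
  obtains u where "u \<in> I \<rightarrow> carrier E" and "c = (\<Oplus>\<^bsub>V\<^esub>i\<in>I. u i \<odot>\<^bsub>V\<^esub> \<iota> (k i))"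
proof -
  have kV: "\<iota> (k i) \<in> carrier V" if "i \<in> I" for i using k_K[OF that] by simp
  define S where "S = {c. \<exists>u\<in>I \<rightarrow> carrier E. c = (\<Oplus>\<^bsub>V\<^esub>i\<in>I. u i \<odot>\<^bsub>V\<^esub> \<iota> (k i))}"
  have "submodule E S V"
  proof (intro submodule.intro V.module_axioms)
    show "S \<subseteq> carrier V" using kV by (auto simp: S_def intro!: V.M.finsum_closed)
    have "(\<Oplus>\<^bsub>V\<^esub>i\<in>I. \<zero>\<^bsub>E\<^esub> \<odot>\<^bsub>V\<^esub> \<iota> (k i)) = (\<Oplus>\<^bsub>V\<^esub>i\<in>I. \<zero>\<^bsub>V\<^esub>)"
      by (rule V.M.finsum_cong') (use kV in auto)
    then show "\<zero>\<^bsub>V\<^esub> \<in> S" by (auto simp: S_def intro!: bexI[of _ "\<lambda>_. \<zero>\<^bsub>E\<^esub>"])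
  next
    fix x y assume "x \<in> S" "y \<in> S"
    then obtain u w where uw: "u \<in> I \<rightarrow> carrier E" "x = (\<Oplus>\<^bsub>V\<^esub>i\<in>I. u i \<odot>\<^bsub>V\<^esub> \<iota> (k i))"
      "w \<in> I \<rightarrow> carrier E" "y = (\<Oplus>\<^bsub>V\<^esub>i\<in>I. w i \<odot>\<^bsub>V\<^esub> \<iota> (k i))" by (auto simp: S_def)
    have "(\<Oplus>\<^bsub>V\<^esub>i\<in>I. (u i \<oplus>\<^bsub>E\<^esub> w i) \<odot>\<^bsub>V\<^esub> \<iota> (k i)) = (\<Oplus>\<^bsub>V\<^esub>i\<in>I. u i \<odot>\<^bsub>V\<^esub> \<iota> (k i) \<oplus>\<^bsub>V\<^esub> w i \<odot>\<^bsub>V\<^esub> \<iota> (k i))"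
      by (rule V.M.finsum_cong') (use uw(1,3) kV in \<open>auto simp: V.smult_l_distr Pi_iff\<close>)
    also have "\<dots> = x \<oplus>\<^bsub>V\<^esub> y"
      unfolding uw(2,4) by (rule V.M.finsum_addf) (use uw(1,3) kV in auto)
    finally show "x \<oplus>\<^bsub>V\<^esub> y \<in> S"
      using uw(1,3) by (auto simp: S_def Pi_iff intro!: bexI[of _ "\<lambda>i. u i \<oplus>\<^bsub>E\<^esub> w i"])
  next
    fix r x assume r: "r \<in> carrier E" and "x \<in> S"
    then obtain u where u: "u \<in> I \<rightarrow> carrier E" "x = (\<Oplus>\<^bsub>V\<^esub>i\<in>I. u i \<odot>\<^bsub>V\<^esub> \<iota> (k i))" by (auto simp: S_def)
    have "r \<odot>\<^bsub>V\<^esub> x = (\<Oplus>\<^bsub>V\<^esub>i\<in>I. r \<odot>\<^bsub>V\<^esub> (u i \<odot>\<^bsub>V\<^esub> \<iota> (k i)))"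
      unfolding u(2)
      by (rule finsum_hom[OF V.algebra_abelian_group V.algebra_abelian_group])
        (use r u(1) kV in \<open>auto simp: V.smult_r_distr\<close>)
    also have "\<dots> = (\<Oplus>\<^bsub>V\<^esub>i\<in>I. (r \<otimes>\<^bsub>E\<^esub> u i) \<odot>\<^bsub>V\<^esub> \<iota> (k i))"
      by (rule V.M.finsum_cong') (use u(1) r kV in \<open>auto simp: V.smult_assoc1 Pi_iff\<close>)
    finally show "r \<odot>\<^bsub>V\<^esub> x \<in> S"
      using u(1) r by (auto simp: S_def Pi_iff intro!: bexI[of _ "\<lambda>i. r \<otimes>\<^bsub>E\<^esub> u i"])
  qed
  moreover have "\<iota> x \<in> S" if x: "x \<in> K" for x
  proof -
    obtain r where r: "r \<in> I \<rightarrow> carrier F" "x = (\<Oplus>\<^bsub>A\<^esub>i\<in>I. r i \<odot>\<^bsub>A\<^esub> k i)" using k_span[OF x] by blast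
    have "\<iota> x = (\<Oplus>\<^bsub>V\<^esub>i\<in>I. \<iota> (r i \<odot>\<^bsub>A\<^esub> k i))"
      unfolding r(2) by (rule incl_finsum) (use r(1) k_K in auto)
    also have "\<dots> = (\<Oplus>\<^bsub>V\<^esub>i\<in>I. \<phi> (r i) \<odot>\<^bsub>V\<^esub> \<iota> (k i))"
      by (rule V.M.finsum_cong') (use r(1) k_K kV in \<open>auto simp: incl_smult Pi_iff\<close>)
    finally show ?thesis using r(1) by (auto simp: S_def Pi_iff intro!: bexI[of _ "\<lambda>i. \<phi> (r i)"])
  qed
  ultimately have "c \<in> S" using KE_induct[OF c] by blast
  then show ?thesis using that by (auto simp: S_def)
qed

text \<open>The condition \<open>\<iota> e u = u\<close> supplies each coefficient with the factor
  \<open>e\<close>. With \<open>e = \<epsilon> i\<close>, the identities of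
  \<open>etale_decomposition\<close> become identities for operators on \<open>V\<close>.\<close>

lemma incl_horner:
  assumes cs: "set cs \<subseteq> carrier F" and x: "x \<in> K" and e: "e \<in> K" and u: "u \<in> carrier V" "\<iota> e \<otimes>\<^bsub>V\<^esub> u = u"
  shows "horner V (\<lambda>y. \<iota> x \<otimes>\<^bsub>V\<^esub> y) (map \<phi> cs) u = \<iota> (horner KA (\<lambda>y. x \<otimes>\<^bsub>A\<^esub> y) cs e) \<otimes>\<^bsub>V\<^esub> u"
    and "horner_deriv V (\<lambda>y. \<iota> x \<otimes>\<^bsub>V\<^esub> y) (map \<phi> cs) u = \<iota> (horner_deriv KA (\<lambda>y. x \<otimes>\<^bsub>A\<^esub> y) cs e) \<otimes>\<^bsub>V\<^esub> u"
    and "horner KA (\<lambda>y. x \<otimes>\<^bsub>A\<^esub> y) cs e \<in> K" "horner_deriv KA (\<lambda>y. x \<otimes>\<^bsub>A\<^esub> y) cs e \<in> K"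
proof -
  interpret K: submodule F K A by (rule K_submodule)
  let ?h = "\<lambda>cs. horner KA (\<lambda>y. x \<otimes>\<^bsub>A\<^esub> y) cs e" and ?d = "\<lambda>cs. horner_deriv KA (\<lambda>y. x \<otimes>\<^bsub>A\<^esub> y) cs e"
  have K: "?h cs \<in> K \<and> ?d cs \<in> K" if "set cs \<subseteq> carrier F" for cs
    using that by (induction cs) (use x e in auto)
  show "?h cs \<in> K" "?d cs \<in> K" using K[OF cs] by auto
  have assoc: "\<iota> (x \<otimes>\<^bsub>A\<^esub> y) \<otimes>\<^bsub>V\<^esub> u = \<iota> x \<otimes>\<^bsub>V\<^esub> (\<iota> y \<otimes>\<^bsub>V\<^esub> u)" if "y \<in> K" for y
    using that x u by (simp add: incl_mult V.nucleus_assoc(1)[OF incl_K_nuc[OF x]])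
  have "horner V (\<lambda>y. \<iota> x \<otimes>\<^bsub>V\<^esub> y) (map \<phi> cs) u = \<iota> (?h cs) \<otimes>\<^bsub>V\<^esub> u \<and>
    horner_deriv V (\<lambda>y. \<iota> x \<otimes>\<^bsub>V\<^esub> y) (map \<phi> cs) u = \<iota> (?d cs) \<otimes>\<^bsub>V\<^esub> u"
    using cs
  proof (induction cs)
    case Nil
    then show ?case using u by (simp add: incl_zero V.mult_zero_left)
  next
    case (Cons c cs)
    have h: "?h cs \<in> K" "?d cs \<in> K" "c \<in> carrier F" using K Cons.prems by auto
    have hx: "x \<otimes>\<^bsub>A\<^esub> ?h cs \<in> K" "x \<otimes>\<^bsub>A\<^esub> ?d cs \<in> K" using h x by auto
    show ?case
      using Cons h hx e u
      by (simp add: incl_add incl_smult V.l_distr V.smult_mult_left assoc)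
  qed
  then show "horner V (\<lambda>y. \<iota> x \<otimes>\<^bsub>V\<^esub> y) (map \<phi> cs) u = \<iota> (?h cs) \<otimes>\<^bsub>V\<^esub> u"
    "horner_deriv V (\<lambda>y. \<iota> x \<otimes>\<^bsub>V\<^esub> y) (map \<phi> cs) u = \<iota> (?d cs) \<otimes>\<^bsub>V\<^esub> u" by auto
qed

text \<open>Simultaneous diagonalisation of the \<open>k j\<close> on each piece
  \<open>Ui i\<close>, adding one index at a time. A joint eigenvector for \<open>J\<close> lies in
  the joint eigenspace \<open>S\<close> with its eigenvalues; multiplication by the next
  \<open>k j\<close> preserves \<open>S\<close>, is killed by the separable polynomial, and so
  splits the vector into eigenvectors within \<open>S\<close>. Summing the images of the
  \<open>\<epsilon> i\<close> gives the unit.\<close>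

lemma one_in_eigenspan:
  "\<one>\<^bsub>V\<^esub> \<in> V.span {c \<in> KE. \<forall>j\<in>I. \<exists>\<mu>\<in>carrier E. \<iota> (k j) \<otimes>\<^bsub>V\<^esub> c = \<mu> \<odot>\<^bsub>V\<^esub> c}"
proof -
  interpret C: submodule E KE V by (rule KE_submodule)
  obtain m :: nat and \<epsilon> where raw: "\<forall>i<m. \<epsilon> i \<in> carrier KA"
    "(\<Oplus>\<^bsub>KA\<^esub>i\<in>{..<m}. \<epsilon> i) = \<one>\<^bsub>KA\<^esub>" "\<forall>i<m. \<epsilon> i \<otimes>\<^bsub>KA\<^esub> \<epsilon> i = \<epsilon> i"
    "\<forall>i<m. \<forall>x\<in>carrier KA. \<exists>cs. set cs \<subseteq> carrier F \<and> cs \<noteq> [] \<and> last cs \<noteq> \<zero>\<^bsub>F\<^esub> \<and>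
      horner KA (\<lambda>y. x \<otimes>\<^bsub>KA\<^esub> y) cs (\<epsilon> i) = \<zero>\<^bsub>KA\<^esub> \<and>
      (\<exists>z\<in>carrier KA. z \<otimes>\<^bsub>KA\<^esub> horner_deriv KA (\<lambda>y. x \<otimes>\<^bsub>KA\<^esub> y) cs (\<epsilon> i) = \<epsilon> i)"
    using etale_decomposition(2)[OF etale subalgebra_unital[OF subalgebra]] by (elim exE conjE) (rule that)
  note \<epsilon> = raw(1)[simplified, rule_format] and sum = raw(2)[simplified]
    and idem = raw(3)[simplified, rule_format] and ann = raw(4)[simplified, rule_format]
  define Ui where "Ui i = {c \<in> KE. \<iota> (\<epsilon> i) \<otimes>\<^bsub>V\<^esub> c = c}" for i
  define Eg where "Eg i J = {c \<in> Ui i. \<forall>j\<in>J. \<exists>\<mu>\<in>carrier E. \<iota> (k j) \<otimes>\<^bsub>V\<^esub> c = \<mu> \<odot>\<^bsub>V\<^esub> c}" for i J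
  have Egc: "Eg i J \<subseteq> carrier V" for i J by (auto simp: Eg_def Ui_def)
  have main: "Ui i \<subseteq> V.span (Eg i J)" if i: "i < m" and J: "finite J" "J \<subseteq> I" for i J
    using J
  proof (induction J rule: finite_induct)
    case empty
    have "Eg i {} = Ui i" by (simp add: Eg_def)
    then show ?case using V.in_own_span[OF Egc[of i "{}"]] by simp
  next
    case (insert j J)
    have j: "j \<in> I" "k j \<in> K" using insert.prems k_K by auto
    obtain cs z where cs: "set cs \<subseteq> carrier F" "cs \<noteq> []" "last cs \<noteq> \<zero>\<^bsub>F\<^esub>"
      "horner KA (\<lambda>y. k j \<otimes>\<^bsub>A\<^esub> y) cs (\<epsilon> i) = \<zero>\<^bsub>A\<^esub>"
      "z \<in> K" "z \<otimes>\<^bsub>A\<^esub> horner_deriv KA (\<lambda>y. k j \<otimes>\<^bsub>A\<^esub> y) cs (\<epsilon> i) = \<epsilon> i"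
      using ann[OF i j(2)] by blast
    have \<phi>cs: "set (map \<phi> cs) \<subseteq> carrier E" "map \<phi> cs \<noteq> []"
      using cs(1,2) by auto
    have "last (map \<phi> cs) \<noteq> \<zero>\<^bsub>E\<^esub>"
      using cs(3) scalar_zero_iff[OF subsetD[OF cs(1) last_in_set[OF cs(2)]]] by (simp add: last_map[OF cs(2)])
    note \<phi>cs = \<phi>cs this
    have "Eg i J \<subseteq> V.span (Eg i (insert j J))"
    proof
      fix v assume v: "v \<in> Eg i J"
      then obtain l where l: "\<forall>j\<in>J. l j \<in> carrier E \<and> \<iota> (k j) \<otimes>\<^bsub>V\<^esub> v = l j \<odot>\<^bsub>V\<^esub> v"
        unfolding Eg_def by simp metis
      \<comment> \<open>All vectors of \<open>Ui i\<close> with the same eigenvalues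
        \<open>l\<close> as \<open>v\<close>; this keeps the earlier conditions while
        \<open>k j\<close> is diagonalised.\<close>
      define S where "S = {u \<in> Ui i. \<forall>j\<in>J. \<iota> (k j) \<otimes>\<^bsub>V\<^esub> u = l j \<odot>\<^bsub>V\<^esub> u}"
      define T where "T = (\<lambda>u. \<iota> (k j) \<otimes>\<^bsub>V\<^esub> u)"
      have Sd: "u \<in> carrier V" "u \<in> KE" "\<iota> (\<epsilon> i) \<otimes>\<^bsub>V\<^esub> u = u" if "u \<in> S" for u using that by (auto simp: S_def Ui_def)
      have JK: "k j' \<in> K" if "j' \<in> J" for j' using that insert.prems k_K by auto
      have \<iota>k: "\<iota> (k j) \<in> carrier V" "\<iota> (\<epsilon> i) \<in> carrier V" using j \<epsilon>[OF i] by auto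
      have swap: "\<iota> x \<otimes>\<^bsub>V\<^esub> (\<iota> y \<otimes>\<^bsub>V\<^esub> u) = \<iota> y \<otimes>\<^bsub>V\<^esub> (\<iota> x \<otimes>\<^bsub>V\<^esub> u)" if "x \<in> K" "y \<in> K" "u \<in> carrier V" for x y u
      proof -
        have "\<iota> x \<otimes>\<^bsub>V\<^esub> (\<iota> y \<otimes>\<^bsub>V\<^esub> u) = \<iota> (x \<otimes>\<^bsub>A\<^esub> y) \<otimes>\<^bsub>V\<^esub> u"
          using that by (simp add: incl_mult V.nucleus_assoc(1)[OF incl_K_nuc])
        also have "\<dots> = \<iota> y \<otimes>\<^bsub>V\<^esub> (\<iota> x \<otimes>\<^bsub>V\<^esub> u)"
          using that K_comm[of x y] by (simp add: incl_mult V.nucleus_assoc(1)[OF incl_K_nuc])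
        finally show ?thesis .
      qed
      interpret O: linear_operator E V T S
      proof (intro linear_operator.intro linear_operator_axioms.intro)
        show "vectorspace E V" by (rule V.vectorspace_axioms)
        show "submodule E S V"
        proof (intro submodule.intro V.module_axioms)
          show "\<zero>\<^bsub>V\<^esub> \<in> S" using l \<iota>k JK by (auto simp: S_def Ui_def V.mult_zero_right)
          show "u \<oplus>\<^bsub>V\<^esub> w \<in> S" if "u \<in> S" "w \<in> S" for u w
            using that l \<iota>k JK by (auto simp: S_def Ui_def V.r_distr V.smult_r_distr)
          show "r \<odot>\<^bsub>V\<^esub> u \<in> S" if "r \<in> carrier E" "u \<in> S" for r u
            using that l \<iota>k JK
            by (auto simp: S_def Ui_def V.smult_mult_right V.smult_assoc1[symmetric] V.R.m_comm)
        qed (use Sd in auto)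
        show "T u \<in> S" if u: "u \<in> S" for u
        proof -
          have "\<iota> (\<epsilon> i) \<otimes>\<^bsub>V\<^esub> T u = T u"
            unfolding T_def using swap[OF \<epsilon>[OF i] j(2) Sd(1)[OF u]] Sd(3)[OF u] by simp
          moreover have "\<iota> (k j') \<otimes>\<^bsub>V\<^esub> T u = l j' \<odot>\<^bsub>V\<^esub> T u" if j': "j' \<in> J" for j'
          proof -
            have "\<iota> (k j') \<otimes>\<^bsub>V\<^esub> u = l j' \<odot>\<^bsub>V\<^esub> u" using u j' by (simp add: S_def)
            then show ?thesis
              unfolding T_def using swap[OF JK[OF j'] j(2) Sd(1)[OF u]] l j' \<iota>k Sd(1)[OF u]
              by (simp add: V.smult_mult_right)
          qed
          ultimately show ?thesis using KE_mult[OF Sd(2)[OF u] j(2)] by (simp add: S_def Ui_def T_def)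
        qed
        show "T (u \<oplus>\<^bsub>V\<^esub> w) = T u \<oplus>\<^bsub>V\<^esub> T w" if "u \<in> S" "w \<in> S" for u w
          using that Sd \<iota>k by (simp add: T_def V.r_distr)
        show "T (r \<odot>\<^bsub>V\<^esub> u) = r \<odot>\<^bsub>V\<^esub> T u" if "r \<in> carrier E" "u \<in> S" for r u
          using that Sd \<iota>k by (simp add: T_def V.smult_mult_right)
      qed
      interpret L: split_operator E V T S
      proof (intro split_operator.intro O.linear_operator_axioms split_operator_axioms.intro)
        show "\<exists>\<mu>\<in>carrier E. peval E cs \<mu> = \<zero>\<^bsub>E\<^esub>"
          if "set cs \<subseteq> carrier E" "length cs \<ge> 2" "last cs \<noteq> \<zero>\<^bsub>E\<^esub>" for cs by (rule has_root[OF that])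
        fix u w \<mu> assume u: "u \<in> S" and w: "w \<in> S" and \<mu>: "\<mu> \<in> carrier E"
          and Tu: "T u = \<mu> \<odot>\<^bsub>V\<^esub> u \<oplus>\<^bsub>V\<^esub> w" and Tw: "T w = \<mu> \<odot>\<^bsub>V\<^esub> w"
        \<comment> \<open>The values of the polynomial and of its derivative at
          \<open>\<mu>\<close>. On a Jordan pair, annihilation gives \<open>p u + d w = 0\<close>
          and \<open>p w = 0\<close>. If \<open>w \<noteq> 0\<close>, then \<open>p = 0\<close> and
          \<open>d w = 0\<close>; but \<open>d w\<close> is the derivative at \<open>k j\<close>
          applied to \<open>w\<close>, and \<open>z\<close> undoes this, which forces
          \<open>w = 0\<close>.\<close>
        define p d where "p = peval E (map \<phi> cs) \<mu>" and "d = peval_deriv E (map \<phi> cs) \<mu>"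
        have pd: "p \<in> carrier E" "d \<in> carrier E"
          unfolding p_def d_def using V.R.peval_closed[OF \<phi>cs(1) \<mu>] V.R.peval_deriv_closed[OF \<phi>cs(1) \<mu>] by auto
        have uw: "u \<in> carrier V" "w \<in> carrier V" using Sd u w by auto
        have "horner V T (map \<phi> cs) u = \<zero>\<^bsub>V\<^esub>"
          unfolding T_def using incl_horner(1)[OF cs(1) j(2) \<epsilon>[OF i] Sd(1,3)[OF u]] cs(4) uw
          by (simp add: incl_zero V.mult_zero_left)
        then have z: "p \<odot>\<^bsub>V\<^esub> u \<oplus>\<^bsub>V\<^esub> d \<odot>\<^bsub>V\<^esub> w = \<zero>\<^bsub>V\<^esub>"
          using O.horner_taylor[OF u w \<mu> Tu Tw \<phi>cs(1)] by (simp add: p_def d_def)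
        have "horner V T (map \<phi> cs) w = \<zero>\<^bsub>V\<^esub>"
          unfolding T_def using incl_horner(1)[OF cs(1) j(2) \<epsilon>[OF i] Sd(1,3)[OF w]] cs(4) uw
          by (simp add: incl_zero V.mult_zero_left)
        then have pw: "p \<odot>\<^bsub>V\<^esub> w = \<zero>\<^bsub>V\<^esub>"
          using O.horner_eigen(1)[OF w \<mu> Tw \<phi>cs(1)] by (simp add: p_def)
        show "w = \<zero>\<^bsub>V\<^esub>"
        proof (rule ccontr)
          assume wn: "w \<noteq> \<zero>\<^bsub>V\<^esub>"
          then have "p = \<zero>\<^bsub>E\<^esub>" using V.nonzero_smult[OF pd(1) uw(2) pw] by simp
          then have dw: "d \<odot>\<^bsub>V\<^esub> w = \<zero>\<^bsub>V\<^esub>" using z uw pd by simp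
          define hd where "hd = horner_deriv KA (\<lambda>y. k j \<otimes>\<^bsub>A\<^esub> y) cs (\<epsilon> i)"
          have hdK: "hd \<in> K" unfolding hd_def by (rule incl_horner(4)[OF cs(1) j(2) \<epsilon>[OF i] Sd(1,3)[OF w]])
          have "\<iota> hd \<otimes>\<^bsub>V\<^esub> w = d \<odot>\<^bsub>V\<^esub> w"
            using incl_horner(2)[OF cs(1) j(2) \<epsilon>[OF i] Sd(1,3)[OF w]] O.horner_eigen(2)[OF w \<mu> Tw \<phi>cs(1)]
            by (simp add: hd_def d_def T_def)
          then have "\<iota> z \<otimes>\<^bsub>V\<^esub> (\<iota> hd \<otimes>\<^bsub>V\<^esub> w) = \<zero>\<^bsub>V\<^esub>" using dw cs(5) by (simp add: V.mult_zero_right)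
          moreover have "\<iota> z \<otimes>\<^bsub>V\<^esub> (\<iota> hd \<otimes>\<^bsub>V\<^esub> w) = \<iota> (z \<otimes>\<^bsub>A\<^esub> hd) \<otimes>\<^bsub>V\<^esub> w"
            using cs(5) hdK uw by (simp add: incl_mult V.nucleus_assoc(1)[OF incl_K_nuc])
          ultimately show False using cs(6) Sd(3)[OF w] wn by (simp add: hd_def)
        qed
      qed
      have vS: "v \<in> S" using v l by (auto simp: S_def Eg_def)
      have "horner V T (map \<phi> cs) v = \<zero>\<^bsub>V\<^esub>"
        unfolding T_def using incl_horner(1)[OF cs(1) j(2) \<epsilon>[OF i] Sd(1,3)[OF vS]] cs(4) Sd(1)[OF vS]
        by (simp add: incl_zero V.mult_zero_left)
      then have "v \<in> V.span L.eigenvectors" by (rule L.annihilated_in_eigenspan[OF \<phi>cs vS])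
      moreover have "L.eigenvectors \<subseteq> Eg i (insert j J)"
      proof
        fix u assume "u \<in> L.eigenvectors"
        then have "u \<in> S" "\<exists>\<mu>\<in>carrier E. T u = \<mu> \<odot>\<^bsub>V\<^esub> u" by (simp_all add: L.eigenvectors_def)
        then show "u \<in> Eg i (insert j J)" using l by (auto simp: S_def Eg_def T_def)
      qed
      ultimately show "v \<in> V.span (Eg i (insert j J))" using V.span_is_monotone by blast
    qed
    then have "V.span (Eg i J) \<subseteq> V.span (Eg i (insert j J))"
      by (rule V.span_is_subset[OF _ V.span_is_submodule[OF Egc]])
    then show ?case using insert by auto
  qed
  let ?Eg = "{c \<in> KE. \<forall>j\<in>I. \<exists>\<mu>\<in>carrier E. \<iota> (k j) \<otimes>\<^bsub>V\<^esub> c = \<mu> \<odot>\<^bsub>V\<^esub> c}"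
  have "?Eg \<subseteq> carrier V" by auto
  then have sub: "submodule E (V.span ?Eg) V" by (rule V.span_is_submodule)
  have "\<iota> (\<epsilon> i) \<in> V.span ?Eg" if i: "i < m" for i
  proof -
    have "\<iota> (\<epsilon> i) \<in> Ui i"
      using \<epsilon>[OF i] idem[OF i] incl_KE by (simp add: Ui_def incl_mult[symmetric])
    moreover have "V.span (Eg i I) \<subseteq> V.span ?Eg"
      by (rule V.span_is_monotone) (auto simp: Eg_def Ui_def)
    ultimately show ?thesis using main[OF i finite_I subset_refl] by blast
  qed
  then have "(\<Oplus>\<^bsub>V\<^esub>i\<in>{..<m}. \<iota> (\<epsilon> i)) \<in> V.span ?Eg"
    by (intro V.finsum_span_submodule[OF sub]) auto
  moreover have "(\<Oplus>\<^bsub>V\<^esub>i\<in>{..<m}. \<iota> (\<epsilon> i)) = \<one>\<^bsub>V\<^esub>"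
  proof -
    have "(\<Oplus>\<^bsub>KA\<^esub>i\<in>{..<m}. \<epsilon> i) = (\<Oplus>\<^bsub>A\<^esub>i\<in>{..<m}. \<epsilon> i)"
      by (rule finsum_hom[OF KP.B.algebra_abelian_group algebra_abelian_group, where h = "\<lambda>x. x"])
        (use \<epsilon> in auto)
    then have "\<one>\<^bsub>A\<^esub> = (\<Oplus>\<^bsub>A\<^esub>i\<in>{..<m}. \<epsilon> i)" using sum by simp
    then have "\<iota> \<one>\<^bsub>A\<^esub> = (\<Oplus>\<^bsub>V\<^esub>i\<in>{..<m}. \<iota> (\<epsilon> i))"
      using incl_finsum[of \<epsilon> "{..<m}"] \<epsilon> by auto
    then show ?thesis by (simp add: incl_one)
  qed
  ultimately show ?thesis by simp
qed

end

section \<open>Nonvanishing corners over the splitting field\<close>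

context split_subalgebra
begin

text \<open>The unit is expanded in joint eigenvectors and the coefficients are absorbed. The
  eigenvectors themselves serve as indices; some \<open>e v\<close> may be zero and two of them may
  be proportional. An eigenvector of the basis elements is one for all of \<open>KE\<close> by
  linearity.\<close>

lemma eigen_decomposition:
  "\<exists>(P :: 'v set) e. finite P \<and> e \<in> P \<rightarrow> KE \<and> (\<Oplus>\<^bsub>V\<^esub>v\<in>P. e v) = \<one>\<^bsub>V\<^esub> \<and>
    (\<forall>v\<in>P. \<forall>c\<in>KE. \<exists>\<mu>\<in>carrier E. c \<otimes>\<^bsub>V\<^esub> e v = \<mu> \<odot>\<^bsub>V\<^esub> e v)"
proof -
  interpret C: submodule E KE V by (rule KE_submodule)
  let ?Eg = "{c \<in> KE. \<forall>j\<in>I. \<exists>\<mu>\<in>carrier E. \<iota> (k j) \<otimes>\<^bsub>V\<^esub> c = \<mu> \<odot>\<^bsub>V\<^esub> c}"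
  obtain P a where P: "finite P" "P \<subseteq> ?Eg" "a \<in> P \<rightarrow> carrier E" "V.lincomb a P = \<one>\<^bsub>V\<^esub>"
    using one_in_eigenspan unfolding V.span_def by auto
  define e where "e v = a v \<odot>\<^bsub>V\<^esub> v" for v
  have eC: "e v \<in> KE" if "v \<in> P" for v using P that by (auto simp: e_def)
  have eig: "\<exists>\<mu>\<in>carrier E. c \<otimes>\<^bsub>V\<^esub> e v = \<mu> \<odot>\<^bsub>V\<^esub> e v" if v: "v \<in> P" and c: "c \<in> KE" for v c
  proof -
    have vE: "v \<in> KE" "\<forall>j\<in>I. \<exists>\<mu>\<in>carrier E. \<iota> (k j) \<otimes>\<^bsub>V\<^esub> v = \<mu> \<odot>\<^bsub>V\<^esub> v" using P(2) v by auto
    obtain l where l: "\<forall>j\<in>I. l j \<in> carrier E \<and> \<iota> (k j) \<otimes>\<^bsub>V\<^esub> v = l j \<odot>\<^bsub>V\<^esub> v" using vE(2) by metis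
    obtain u where u: "u \<in> I \<rightarrow> carrier E" "c = (\<Oplus>\<^bsub>V\<^esub>i\<in>I. u i \<odot>\<^bsub>V\<^esub> \<iota> (k i))" using KE_comb[OF c] by metis
    have av: "a v \<in> carrier E" using P(3) v by auto
    have vc: "v \<in> carrier V" using vE by simp
    have kV: "\<iota> (k i) \<in> carrier V" if "i \<in> I" for i using k_K[OF that] by simp
    have "c \<otimes>\<^bsub>V\<^esub> v = (\<Oplus>\<^bsub>V\<^esub>i\<in>I. (u i \<odot>\<^bsub>V\<^esub> \<iota> (k i)) \<otimes>\<^bsub>V\<^esub> v)"
      unfolding u(2) by (rule V.finsum_mult_left[OF _ vc]) (use u(1) kV in auto)
    also have "\<dots> = (\<Oplus>\<^bsub>V\<^esub>i\<in>I. (u i \<otimes>\<^bsub>E\<^esub> l i) \<odot>\<^bsub>V\<^esub> v)"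
      by (rule V.M.finsum_cong') (use u(1) kV l vc in \<open>auto simp: V.smult_mult_left V.smult_assoc1 Pi_iff\<close>)
    also have "\<dots> = (\<Oplus>\<^bsub>E\<^esub>i\<in>I. u i \<otimes>\<^bsub>E\<^esub> l i) \<odot>\<^bsub>V\<^esub> v"
      by (rule finsum_hom[OF V.R.abelian_group_axioms V.algebra_abelian_group, where h = "\<lambda>r. r \<odot>\<^bsub>V\<^esub> v", symmetric])
        (use u(1) l vc in \<open>auto simp: V.smult_l_distr Pi_iff\<close>)
    finally have cv: "c \<otimes>\<^bsub>V\<^esub> v = (\<Oplus>\<^bsub>E\<^esub>i\<in>I. u i \<otimes>\<^bsub>E\<^esub> l i) \<odot>\<^bsub>V\<^esub> v" .
    have m: "(\<Oplus>\<^bsub>E\<^esub>i\<in>I. u i \<otimes>\<^bsub>E\<^esub> l i) \<in> carrier E" by (rule V.R.finsum_closed) (use u(1) l in auto)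
    have "c \<otimes>\<^bsub>V\<^esub> e v = (\<Oplus>\<^bsub>E\<^esub>i\<in>I. u i \<otimes>\<^bsub>E\<^esub> l i) \<odot>\<^bsub>V\<^esub> e v"
      using av vc m c cv by (simp add: e_def V.smult_mult_right V.smult_assoc1[symmetric] V.R.m_comm)
    then show ?thesis using m by blast
  qed
  have "(\<Oplus>\<^bsub>V\<^esub>v\<in>P. e v) = \<one>\<^bsub>V\<^esub>" using P(4) by (simp add: V.lincomb_def e_def)
  moreover have "e \<in> P \<rightarrow> KE" using eC by blast
  ultimately show ?thesis using P(1) eig by blast
qed

text \<open>On the corner cut out by \<open>e v\<close> and \<open>e w\<close> the whole enveloping
  ring acts by scalars. This yields reducedness, hence the cyclic vector \<open>a\<close>. Cyclicity
  makes each corner a multiple of the corner of \<open>a\<close>, independence of the translates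
  makes that one nonzero, and \<open>nonzero_corner\<close> applies.\<close>

theorem corner_nonzero:
  assumes mf: "minimally_faithful ER (enveloping_module A)"
    and f: "f \<in> nucleus V" "f \<otimes>\<^bsub>V\<^esub> f = f" "f \<noteq> \<zero>\<^bsub>V\<^esub>"
    and g: "g \<in> nucleus V" "g \<otimes>\<^bsub>V\<^esub> g = g" "g \<noteq> \<zero>\<^bsub>V\<^esub>"
  obtains a where "a \<in> carrier A" and "f \<otimes>\<^bsub>V\<^esub> (\<iota> a \<otimes>\<^bsub>V\<^esub> g) \<noteq> \<zero>\<^bsub>V\<^esub>"
proof -
  obtain P e where P: "finite P" "e \<in> P \<rightarrow> KE" "(\<Oplus>\<^bsub>V\<^esub>v\<in>P. e v) = \<one>\<^bsub>V\<^esub>"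
    and eig': "\<forall>v\<in>(P :: 'v set). \<forall>c\<in>KE. \<exists>\<mu>\<in>carrier E. c \<otimes>\<^bsub>V\<^esub> e v = \<mu> \<odot>\<^bsub>V\<^esub> e v"
    using eigen_decomposition by blast
  note eig = eig'[rule_format]
  have eC: "e v \<in> KE" "e v \<in> carrier V" "e v \<in> nucleus V" if "v \<in> P" for v
    using Pi_mem[OF P(2) that] KE_nucleus by auto
  have kV: "\<iota> (k i) \<in> carrier V" if "i \<in> I" for i using k_K[OF that] by simp
  have tA: "t p x \<in> carrier A" if "p \<in> I \<times> I" "x \<in> carrier A" for p x using T.t_closed[OF that] .
  have corner_t: "\<exists>\<gamma>\<in>carrier E. \<forall>x\<in>carrier A. e v \<otimes>\<^bsub>V\<^esub> (\<iota> (t p x) \<otimes>\<^bsub>V\<^esub> e w) = \<gamma> \<odot>\<^bsub>V\<^esub> (e v \<otimes>\<^bsub>V\<^esub> (\<iota> x \<otimes>\<^bsub>V\<^esub> e w))"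
    if v: "v \<in> P" and w: "w \<in> P" and p: "p \<in> I \<times> I" for v w p
  proof -
    have p': "k (fst p) \<in> K" "k (snd p) \<in> K" using p k_K by auto
    obtain \<mu> where \<mu>: "\<mu> \<in> carrier E" "\<iota> (k (fst p)) \<otimes>\<^bsub>V\<^esub> e v = \<mu> \<odot>\<^bsub>V\<^esub> e v" using eig[OF v incl_KE[OF p'(1)]] by blast
    obtain \<nu> where \<nu>: "\<nu> \<in> carrier E" "\<iota> (k (snd p)) \<otimes>\<^bsub>V\<^esub> e w = \<nu> \<odot>\<^bsub>V\<^esub> e w" using eig[OF w incl_KE[OF p'(2)]] by blast
    have "e v \<otimes>\<^bsub>V\<^esub> (\<iota> (t p x) \<otimes>\<^bsub>V\<^esub> e w) = (\<mu> \<otimes>\<^bsub>E\<^esub> \<nu>) \<odot>\<^bsub>V\<^esub> (e v \<otimes>\<^bsub>V\<^esub> (\<iota> x \<otimes>\<^bsub>V\<^esub> e w))" if x: "x \<in> carrier A" for x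
    proof -
      let ?k = "\<iota> (k (fst p))" and ?k' = "\<iota> (k (snd p))"
      have kc: "?k \<in> carrier V" "?k' \<in> carrier V" "\<iota> x \<in> carrier V" using p' x by auto
      have "\<iota> (t p x) \<otimes>\<^bsub>V\<^esub> e w = ((?k \<otimes>\<^bsub>V\<^esub> \<iota> x) \<otimes>\<^bsub>V\<^esub> ?k') \<otimes>\<^bsub>V\<^esub> e w"
        using p' x by (simp add: t_def incl_mult mult_closed)
      also have "\<dots> = (?k \<otimes>\<^bsub>V\<^esub> \<iota> x) \<otimes>\<^bsub>V\<^esub> (?k' \<otimes>\<^bsub>V\<^esub> e w)"
        using V.nucleus_assoc(2)[OF incl_K_nuc[OF p'(2)]] kc eC[OF w] by (simp add: V.mult_closed)
      also have "\<dots> = \<nu> \<odot>\<^bsub>V\<^esub> (?k \<otimes>\<^bsub>V\<^esub> (\<iota> x \<otimes>\<^bsub>V\<^esub> e w))"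
        unfolding \<nu>(2) using kc \<nu>(1) eC[OF w] V.nucleus_assoc(1)[OF incl_K_nuc[OF p'(1)]]
        by (simp add: V.smult_mult_right V.mult_closed)
      finally have "e v \<otimes>\<^bsub>V\<^esub> (\<iota> (t p x) \<otimes>\<^bsub>V\<^esub> e w) = \<nu> \<odot>\<^bsub>V\<^esub> (e v \<otimes>\<^bsub>V\<^esub> (?k \<otimes>\<^bsub>V\<^esub> (\<iota> x \<otimes>\<^bsub>V\<^esub> e w)))"
        using kc \<nu>(1) eC[OF v] eC[OF w] by (simp add: V.smult_mult_right V.mult_closed)
      also have "e v \<otimes>\<^bsub>V\<^esub> (?k \<otimes>\<^bsub>V\<^esub> (\<iota> x \<otimes>\<^bsub>V\<^esub> e w)) = (e v \<otimes>\<^bsub>V\<^esub> ?k) \<otimes>\<^bsub>V\<^esub> (\<iota> x \<otimes>\<^bsub>V\<^esub> e w)"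
        using V.nucleus_assoc(1)[OF eC(3)[OF v]] kc eC[OF w] by (simp add: V.mult_closed)
      also have "e v \<otimes>\<^bsub>V\<^esub> ?k = \<mu> \<odot>\<^bsub>V\<^esub> e v" using KE_comm[OF eC(1)[OF v] p'(1)] \<mu>(2) by simp
      also have "\<nu> \<odot>\<^bsub>V\<^esub> ((\<mu> \<odot>\<^bsub>V\<^esub> e v) \<otimes>\<^bsub>V\<^esub> (\<iota> x \<otimes>\<^bsub>V\<^esub> e w)) = (\<mu> \<otimes>\<^bsub>E\<^esub> \<nu>) \<odot>\<^bsub>V\<^esub> (e v \<otimes>\<^bsub>V\<^esub> (\<iota> x \<otimes>\<^bsub>V\<^esub> e w))"
        using kc \<mu>(1) \<nu>(1) eC[OF v] eC[OF w]
        by (simp add: V.smult_mult_left V.mult_closed V.smult_assoc1[symmetric] V.R.m_comm)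
      finally show ?thesis .
    qed
    then show ?thesis using \<mu>(1) \<nu>(1) by blast
  qed
  have corner_act: "\<exists>\<gamma>\<in>carrier E. \<forall>x\<in>carrier A. e v \<otimes>\<^bsub>V\<^esub> (\<iota> (T.act c x) \<otimes>\<^bsub>V\<^esub> e w) = \<gamma> \<odot>\<^bsub>V\<^esub> (e v \<otimes>\<^bsub>V\<^esub> (\<iota> x \<otimes>\<^bsub>V\<^esub> e w))"
    if v: "v \<in> P" and w: "w \<in> P" and c: "c \<in> I \<times> I \<rightarrow> carrier F" for v w c
  proof -
    obtain \<gamma> where \<gamma>: "\<forall>p\<in>I \<times> I. \<gamma> p \<in> carrier E \<and> (\<forall>x\<in>carrier A. e v \<otimes>\<^bsub>V\<^esub> (\<iota> (t p x) \<otimes>\<^bsub>V\<^esub> e w) = \<gamma> p \<odot>\<^bsub>V\<^esub> (e v \<otimes>\<^bsub>V\<^esub> (\<iota> x \<otimes>\<^bsub>V\<^esub> e w)))"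
      using corner_t[OF v w] by metis
    have cp: "\<phi> (c p) \<in> carrier E" "c p \<in> carrier F" if "p \<in> I \<times> I" for p
      using Pi_mem[OF c that] by simp_all
    define \<delta> where "\<delta> = (\<Oplus>\<^bsub>E\<^esub>p\<in>I \<times> I. \<phi> (c p) \<otimes>\<^bsub>E\<^esub> \<gamma> p)"
    have \<delta>: "\<delta> \<in> carrier E" unfolding \<delta>_def by (rule V.R.finsum_closed) (use cp \<gamma> in auto)
    have "e v \<otimes>\<^bsub>V\<^esub> (\<iota> (T.act c x) \<otimes>\<^bsub>V\<^esub> e w) = \<delta> \<odot>\<^bsub>V\<^esub> (e v \<otimes>\<^bsub>V\<^esub> (\<iota> x \<otimes>\<^bsub>V\<^esub> e w))" if x: "x \<in> carrier A" for x
    proof -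
      let ?b = "e v \<otimes>\<^bsub>V\<^esub> (\<iota> x \<otimes>\<^bsub>V\<^esub> e w)"
      have b: "?b \<in> carrier V" using eC v w x by (simp add: V.mult_closed)
      have "e v \<otimes>\<^bsub>V\<^esub> (\<iota> (T.act c x) \<otimes>\<^bsub>V\<^esub> e w) = (\<Oplus>\<^bsub>V\<^esub>p\<in>I \<times> I. e v \<otimes>\<^bsub>V\<^esub> (\<iota> (c p \<odot>\<^bsub>A\<^esub> t p x) \<otimes>\<^bsub>V\<^esub> e w))"
        unfolding T.act_def
        by (rule finsum_hom[OF algebra_abelian_group V.algebra_abelian_group, where h = "\<lambda>y. e v \<otimes>\<^bsub>V\<^esub> (\<iota> y \<otimes>\<^bsub>V\<^esub> e w)"])
          (use eC v w T.summand_closed[OF c x] in \<open>auto simp: V.mult_closed incl_add V.l_distr V.r_distr\<close>)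
      also have "\<dots> = (\<Oplus>\<^bsub>V\<^esub>p\<in>I \<times> I. (\<phi> (c p) \<otimes>\<^bsub>E\<^esub> \<gamma> p) \<odot>\<^bsub>V\<^esub> ?b)"
      proof (rule V.M.finsum_cong'[OF refl])
        fix p assume p: "p \<in> I \<times> I"
        show "e v \<otimes>\<^bsub>V\<^esub> (\<iota> (c p \<odot>\<^bsub>A\<^esub> t p x) \<otimes>\<^bsub>V\<^esub> e w) = (\<phi> (c p) \<otimes>\<^bsub>E\<^esub> \<gamma> p) \<odot>\<^bsub>V\<^esub> ?b"
          using cp[OF p] tA[OF p x] eC[OF v] eC[OF w] bspec[OF \<gamma> p] x b
          by (simp add: incl_smult V.smult_mult_left V.smult_mult_right V.mult_closed V.smult_assoc1)
      qed (use cp \<gamma> b in auto)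
      also have "\<dots> = \<delta> \<odot>\<^bsub>V\<^esub> ?b"
        unfolding \<delta>_def
        by (rule finsum_hom[OF V.R.abelian_group_axioms V.algebra_abelian_group, where h = "\<lambda>r. r \<odot>\<^bsub>V\<^esub> ?b", symmetric])
          (use cp \<gamma> b in \<open>auto simp: V.smult_l_distr\<close>)
      finally show ?thesis .
    qed
    with \<delta> show ?thesis by blast
  qed
  \<comment> \<open>Inserting the expansion of the unit on both sides shows that vectors are
    determined by their corners.\<close>
  have total: "x = \<zero>\<^bsub>V\<^esub>" if x: "x \<in> carrier V" and z: "\<And>v w. \<lbrakk>v \<in> P; w \<in> P\<rbrakk> \<Longrightarrow> e v \<otimes>\<^bsub>V\<^esub> (x \<otimes>\<^bsub>V\<^esub> e w) = \<zero>\<^bsub>V\<^esub>" for x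
  proof -
    have z1: "x \<otimes>\<^bsub>V\<^esub> e w = \<zero>\<^bsub>V\<^esub>" if w: "w \<in> P" for w
    proof -
      have xw: "x \<otimes>\<^bsub>V\<^esub> e w \<in> carrier V" using x eC w by (simp add: V.mult_closed)
      have "(\<Oplus>\<^bsub>V\<^esub>v\<in>P. e v) \<otimes>\<^bsub>V\<^esub> (x \<otimes>\<^bsub>V\<^esub> e w) = (\<Oplus>\<^bsub>V\<^esub>v\<in>P. e v \<otimes>\<^bsub>V\<^esub> (x \<otimes>\<^bsub>V\<^esub> e w))"
        by (rule V.finsum_mult_left[OF _ xw]) (use eC in auto)
      also have "\<dots> = (\<Oplus>\<^bsub>V\<^esub>v\<in>P. \<zero>\<^bsub>V\<^esub>)" by (rule V.M.finsum_cong') (use z w in auto)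
      finally show ?thesis using P(3) xw by (simp add: V.l_one)
    qed
    have "x \<otimes>\<^bsub>V\<^esub> (\<Oplus>\<^bsub>V\<^esub>w\<in>P. e w) = (\<Oplus>\<^bsub>V\<^esub>w\<in>P. x \<otimes>\<^bsub>V\<^esub> e w)"
      by (rule V.finsum_mult_right[OF _ x]) (use eC in auto)
    also have "\<dots> = (\<Oplus>\<^bsub>V\<^esub>w\<in>P. \<zero>\<^bsub>V\<^esub>)" by (rule V.M.finsum_cong') (use z1 in auto)
    finally show ?thesis using P(3) x by (simp add: V.r_one)
  qed
  have reduced: "T.act c x = \<zero>\<^bsub>A\<^esub>"
    if c: "c \<in> I \<times> I \<rightarrow> carrier F" and x: "x \<in> carrier A" and cc: "T.act c (T.act c x) = \<zero>\<^bsub>A\<^esub>" for c x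
  proof -
    have y: "T.act c x \<in> carrier A" by (rule T.act_closed[OF c x])
    have z: "e v \<otimes>\<^bsub>V\<^esub> (\<iota> (T.act c x) \<otimes>\<^bsub>V\<^esub> e w) = \<zero>\<^bsub>V\<^esub>" if v: "v \<in> P" and w: "w \<in> P" for v w
    proof -
      let ?b = "e v \<otimes>\<^bsub>V\<^esub> (\<iota> (T.act c x) \<otimes>\<^bsub>V\<^esub> e w)" and ?d = "e v \<otimes>\<^bsub>V\<^esub> (\<iota> x \<otimes>\<^bsub>V\<^esub> e w)"
      have b: "?b \<in> carrier V" using eC v w y by (simp add: V.mult_closed)
      have b0: "?d \<in> carrier V" using eC v w x by (simp add: V.mult_closed)
      obtain \<gamma> where \<gamma>: "\<gamma> \<in> carrier E" "\<forall>x\<in>carrier A. e v \<otimes>\<^bsub>V\<^esub> (\<iota> (T.act c x) \<otimes>\<^bsub>V\<^esub> e w) = \<gamma> \<odot>\<^bsub>V\<^esub> (e v \<otimes>\<^bsub>V\<^esub> (\<iota> x \<otimes>\<^bsub>V\<^esub> e w))"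
        using corner_act[OF v w c] by blast
      \<comment> \<open>A second application of \<open>act c\<close> multiplies the corner by the
        same \<open>\<gamma>\<close>. Over a field, \<open>\<gamma> b = 0\<close> with
        \<open>b = \<gamma> d\<close> gives \<open>b = 0\<close>.\<close>
      have "\<gamma> \<odot>\<^bsub>V\<^esub> ?b = \<zero>\<^bsub>V\<^esub>"
        using bspec[OF \<gamma>(2) y] cc eC[OF v] eC[OF w] by (simp add: incl_zero V.mult_zero_left V.mult_zero_right)
      then have "\<gamma> = \<zero>\<^bsub>E\<^esub> \<or> ?b = \<zero>\<^bsub>V\<^esub>" by (rule V.nonzero_smult[OF \<gamma>(1) b])
      moreover have "?b = \<gamma> \<odot>\<^bsub>V\<^esub> ?d" using \<gamma>(2) x by blast
      ultimately show ?thesis using b0 by auto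
    qed
    have "\<iota> (T.act c x) = \<zero>\<^bsub>V\<^esub>" by (rule total[OF incl_closed[OF y]]) (rule z)
    then show ?thesis by (rule incl_inj[OF fin_dim y])
  qed
  obtain a where a: "a \<in> carrier A" "indep_family F A (I \<times> I) (\<lambda>p. t p a)"
    and gen: "\<And>x. x \<in> carrier A \<Longrightarrow> \<exists>c\<in>I \<times> I \<rightarrow> carrier F. x = T.act c a"
  proof (rule minimal_cyclic[OF mf])
    show "T.act c x = \<zero>\<^bsub>A\<^esub>"
      if "c \<in> I \<times> I \<rightarrow> carrier F" "x \<in> carrier A" "T.act c (T.act c x) = \<zero>\<^bsub>A\<^esub>" for c x
      by (rule reduced[OF that])
  qed (rule that)
  have \<iota>a: "\<iota> a \<in> carrier V" using a by simp
  have corner: "\<exists>r\<in>carrier E. e v \<otimes>\<^bsub>V\<^esub> (x \<otimes>\<^bsub>V\<^esub> e w) = r \<odot>\<^bsub>V\<^esub> (e v \<otimes>\<^bsub>V\<^esub> (\<iota> a \<otimes>\<^bsub>V\<^esub> e w))"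
    if v: "v \<in> P" and w: "w \<in> P" and x: "x \<in> carrier V" for v w x
  proof -
    let ?b = "e v \<otimes>\<^bsub>V\<^esub> (\<iota> a \<otimes>\<^bsub>V\<^esub> e w)"
    have b: "?b \<in> carrier V" using eC v w \<iota>a by (simp add: V.mult_closed)
    note ec = eC[OF v] eC[OF w]
    show ?thesis
      using x
    proof (rule generated)
      fix y assume "y \<in> carrier A"
      then obtain c where "c \<in> I \<times> I \<rightarrow> carrier F" "y = T.act c a" using gen by blast
      then show "\<exists>r\<in>carrier E. e v \<otimes>\<^bsub>V\<^esub> (\<iota> y \<otimes>\<^bsub>V\<^esub> e w) = r \<odot>\<^bsub>V\<^esub> ?b"
        using corner_act[OF v w] a(1) by blast
    next
      fix y z assume y: "y \<in> carrier V" and z: "z \<in> carrier V"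
        and "\<exists>r\<in>carrier E. e v \<otimes>\<^bsub>V\<^esub> (y \<otimes>\<^bsub>V\<^esub> e w) = r \<odot>\<^bsub>V\<^esub> ?b"
        and "\<exists>r\<in>carrier E. e v \<otimes>\<^bsub>V\<^esub> (z \<otimes>\<^bsub>V\<^esub> e w) = r \<odot>\<^bsub>V\<^esub> ?b"
      then obtain r s where rs: "r \<in> carrier E" "s \<in> carrier E"
        "e v \<otimes>\<^bsub>V\<^esub> (y \<otimes>\<^bsub>V\<^esub> e w) = r \<odot>\<^bsub>V\<^esub> ?b" "e v \<otimes>\<^bsub>V\<^esub> (z \<otimes>\<^bsub>V\<^esub> e w) = s \<odot>\<^bsub>V\<^esub> ?b" by blast
      have "e v \<otimes>\<^bsub>V\<^esub> ((y \<oplus>\<^bsub>V\<^esub> z) \<otimes>\<^bsub>V\<^esub> e w) = (r \<oplus>\<^bsub>E\<^esub> s) \<odot>\<^bsub>V\<^esub> ?b"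
        using y z rs ec b by (simp add: V.l_distr V.r_distr V.mult_closed V.smult_l_distr)
      then show "\<exists>r\<in>carrier E. e v \<otimes>\<^bsub>V\<^esub> ((y \<oplus>\<^bsub>V\<^esub> z) \<otimes>\<^bsub>V\<^esub> e w) = r \<odot>\<^bsub>V\<^esub> ?b" using rs by blast
    next
      fix r y assume r: "r \<in> carrier E" and y: "y \<in> carrier V"
        and "\<exists>r\<in>carrier E. e v \<otimes>\<^bsub>V\<^esub> (y \<otimes>\<^bsub>V\<^esub> e w) = r \<odot>\<^bsub>V\<^esub> ?b"
      then obtain s where s: "s \<in> carrier E" "e v \<otimes>\<^bsub>V\<^esub> (y \<otimes>\<^bsub>V\<^esub> e w) = s \<odot>\<^bsub>V\<^esub> ?b" by blast
      have "e v \<otimes>\<^bsub>V\<^esub> ((r \<odot>\<^bsub>V\<^esub> y) \<otimes>\<^bsub>V\<^esub> e w) = (r \<otimes>\<^bsub>E\<^esub> s) \<odot>\<^bsub>V\<^esub> ?b"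
        using y s r ec b by (simp add: V.smult_mult_left V.smult_mult_right V.mult_closed V.smult_assoc1)
      then show "\<exists>s\<in>carrier E. e v \<otimes>\<^bsub>V\<^esub> ((r \<odot>\<^bsub>V\<^esub> y) \<otimes>\<^bsub>V\<^esub> e w) = s \<odot>\<^bsub>V\<^esub> ?b" using r s by blast
    qed
  qed
  have nonzero: "e v \<otimes>\<^bsub>V\<^esub> (\<iota> a \<otimes>\<^bsub>V\<^esub> e w) \<noteq> \<zero>\<^bsub>V\<^esub>"
    if v: "v \<in> P" and w: "w \<in> P" and nz: "e v \<noteq> \<zero>\<^bsub>V\<^esub>" "e w \<noteq> \<zero>\<^bsub>V\<^esub>" for v w
  proof
    assume zero: "e v \<otimes>\<^bsub>V\<^esub> (\<iota> a \<otimes>\<^bsub>V\<^esub> e w) = \<zero>\<^bsub>V\<^esub>"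
    \<comment> \<open>In coordinates, the corner of \<open>\<iota> a\<close> is the sum of the
      \<open>u i s j \<iota> (t (i, j) a)\<close>. A functional dual to \<open>t (i0, j0) a\<close>
      maps it to \<open>u i0 s j0\<close>, a product of two nonzero field elements.\<close>
    obtain u where u: "u \<in> I \<rightarrow> carrier E" "e v = (\<Oplus>\<^bsub>V\<^esub>i\<in>I. u i \<odot>\<^bsub>V\<^esub> \<iota> (k i))" using KE_comb[OF eC(1)[OF v]] by metis
    obtain s where s: "s \<in> I \<rightarrow> carrier E" "e w = (\<Oplus>\<^bsub>V\<^esub>i\<in>I. s i \<odot>\<^bsub>V\<^esub> \<iota> (k i))" using KE_comb[OF eC(1)[OF w]] by metis
    have nzc: "\<exists>i\<in>I. u i \<noteq> \<zero>\<^bsub>E\<^esub>" if "u \<in> I \<rightarrow> carrier E" "(\<Oplus>\<^bsub>V\<^esub>i\<in>I. u i \<odot>\<^bsub>V\<^esub> \<iota> (k i)) \<noteq> \<zero>\<^bsub>V\<^esub>" for u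
    proof (rule ccontr)
      assume *: "\<not> ?thesis"
      have "(\<Oplus>\<^bsub>V\<^esub>i\<in>I. u i \<odot>\<^bsub>V\<^esub> \<iota> (k i)) = (\<Oplus>\<^bsub>V\<^esub>i\<in>I. \<zero>\<^bsub>V\<^esub>)"
        by (rule V.M.finsum_cong') (use * kV in auto)
      with that(2) show False by simp
    qed
    obtain i0 where i0: "i0 \<in> I" "u i0 \<noteq> \<zero>\<^bsub>E\<^esub>" using nzc[OF u(1)] u(2) nz by auto
    obtain j0 where j0: "j0 \<in> I" "s j0 \<noteq> \<zero>\<^bsub>E\<^esub>" using nzc[OF s(1)] s(2) nz by auto
    have uc: "u i \<in> carrier E" "s i \<in> carrier E" if "i \<in> I" for i using that u(1) s(1) by auto
    obtain g where g: "linear_functional F A g" "g (t (i0, j0) a) = \<one>\<^bsub>F\<^esub>"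
      "\<And>q. \<lbrakk>q \<in> I \<times> I; q \<noteq> (i0, j0)\<rbrakk> \<Longrightarrow> g (t q a) = \<zero>\<^bsub>F\<^esub>"
    proof (rule dual_functional[OF fin_dim _ _ a(2), of "(i0, j0)"])
      show "finite (I \<times> I)" using finite_I by simp
      show "(\<lambda>p. t p a) \<in> I \<times> I \<rightarrow> carrier A" using tA a(1) by auto
    qed (use i0 j0 in auto)
    obtain G where G: "linear_functional E V G" "\<forall>x\<in>carrier A. G (\<iota> x) = \<phi> (g x)" using functional[OF g(1)] by blast
    have Gt: "G ((\<iota> (k i) \<otimes>\<^bsub>V\<^esub> \<iota> a) \<otimes>\<^bsub>V\<^esub> \<iota> (k j)) = (if (i, j) = (i0, j0) then \<one>\<^bsub>E\<^esub> else \<zero>\<^bsub>E\<^esub>)"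
      if "i \<in> I" "j \<in> I" for i j
    proof -
      have "(\<iota> (k i) \<otimes>\<^bsub>V\<^esub> \<iota> a) \<otimes>\<^bsub>V\<^esub> \<iota> (k j) = \<iota> (t (i, j) a)"
        using that k_K a(1) by (simp add: t_def incl_mult mult_closed)
      then show ?thesis
        using G(2) tA[of "(i, j)" a] that a(1) g(2) g(3)[of "(i, j)"] by (auto simp: scalar_one scalar_zero)
    qed
    have Gw: "G ((\<iota> (k i) \<otimes>\<^bsub>V\<^esub> \<iota> a) \<otimes>\<^bsub>V\<^esub> e w) = (if i = i0 then s j0 else \<zero>\<^bsub>E\<^esub>)" if i: "i \<in> I" for i
    proof -
      have ka: "\<iota> (k i) \<otimes>\<^bsub>V\<^esub> \<iota> a \<in> carrier V" using kV[OF i] \<iota>a by (simp add: V.mult_closed)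
      have "(\<iota> (k i) \<otimes>\<^bsub>V\<^esub> \<iota> a) \<otimes>\<^bsub>V\<^esub> e w = (\<Oplus>\<^bsub>V\<^esub>j\<in>I. (\<iota> (k i) \<otimes>\<^bsub>V\<^esub> \<iota> a) \<otimes>\<^bsub>V\<^esub> (s j \<odot>\<^bsub>V\<^esub> \<iota> (k j)))"
        unfolding s(2) by (rule V.finsum_mult_right[OF _ ka]) (use uc kV in auto)
      also have "\<dots> = (\<Oplus>\<^bsub>V\<^esub>j\<in>I. s j \<odot>\<^bsub>V\<^esub> ((\<iota> (k i) \<otimes>\<^bsub>V\<^esub> \<iota> a) \<otimes>\<^bsub>V\<^esub> \<iota> (k j)))"
        by (rule V.M.finsum_cong') (use uc kV ka in \<open>auto simp: V.smult_mult_right V.mult_closed\<close>)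
      finally have "G ((\<iota> (k i) \<otimes>\<^bsub>V\<^esub> \<iota> a) \<otimes>\<^bsub>V\<^esub> e w) = (\<Oplus>\<^bsub>E\<^esub>j\<in>I. s j \<otimes>\<^bsub>E\<^esub> G ((\<iota> (k i) \<otimes>\<^bsub>V\<^esub> \<iota> a) \<otimes>\<^bsub>V\<^esub> \<iota> (k j)))"
        using linear_functional_sum[OF V.vectorspace_axioms G(1), of "\<lambda>j. (\<iota> (k i) \<otimes>\<^bsub>V\<^esub> \<iota> a) \<otimes>\<^bsub>V\<^esub> \<iota> (k j)" I s] kV ka s(1)
        by (simp add: V.mult_closed)
      also have "\<dots> = (\<Oplus>\<^bsub>E\<^esub>j\<in>I. if j0 = j then (if i = i0 then s j else \<zero>\<^bsub>E\<^esub>) else \<zero>\<^bsub>E\<^esub>)"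
        by (rule V.R.finsum_cong') (use Gt[OF i] uc in auto)
      also have "\<dots> = (if i = i0 then s j0 else \<zero>\<^bsub>E\<^esub>)"
        by (rule V.R.finsum_singleton) (use j0 finite_I uc in auto)
      finally show ?thesis .
    qed
    have aw: "\<iota> a \<otimes>\<^bsub>V\<^esub> e w \<in> carrier V" using \<iota>a eC w by (simp add: V.mult_closed)
    have "e v \<otimes>\<^bsub>V\<^esub> (\<iota> a \<otimes>\<^bsub>V\<^esub> e w) = (\<Oplus>\<^bsub>V\<^esub>i\<in>I. (u i \<odot>\<^bsub>V\<^esub> \<iota> (k i)) \<otimes>\<^bsub>V\<^esub> (\<iota> a \<otimes>\<^bsub>V\<^esub> e w))"
      unfolding u(2) by (rule V.finsum_mult_left[OF _ aw]) (use uc kV in auto)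
    also have "\<dots> = (\<Oplus>\<^bsub>V\<^esub>i\<in>I. u i \<odot>\<^bsub>V\<^esub> ((\<iota> (k i) \<otimes>\<^bsub>V\<^esub> \<iota> a) \<otimes>\<^bsub>V\<^esub> e w))"
      by (rule V.M.finsum_cong')
        (use uc kV aw \<iota>a eC[OF w] V.nucleus_assoc(1)[OF incl_K_nuc[OF k_K]] in \<open>auto simp: V.smult_mult_left V.mult_closed\<close>)
    finally have "G \<zero>\<^bsub>V\<^esub> = (\<Oplus>\<^bsub>E\<^esub>i\<in>I. u i \<otimes>\<^bsub>E\<^esub> G ((\<iota> (k i) \<otimes>\<^bsub>V\<^esub> \<iota> a) \<otimes>\<^bsub>V\<^esub> e w))"
      using linear_functional_sum[OF V.vectorspace_axioms G(1), of "\<lambda>i. (\<iota> (k i) \<otimes>\<^bsub>V\<^esub> \<iota> a) \<otimes>\<^bsub>V\<^esub> e w" I u] kV \<iota>a eC[OF w] u(1) zero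
      by (simp add: V.mult_closed)
    also have "\<dots> = (\<Oplus>\<^bsub>E\<^esub>i\<in>I. if i0 = i then u i \<otimes>\<^bsub>E\<^esub> s j0 else \<zero>\<^bsub>E\<^esub>)"
      by (rule V.R.finsum_cong') (use Gw uc j0 in auto)
    also have "\<dots> = u i0 \<otimes>\<^bsub>E\<^esub> s j0"
      by (rule V.R.finsum_singleton) (use i0 j0 finite_I uc in auto)
    also have "G \<zero>\<^bsub>V\<^esub> = \<zero>\<^bsub>E\<^esub>"
    proof -
      have "G (\<zero>\<^bsub>E\<^esub> \<odot>\<^bsub>V\<^esub> \<zero>\<^bsub>V\<^esub>) = \<zero>\<^bsub>E\<^esub> \<otimes>\<^bsub>E\<^esub> G \<zero>\<^bsub>V\<^esub>" "G \<zero>\<^bsub>V\<^esub> \<in> carrier E"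
        using G(1) V.M.zero_closed V.R.zero_closed unfolding linear_functional_def by blast+
      then show ?thesis by simp
    qed
    finally show False using V.integral[of "u i0" "s j0"] uc i0 j0 by auto
  qed
  have idem: "\<exists>r\<in>carrier E. e v \<otimes>\<^bsub>V\<^esub> e v = r \<odot>\<^bsub>V\<^esub> e v \<and> (r = \<zero>\<^bsub>E\<^esub> \<longrightarrow> e v = \<zero>\<^bsub>V\<^esub>)" if v: "v \<in> P" for v
  proof -
    obtain r where r: "r \<in> carrier E" "e v \<otimes>\<^bsub>V\<^esub> e v = r \<odot>\<^bsub>V\<^esub> e v" using eig[OF v eC(1)[OF v]] by blast
    have "e v = \<zero>\<^bsub>V\<^esub>" if "r = \<zero>\<^bsub>E\<^esub>"
    proof -
      \<comment> \<open>If \<open>e v\<close> squares to zero, then \<open>e v e w = s e w\<close>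
        yields \<open>s (e v e w) = 0\<close>, so \<open>e v e w = 0\<close> for every
        \<open>w\<close>; summing over \<open>w\<close> gives \<open>e v = 0\<close>.\<close>
      have ee: "e v \<otimes>\<^bsub>V\<^esub> e v = \<zero>\<^bsub>V\<^esub>" using r that eC[OF v] by simp
      have "e v \<otimes>\<^bsub>V\<^esub> e w = \<zero>\<^bsub>V\<^esub>" if w: "w \<in> P" for w
      proof -
        obtain s where s: "s \<in> carrier E" "e v \<otimes>\<^bsub>V\<^esub> e w = s \<odot>\<^bsub>V\<^esub> e w" using eig[OF w eC(1)[OF v]] by blast
        have "(e v \<otimes>\<^bsub>V\<^esub> e v) \<otimes>\<^bsub>V\<^esub> e w = s \<odot>\<^bsub>V\<^esub> (e v \<otimes>\<^bsub>V\<^esub> e w)"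
          using V.nucleus_assoc(1)[OF eC(3)[OF v] eC(2)[OF v] eC(2)[OF w]] s eC[OF v] eC[OF w]
          by (simp add: V.smult_mult_right)
        then have "s \<odot>\<^bsub>V\<^esub> (e v \<otimes>\<^bsub>V\<^esub> e w) = \<zero>\<^bsub>V\<^esub>" using ee eC[OF w] by (simp add: V.mult_zero_left)
        then have "s = \<zero>\<^bsub>E\<^esub> \<or> e v \<otimes>\<^bsub>V\<^esub> e w = \<zero>\<^bsub>V\<^esub>"
          by (rule V.nonzero_smult[OF s(1) V.mult_closed[OF eC(2)[OF v] eC(2)[OF w]]])
        then show ?thesis using s eC[OF w] by auto
      qed
      then have "(\<Oplus>\<^bsub>V\<^esub>w\<in>P. e v \<otimes>\<^bsub>V\<^esub> e w) = (\<Oplus>\<^bsub>V\<^esub>w\<in>P. \<zero>\<^bsub>V\<^esub>)" by (intro V.M.finsum_cong') auto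
      then have "e v \<otimes>\<^bsub>V\<^esub> (\<Oplus>\<^bsub>V\<^esub>w\<in>P. e w) = \<zero>\<^bsub>V\<^esub>"
        using V.finsum_mult_right[of e P "e v"] eC eC[OF v] by auto
      then show ?thesis using P(3) eC[OF v] by (simp add: V.r_one)
    qed
    with r show ?thesis by blast
  qed
  obtain x where x: "x \<in> carrier V" "f \<otimes>\<^bsub>V\<^esub> (x \<otimes>\<^bsub>V\<^esub> g) \<noteq> \<zero>\<^bsub>V\<^esub>"
    by (rule V.nonzero_corner[OF P(1) _ P(3) \<iota>a corner nonzero idem f g]) (use eC in auto)
  \<comment> \<open>The witness lives in \<open>V\<close>; the condition is linear in it, so some
    element of \<open>A\<close> already works.\<close>
  have "\<exists>a\<in>carrier A. f \<otimes>\<^bsub>V\<^esub> (\<iota> a \<otimes>\<^bsub>V\<^esub> g) \<noteq> \<zero>\<^bsub>V\<^esub>"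
  proof (rule ccontr)
    assume *: "\<not> ?thesis"
    have "f \<otimes>\<^bsub>V\<^esub> (x \<otimes>\<^bsub>V\<^esub> g) = \<zero>\<^bsub>V\<^esub>"
      using x(1)
      by (rule generated)
        (use * f(1) g(1) in \<open>auto simp: V.l_distr V.r_distr V.smult_mult_left V.smult_mult_right V.mult_closed\<close>)
    with x(2) show False by simp
  qed
  then show ?thesis using that by blast
qed

end

section \<open>Split etale algebras\<close>

text \<open>Over an algebraically closed field the number of roots is the degree, here
  \<open>length cs - 1\<close>, which is positive.\<close>

lemma (in algebraically_closed) exists_root:
  assumes cs: "set cs \<subseteq> carrier L" "length cs \<ge> 2" "last cs \<noteq> \<zero>\<^bsub>L\<^esub>"
  shows "\<exists>\<mu>\<in>carrier L. peval L cs \<mu> = \<zero>\<^bsub>L\<^esub>"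
proof -
  have ne: "cs \<noteq> []" using cs(2) by auto
  have P: "rev cs \<in> carrier (poly_ring L)"
    unfolding univ_poly_carrier[symmetric] polynomial_def using cs(1,3) ne by (auto simp: hd_rev)
  have "size (roots (rev cs)) = length cs - 1"
    using roots_over_carrier[OF P] by (simp add: splitted_def)
  then have "roots (rev cs) \<noteq> {#}" using cs(2) by auto
  then obtain \<mu> where "\<mu> \<in># roots (rev cs)" by blast
  then have "is_root (rev cs) \<mu>" using roots_mem_iff_is_root[OF P] by blast
  then have "\<mu> \<in> carrier L" "eval (rev cs) \<mu> = \<zero>\<^bsub>L\<^esub>" by (auto simp: is_root_def)
  then show ?thesis using eval_rev[OF cs(1)] by auto
qed

text \<open>A maximal independent subset of \<open>W\<close> exists because \<open>dim\<close>
  bounds all independent sets of \<open>V\<close>, and by maximality every element of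
  \<open>W\<close> lies in its span.\<close>

lemma (in vectorspace) subspace_basis:
  assumes "fin_dim" and W: "submodule K W V"
  shows "\<exists>\<beta>. finite \<beta> \<and> \<beta> \<subseteq> W \<and> indep_family K V \<beta> (\<lambda>b. b) \<and>
    (\<forall>x\<in>W. \<exists>r\<in>\<beta> \<rightarrow> carrier K. x = (\<Oplus>\<^bsub>V\<^esub>b\<in>\<beta>. r b \<odot>\<^bsub>V\<^esub> b))"
proof -
  have Wc: "W \<subseteq> carrier V" by (rule submodule.subset[OF W])
  define P where "P B \<longleftrightarrow> B \<subseteq> W \<and> lin_indpt B" for B
  have "lin_indpt {}" by (simp add: lin_dep_def)
  then have "\<exists>B. finite B \<and> maximal B P"
    by (intro maximal_exists[where B = "{}" and N = dim])
      (use assms(1) Wc li_le_dim in \<open>auto simp: P_def\<close>)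
  then obtain B where B: "finite B" "maximal B P" by blast
  then have BW: "B \<subseteq> W" and li: "lin_indpt B" by (auto simp: maximal_def P_def)
  have Bc: "B \<subseteq> carrier V" using BW Wc by blast
  have ind: "indep_family K V B (\<lambda>b. b)"
    unfolding indep_family_def
  proof (intro ballI impI)
    fix d b assume d: "d \<in> B \<rightarrow> carrier K" "(\<Oplus>\<^bsub>V\<^esub>b\<in>B. d b \<odot>\<^bsub>V\<^esub> b) = \<zero>\<^bsub>V\<^esub>" and b: "b \<in> B"
    have "d \<in> B \<rightarrow> {\<zero>\<^bsub>K\<^esub>}"
      by (rule not_lindepD[OF li B(1) subset_refl d(1)]) (use d(2) in \<open>simp add: lincomb_def\<close>)
    with b show "d b = \<zero>\<^bsub>K\<^esub>" by auto
  qed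
  have "\<exists>r\<in>B \<rightarrow> carrier K. x = (\<Oplus>\<^bsub>V\<^esub>b\<in>B. r b \<odot>\<^bsub>V\<^esub> b)" if x: "x \<in> W" for x
  proof -
    have "x \<in> span B"
    proof (cases "x \<in> B")
      case True
      then show ?thesis using in_own_span[OF Bc] by blast
    next
      case False
      have "\<not> P (B \<union> {x})" using B(2) False unfolding maximal_def by blast
      then have "lin_dep (B \<union> {x})" using BW x by (simp add: P_def)
      then show ?thesis using lin_dep_iff_in_span[OF Bc li _ False] x Wc by blast
    qed
    then show ?thesis using finite_span[OF B(1) Bc] by (auto simp: lincomb_def)
  qed
  with B(1) BW ind show ?thesis by blast
qed

section \<open>Dimension and subalgebras under extension of scalars\<close>

text \<open>Independence is \<open>incl_indep\<close>, spanning is the clause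
  \<open>generated\<close>.\<close>

lemma (in base_change) basis_incl:
  assumes fin: "A.fin_dim" and \<beta>: "finite \<beta>" "A.basis \<beta>"
  shows "inj_on \<iota> \<beta>" and "V.basis (\<iota> ` \<beta>)"
proof -
  have \<beta>c: "\<beta> \<subseteq> carrier A" and li: "A.lin_indpt \<beta>" and gen: "A.span \<beta> = carrier A"
    using \<beta>(2) by (auto simp: A.basis_def)
  have "indep_family F A \<beta> (\<lambda>b. b)"
    unfolding indep_family_def
  proof (intro ballI impI)
    fix d b assume d: "d \<in> \<beta> \<rightarrow> carrier F" "(\<Oplus>\<^bsub>A\<^esub>b\<in>\<beta>. d b \<odot>\<^bsub>A\<^esub> b) = \<zero>\<^bsub>A\<^esub>" and b: "b \<in> \<beta>"
    have "d \<in> \<beta> \<rightarrow> {\<zero>\<^bsub>F\<^esub>}"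
      by (rule A.not_lindepD[OF li \<beta>(1) subset_refl d(1)]) (use d(2) in \<open>simp add: A.lincomb_def\<close>)
    with b show "d b = \<zero>\<^bsub>F\<^esub>" by auto
  qed
  then have ind: "indep_family E V \<beta> \<iota>"
    using incl_indep[OF fin \<beta>(1), of "\<lambda>b. b"] \<beta>c by auto
  have \<iota>\<beta>: "\<iota> \<in> \<beta> \<rightarrow> carrier V" "\<iota> ` \<beta> \<subseteq> carrier V" using \<beta>c by auto
  show "inj_on \<iota> \<beta>" by (rule V.indep_family_inj[OF \<beta>(1) \<iota>\<beta>(1) ind])
  have sp: "submodule E (V.span (\<iota> ` \<beta>)) V" by (rule V.span_is_submodule[OF \<iota>\<beta>(2)])
  interpret S: submodule E "V.span (\<iota> ` \<beta>)" V by (rule sp)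
  have own: "\<iota> b \<in> V.span (\<iota> ` \<beta>)" if "b \<in> \<beta>" for b using V.in_own_span[OF \<iota>\<beta>(2)] that by blast
  have "x \<in> V.span (\<iota> ` \<beta>)" if "x \<in> carrier V" for x
    using that
  proof (rule generated)
    fix a assume "a \<in> carrier A"
    then obtain r where r: "r \<in> \<beta> \<rightarrow> carrier F" "a = A.lincomb r \<beta>"
      using A.finite_span[OF \<beta>(1) \<beta>c] gen by auto
    have "\<iota> a = (\<Oplus>\<^bsub>V\<^esub>b\<in>\<beta>. \<iota> (r b \<odot>\<^bsub>A\<^esub> b))"
      unfolding r(2) A.lincomb_def by (rule incl_finsum) (use r(1) \<beta>c in auto)
    also have "\<dots> \<in> V.span (\<iota> ` \<beta>)"
    proof (rule V.finsum_span_submodule[OF sp], rule Pi_I)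
      fix b assume b: "b \<in> \<beta>"
      then have "r b \<in> carrier F" "b \<in> carrier A" using r(1) \<beta>c by auto
      then show "\<iota> (r b \<odot>\<^bsub>A\<^esub> b) \<in> V.span (\<iota> ` \<beta>)" using own[OF b] by (simp add: incl_smult)
    qed
    finally show "\<iota> a \<in> V.span (\<iota> ` \<beta>)" .
  qed auto
  then have "V.span (\<iota> ` \<beta>) = carrier V" using S.subset by blast
  then show "V.basis (\<iota> ` \<beta>)"
    using V.indep_family_lin_indpt[OF \<beta>(1) \<iota>\<beta>(1) ind] \<iota>\<beta>(2) by (simp add: V.basis_def)
qed

lemma (in base_change) fin_dim_incl:
  assumes "A.fin_dim"
  shows "V.fin_dim" and "V.dim = A.dim"
proof -
  obtain \<beta> where \<beta>: "finite \<beta>" "A.basis \<beta>" using A.finite_basis_exists[OF assms] by blast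
  note b = basis_incl[OF assms \<beta>]
  show "V.fin_dim" unfolding V.fin_dim_def using b(2) \<beta>(1) by (intro exI[of _ "\<iota> ` \<beta>"]) (simp add: V.basis_def)
  show "V.dim = A.dim"
    using V.dim_basis[OF _ b(2)] A.dim_basis[OF \<beta>] card_image[OF b(1)] \<beta>(1) by simp
qed

text \<open>Every relation for \<open>E \<otimes> K\<close> is one for \<open>E \<otimes> A\<close>,
  so representatives may be kept. The products agree on formal sums because a change of the carrier
  leaves the multiplication untouched.\<close>

lemma scalar_extension_inclusion:
  fixes F :: "'f ring" and A :: "('f, 'a) module" and E :: "'e ring"
  assumes "field E" and \<phi>: "\<phi> \<in> ring_hom F E" and A: "unital_algebra F A" and sub: "unital_subalgebra F A K"
  defines "j \<equiv> tensor_inclusion F (algebra_via \<phi> E) A"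
    and "W \<equiv> scalar_extension F \<phi> E (A\<lparr>carrier := K\<rparr>)" and "V \<equiv> scalar_extension F \<phi> E A"
  shows "x \<in> carrier W \<Longrightarrow> j x \<in> carrier V"
    and "\<lbrakk>x \<in> carrier W; y \<in> carrier W\<rbrakk> \<Longrightarrow> j (x \<oplus>\<^bsub>W\<^esub> y) = j x \<oplus>\<^bsub>V\<^esub> j y"
    and "\<lbrakk>x \<in> carrier W; y \<in> carrier W\<rbrakk> \<Longrightarrow> j (x \<otimes>\<^bsub>W\<^esub> y) = j x \<otimes>\<^bsub>V\<^esub> j y"
    and "\<lbrakk>r \<in> carrier E; x \<in> carrier W\<rbrakk> \<Longrightarrow> j (r \<odot>\<^bsub>W\<^esub> x) = r \<odot>\<^bsub>V\<^esub> j x"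
    and "j \<one>\<^bsub>W\<^esub> = \<one>\<^bsub>V\<^esub>"
    and "z \<in> K \<Longrightarrow> j (scalar_incl F \<phi> E (A\<lparr>carrier := K\<rparr>) z) = scalar_incl F \<phi> E A z"
proof -
  interpret A: unital_algebra F A by fact
  have Kc: "K \<subseteq> carrier A"
    using sub submodule.subset[of F K A] by (simp add: unital_subalgebra_def subspace_def)
  interpret P: comm_algebra_pair F "algebra_via \<phi> E" A by (rule scalar_extension_pair) fact+
  interpret Q: comm_algebra_pair F "algebra_via \<phi> E" "A\<lparr>carrier := K\<rparr>"
    by (rule scalar_extension_pair[OF assms(1,2) A.subalgebra_unital[OF sub]])
  have rel: "r \<in> P.ker" if "r \<in> tensor_relations F (algebra_via \<phi> E) (A\<lparr>carrier := K\<rparr>)" for r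
    using that
  proof (cases rule: Q.relation_cases)
    case (left b b' c)
    then show ?thesis using P.kernel_left[of b b' c] Kc by auto
  next
    case (right b c c')
    then show ?thesis using P.kernel_right[of b c c'] Kc by auto
  next
    case (scalar s b c)
    then show ?thesis using P.kernel_scalar[of s b c] Kc by auto
  qed
  have ker: "x \<in> P.ker" if "x \<in> Q.ker" for x
    using that by (induction rule: Q.kernel_induct) (simp_all add: rel P.kernel_diff)
  have keys: "Poly_Mapping.keys x \<subseteq> P.pure" if "Poly_Mapping.keys x \<subseteq> Q.pure" for x
    using that Kc by fastforce
  have jc: "j (Q.cls x) = P.cls x" for x
    unfolding j_def tensor_inclusion_def
  proof (rule UN_eq_const[OF Q.self_in_class])
    show "P.cls u = P.cls x" if "u \<in> Q.cls x" for u
      by (rule P.class_eqI) (use that ker in \<open>simp add: Q.mem_class_iff\<close>)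
  qed
  have fm: "frag_mult B (A\<lparr>carrier := K\<rparr>) x y = frag_mult B A x y" for B :: "('f, 'e) module" and x y
    by (simp add: frag_mult_def)
  have WV: "W = Q.TA" "V = P.TA" by (simp_all add: W_def V_def scalar_extension_def)
  show "j x \<in> carrier V" if "x \<in> carrier W"
    using that unfolding WV by (elim Q.tensor_cases) (simp only: jc keys P.class_closed)
  show "j (x \<oplus>\<^bsub>W\<^esub> y) = j x \<oplus>\<^bsub>V\<^esub> j y" if "x \<in> carrier W" "y \<in> carrier W"
    using that unfolding WV by (elim Q.tensor_cases) (simp only: jc Q.add_tensor P.add_tensor)
  show "j (x \<otimes>\<^bsub>W\<^esub> y) = j x \<otimes>\<^bsub>V\<^esub> j y" if "x \<in> carrier W" "y \<in> carrier W"
    using that unfolding WV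
    by (elim Q.tensor_cases) (simp only: jc Q.mult_tensor P.mult_tensor keys fm)
  show "j (r \<odot>\<^bsub>W\<^esub> x) = r \<odot>\<^bsub>V\<^esub> j x" if r: "r \<in> carrier E" and x: "x \<in> carrier W"
  proof -
    obtain u where u: "x = Q.cls u" "Poly_Mapping.keys u \<subseteq> Q.pure"
      using x unfolding WV by (rule Q.tensor_cases)
    show ?thesis
      unfolding WV u(1) jc
      using r Q.smult_tensor[OF _ u(2), of r] P.smult_tensor[OF _ keys[OF u(2)], of r]
      by (simp add: jc fm)
  qed
  show "j \<one>\<^bsub>W\<^esub> = \<one>\<^bsub>V\<^esub>" unfolding WV by (simp add: jc Q.one_tensor P.one_tensor)
  show "j (scalar_incl F \<phi> E (A\<lparr>carrier := K\<rparr>) z) = scalar_incl F \<phi> E A z" if "z \<in> K"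
    by (simp add: scalar_incl_def jc)
qed

text \<open>Flatness of \<open>E\<close> over \<open>F\<close>, by hand. An \<open>F\<close>-basis
  of \<open>K\<close> spans \<open>E \<otimes> K\<close> over \<open>E\<close>, and its images in
  \<open>E \<otimes> A\<close> are independent because it is independent in \<open>A\<close>. The
  purpose is to keep the idempotents of \<open>E \<otimes> K\<close> nonzero in
  \<open>E \<otimes> A\<close>.\<close>

lemma scalar_extension_inclusion_zero:
  fixes F :: "'f ring" and A :: "('f, 'a) module" and E :: "'e ring"
  assumes "field E" and \<phi>: "\<phi> \<in> ring_hom F E" and A: "unital_algebra F A" and sub: "unital_subalgebra F A K"
    and fin: "vectorspace.fin_dim F A"
    and x: "x \<in> carrier (scalar_extension F \<phi> E (A\<lparr>carrier := K\<rparr>))"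
    and z: "tensor_inclusion F (algebra_via \<phi> E) A x = \<zero>\<^bsub>scalar_extension F \<phi> E A\<^esub>"
  shows "x = \<zero>\<^bsub>scalar_extension F \<phi> E (A\<lparr>carrier := K\<rparr>)\<^esub>"
proof -
  let ?j = "tensor_inclusion F (algebra_via \<phi> E) A"
  let ?W = "scalar_extension F \<phi> E (A\<lparr>carrier := K\<rparr>)" and ?V = "scalar_extension F \<phi> E A"
  let ?\<iota> = "scalar_incl F \<phi> E A" and ?\<kappa> = "scalar_incl F \<phi> E (A\<lparr>carrier := K\<rparr>)"
  interpret A: unital_algebra F A by fact
  interpret KA: unital_algebra F "A\<lparr>carrier := K\<rparr>" by (rule A.subalgebra_unital[OF sub])
  interpret V: base_change F A E ?V \<phi> ?\<iota> by (rule base_change_scalar_extension) fact+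
  interpret W: base_change F "A\<lparr>carrier := K\<rparr>" E ?W \<phi> ?\<kappa>
    by (rule base_change_scalar_extension[OF assms(1,2) KA.unital_algebra_axioms])
  note j = scalar_extension_inclusion[OF assms(1-4)]
  have subm: "submodule F K A" using sub by (simp add: unital_subalgebra_def subspace_def)
  have Kc: "K \<subseteq> carrier A" by (rule submodule.subset[OF subm])
  obtain \<beta> where \<beta>: "finite \<beta>" "\<beta> \<subseteq> K" "indep_family F A \<beta> (\<lambda>b. b)"
    and gen: "\<forall>y\<in>K. \<exists>r\<in>\<beta> \<rightarrow> carrier F. y = (\<Oplus>\<^bsub>A\<^esub>b\<in>\<beta>. r b \<odot>\<^bsub>A\<^esub> b)"
    using A.subspace_basis[OF fin subm] by (elim exE conjE) (rule that)
  have ind: "indep_family E ?V \<beta> ?\<iota>"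
    using V.incl_indep[OF fin \<beta>(1) _ \<beta>(3)] \<beta>(2) Kc by auto
  have \<kappa>\<beta>: "?\<kappa> ` \<beta> \<subseteq> carrier ?W" using \<beta>(2) by auto
  have sp: "submodule E (W.V.span (?\<kappa> ` \<beta>)) ?W" by (rule W.V.span_is_submodule[OF \<kappa>\<beta>])
  interpret S: submodule E "W.V.span (?\<kappa> ` \<beta>)" ?W by (rule sp)
  have "x \<in> W.V.span (?\<kappa> ` \<beta>)"
    using x
  proof (rule W.generated)
    fix a assume "a \<in> carrier (A\<lparr>carrier := K\<rparr>)"
    then obtain r where r: "r \<in> \<beta> \<rightarrow> carrier F" "a = (\<Oplus>\<^bsub>A\<^esub>b\<in>\<beta>. r b \<odot>\<^bsub>A\<^esub> b)" using gen by auto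
    have "a = (\<Oplus>\<^bsub>A\<lparr>carrier := K\<rparr>\<^esub>b\<in>\<beta>. r b \<odot>\<^bsub>A\<^esub> b)"
      unfolding r(2)
      by (rule finsum_hom[OF KA.algebra_abelian_group A.algebra_abelian_group, where h = "\<lambda>x. x", symmetric])
        (use r(1) \<beta>(2) Kc submodule.smult_closed[OF subm] in \<open>auto simp: Pi_iff subset_iff\<close>)
    then have "?\<kappa> a = (\<Oplus>\<^bsub>?W\<^esub>b\<in>\<beta>. ?\<kappa> (r b \<odot>\<^bsub>A\<^esub> b))"
      using W.incl_finsum[of "\<lambda>b. r b \<odot>\<^bsub>A\<^esub> b" \<beta>] r(1) \<beta>(2) submodule.smult_closed[OF subm] by auto
    also have "\<dots> \<in> W.V.span (?\<kappa> ` \<beta>)"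
    proof (rule W.V.finsum_span_submodule[OF sp], rule Pi_I)
      fix b assume b: "b \<in> \<beta>"
      then have "r b \<in> carrier F" "b \<in> K" using r(1) \<beta>(2) by auto
      then show "?\<kappa> (r b \<odot>\<^bsub>A\<^esub> b) \<in> W.V.span (?\<kappa> ` \<beta>)"
        using W.incl_smult[of "r b" b] W.V.in_own_span[OF \<kappa>\<beta>] b by auto
    qed
    finally show "?\<kappa> a \<in> W.V.span (?\<kappa> ` \<beta>)" .
  qed auto
  then obtain d where d: "d \<in> ?\<kappa> ` \<beta> \<rightarrow> carrier E" "x = W.V.lincomb d (?\<kappa> ` \<beta>)"
    using W.V.finite_span[OF finite_imageI[OF \<beta>(1)] \<kappa>\<beta>] by auto
  have jk: "?j (?\<kappa> b) = ?\<iota> b" if "b \<in> \<beta>" for b using j(6) that \<beta>(2) by blast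
  have inj: "inj_on ?\<kappa> \<beta>"
  proof (rule inj_onI)
    fix b b' assume "b \<in> \<beta>" "b' \<in> \<beta>" "?\<kappa> b = ?\<kappa> b'"
    then have "?\<iota> b = ?\<iota> b'" using jk by metis
    moreover have "inj_on ?\<iota> \<beta>"
      by (rule V.V.indep_family_inj[OF \<beta>(1) _ ind]) (use \<beta>(2) Kc in auto)
    ultimately show "b = b'" using \<open>b \<in> \<beta>\<close> \<open>b' \<in> \<beta>\<close> by (meson inj_onD)
  qed
  have "x = (\<Oplus>\<^bsub>?W\<^esub>b\<in>\<beta>. d (?\<kappa> b) \<odot>\<^bsub>?W\<^esub> ?\<kappa> b)"
    unfolding d(2) W.V.lincomb_def
    by (rule W.V.M.add.finprod_reindex[OF _ inj]) (use d(1) \<kappa>\<beta> in auto)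
  moreover from this have "?j x = (\<Oplus>\<^bsub>?V\<^esub>b\<in>\<beta>. ?j (d (?\<kappa> b) \<odot>\<^bsub>?W\<^esub> ?\<kappa> b))"
    by (simp only:, intro finsum_hom[OF W.V.algebra_abelian_group V.V.algebra_abelian_group] j(1,2))
      (use d(1) \<kappa>\<beta> in auto)
  moreover have "(\<Oplus>\<^bsub>?V\<^esub>b\<in>\<beta>. ?j (d (?\<kappa> b) \<odot>\<^bsub>?W\<^esub> ?\<kappa> b)) = (\<Oplus>\<^bsub>?V\<^esub>b\<in>\<beta>. d (?\<kappa> b) \<odot>\<^bsub>?V\<^esub> ?\<iota> b)"
  proof (rule V.V.M.finsum_cong'[OF refl])
    have b: "d (?\<kappa> b) \<in> carrier E" "?\<kappa> b \<in> carrier ?W" "?\<iota> b \<in> carrier ?V" if "b \<in> \<beta>" for b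
      using d(1) \<kappa>\<beta> \<beta>(2) Kc that by auto
    show "(\<lambda>b. d (?\<kappa> b) \<odot>\<^bsub>?V\<^esub> ?\<iota> b) \<in> \<beta> \<rightarrow> carrier ?V" using b by auto
    show "?j (d (?\<kappa> b) \<odot>\<^bsub>?W\<^esub> ?\<kappa> b) = d (?\<kappa> b) \<odot>\<^bsub>?V\<^esub> ?\<iota> b" if "b \<in> \<beta>" for b
      using j(4)[OF b(1,2)[OF that]] jk[OF that] by simp
  qed
  ultimately have "\<forall>b\<in>\<beta>. d (?\<kappa> b) = \<zero>\<^bsub>E\<^esub>"
    using ind z d(1) unfolding indep_family_def by (auto simp: Pi_iff dest!: bspec[where x = "\<lambda>b. d (?\<kappa> b)"])
  then have "x = (\<Oplus>\<^bsub>?W\<^esub>b\<in>\<beta>. \<zero>\<^bsub>?W\<^esub>)"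
    unfolding \<open>x = (\<Oplus>\<^bsub>?W\<^esub>b\<in>\<beta>. d (?\<kappa> b) \<odot>\<^bsub>?W\<^esub> ?\<kappa> b)\<close>
    by (intro W.V.M.finsum_cong') (use \<kappa>\<beta> in auto)
  then show ?thesis by simp
qed

text \<open>The \<open>\<delta> i\<close> are the preimages of the unit vectors; the coefficients of
  \<open>x\<close> are the components of \<open>\<theta> x\<close>.\<close>

lemma split_etale_idempotents:
  fixes n :: nat
  assumes "unital_algebra E W" and "\<theta> \<in> algebra_iso E W (product_algebra {..<n} (\<lambda>_. algebra_via id E))"
  obtains \<delta> where "\<And>i. i < n \<Longrightarrow> \<delta> i \<in> carrier W" and "\<And>i. i < n \<Longrightarrow> \<delta> i \<noteq> \<zero>\<^bsub>W\<^esub>"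
    and "\<And>i j. \<lbrakk>i < n; j < n\<rbrakk> \<Longrightarrow> \<delta> i \<otimes>\<^bsub>W\<^esub> \<delta> j = (if i = j then \<delta> i else \<zero>\<^bsub>W\<^esub>)"
    and "(\<Oplus>\<^bsub>W\<^esub>i\<in>{..<n}. \<delta> i) = \<one>\<^bsub>W\<^esub>"
    and "\<And>x. x \<in> carrier W \<Longrightarrow> \<exists>r\<in>{..<n} \<rightarrow> carrier E. x = (\<Oplus>\<^bsub>W\<^esub>i\<in>{..<n}. r i \<odot>\<^bsub>W\<^esub> \<delta> i)"
proof -
  interpret W: unital_algebra E W by fact
  let ?P = "product_algebra {..<n} (\<lambda>_. algebra_via id E)"
  have ring: "\<theta> \<in> ring_hom W ?P" and bij: "bij_betw \<theta> (carrier W) (carrier ?P)"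
    and sm: "\<And>r x. \<lbrakk>r \<in> carrier E; x \<in> carrier W\<rbrakk> \<Longrightarrow> \<theta> (r \<odot>\<^bsub>W\<^esub> x) = r \<odot>\<^bsub>?P\<^esub> \<theta> x"
    using assms(2) by (auto simp: algebra_iso_def ring_iso_def)
  have hP: "\<theta> x \<in> {..<n} \<rightarrow>\<^sub>E carrier E" if "x \<in> carrier W" for x
    using bij_betwE[OF bij] that by (simp add: product_algebra_def)
  have hc: "\<theta> x i \<in> carrier E" if "x \<in> carrier W" "i < n" for x i using hP[OF that(1)] that(2) by auto
  have ho: "\<theta> \<one>\<^bsub>W\<^esub> i = \<one>\<^bsub>E\<^esub>" if "i < n" for i
    using ring_hom_one[OF ring] that by (simp add: product_algebra_def)
  have hm: "\<theta> (x \<otimes>\<^bsub>W\<^esub> y) i = \<theta> x i \<otimes>\<^bsub>E\<^esub> \<theta> y i" if "x \<in> carrier W" "y \<in> carrier W" "i < n" for x y i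
    using ring_hom_mult[OF ring that(1,2)] that(3) by (simp add: product_algebra_def)
  have ha: "\<theta> (x \<oplus>\<^bsub>W\<^esub> y) i = \<theta> x i \<oplus>\<^bsub>E\<^esub> \<theta> y i" if "x \<in> carrier W" "y \<in> carrier W" "i < n" for x y i
    using ring_hom_add[OF ring that(1,2)] that(3) by (simp add: product_algebra_def)
  have hs: "\<theta> (r \<odot>\<^bsub>W\<^esub> x) i = r \<otimes>\<^bsub>E\<^esub> \<theta> x i" if "r \<in> carrier E" "x \<in> carrier W" "i < n" for r x i
    using sm[OF that(1,2)] that(3) by (simp add: product_algebra_def)
  have hz: "\<theta> \<zero>\<^bsub>W\<^esub> i = \<zero>\<^bsub>E\<^esub>" if "i < n" for i
    using hs[of "\<zero>\<^bsub>E\<^esub>" "\<zero>\<^bsub>W\<^esub>" i] hc[of "\<zero>\<^bsub>W\<^esub>" i] that by simp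
  have heq: "x = y" if "x \<in> carrier W" "y \<in> carrier W" "\<And>i. i < n \<Longrightarrow> \<theta> x i = \<theta> y i" for x y
  proof -
    have "\<theta> x = \<theta> y" by (rule PiE_ext[OF hP[OF that(1)] hP[OF that(2)]]) (use that(3) in simp)
    then show ?thesis using bij that(1,2) by (meson bij_betw_def inj_onD)
  qed
  have "\<exists>x\<in>carrier W. \<forall>j<n. \<theta> x j = (if j = i then \<one>\<^bsub>E\<^esub> else \<zero>\<^bsub>E\<^esub>)" for i
  proof -
    let ?f = "\<lambda>j\<in>{..<n}. if j = i then \<one>\<^bsub>E\<^esub> else \<zero>\<^bsub>E\<^esub>"
    have "?f \<in> carrier ?P" by (simp add: product_algebra_def)
    then have "?f \<in> \<theta> ` carrier W" by (simp only: bij_betw_imp_surj_on[OF bij])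
    then obtain x where x: "\<theta> x = ?f" "x \<in> carrier W" by (elim imageE) (rule that[OF sym])
    have "\<forall>j<n. \<theta> x j = (if j = i then \<one>\<^bsub>E\<^esub> else \<zero>\<^bsub>E\<^esub>)" unfolding x(1) by simp
    with x(2) show ?thesis by blast
  qed
  then obtain \<delta> where \<delta>: "\<And>i. \<delta> i \<in> carrier W" "\<And>i j. j < n \<Longrightarrow> \<theta> (\<delta> i) j = (if j = i then \<one>\<^bsub>E\<^esub> else \<zero>\<^bsub>E\<^esub>)"
    by metis
  have comb: "x = (\<Oplus>\<^bsub>W\<^esub>i\<in>{..<n}. \<theta> x i \<odot>\<^bsub>W\<^esub> \<delta> i)" if x: "x \<in> carrier W" for x
  proof (rule heq)
    fix j assume j: "j < n"
    have "\<theta> (\<Oplus>\<^bsub>W\<^esub>i\<in>{..<n}. \<theta> x i \<odot>\<^bsub>W\<^esub> \<delta> i) j = (\<Oplus>\<^bsub>E\<^esub>i\<in>{..<n}. \<theta> (\<theta> x i \<odot>\<^bsub>W\<^esub> \<delta> i) j)"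
      by (rule finsum_hom[OF W.algebra_abelian_group W.R.abelian_group_axioms, where h = "\<lambda>y. \<theta> y j"])
        (use x \<delta>(1) hc ha j in auto)
    also have "\<dots> = (\<Oplus>\<^bsub>E\<^esub>i\<in>{..<n}. if j = i then \<theta> x i else \<zero>\<^bsub>E\<^esub>)"
      by (rule W.R.finsum_cong') (use x \<delta> hc hs j in auto)
    also have "\<dots> = \<theta> x j" by (rule W.R.finsum_singleton) (use j x hc in auto)
    finally show "\<theta> x j = \<theta> (\<Oplus>\<^bsub>W\<^esub>i\<in>{..<n}. \<theta> x i \<odot>\<^bsub>W\<^esub> \<delta> i) j" by simp
  qed (use x \<delta>(1) hc in auto)
  show ?thesis
  proof (rule that)
    show "\<delta> i \<in> carrier W" for i by (rule \<delta>(1))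
    show "\<delta> i \<noteq> \<zero>\<^bsub>W\<^esub>" if "i < n" for i
    proof
      assume "\<delta> i = \<zero>\<^bsub>W\<^esub>"
      with \<delta>(2)[OF that, of i] hz[OF that] show False by simp
    qed
    show "\<delta> i \<otimes>\<^bsub>W\<^esub> \<delta> j = (if i = j then \<delta> i else \<zero>\<^bsub>W\<^esub>)" for i j
      by (rule heq) (auto simp: \<delta> hm hz W.mult_closed)
    have "\<one>\<^bsub>W\<^esub> = (\<Oplus>\<^bsub>W\<^esub>i\<in>{..<n}. \<theta> \<one>\<^bsub>W\<^esub> i \<odot>\<^bsub>W\<^esub> \<delta> i)" by (rule comb[OF W.one_closed])
    also have "\<dots> = (\<Oplus>\<^bsub>W\<^esub>i\<in>{..<n}. \<delta> i)"
      by (rule W.M.finsum_cong') (use \<delta>(1) ho in auto)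
    finally show "(\<Oplus>\<^bsub>W\<^esub>i\<in>{..<n}. \<delta> i) = \<one>\<^bsub>W\<^esub>" by simp
    show "\<exists>r\<in>{..<n} \<rightarrow> carrier E. x = (\<Oplus>\<^bsub>W\<^esub>i\<in>{..<n}. r i \<odot>\<^bsub>W\<^esub> \<delta> i)" if "x \<in> carrier W" for x
      using comb[OF that] hc[OF that] by (intro bexI[of _ "\<theta> x"]) auto
  qed
qed

section \<open>Skew matrix units\<close>

lemma skew_matrix_algebra_simps [simp]:
  "carrier (skew_matrix_algebra E n c) = {..<n} \<times> {..<n} \<rightarrow>\<^sub>E carrier E"
  "x \<otimes>\<^bsub>skew_matrix_algebra E n c\<^esub> y = restrict
     (\<lambda>(i, l). \<Oplus>\<^bsub>E\<^esub>j\<in>{..<n}. c i j l \<otimes>\<^bsub>E\<^esub> (x (i, j) \<otimes>\<^bsub>E\<^esub> y (j, l))) ({..<n} \<times> {..<n})"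
  "\<one>\<^bsub>skew_matrix_algebra E n c\<^esub> = restrict (\<lambda>(i, j). if i = j then \<one>\<^bsub>E\<^esub> else \<zero>\<^bsub>E\<^esub>) ({..<n} \<times> {..<n})"
  "\<zero>\<^bsub>skew_matrix_algebra E n c\<^esub> = restrict (\<lambda>_. \<zero>\<^bsub>E\<^esub>) ({..<n} \<times> {..<n})"
  "x \<oplus>\<^bsub>skew_matrix_algebra E n c\<^esub> y = restrict (\<lambda>p. x p \<oplus>\<^bsub>E\<^esub> y p) ({..<n} \<times> {..<n})"
  "r \<odot>\<^bsub>skew_matrix_algebra E n c\<^esub> x = restrict (\<lambda>p. r \<otimes>\<^bsub>E\<^esub> x p) ({..<n} \<times> {..<n})"
  by (simp_all add: skew_matrix_algebra_def)

text \<open>\<open>diagonal_subalgebra\<close> is a span, and reasoning about spans requires the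
  module laws.\<close>

lemma skew_matrix_module:
  assumes "field E"
  shows "Module.module E (skew_matrix_algebra E n c)"
proof -
  interpret field E by fact
  let ?J = "{..<n} \<times> {..<n}"
  have ext: "x = y" if "x \<in> ?J \<rightarrow>\<^sub>E carrier E" "y \<in> ?J \<rightarrow>\<^sub>E carrier E" "\<And>p. p \<in> ?J \<Longrightarrow> x p = y p" for x y
    by (rule PiE_ext[OF that])
  have val: "x p \<in> carrier E" if "x \<in> ?J \<rightarrow>\<^sub>E carrier E" "p \<in> ?J" for x p
    using that by (rule PiE_mem)
  have cl: "restrict f ?J \<in> ?J \<rightarrow>\<^sub>E carrier E" if "\<And>p. p \<in> ?J \<Longrightarrow> f p \<in> carrier E" for f
    using that by (simp add: restrict_PiE_iff)
  have "abelian_group (skew_matrix_algebra E n c)"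
  proof (rule abelian_groupI, goal_cases)
    case (6 x)
    then have x: "x \<in> ?J \<rightarrow>\<^sub>E carrier E" by simp
    show ?case
    proof (rule bexI[of _ "restrict (\<lambda>p. \<ominus>\<^bsub>E\<^esub> x p) ?J"])
      show "restrict (\<lambda>p. \<ominus>\<^bsub>E\<^esub> x p) ?J \<oplus>\<^bsub>skew_matrix_algebra E n c\<^esub> x = \<zero>\<^bsub>skew_matrix_algebra E n c\<^esub>"
        unfolding skew_matrix_algebra_simps by (rule restrict_ext) (use val[OF x] in \<open>simp add: l_neg del: mem_Sigma_iff\<close>)
    qed (use val[OF x] in \<open>simp add: cl del: mem_Sigma_iff\<close>)
  qed (unfold skew_matrix_algebra_simps,
      (rule cl, simp add: val del: mem_Sigma_iff)+,
      (rule ext, (rule cl | assumption), simp_all add: val cl a_ac restrict_PiE_iff del: mem_Sigma_iff)+)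
  then show ?thesis
    by (rule moduleI[OF is_cring], unfold skew_matrix_algebra_simps)
      (rule cl | rule ext | assumption | simp add: val cl l_distr r_distr m_assoc restrict_PiE_iff del: mem_Sigma_iff)+
qed

text \<open>Orthogonal nuclear idempotents with one nonzero vector in each of the
  \<open>n * n\<close> corners. The dimension leaves room for nothing else, so the corners are
  lines. Setting \<open>v i i = e i\<close> is the normalisation that makes the skew set
  reduced.\<close>

locale peirce_frame = unital_algebra F A for F :: "'f ring" and A :: "('f, 'a) module" +
  fixes n :: nat and e :: "nat \<Rightarrow> 'a" and v :: "nat \<Rightarrow> nat \<Rightarrow> 'a"
  assumes fin_dim: "fin_dim" and dim: "dim = n * n"
    and e_nucleus: "i < n \<Longrightarrow> e i \<in> nucleus A"
    and e_mult: "\<lbrakk>i < n; j < n\<rbrakk> \<Longrightarrow> e i \<otimes>\<^bsub>A\<^esub> e j = (if i = j then e i else \<zero>\<^bsub>A\<^esub>)"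
    and e_sum: "(\<Oplus>\<^bsub>A\<^esub>i\<in>{..<n}. e i) = \<one>\<^bsub>A\<^esub>"
    and v_closed: "\<lbrakk>i < n; j < n\<rbrakk> \<Longrightarrow> v i j \<in> carrier A"
    and v_corner: "\<lbrakk>i < n; j < n\<rbrakk> \<Longrightarrow> e i \<otimes>\<^bsub>A\<^esub> (v i j \<otimes>\<^bsub>A\<^esub> e j) = v i j"
    and v_nonzero: "\<lbrakk>i < n; j < n\<rbrakk> \<Longrightarrow> v i j \<noteq> \<zero>\<^bsub>A\<^esub>"
    and v_diag: "i < n \<Longrightarrow> v i i = e i"
begin

abbreviation "J \<equiv> {..<n} \<times> {..<n}"

definition corner :: "nat \<Rightarrow> nat \<Rightarrow> 'a \<Rightarrow> 'a" where
  "corner i j x = e i \<otimes>\<^bsub>A\<^esub> (x \<otimes>\<^bsub>A\<^esub> e j)"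

definition coord :: "nat \<Rightarrow> nat \<Rightarrow> 'a \<Rightarrow> 'f" where
  "coord i j x = (THE r. r \<in> carrier F \<and> corner i j x = r \<odot>\<^bsub>A\<^esub> v i j)"

text \<open>The structure constants of the \<open>v i j\<close>. They may vanish, as the product of
  two corner vectors can be zero.\<close>

definition skew_coeff :: "nat \<Rightarrow> nat \<Rightarrow> nat \<Rightarrow> 'f" where
  "skew_coeff i j k = coord i k (v i j \<otimes>\<^bsub>A\<^esub> v j k)"

definition coords :: "'a \<Rightarrow> nat \<times> nat \<Rightarrow> 'f" where
  "coords x = restrict (\<lambda>(i, j). coord i j x) J"

lemma e_closed: "i < n \<Longrightarrow> e i \<in> carrier A"
  using e_nucleus by simp

lemma corner_closed: "\<lbrakk>i < n; j < n; x \<in> carrier A\<rbrakk> \<Longrightarrow> corner i j x \<in> carrier A"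
  by (simp add: corner_def e_closed mult_closed)

lemma corner_add: "\<lbrakk>i < n; j < n; x \<in> carrier A; y \<in> carrier A\<rbrakk> \<Longrightarrow>
    corner i j (x \<oplus>\<^bsub>A\<^esub> y) = corner i j x \<oplus>\<^bsub>A\<^esub> corner i j y"
  by (simp add: corner_def e_closed mult_closed l_distr r_distr)

lemma corner_smult: "\<lbrakk>i < n; j < n; r \<in> carrier F; x \<in> carrier A\<rbrakk> \<Longrightarrow>
    corner i j (r \<odot>\<^bsub>A\<^esub> x) = r \<odot>\<^bsub>A\<^esub> corner i j x"
  by (simp add: corner_def e_closed mult_closed smult_mult_left smult_mult_right)

lemma e_v:
  assumes "i < n" "k < n" "l < n"
  shows "e i \<otimes>\<^bsub>A\<^esub> v k l = (if i = k then v k l else \<zero>\<^bsub>A\<^esub>)"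
proof -
  have c: "v k l \<otimes>\<^bsub>A\<^esub> e l \<in> carrier A" using assms by (simp add: mult_closed v_closed e_closed)
  have "e i \<otimes>\<^bsub>A\<^esub> v k l = (e i \<otimes>\<^bsub>A\<^esub> e k) \<otimes>\<^bsub>A\<^esub> (v k l \<otimes>\<^bsub>A\<^esub> e l)"
    using nucleus_assoc(1)[OF e_nucleus[OF assms(1)] e_closed[OF assms(2)] c] v_corner[OF assms(2,3)] by simp
  also have "\<dots> = (if i = k then v k l else \<zero>\<^bsub>A\<^esub>)"
    using e_mult[OF assms(1,2)] v_corner[OF assms(2,3)] mult_zero_left[OF c] by simp
  finally show ?thesis .
qed

lemma v_e:
  assumes "k < n" "l < n" "j < n"
  shows "v k l \<otimes>\<^bsub>A\<^esub> e j = (if l = j then v k l else \<zero>\<^bsub>A\<^esub>)"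
proof -
  have c: "e k \<otimes>\<^bsub>A\<^esub> v k l \<in> carrier A" using assms by (simp add: mult_closed v_closed e_closed)
  have v: "v k l = (e k \<otimes>\<^bsub>A\<^esub> v k l) \<otimes>\<^bsub>A\<^esub> e l"
    using nucleus_assoc(1)[OF e_nucleus[OF assms(1)] v_closed[OF assms(1,2)] e_closed[OF assms(2)]]
      v_corner[OF assms(1,2)] by simp
  have "v k l \<otimes>\<^bsub>A\<^esub> e j = ((e k \<otimes>\<^bsub>A\<^esub> v k l) \<otimes>\<^bsub>A\<^esub> e l) \<otimes>\<^bsub>A\<^esub> e j" using v by simp
  also have "\<dots> = (e k \<otimes>\<^bsub>A\<^esub> v k l) \<otimes>\<^bsub>A\<^esub> (e l \<otimes>\<^bsub>A\<^esub> e j)"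
    by (rule nucleus_assoc(3)[OF e_nucleus[OF assms(3)] c e_closed[OF assms(2)]])
  also have "\<dots> = (if l = j then v k l else \<zero>\<^bsub>A\<^esub>)"
    by (cases "l = j") (use e_mult[OF assms(2,3)] v[symmetric] mult_zero_right[OF c] in simp_all)
  finally show ?thesis .
qed

lemma corner_v:
  assumes "i < n" "j < n" "k < n" "l < n"
  shows "corner i j (v k l) = (if i = k \<and> j = l then v k l else \<zero>\<^bsub>A\<^esub>)"
  using assms by (simp add: corner_def v_e e_v e_closed mult_zero_right)

lemma corner_comb:
  assumes ij: "i < n" "j < n" and a: "a \<in> J \<rightarrow> carrier F"
  shows "corner i j (\<Oplus>\<^bsub>A\<^esub>p\<in>J. a p \<odot>\<^bsub>A\<^esub> v (fst p) (snd p)) = a (i, j) \<odot>\<^bsub>A\<^esub> v i j"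
proof -
  have av: "a p \<in> carrier F" "v (fst p) (snd p) \<in> carrier A" if "p \<in> J" for p
    using that a v_closed by auto
  have "corner i j (\<Oplus>\<^bsub>A\<^esub>p\<in>J. a p \<odot>\<^bsub>A\<^esub> v (fst p) (snd p)) = (\<Oplus>\<^bsub>A\<^esub>p\<in>J. corner i j (a p \<odot>\<^bsub>A\<^esub> v (fst p) (snd p)))"
    by (rule finsum_hom[OF algebra_abelian_group algebra_abelian_group])
      (use ij av corner_closed corner_add in auto)
  also have "\<dots> = (\<Oplus>\<^bsub>A\<^esub>p\<in>J. if (i, j) = p then a p \<odot>\<^bsub>A\<^esub> v (fst p) (snd p) else \<zero>\<^bsub>A\<^esub>)"
  proof (rule M.finsum_cong'[OF refl])
    fix p assume p: "p \<in> J"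
    then have "fst p < n" "snd p < n" by auto
    then show "corner i j (a p \<odot>\<^bsub>A\<^esub> v (fst p) (snd p)) = (if (i, j) = p then a p \<odot>\<^bsub>A\<^esub> v (fst p) (snd p) else \<zero>\<^bsub>A\<^esub>)"
      using av[OF p] ij by (cases p) (simp add: corner_smult corner_v)
  qed (use av in auto)
  also have "\<dots> = a (i, j) \<odot>\<^bsub>A\<^esub> v i j"
    using M.finsum_singleton[of "(i, j)" J "\<lambda>p. a p \<odot>\<^bsub>A\<^esub> v (fst p) (snd p)"] ij av by auto
  finally show ?thesis .
qed

lemma v_cancel:
  assumes ij: "i < n" "j < n" and "r \<in> carrier F" "s \<in> carrier F" and eq: "r \<odot>\<^bsub>A\<^esub> v i j = s \<odot>\<^bsub>A\<^esub> v i j"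
  shows "r = s"
proof -
  have v: "v i j \<in> carrier A" by (rule v_closed[OF ij])
  have "(r \<oplus>\<^bsub>F\<^esub> \<ominus>\<^bsub>F\<^esub> s) \<odot>\<^bsub>A\<^esub> v i j = \<zero>\<^bsub>A\<^esub>"
    using assms v by (simp add: smult_l_distr smult_l_minus M.r_neg)
  then have "r \<oplus>\<^bsub>F\<^esub> \<ominus>\<^bsub>F\<^esub> s = \<zero>\<^bsub>F\<^esub>"
    using nonzero_smult[OF _ v] v_nonzero[OF ij] assms(3,4) by auto
  then show ?thesis using assms(3,4) by (metis R.add.inv_closed R.minus_equality R.minus_minus)
qed

text \<open>The corner at \<open>(i, j)\<close> isolates one term of a relation.\<close>

lemma v_indep: "indep_family F A J (\<lambda>p. v (fst p) (snd p))"
  unfolding indep_family_def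
proof (intro ballI impI)
  fix d p assume d: "d \<in> J \<rightarrow> carrier F" and z: "(\<Oplus>\<^bsub>A\<^esub>p\<in>J. d p \<odot>\<^bsub>A\<^esub> v (fst p) (snd p)) = \<zero>\<^bsub>A\<^esub>" and p: "p \<in> J"
  obtain i j where ij: "p = (i, j)" "i < n" "j < n" using p by auto
  have "corner i j \<zero>\<^bsub>A\<^esub> = \<zero>\<^bsub>A\<^esub>"
    using ij by (simp add: corner_def mult_zero_left mult_zero_right e_closed)
  then have "d p \<odot>\<^bsub>A\<^esub> v i j = \<zero>\<^bsub>A\<^esub>" using corner_comb[OF ij(2,3) d] z ij(1) by simp
  moreover have "\<zero>\<^bsub>F\<^esub> \<odot>\<^bsub>A\<^esub> v i j = \<zero>\<^bsub>A\<^esub>" using v_closed ij by simp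
  ultimately show "d p = \<zero>\<^bsub>F\<^esub>" using v_cancel[OF ij(2,3), of "d p" "\<zero>\<^bsub>F\<^esub>"] d p by auto
qed

text \<open>A count: \<open>n * n\<close> independent vectors in a space of dimension
  \<open>n * n\<close> form a basis. This is where the dimension enters.\<close>

lemma v_span:
  assumes x: "x \<in> carrier A"
  obtains a where "a \<in> J \<rightarrow> carrier F" and "x = (\<Oplus>\<^bsub>A\<^esub>p\<in>J. a p \<odot>\<^bsub>A\<^esub> v (fst p) (snd p))"
proof -
  let ?v = "\<lambda>p. v (fst p) (snd p)"
  have vJ: "?v \<in> J \<rightarrow> carrier A" using v_closed by auto
  have fin: "finite J" by simp
  have inj: "inj_on ?v J" by (rule indep_family_inj[OF fin vJ v_indep])
  have vc: "?v ` J \<subseteq> carrier A" using vJ by blast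
  have "basis (?v ` J)"
    by (rule dim_li_is_basis[OF fin_dim _ vc indep_family_lin_indpt[OF fin vJ v_indep]])
      (simp_all add: card_image[OF inj] dim)
  then have "x \<in> span (?v ` J)" using x by (simp add: basis_def)
  then obtain a where a: "a \<in> ?v ` J \<rightarrow> carrier F" "x = lincomb a (?v ` J)"
    using finite_span[OF finite_imageI[OF fin] vc] by auto
  have "x = (\<Oplus>\<^bsub>A\<^esub>p\<in>J. a (?v p) \<odot>\<^bsub>A\<^esub> ?v p)"
    unfolding a(2) lincomb_def
    by (rule M.add.finprod_reindex[OF _ inj]) (use a(1) vc in \<open>auto simp: Pi_iff image_subset_iff\<close>)
  moreover have "(\<lambda>p. a (?v p)) \<in> J \<rightarrow> carrier F" using a(1) by auto
  ultimately show ?thesis using that by blast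
qed

lemma coord_eqI: "\<lbrakk>i < n; j < n; r \<in> carrier F; corner i j x = r \<odot>\<^bsub>A\<^esub> v i j\<rbrakk> \<Longrightarrow> coord i j x = r"
  unfolding coord_def by (rule the_equality) (use v_cancel in auto)

lemma coord_comb:
  assumes "i < n" "j < n" and "a \<in> J \<rightarrow> carrier F"
  shows "coord i j (\<Oplus>\<^bsub>A\<^esub>p\<in>J. a p \<odot>\<^bsub>A\<^esub> v (fst p) (snd p)) = a (i, j)"
  by (rule coord_eqI[OF assms(1,2) _ corner_comb[OF assms]]) (use assms in auto)

lemma coord:
  assumes "i < n" "j < n" "x \<in> carrier A"
  shows "coord i j x \<in> carrier F" and "corner i j x = coord i j x \<odot>\<^bsub>A\<^esub> v i j"
proof -
  obtain a where a: "a \<in> J \<rightarrow> carrier F" "x = (\<Oplus>\<^bsub>A\<^esub>p\<in>J. a p \<odot>\<^bsub>A\<^esub> v (fst p) (snd p))"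
    by (rule v_span[OF assms(3)])
  have "coord i j x = a (i, j)" unfolding a(2) by (rule coord_comb[OF assms(1,2) a(1)])
  then show "coord i j x \<in> carrier F" "corner i j x = coord i j x \<odot>\<^bsub>A\<^esub> v i j"
    using corner_comb[OF assms(1,2) a(1)] a assms(1,2) by auto
qed

lemma coords_inj: "inj_on coords (carrier A)"
proof (rule inj_onI)
  have exp: "x = (\<Oplus>\<^bsub>A\<^esub>p\<in>J. coords x p \<odot>\<^bsub>A\<^esub> v (fst p) (snd p))" if x: "x \<in> carrier A" for x
  proof -
    obtain a where a: "a \<in> J \<rightarrow> carrier F" "x = (\<Oplus>\<^bsub>A\<^esub>p\<in>J. a p \<odot>\<^bsub>A\<^esub> v (fst p) (snd p))"
      by (rule v_span[OF x])
    have "coords x p = a p" if "p \<in> J" for p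
      using that coord_comb[OF _ _ a(1)] a(2) by (cases p) (simp add: coords_def)
    then show ?thesis
      by (subst a(2), intro M.finsum_cong') (use a(1) v_closed in \<open>auto simp: Pi_iff\<close>)
  qed
  show "x = y" if "x \<in> carrier A" "y \<in> carrier A" "coords x = coords y" for x y
    using exp[OF that(1)] exp[OF that(2)] that(3) by simp
qed

lemma coords_closed: "x \<in> carrier A \<Longrightarrow> coords x \<in> J \<rightarrow>\<^sub>E carrier F"
  using coord(1) by (auto simp: coords_def)

lemma coords_surj:
  assumes f: "f \<in> J \<rightarrow>\<^sub>E carrier F"
  shows "\<exists>x\<in>carrier A. coords x = f"
proof -
  have fJ: "f \<in> J \<rightarrow> carrier F" using f by auto
  define x where "x = (\<Oplus>\<^bsub>A\<^esub>p\<in>J. f p \<odot>\<^bsub>A\<^esub> v (fst p) (snd p))"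
  have x: "x \<in> carrier A" unfolding x_def by (rule M.finsum_closed) (use fJ v_closed in auto)
  have "coords x = f"
    by (rule PiE_ext[OF coords_closed[OF x] f]) (use coord_comb[OF _ _ fJ] in \<open>auto simp: coords_def x_def\<close>)
  with x show ?thesis by blast
qed

text \<open>The unit, written as the sum of the \<open>e j = e j e j\<close>, is inserted between
  \<open>x\<close> and \<open>y\<close>. Every bracket is moved past a nuclear idempotent, so
  \<open>x\<close> and \<open>y\<close> may be arbitrary.\<close>

lemma corner_mult:
  assumes i: "i < n" and l: "l < n" and x: "x \<in> carrier A" and y: "y \<in> carrier A"
  shows "corner i l (x \<otimes>\<^bsub>A\<^esub> y) = (\<Oplus>\<^bsub>A\<^esub>j\<in>{..<n}. corner i j x \<otimes>\<^bsub>A\<^esub> corner j l y)"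
proof -
  let ?a = "e i \<otimes>\<^bsub>A\<^esub> x" and ?b = "y \<otimes>\<^bsub>A\<^esub> e l"
  have c: "?a \<in> carrier A" "?b \<in> carrier A" using assms by (simp_all add: mult_closed e_closed)
  have "corner i l (x \<otimes>\<^bsub>A\<^esub> y) = ?a \<otimes>\<^bsub>A\<^esub> ?b"
    using nucleus_assoc(3)[OF e_nucleus[OF l] x y] nucleus_assoc(1)[OF e_nucleus[OF i] x c(2)]
    by (simp add: corner_def)
  also have "\<dots> = ?a \<otimes>\<^bsub>A\<^esub> ((\<Oplus>\<^bsub>A\<^esub>j\<in>{..<n}. e j) \<otimes>\<^bsub>A\<^esub> ?b)" using c by (simp add: e_sum l_one)
  also have "\<dots> = (\<Oplus>\<^bsub>A\<^esub>j\<in>{..<n}. ?a \<otimes>\<^bsub>A\<^esub> (e j \<otimes>\<^bsub>A\<^esub> ?b))"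
    using c e_closed by (subst finsum_mult_left, simp_all, subst finsum_mult_right) (auto simp: mult_closed)
  also have "\<dots> = (\<Oplus>\<^bsub>A\<^esub>j\<in>{..<n}. corner i j x \<otimes>\<^bsub>A\<^esub> corner j l y)"
  proof (rule M.finsum_cong'[OF refl])
    show "(\<lambda>j. corner i j x \<otimes>\<^bsub>A\<^esub> corner j l y) \<in> {..<n} \<rightarrow> carrier A"
      using corner_closed assms mult_closed by auto
    fix j assume "j \<in> {..<n}"
    then have j: "j < n" by simp
    have jb: "e j \<otimes>\<^bsub>A\<^esub> ?b \<in> carrier A" using j c by (simp add: mult_closed e_closed)
    have "corner i j x \<otimes>\<^bsub>A\<^esub> corner j l y = (?a \<otimes>\<^bsub>A\<^esub> e j) \<otimes>\<^bsub>A\<^esub> (e j \<otimes>\<^bsub>A\<^esub> ?b)"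
      using nucleus_assoc(1)[OF e_nucleus[OF i] x e_closed[OF j]] by (simp add: corner_def)
    also have "\<dots> = ?a \<otimes>\<^bsub>A\<^esub> (e j \<otimes>\<^bsub>A\<^esub> (e j \<otimes>\<^bsub>A\<^esub> ?b))"
      by (rule nucleus_assoc(2)[OF e_nucleus[OF j] c(1) jb])
    also have "e j \<otimes>\<^bsub>A\<^esub> (e j \<otimes>\<^bsub>A\<^esub> ?b) = e j \<otimes>\<^bsub>A\<^esub> ?b"
      using nucleus_assoc(1)[OF e_nucleus[OF j] e_closed[OF j] c(2)] e_mult[OF j j] by simp
    finally show "?a \<otimes>\<^bsub>A\<^esub> (e j \<otimes>\<^bsub>A\<^esub> ?b) = corner i j x \<otimes>\<^bsub>A\<^esub> corner j l y" by simp
  qed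
  finally show ?thesis .
qed

lemma v_mult:
  assumes ijk: "i < n" "j < n" "k < n"
  shows "corner i k (v i j \<otimes>\<^bsub>A\<^esub> v j k) = v i j \<otimes>\<^bsub>A\<^esub> v j k"
proof -
  note vc = v_closed[OF ijk(1,2)] v_closed[OF ijk(2,3)]
  have "(v i j \<otimes>\<^bsub>A\<^esub> v j k) \<otimes>\<^bsub>A\<^esub> e k = v i j \<otimes>\<^bsub>A\<^esub> v j k"
    using nucleus_assoc(3)[OF e_nucleus[OF ijk(3)] vc] v_e ijk by simp
  moreover have "e i \<otimes>\<^bsub>A\<^esub> (v i j \<otimes>\<^bsub>A\<^esub> v j k) = v i j \<otimes>\<^bsub>A\<^esub> v j k"
    using nucleus_assoc(1)[OF e_nucleus[OF ijk(1)] vc] e_v ijk by simp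
  ultimately show ?thesis by (simp add: corner_def)
qed

lemma skew_coeff:
  assumes "i < n" "j < n" "k < n"
  shows "skew_coeff i j k \<in> carrier F" and "v i j \<otimes>\<^bsub>A\<^esub> v j k = skew_coeff i j k \<odot>\<^bsub>A\<^esub> v i k"
  using coord[of i k "v i j \<otimes>\<^bsub>A\<^esub> v j k"] v_mult[OF assms] assms
  by (simp_all add: skew_coeff_def mult_closed v_closed)

text \<open>The conditions \<open>c i i j = c i j j = 1\<close> express that the diagonal vectors
  \<open>v i i = e i\<close> act as units on the corners.\<close>

lemma reduced_skew_coeff: "reduced_skew_set F n skew_coeff"
  unfolding reduced_skew_set_def
proof (intro conjI allI impI)
  fix i j assume ij: "i < n" "j < n"
  have "v i i \<otimes>\<^bsub>A\<^esub> v i j = v i j" "v i j \<otimes>\<^bsub>A\<^esub> v j j = v i j"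
    using ij by (simp_all add: v_diag e_v v_e)
  then have "skew_coeff i i j \<odot>\<^bsub>A\<^esub> v i j = \<one>\<^bsub>F\<^esub> \<odot>\<^bsub>A\<^esub> v i j" "skew_coeff i j j \<odot>\<^bsub>A\<^esub> v i j = \<one>\<^bsub>F\<^esub> \<odot>\<^bsub>A\<^esub> v i j"
    using skew_coeff(2)[OF ij(1,1,2)] skew_coeff(2)[OF ij(1,2,2)] v_closed[OF ij] by simp_all
  then show "skew_coeff i i j = \<one>\<^bsub>F\<^esub>" "skew_coeff i j j = \<one>\<^bsub>F\<^esub>"
    using v_cancel[OF ij] skew_coeff(1) ij by auto
qed (rule skew_coeff(1))

text \<open>The Peirce rule \<open>corner_mult\<close> read in coordinates, which is the product
  formula of the skew matrix algebra.\<close>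

lemma coord_mult:
  assumes i: "i < n" and l: "l < n" and x: "x \<in> carrier A" and y: "y \<in> carrier A"
  shows "coord i l (x \<otimes>\<^bsub>A\<^esub> y) = (\<Oplus>\<^bsub>F\<^esub>j\<in>{..<n}. skew_coeff i j l \<otimes>\<^bsub>F\<^esub> (coord i j x \<otimes>\<^bsub>F\<^esub> coord j l y))"
proof (rule coord_eqI[OF i l])
  let ?r = "\<lambda>j. skew_coeff i j l \<otimes>\<^bsub>F\<^esub> (coord i j x \<otimes>\<^bsub>F\<^esub> coord j l y)"
  have rc: "?r j \<in> carrier F" if "j < n" for j using that assms by (simp add: coord(1) skew_coeff(1))
  show "(\<Oplus>\<^bsub>F\<^esub>j\<in>{..<n}. ?r j) \<in> carrier F" by (rule R.finsum_closed) (use rc in auto)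
  have vil: "v i l \<in> carrier A" by (rule v_closed[OF i l])
  have "corner i l (x \<otimes>\<^bsub>A\<^esub> y) = (\<Oplus>\<^bsub>A\<^esub>j\<in>{..<n}. corner i j x \<otimes>\<^bsub>A\<^esub> corner j l y)"
    by (rule corner_mult[OF assms])
  also have "\<dots> = (\<Oplus>\<^bsub>A\<^esub>j\<in>{..<n}. ?r j \<odot>\<^bsub>A\<^esub> v i l)"
  proof (rule M.finsum_cong'[OF refl])
    fix j assume "j \<in> {..<n}"
    then have j: "j < n" by simp
    note cc = coord(1)[OF i j x] coord(1)[OF j l y] skew_coeff(1)[OF i j l] v_closed[OF i j] v_closed[OF j l]
    have "corner i j x \<otimes>\<^bsub>A\<^esub> corner j l y = coord j l y \<odot>\<^bsub>A\<^esub> (coord i j x \<odot>\<^bsub>A\<^esub> (skew_coeff i j l \<odot>\<^bsub>A\<^esub> v i l))"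
      using cc skew_coeff(2)[OF i j l]
      by (simp only: coord(2)[OF i j x] coord(2)[OF j l y] smult_mult_left smult_mult_right smult_closed)
    also have "\<dots> = (coord j l y \<otimes>\<^bsub>F\<^esub> coord i j x \<otimes>\<^bsub>F\<^esub> skew_coeff i j l) \<odot>\<^bsub>A\<^esub> v i l"
      using cc vil by (simp add: smult_assoc1)
    also have "coord j l y \<otimes>\<^bsub>F\<^esub> coord i j x \<otimes>\<^bsub>F\<^esub> skew_coeff i j l = ?r j"
      using cc by (simp add: R.m_ac)
    finally show "corner i j x \<otimes>\<^bsub>A\<^esub> corner j l y = ?r j \<odot>\<^bsub>A\<^esub> v i l" .
  qed (use rc vil in auto)
  also have "\<dots> = (\<Oplus>\<^bsub>F\<^esub>j\<in>{..<n}. ?r j) \<odot>\<^bsub>A\<^esub> v i l"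
    by (rule finsum_hom[OF R.abelian_group_axioms algebra_abelian_group, where h = "\<lambda>r. r \<odot>\<^bsub>A\<^esub> v i l", symmetric])
      (use rc vil in \<open>auto simp: smult_l_distr\<close>)
  finally show "corner i l (x \<otimes>\<^bsub>A\<^esub> y) = (\<Oplus>\<^bsub>F\<^esub>j\<in>{..<n}. ?r j) \<odot>\<^bsub>A\<^esub> v i l" .
qed

lemma coord_add:
  assumes "i < n" "j < n" "x \<in> carrier A" "y \<in> carrier A"
  shows "coord i j (x \<oplus>\<^bsub>A\<^esub> y) = coord i j x \<oplus>\<^bsub>F\<^esub> coord i j y"
  using assms by (intro coord_eqI) (simp_all add: coord(1) coord(2)[symmetric] corner_add smult_l_distr v_closed)

lemma coord_smult:
  assumes "i < n" "j < n" "r \<in> carrier F" "x \<in> carrier A"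
  shows "coord i j (r \<odot>\<^bsub>A\<^esub> x) = r \<otimes>\<^bsub>F\<^esub> coord i j x"
  using assms by (intro coord_eqI) (simp_all add: coord(1) coord(2)[symmetric] corner_smult smult_assoc1 v_closed)

lemma coord_v:
  assumes "i < n" "j < n" "k < n" "l < n"
  shows "coord i j (v k l) = (if i = k \<and> j = l then \<one>\<^bsub>F\<^esub> else \<zero>\<^bsub>F\<^esub>)"
  using assms by (intro coord_eqI) (simp_all add: corner_v v_closed)

lemma coord_one:
  assumes "i < n" "j < n"
  shows "coord i j \<one>\<^bsub>A\<^esub> = (if i = j then \<one>\<^bsub>F\<^esub> else \<zero>\<^bsub>F\<^esub>)"
  using assms by (intro coord_eqI) (auto simp: corner_def l_one e_closed e_mult v_diag v_closed)

lemma coords_add: "\<lbrakk>x \<in> carrier A; y \<in> carrier A\<rbrakk> \<Longrightarrow>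
    coords (x \<oplus>\<^bsub>A\<^esub> y) = coords x \<oplus>\<^bsub>skew_matrix_algebra F n skew_coeff\<^esub> coords y"
  unfolding skew_matrix_algebra_simps coords_def by (rule restrict_ext) (auto simp: coord_add)

lemma coords_smult: "\<lbrakk>r \<in> carrier F; x \<in> carrier A\<rbrakk> \<Longrightarrow>
    coords (r \<odot>\<^bsub>A\<^esub> x) = r \<odot>\<^bsub>skew_matrix_algebra F n skew_coeff\<^esub> coords x"
  unfolding skew_matrix_algebra_simps coords_def by (rule restrict_ext) (auto simp: coord_smult)

lemma coords_mult:
  assumes "x \<in> carrier A" "y \<in> carrier A"
  shows "coords (x \<otimes>\<^bsub>A\<^esub> y) = coords x \<otimes>\<^bsub>skew_matrix_algebra F n skew_coeff\<^esub> coords y"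
proof -
  have "(\<Oplus>\<^bsub>F\<^esub>j\<in>{..<n}. skew_coeff i j l \<otimes>\<^bsub>F\<^esub> (coords x (i, j) \<otimes>\<^bsub>F\<^esub> coords y (j, l))) = coord i l (x \<otimes>\<^bsub>A\<^esub> y)"
    if "i < n" "l < n" for i l
    unfolding coord_mult[OF that assms]
    by (rule R.finsum_cong') (use that assms coord(1) skew_coeff(1) in \<open>auto simp: coords_def\<close>)
  then show ?thesis
    unfolding skew_matrix_algebra_simps coords_def[of "x \<otimes>\<^bsub>A\<^esub> y"] by (intro restrict_ext) auto
qed

lemma coords_iso: "coords \<in> algebra_iso F A (skew_matrix_algebra F n skew_coeff)"
proof -
  let ?B = "skew_matrix_algebra F n skew_coeff"
  have "coords \<one>\<^bsub>A\<^esub> = \<one>\<^bsub>?B\<^esub>"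
    unfolding skew_matrix_algebra_simps coords_def by (rule restrict_ext) (auto simp: coord_one)
  then have "coords \<in> ring_hom A ?B"
    using coords_closed coords_mult coords_add by (intro ring_hom_memI) simp_all
  moreover have "bij_betw coords (carrier A) (carrier ?B)"
  proof (rule bij_betw_imageI[OF coords_inj], rule equalityI; rule subsetI)
    show "f \<in> carrier ?B" if "f \<in> coords ` carrier A" for f using that coords_closed by auto
    show "f \<in> coords ` carrier A" if "f \<in> carrier ?B" for f
      using coords_surj[of f] that by (simp only: skew_matrix_algebra_simps image_iff) metis
  qed
  ultimately show ?thesis using coords_smult by (simp add: algebra_iso_def ring_iso_def)
qed

text \<open>\<open>D\<close> contains the idempotents and lies in their span, so its image is a
  submodule that contains the diagonal matrix units and lies in their span.\<close>

lemma coords_diagonal: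
  assumes D: "submodule F D A" and eD: "\<And>i. i < n \<Longrightarrow> e i \<in> D" and De: "D \<subseteq> span (e ` {..<n})"
  shows "coords ` D = diagonal_subalgebra F n skew_coeff"
proof -
  let ?B = "skew_matrix_algebra F n skew_coeff"
  interpret B: Module.module F ?B by (rule skew_matrix_module[OF field_axioms])
  interpret D: submodule F D A by fact
  have Dc: "D \<subseteq> carrier A" by (rule D.subset)
  define U where "U = {matrix_unit F n i i | i. i < n}"
  have "matrix_unit F n i i \<in> carrier ?B" for i
    unfolding matrix_unit_def skew_matrix_algebra_simps restrict_PiE_iff by simp
  then have Uc: "U \<subseteq> carrier ?B" unfolding U_def by blast
  interpret S: submodule F "B.span U" ?B by (rule B.span_is_submodule[OF Uc])
  have ce: "coords (e i) = matrix_unit F n i i" if i: "i < n" for i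
    unfolding coords_def matrix_unit_def v_diag[OF i, symmetric]
    by (rule restrict_ext) (use i in \<open>auto simp: coord_v split: if_splits\<close>)
  have zero: "coords \<zero>\<^bsub>A\<^esub> = \<zero>\<^bsub>?B\<^esub>"
  proof -
    have "coords (\<zero>\<^bsub>F\<^esub> \<odot>\<^bsub>A\<^esub> \<zero>\<^bsub>A\<^esub>) = \<zero>\<^bsub>F\<^esub> \<odot>\<^bsub>?B\<^esub> coords \<zero>\<^bsub>A\<^esub>" by (rule coords_smult) simp_all
    also have "\<dots> = \<zero>\<^bsub>?B\<^esub>" by (rule B.smult_l_null) (use coords_closed in simp)
    finally show ?thesis by simp
  qed
  have "submodule F {x \<in> carrier A. coords x \<in> B.span U} A"
    by (intro submodule.intro module_axioms)
      (simp_all only: mem_Collect_eq coords_add coords_smult zero S.smult_closed S.m_closed S.zero_closed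
        M.zero_closed M.a_closed smult_closed, blast)
  then have "span (e ` {..<n}) \<subseteq> {x \<in> carrier A. coords x \<in> B.span U}"
    by (rule span_is_subset[rotated])
      (use B.in_own_span[OF Uc] e_closed in \<open>auto simp: ce U_def\<close>)
  then have 1: "coords ` D \<subseteq> B.span U" using De by blast
  have "submodule F (coords ` D) ?B"
  proof (intro submodule.intro B.module_axioms)
    show "coords ` D \<subseteq> carrier ?B" using Dc coords_closed by auto
    show "\<zero>\<^bsub>?B\<^esub> \<in> coords ` D" using zero D.zero_closed by (metis imageI)
    show "x \<oplus>\<^bsub>?B\<^esub> y \<in> coords ` D" if xy: "x \<in> coords ` D" "y \<in> coords ` D" for x y
    proof -
      obtain x' y' where "x = coords x'" "x' \<in> D" "y = coords y'" "y' \<in> D" using xy by blast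
      then show ?thesis using coords_add[of x' y'] Dc D.m_closed by (metis imageI subsetD)
    qed
    show "r \<odot>\<^bsub>?B\<^esub> x \<in> coords ` D" if rx: "r \<in> carrier F" "x \<in> coords ` D" for r x
    proof -
      obtain x' where "x = coords x'" "x' \<in> D" using rx by blast
      then show ?thesis using coords_smult[of r x'] Dc D.smult_closed rx(1) by (metis imageI subsetD)
    qed
  qed
  then have "B.span U \<subseteq> coords ` D"
    by (rule B.span_is_subset[rotated]) (auto simp: U_def ce[symmetric] eD)
  with 1 show ?thesis by (auto simp: diagonal_subalgebra_def U_def)
qed

end

section \<open>Splitting semiassociative algebras\<close>

text \<open>The condition \<open>f (\<iota> a g) \<noteq> 0\<close> is tested after a further extension to the algebraic closure
  of \<open>E\<close>, which splits every etale algebra.\<close>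

lemma scalar_extension_corner:
  fixes F :: "'f ring" and A :: "('f, 'a) module" and E :: "'e ring" and \<phi> :: "'f \<Rightarrow> 'e"
  defines "V \<equiv> scalar_extension F \<phi> E A"
  assumes A: "unital_algebra F A" and fin: "vectorspace.fin_dim F A"
    and K: "unital_subalgebra F A K" "K \<subseteq> nucleus A" "etale_algebra F (A\<lparr>carrier := K\<rparr>)"
    and mf: "minimally_faithful (enveloping_ring F A K) (enveloping_module A)"
    and E: "field E" and \<phi>: "\<phi> \<in> ring_hom F E"
    and f: "f \<in> nucleus V" "f \<otimes>\<^bsub>V\<^esub> f = f" "f \<noteq> \<zero>\<^bsub>V\<^esub>"
    and g: "g \<in> nucleus V" "g \<otimes>\<^bsub>V\<^esub> g = g" "g \<noteq> \<zero>\<^bsub>V\<^esub>"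
  shows "\<exists>x\<in>carrier V. f \<otimes>\<^bsub>V\<^esub> (x \<otimes>\<^bsub>V\<^esub> g) \<noteq> \<zero>\<^bsub>V\<^esub>"
proof -
  interpret A: unital_algebra F A by fact
  interpret E: field E by fact
  let ?\<iota> = "scalar_incl F \<phi> E A"
  interpret V: base_change F A E V \<phi> ?\<iota>
    unfolding V_def by (rule base_change_scalar_extension[OF E \<phi> A])
  have finV: "V.V.fin_dim" by (rule V.fin_dim_incl(1)[OF fin])
  \<comment> \<open>\<open>?\<epsilon>\<close> embeds \<open>E\<close> into its algebraic closure
    and takes the place of \<open>\<phi>\<close> in the second extension.\<close>
  let ?L = "E.alg_closure" and ?\<epsilon> = "E.indexed_const :: 'e \<Rightarrow> ('e list \<times> nat) multiset \<Rightarrow> 'e"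
  interpret L: algebraic_closure ?L "?\<epsilon> ` carrier E" by (rule E.alg_closureE(1))
  let ?W = "scalar_extension E ?\<epsilon> ?L V" and ?\<kappa> = "scalar_incl E ?\<epsilon> ?L V"
  interpret W: base_change E V ?L ?W ?\<epsilon> ?\<kappa>
    by (rule base_change_scalar_extension[OF L.field_axioms E.alg_closureE(2) V.V.unital_algebra_axioms])
  have sub: "submodule F K A" using K(1) by (simp add: unital_subalgebra_def subspace_def)
  obtain \<beta> where \<beta>: "finite \<beta>" "\<beta> \<subseteq> K" "indep_family F A \<beta> (\<lambda>b. b)"
    and gen: "\<forall>y\<in>K. \<exists>r\<in>\<beta> \<rightarrow> carrier F. y = (\<Oplus>\<^bsub>A\<^esub>b\<in>\<beta>. r b \<odot>\<^bsub>A\<^esub> b)"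
    using A.subspace_basis[OF fin sub] by (elim exE conjE) (rule that)
  interpret KA: cring "A\<lparr>carrier := K\<rparr>"
    by (rule etale_decomposition(1)[OF K(3) A.subalgebra_unital[OF K(1)]])
  interpret S: split_subalgebra F A K \<beta> "\<lambda>b. b" ?L ?W "?\<epsilon> \<circ> \<phi>" "?\<kappa> \<circ> ?\<iota>"
  proof (intro split_subalgebra.intro nuclear_subalgebra.intro nuclear_subalgebra_axioms.intro
      split_subalgebra_axioms.intro A fin K(1-3) \<beta>(1,3) base_change_trans)
    show "base_change F A E V \<phi> ?\<iota>" "base_change E V ?L ?W ?\<epsilon> ?\<kappa>" by unfold_locales
    show "x \<otimes>\<^bsub>A\<^esub> y = y \<otimes>\<^bsub>A\<^esub> x" if "x \<in> K" "y \<in> K" for x y using KA.m_comm that by simp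
    show "(\<lambda>b. b) \<in> \<beta> \<rightarrow> K" using \<beta>(2) by auto
  qed (rule bspec[OF gen], assumption, rule L.exists_root)
  have fg: "f \<in> carrier V" "g \<in> carrier V" using f(1) g(1) by simp_all
  \<comment> \<open>Idempotents stay nonzero in the closure; injectivity rests on \<open>V\<close>
    being again finite dimensional.\<close>
  have nz: "?\<kappa> x \<noteq> \<zero>\<^bsub>?W\<^esub>" if "x \<in> carrier V" "x \<noteq> \<zero>\<^bsub>V\<^esub>" for x
    using W.incl_inj[OF finV that(1)] that(2) by blast
  obtain a where a: "a \<in> carrier A" "?\<kappa> f \<otimes>\<^bsub>?W\<^esub> ((?\<kappa> \<circ> ?\<iota>) a \<otimes>\<^bsub>?W\<^esub> ?\<kappa> g) \<noteq> \<zero>\<^bsub>?W\<^esub>"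
  proof (rule S.corner_nonzero[OF mf, of "?\<kappa> f" "?\<kappa> g"])
    show "?\<kappa> f \<otimes>\<^bsub>?W\<^esub> ?\<kappa> f = ?\<kappa> f" "?\<kappa> g \<otimes>\<^bsub>?W\<^esub> ?\<kappa> g = ?\<kappa> g"
      using fg f(2) g(2) by (simp_all add: W.incl_mult[symmetric])
  qed (use W.incl_nucleus[OF f(1)] W.incl_nucleus[OF g(1)] nz fg f(3) g(3) in blast)+
  have \<iota>a: "?\<iota> a \<in> carrier V" using a(1) by simp
  have "?\<kappa> (f \<otimes>\<^bsub>V\<^esub> (?\<iota> a \<otimes>\<^bsub>V\<^esub> g)) \<noteq> \<zero>\<^bsub>?W\<^esub>"
    using a(2) fg \<iota>a by (simp add: W.incl_mult V.V.mult_closed)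
  then have "f \<otimes>\<^bsub>V\<^esub> (?\<iota> a \<otimes>\<^bsub>V\<^esub> g) \<noteq> \<zero>\<^bsub>V\<^esub>" using W.incl_zero by metis
  with \<iota>a show ?thesis by blast
qed

theorem theorem7p1:
  fixes F :: "'f ring" and A :: "('f, 'a) module" and E :: "'e ring"
    and \<phi> :: "'f \<Rightarrow> 'e" and K :: "'a set" and n :: nat
  assumes "field F" and "infinite (carrier F)"
    and "semiassociative_of_degree F A n"
    and "unital_subalgebra F A K" and "K \<subseteq> nucleus A"
    and "etale_algebra F (A\<lparr>carrier := K\<rparr>)"
    and "vectorspace.dim F (A\<lparr>carrier := K\<rparr>) = n"
    and "field E" and "\<phi> \<in> ring_hom F E"
    and "splits_etale F \<phi> E (A\<lparr>carrier := K\<rparr>)"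
  shows "splits_algebra F \<phi> E A \<and>
    (\<exists>c. reduced_skew_set E n c \<and>
      (\<exists>h \<in> algebra_iso E (scalar_extension F \<phi> E A) (skew_matrix_algebra E n c).
        h ` (tensor_inclusion F (algebra_via \<phi> E) A `
               carrier (scalar_extension F \<phi> E (A\<lparr>carrier := K\<rparr>)))
          = diagonal_subalgebra E n c))"
proof -
  have A: "unital_algebra F A" and fin: "vectorspace.fin_dim F A"
    using assms(3)
    by (auto simp: semiassociative_of_degree_def semiassociative_algebra_def central_algebra_def)
  \<comment> \<open>The etale subalgebra provided by the definition; it is kept apart from the given
    \<open>K\<close>.\<close>
  obtain K0 where K0: "unital_subalgebra F A K0" "K0 \<subseteq> nucleus A" "etale_algebra F (A\<lparr>carrier := K0\<rparr>)"
    "minimally_faithful (enveloping_ring F A K0) (enveloping_module A)"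
    using assms(3) unfolding semiassociative_of_degree_def semiassociative_algebra_def by blast
  interpret A: unital_algebra F A by fact
  have "(real n)\<^sup>2 = real A.dim" using assms(3) by (simp add: semiassociative_of_degree_def)
  then have dim: "A.dim = n * n" unfolding power2_eq_square of_nat_mult[symmetric] of_nat_eq_iff by simp
  interpret KA: unital_algebra F "A\<lparr>carrier := K\<rparr>" by (rule A.subalgebra_unital[OF assms(4)])
  let ?V = "scalar_extension F \<phi> E A" and ?\<iota> = "scalar_incl F \<phi> E A"
  let ?W = "scalar_extension F \<phi> E (A\<lparr>carrier := K\<rparr>)" and ?\<kappa> = "scalar_incl F \<phi> E (A\<lparr>carrier := K\<rparr>)"
  interpret V: base_change F A E ?V \<phi> ?\<iota> by (rule base_change_scalar_extension[OF assms(8,9) A])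
  interpret W: base_change F "A\<lparr>carrier := K\<rparr>" E ?W \<phi> ?\<kappa>
    by (rule base_change_scalar_extension[OF assms(8,9) KA.unital_algebra_axioms])
  \<comment> \<open>\<open>E \<otimes> K\<close> is a tensor product of its own, not a subset of
    \<open>E \<otimes> A\<close>. The splitting hypothesis speaks about it, so its idempotents have
    to be carried over by \<open>j\<close>.\<close>
  define j where "j = tensor_inclusion F (algebra_via \<phi> E) A"
  note j = scalar_extension_inclusion[OF assms(8,9) A assms(4), folded j_def]
  have j_nucleus: "j x \<in> nucleus ?V" if "x \<in> carrier ?W" for x
    using that
  proof (rule W.generated)
    fix a assume "a \<in> carrier (A\<lparr>carrier := K\<rparr>)"
    then have "a \<in> K" by simp
    then show "j (?\<kappa> a) \<in> nucleus ?V" using V.incl_nucleus assms(5) j(6) by auto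
  qed (simp_all add: j V.V.add_nucleus V.V.smult_nucleus)
  have j_zero: "j \<zero>\<^bsub>?W\<^esub> = \<zero>\<^bsub>?V\<^esub>"
    using j(4)[of "\<zero>\<^bsub>E\<^esub>" "\<zero>\<^bsub>?W\<^esub>"] j(1)[of "\<zero>\<^bsub>?W\<^esub>"] by simp
  obtain \<theta> where "\<theta> \<in> algebra_iso E ?W (product_algebra {..<n} (\<lambda>_. algebra_via id E))"
    using assms(7,10) unfolding splits_etale_def by blast
  then obtain \<delta> where \<delta>: "\<And>i. i < n \<Longrightarrow> \<delta> i \<in> carrier ?W" "\<And>i. i < n \<Longrightarrow> \<delta> i \<noteq> \<zero>\<^bsub>?W\<^esub>"
    "\<And>i j. \<lbrakk>i < n; j < n\<rbrakk> \<Longrightarrow> \<delta> i \<otimes>\<^bsub>?W\<^esub> \<delta> j = (if i = j then \<delta> i else \<zero>\<^bsub>?W\<^esub>)"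
    "(\<Oplus>\<^bsub>?W\<^esub>i\<in>{..<n}. \<delta> i) = \<one>\<^bsub>?W\<^esub>"
    and \<delta>_span: "\<And>x. x \<in> carrier ?W \<Longrightarrow> \<exists>r\<in>{..<n} \<rightarrow> carrier E. x = (\<Oplus>\<^bsub>?W\<^esub>i\<in>{..<n}. r i \<odot>\<^bsub>?W\<^esub> \<delta> i)"
    by (rule split_etale_idempotents[OF W.V.unital_algebra_axioms]) (rule that)
  define e where "e i = j (\<delta> i)" for i
  have e_nuc: "e i \<in> nucleus ?V" if "i < n" for i using j_nucleus \<delta>(1) that by (simp add: e_def)
  have ec: "e i \<in> carrier ?V" if "i < n" for i using j(1) \<delta>(1) that by (simp add: e_def)
  have e_mult: "e i \<otimes>\<^bsub>?V\<^esub> e k = (if i = k then e i else \<zero>\<^bsub>?V\<^esub>)" if "i < n" "k < n" for i k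
    using j(3)[OF \<delta>(1)[OF that(1)] \<delta>(1)[OF that(2)]] \<delta>(3)[OF that] j_zero by (auto simp: e_def)
  have e_idem: "e i \<otimes>\<^bsub>?V\<^esub> e i = e i" if "i < n" for i using e_mult[OF that that] by simp
  \<comment> \<open>Injectivity of the natural map keeps the idempotents nonzero.\<close>
  have e_nz: "e i \<noteq> \<zero>\<^bsub>?V\<^esub>" if "i < n" for i
    using scalar_extension_inclusion_zero[OF assms(8,9) A assms(4) fin \<delta>(1)[OF that]] \<delta>(2)[OF that]
    by (auto simp: e_def j_def)
  have j_finsum: "j (\<Oplus>\<^bsub>?W\<^esub>i\<in>I. h i) = (\<Oplus>\<^bsub>?V\<^esub>i\<in>I. j (h i))" if "h \<in> I \<rightarrow> carrier ?W" for h and I :: "nat set"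
    by (rule finsum_hom[OF W.V.algebra_abelian_group V.V.algebra_abelian_group j(1,2) that])
  have e_sum: "(\<Oplus>\<^bsub>?V\<^esub>i\<in>{..<n}. e i) = \<one>\<^bsub>?V\<^esub>"
    using j_finsum[of \<delta> "{..<n}"] \<delta>(1,4) j(5) by (auto simp: e_def[abs_def])
  have "\<forall>s t. \<exists>x. s < n \<and> t < n \<longrightarrow> x \<in> carrier ?V \<and> e s \<otimes>\<^bsub>?V\<^esub> (x \<otimes>\<^bsub>?V\<^esub> e t) \<noteq> \<zero>\<^bsub>?V\<^esub>"
    using scalar_extension_corner[OF A fin K0 assms(8,9) e_nuc e_idem e_nz e_nuc e_idem e_nz] by blast
  then obtain x where x: "\<And>s t. \<lbrakk>s < n; t < n\<rbrakk> \<Longrightarrow> x s t \<in> carrier ?V"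
    "\<And>s t. \<lbrakk>s < n; t < n\<rbrakk> \<Longrightarrow> e s \<otimes>\<^bsub>?V\<^esub> (x s t \<otimes>\<^bsub>?V\<^esub> e t) \<noteq> \<zero>\<^bsub>?V\<^esub>"
    by metis
  \<comment> \<open>Off the diagonal any nonzero vector of the corner will do; on the diagonal
    \<open>e s\<close> itself is taken, as a reduced skew set requires.\<close>
  define v where "v s t = (if s = t then e s else e s \<otimes>\<^bsub>?V\<^esub> (x s t \<otimes>\<^bsub>?V\<^esub> e t))" for s t
  interpret P: peirce_frame E ?V n e v
  proof (intro peirce_frame.intro peirce_frame_axioms.intro e_nuc e_mult e_sum V.V.unital_algebra_axioms)
    show "V.V.fin_dim" "V.V.dim = n * n" using V.fin_dim_incl[OF fin] dim by simp_all
    fix s t assume st: "s < n" "t < n"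
    note c = ec[OF st(1)] ec[OF st(2)] x(1)[OF st]
    have xt: "x s t \<otimes>\<^bsub>?V\<^esub> e t \<in> carrier ?V" using c by (simp add: V.V.mult_closed)
    show "v s t \<in> carrier ?V" using c xt by (simp add: v_def V.V.mult_closed)
    show "v s t \<noteq> \<zero>\<^bsub>?V\<^esub>" using x(2)[OF st] e_nz[OF st(1)] e_nz[OF st(2)] by (simp add: v_def)
    have "(e s \<otimes>\<^bsub>?V\<^esub> (x s t \<otimes>\<^bsub>?V\<^esub> e t)) \<otimes>\<^bsub>?V\<^esub> e t = e s \<otimes>\<^bsub>?V\<^esub> (x s t \<otimes>\<^bsub>?V\<^esub> e t)"
      using V.V.nucleus_assoc(3)[OF e_nuc[OF st(2)] c(1) xt] V.V.nucleus_assoc(3)[OF e_nuc[OF st(2)] c(3,2)]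
        e_idem[OF st(2)] by simp
    moreover have "e s \<otimes>\<^bsub>?V\<^esub> (e s \<otimes>\<^bsub>?V\<^esub> (x s t \<otimes>\<^bsub>?V\<^esub> e t)) = e s \<otimes>\<^bsub>?V\<^esub> (x s t \<otimes>\<^bsub>?V\<^esub> e t)"
      using V.V.nucleus_assoc(1)[OF e_nuc[OF st(1)] c(1) xt] e_idem[OF st(1)] by simp
    ultimately show "e s \<otimes>\<^bsub>?V\<^esub> (v s t \<otimes>\<^bsub>?V\<^esub> e t) = v s t"
      using e_idem[OF st(1)] e_idem[OF st(2)] by (simp add: v_def)
  qed (simp_all add: v_def)
  let ?D = "j ` carrier ?W"
  have "submodule E ?D ?V"
  proof (intro submodule.intro V.V.module_axioms)
    show "?D \<subseteq> carrier ?V" using j(1) by blast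
    show "\<zero>\<^bsub>?V\<^esub> \<in> ?D" using j_zero W.V.M.zero_closed by (metis imageI)
    show "y \<oplus>\<^bsub>?V\<^esub> z \<in> ?D" if "y \<in> ?D" "z \<in> ?D" for y z
      using that j(2) W.V.M.a_closed by (auto simp: image_iff; metis)
    show "r \<odot>\<^bsub>?V\<^esub> y \<in> ?D" if "r \<in> carrier E" "y \<in> ?D" for r y
      using that j(4) W.V.smult_closed by (auto simp: image_iff; metis)
  qed
  moreover have "e i \<in> ?D" if "i < n" for i using \<delta>(1)[OF that] by (auto simp: e_def)
  moreover have "?D \<subseteq> V.V.span (e ` {..<n})"
  proof
    have en: "e ` {..<n} \<subseteq> carrier ?V" using ec by auto
    interpret S: submodule E "V.V.span (e ` {..<n})" ?V by (rule V.V.span_is_submodule[OF en])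
    fix y assume "y \<in> ?D"
    then obtain z where z: "z \<in> carrier ?W" "y = j z" by blast
    obtain r where r: "r \<in> {..<n} \<rightarrow> carrier E" "z = (\<Oplus>\<^bsub>?W\<^esub>i\<in>{..<n}. r i \<odot>\<^bsub>?W\<^esub> \<delta> i)"
      using \<delta>_span[OF z(1)] by blast
    have "y = (\<Oplus>\<^bsub>?V\<^esub>i\<in>{..<n}. j (r i \<odot>\<^bsub>?W\<^esub> \<delta> i))"
      unfolding z(2) r(2) by (rule j_finsum) (use r(1) \<delta>(1) in auto)
    also have "\<dots> \<in> V.V.span (e ` {..<n})"
    proof (rule V.V.finsum_span_submodule[OF S.submodule_axioms], rule Pi_I)
      fix i assume i: "i \<in> {..<n}"
      then have "r i \<in> carrier E" "\<delta> i \<in> carrier ?W" "e i \<in> V.V.span (e ` {..<n})"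
        using r(1) \<delta>(1) V.V.in_own_span[OF en] by auto
      then show "j (r i \<odot>\<^bsub>?W\<^esub> \<delta> i) \<in> V.V.span (e ` {..<n})" by (simp add: j(4) e_def[symmetric])
    qed
    finally show "y \<in> V.V.span (e ` {..<n})" .
  qed
  ultimately have "P.coords ` ?D = diagonal_subalgebra E n P.skew_coeff"
    by (rule P.coords_diagonal)
  then show ?thesis
    using P.coords_iso P.reduced_skew_coeff
    unfolding splits_algebra_def split_algebra_def j_def by blast
qed

end
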